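(* Let $M_c$ be the weak limit $M_c=\lim_{\tau\downarrow1}\frac{M_{(\tau,0,0)}}{1-1/\tau}$. Then: (1) The Mellin transform of $M_c$ is $$\mathbf{E}[M_c^q]=\frac{G(4-2q)}{G(1-q)\,G^2(2-q)\,G(4-q)},\qquad\Re(q)<1.$$ (2) Its meromorphic continuation (given by the right-hand side) has zeroes at $q=n+5/2$, $n=0,1,2,\dots$, of multiplicity $2n+2$, and poles: at $q=1$ of order $1$, at $q=2$ of order $3$, and at $q=n$, $n=3,4,5,\dots$, of order $2n-2$. (3) It satisfies the functional equation $$\mathbf{E}[M_c^q]=\frac{\Gamma(1-q)\Gamma^2(2-q)\Gamma(4-q)}{\Gamma(4-2q)\Gamma(5-2q)}\,\mathbf{E}[M_c^{q-1}]$$ and the infinite product representation $$\mathbf{E}[M_c^q]=\frac{\Gamma(1-q)\Gamma(3-2q)}{\Gamma(3-q)}\prod_{m=1}^\infty m^{2q}\,\frac{\Gamma^3(1-q+m)}{\Gamma^3(1+m)}\,\frac{\Gamma(2-q+m)}{\Gamma(2-2q+m)}.$$ (4) For $l\in\mathbb{N}$, $$\mathbf{E}[M_c^{-l}]=\prod_{k=0}^{l-1}\frac{(3+l+k)!}{(k+1)!^2\,k!}.$$ (5) $M_c$ has the factorization (in law, with independent factors) $M_c=\frac{\pi}{32}\,L\,X_2\,X_3\,Y$, where $L=\exp(\mathcal{N}(0,4\log2))$ (mean $0$, variance $4\log 2$), $X_2=\beta_{2,2}^{-1}(a=(1,1),b_0=2,b_1=b_2=1/2)$, $X_3$ has the Pareto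 density $2y^{-3}$ on $y>1$, and $Y$ has the Fréchet density $y^{-2}e^{-1/y}$ on $y>0$. In particular, $\log M_c$ is infinitely divisible and absolutely continuous.
   Context: Barnes double gamma function: for $a=(a_1,a_2)$, $a_j>0$, $\zeta_2(s,w\,|\,a)=\sum_{k_1,k_2=0}^\infty(w+k_1a_1+k_2a_2)^{-s}$ for $\Re(s)>2$, $\Re(w)>0$, continued meromorphically in $s$; $\Gamma_2(w\,|\,a)=\exp\bigl(\partial_s\zeta_2(s,w\,|\,a)|_{s=0}\bigr)$, continued meromorphically in $w$. Write $\Gamma_2(w\,|\,\tau)$ for $a=(1,\tau)$. Barnes $G$ function: the entire function $G(z)=(2\pi)^{(z-1)/2}\,\Gamma_2(1\,|\,1)/\Gamma_2(z\,|\,1)$, with $G(1)=1$, $G(z+1)=\Gamma(z)G(z)$, having zeroes at $z=-n$, $n=0,1,2,\dots$, of multiplicity $n+1$. $M_{(\tau,0,0)}$, $\tau>1$ (Selberg integral distribution with $\lambda_1=\lambda_2=0$), is the probability distribution on $(0,\infty)$ with Mellin transform, for $\Re(q)<\tau$, $$\mathbf{E}[M_{(\tau,0,0)}^q]=\tau^{q/\tau}(2\pi)^q\,\Gamma(1-1/\tau)^{-q}\Bigl(\frac{\Gamma_2(1-q+\tau\,|\,\tau)}{\Gamma_2(1+\tau\,|\,\tau)}\Bigr)^2\frac{\Gamma_2(\tau-q\,|\,\tau)}{\Gamma_2(\tau\,|\,\tau)}\frac{\Gamma_2(2-q+2\tau\,|\,\tau)}{\Gamma_2(2-2q+2\tau\,|\,\tau)}.$$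 $\beta_{2,2}(a,b)$, $b=(b_0,b_1,b_2)$ with positive entries, is the probability distribution on $(0,1]$ with $$\mathbf{E}[\beta_{2,2}(a,b)^q]=\frac{\Gamma_2(q+b_0|a)}{\Gamma_2(b_0|a)}\frac{\Gamma_2(b_0+b_1|a)}{\Gamma_2(q+b_0+b_1|a)}\frac{\Gamma_2(b_0+b_2|a)}{\Gamma_2(q+b_0+b_2|a)}\frac{\Gamma_2(q+b_0+b_1+b_2|a)}{\Gamma_2(b_0+b_1+b_2|a)},\quad\Re(q)>-b_0,$$ and $\beta_{2,2}^{-1}$ is the reciprocal random variable. *)

theory Defs
  imports "HOL-Probability.Probability" "HOL-Complex_Analysis.Complex_Analysis"
begin

section \<open>Barnes double zeta, double gamma and G functions\<close>

definition barnes_zeta2_series :: "real \<Rightarrow> real \<Rightarrow> complex \<Rightarrow> complex \<Rightarrow> complex" where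
  "barnes_zeta2_series a1 a2 w s =
     (\<Sum>\<^sub>\<infinity>(k1, k2)\<in>(UNIV :: (nat \<times> nat) set).
        (w + of_nat k1 * of_real a1 + of_nat k2 * of_real a2) powr (- s))"

text \<open>
  Meromorphic continuations are normalised by \<^const>\<open>nicely_meromorphic_on\<close>: removable
  singularities are filled in and the value at a pole is 0. With this normalisation the
  continuation is unique by the identity theorem.
\<close>

definition barnes_zeta2 :: "real \<Rightarrow> real \<Rightarrow> complex \<Rightarrow> complex \<Rightarrow> complex" where
  "barnes_zeta2 a1 a2 w =
     (THE f. f nicely_meromorphic_on UNIV \<and>
             (\<forall>s. Re s > 2 \<longrightarrow> f s = barnes_zeta2_series a1 a2 w s))"

definition Gamma2 :: "real \<Rightarrow> real \<Rightarrow> complex \<Rightarrow> complex" where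
  "Gamma2 a1 a2 =
     (THE g. g nicely_meromorphic_on UNIV \<and>
             (\<forall>w. Re w > 0 \<longrightarrow> g w = exp (deriv (barnes_zeta2 a1 a2 w) 0)))"

text \<open>
  At the poles of \<open>Gamma2 1 1\<close> its value is 0, so the quotient below is 0 there, which is the
  value of the entire function G.
\<close>

definition barnes_G :: "complex \<Rightarrow> complex" where
  "barnes_G z = of_real (2 * pi) powr ((z - 1) / 2) * Gamma2 1 1 1 / Gamma2 1 1 z"


section \<open>Probability distributions on the positive half-line\<close>

definition cmoment :: "real measure \<Rightarrow> complex \<Rightarrow> complex" where
  "cmoment N q = (LINT x|N. complex_of_real x powr q)"

definition has_cmoment :: "real measure \<Rightarrow> complex \<Rightarrow> complex \<Rightarrow> bool" where
  "has_cmoment N q c \<longleftrightarrow>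
     integrable N (\<lambda>x. complex_of_real x powr q) \<and> cmoment N q = c"

definition selberg_mellin :: "real \<Rightarrow> complex \<Rightarrow> complex" where
  "selberg_mellin \<tau> q =
     of_real \<tau> powr (q / of_real \<tau>) * of_real (2 * pi) powr q
     * of_real (Gamma (1 - 1 / \<tau>)) powr (- q)
     * (Gamma2 1 \<tau> (1 - q + of_real \<tau>) / Gamma2 1 \<tau> (1 + of_real \<tau>))\<^sup>2
     * (Gamma2 1 \<tau> (of_real \<tau> - q) / Gamma2 1 \<tau> (of_real \<tau>))
     * (Gamma2 1 \<tau> (2 - q + 2 * of_real \<tau>) / Gamma2 1 \<tau> (2 - 2 * q + 2 * of_real \<tau>))"

text \<open>\<open>N\<close> is the law \<open>M\<^bsub>(\<tau>,0,0)\<^esub>\<close>; the Mellin transform on the imaginary axis determines it.\<close>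

definition selberg_distribution :: "real \<Rightarrow> real measure \<Rightarrow> bool" where
  "selberg_distribution \<tau> N \<longleftrightarrow>
     real_distribution N \<and> (AE x in N. 0 < x) \<and>
     (\<forall>q. Re q < \<tau> \<longrightarrow> has_cmoment N q (selberg_mellin \<tau> q))"

definition beta22_mellin ::
  "real \<Rightarrow> real \<Rightarrow> real \<Rightarrow> real \<Rightarrow> real \<Rightarrow> complex \<Rightarrow> complex" where
  "beta22_mellin a1 a2 b0 b1 b2 q =
     (Gamma2 a1 a2 (q + of_real b0) / Gamma2 a1 a2 (of_real b0))
     * (Gamma2 a1 a2 (of_real (b0 + b1)) / Gamma2 a1 a2 (q + of_real (b0 + b1)))
     * (Gamma2 a1 a2 (of_real (b0 + b2)) / Gamma2 a1 a2 (q + of_real (b0 + b2)))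
     * (Gamma2 a1 a2 (q + of_real (b0 + b1 + b2)) / Gamma2 a1 a2 (of_real (b0 + b1 + b2)))"

definition beta22_distribution ::
  "real \<Rightarrow> real \<Rightarrow> real \<Rightarrow> real \<Rightarrow> real \<Rightarrow> real measure \<Rightarrow> bool" where
  "beta22_distribution a1 a2 b0 b1 b2 N \<longleftrightarrow>
     real_distribution N \<and> (AE x in N. 0 < x \<and> x \<le> 1) \<and>
     (\<forall>q. Re q > - b0 \<longrightarrow> has_cmoment N q (beta22_mellin a1 a2 b0 b1 b2 q))"

definition lognormal_law :: "real \<Rightarrow> real \<Rightarrow> real measure" where
  "lognormal_law \<mu> var = distr (density lborel (normal_density \<mu> (sqrt var))) borel exp"

definition pareto2_law :: "real measure" where
  "pareto2_law = density lborel (\<lambda>y. ennreal (if y > 1 then 2 / y ^ 3 else 0))"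

definition frechet1_law :: "real measure" where
  "frechet1_law = density lborel (\<lambda>y. ennreal (if y > 0 then exp (- 1 / y) / y\<^sup>2 else 0))"

text \<open>For every n at least 1, \<open>N\<close> is the law of a sum of n i.i.d. random variables.\<close>

definition infinitely_divisible :: "real measure \<Rightarrow> bool" where
  "infinitely_divisible N \<longleftrightarrow>
     (\<forall>n::nat. n \<ge> 1 \<longrightarrow> (\<exists>R. real_distribution R \<and>
        N = distr (\<Pi>\<^sub>M i\<in>{..<n::nat}. R) borel (\<lambda>x. \<Sum>i<n. x i)))"


section \<open>The critical Mellin transform\<close>

text \<open>
  At every pole of this meromorphic function the denominator vanishes, so the value there is 0
  by the convention for division.
\<close>

definition critical_mellin :: "complex \<Rightarrow> complex" where
  "critical_mellin q =
     barnes_G (4 - 2 * q) / (barnes_G (1 - q) * (barnes_G (2 - q))\<^sup>2 * barnes_G (4 - q))"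

definition critical_factor :: "complex \<Rightarrow> nat \<Rightarrow> complex" where
  "critical_factor q m =
     of_nat m powr (2 * q) * (Gamma (1 - q + of_nat m) ^ 3 / Gamma (1 + of_nat m) ^ 3)
     * (Gamma (2 - q + of_nat m) / Gamma (2 - 2 * q + of_nat m))"

end

theory Submission
  imports Defs "HOL-Real_Asymp.Real_Asymp"
begin

text \<open>
  Subtracting the polar part at 0 from the kernel of the Mellin transform of the double zeta series gives
  a Binet type formula: log Gamma2(w | 1, tau) is an elementary main term plus a Laplace transform.
  It is jointly continuous in tau and w, so for Re q < 1 the moments of the rescaled Selberg laws tend to
  the critical Mellin transform as tau decreases to 1. The zeroes, poles, functional equation, product and
  negative moments come from the recursion and the asymptotics of G. A duplication formula for G splits
  the critical transform into a Gaussian factor, K(2 - q) / K(2) for a quotient K of G functions,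
  2 / (2 - q) and Gamma(1 - q), and on the imaginary axis each factor has a Levy-Khintchine exponent.
  Hence the critical transform is the characteristic function of an infinitely divisible law with a
  Gaussian component; Levy continuity makes it the weak limit, and the moments for Re q < 1 follow by
  truncation and analytic continuation.
\<close>

section \<open>Characteristic functions\<close>

text \<open>One device recurs wherever a constant has to be found: a quotient is shown to be
  1-periodic by its functional equation, and its known limit along z + n then gives its value. This
  fixes the shift equation of the double gamma function (the kernel directly yields only a mixed
  second difference), the duplication formula and the formula for \<open>barnes_K\<close>. The scale
  1 - 1/\<tau> is forced by x * Gamma x --> 1 at x = 1 - 1/\<tau>, which absorbs the only
  degenerating factor of the Selberg transform. The constants of the factorization come from
  Legendre duplication: the factor 2^(4z - 1) / pi gained by a quotient of G functions in a unit
  step is matched by a quadratic exponent that vanishes at z = 2, that is q = 0. Its quadratic part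
  gives the variance 4 ln 2, its linear part the factor pi/32. For the limit law only the imaginary
  axis is available at first. There powers of positive variables have modulus 1, and on the
  logarithmic scale these moments are characteristic functions. Keeping exponents instead of
  characteristic functions makes n-th roots unambiguous.\<close>

lemma (in real_distribution) integral_gaussian_kernel:
  "(LINT x|M. exp (- (s * x)\<^sup>2 / 2)) = Re (LINT z|std_normal_distribution. char M (s * z))"
proof -
  interpret N: real_distribution std_normal_distribution by (rule real_dist_normal_dist)
  interpret P: pair_prob_space M std_normal_distribution ..
  have int: "integrable (M \<Otimes>\<^sub>M std_normal_distribution) (\<lambda>(x, z). iexp (s * z * x))"
    by (rule P.integrable_const_bound[where B = 1]) (auto simp: split_beta')
  have "(LINT z|std_normal_distribution. char M (s * z)) =
      (LINT z|std_normal_distribution. LINT x|M. iexp (s * z * x))"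
    by (simp add: char_def)
  also have "\<dots> = (LINT x|M. LINT z|std_normal_distribution. iexp (s * z * x))"
    by (rule P.Fubini_integral[OF int])
  also have "\<dots> = (LINT x|M. char std_normal_distribution (s * x))"
    by (simp add: char_def mult_ac)
  also have "\<dots> = complex_of_real (LINT x|M. exp (- (s * x)\<^sup>2 / 2))"
    by (simp add: char_std_normal_distribution)
  finally show ?thesis by simp
qed

text \<open>On |x| >= 1/s the kernel exp (- (s * x)^2 / 2) is at most exp (-1/2), so each unit of
  tail mass lowers the Gaussian mean by at least 1 - exp (-1/2). That mean is an average of the
  characteristic function because the Gaussian is its own Fourier transform.\<close>

lemma (in real_distribution) tail_le_char:
  assumes s: "s > 0"
  shows "measure M {x. \<bar>x\<bar> \<ge> 1 / s} * (1 - exp (- 1 / 2)) \<le> 1 - Re (LINT z|std_normal_distribution. char M (s * z))"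
proof -
  have [measurable]: "{x::real. \<bar>x\<bar> \<ge> 1 / s} \<in> sets borel" by measurable
  have i1: "integrable M (\<lambda>x. exp (- (s * x)\<^sup>2 / 2))"
    by (rule integrable_const_bound[where B = 1]) auto
  have "measure M {x. \<bar>x\<bar> \<ge> 1 / s} * (1 - exp (- 1 / 2)) = (LINT x|M. indicator {x. \<bar>x\<bar> \<ge> 1 / s} x * (1 - exp (- 1 / 2)))"
    by simp
  also have "\<dots> \<le> (LINT x|M. 1 - exp (- (s * x)\<^sup>2 / 2))"
  proof (rule integral_mono)
    show "integrable M (\<lambda>x. indicator {x. \<bar>x\<bar> \<ge> 1 / s} x * (1 - exp (- 1 / 2 :: real)))"
      by (rule integrable_const_bound[where B = 1]) (auto simp: indicator_def)
    show "integrable M (\<lambda>x. 1 - exp (- (s * x)\<^sup>2 / 2))" using i1 by simp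
    show "indicator {x. \<bar>x\<bar> \<ge> 1 / s} x * (1 - exp (- 1 / 2)) \<le> 1 - exp (- (s * x)\<^sup>2 / 2)" for x
    proof (cases "\<bar>x\<bar> \<ge> 1 / s")
      case True
      then have "\<bar>s * x\<bar> \<ge> 1" using s by (simp add: abs_mult field_simps)
      then have "(s * x)\<^sup>2 \<ge> 1" by (metis abs_le_square_iff abs_1 power_one)
      then show ?thesis using True by simp
    qed auto
  qed
  also have "\<dots> = 1 - Re (LINT z|std_normal_distribution. char M (s * z))"
    using i1 prob_space[unfolded space_eq_univ] by (simp add: integral_gaussian_kernel[simplified])
  finally show ?thesis .
qed

lemma (in real_distribution) ex_interval_measure_gt:
  assumes "\<epsilon> > 0"
  shows "\<exists>K. measure M {-K<..K} > 1 - \<epsilon>"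
proof -
  have "(\<lambda>n. measure M {- real n<..real n}) \<longlonglongrightarrow> measure M (\<Union>n. {- real n<..real n})"
    by (rule finite_Lim_measure_incseq) (auto simp: incseq_def)
  moreover have "(\<Union>n. {- real n<..real n}) = UNIV"
  proof -
    have "\<exists>n. - real n < x \<and> x \<le> real n" for x
      using reals_Archimedean2[of "\<bar>x\<bar>"] by (metis abs_less_iff less_imp_le minus_less_iff)
    then show ?thesis by auto
  qed
  ultimately have "(\<lambda>n. measure M {- real n<..real n}) \<longlonglongrightarrow> 1" using prob_space by (simp add: space_eq_univ)
  from order_tendstoD(1)[OF this, of "1 - \<epsilon>"] assms show ?thesis
    by (auto simp: eventually_sequentially)
qed

text \<open>Continuity of the limit at 0 makes its Gaussian average close to 1 at one small scale
  \<open>s\<close>. Dominated convergence transfers this to all but finitely many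
  \<open>\<mu> n\<close>, whose tails \<open>tail_le_char\<close> then bounds; the finitely many
  others are tight one by one.\<close>

lemma tight_of_char_tendsto:
  fixes \<mu> :: "nat \<Rightarrow> real measure"
  assumes \<mu>: "\<And>n. real_distribution (\<mu> n)"
    and lim: "\<And>t. (\<lambda>n. char (\<mu> n) t) \<longlonglongrightarrow> \<phi> t" and cont: "isCont \<phi> 0"
  shows "tight \<mu>"
  unfolding tight_def
proof (intro conjI allI impI \<mu>)
  fix \<epsilon> :: real assume \<epsilon>: "\<epsilon> > 0"
  interpret m: real_distribution "\<mu> n" for n by (rule \<mu>)
  interpret N: real_distribution std_normal_distribution by (rule real_dist_normal_dist)
  have [measurable]: "\<phi> \<in> borel_measurable borel"
    by (rule borel_measurable_LIMSEQ_metric[OF m.char_measurable lim])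
  have \<phi>0: "\<phi> 0 = 1" using lim[of 0] by (simp add: m.char_zero LIMSEQ_const_iff)
  have \<phi>1: "norm (\<phi> t) \<le> 1" for t
    by (rule tendsto_upperbound[OF tendsto_norm[OF lim[of t]]]) (auto intro!: always_eventually m.cmod_char_le_1)
  define I where "I n s = (LINT z|std_normal_distribution. char (\<mu> n) (s * z))" for n s
  define J where "J s = (LINT z|std_normal_distribution. \<phi> (s * z))" for s
  have IJ: "(\<lambda>n. I n s) \<longlonglongrightarrow> J s" for s
    unfolding I_def J_def
    by (rule integral_dominated_convergence[where w = "\<lambda>_. 1"])
       (auto intro!: lim m.cmod_char_le_1)
  have "(\<lambda>n. J (1 / real (Suc n))) \<longlonglongrightarrow> (LINT z|std_normal_distribution. \<phi> 0)"
    unfolding J_def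
  proof (rule integral_dominated_convergence[where w = "\<lambda>_. 1"])
    show "AE z in std_normal_distribution. (\<lambda>n. \<phi> (1 / real (Suc n) * z)) \<longlonglongrightarrow> \<phi> 0"
    proof (intro AE_I2)
      fix z :: real
      have "(\<lambda>n. 1 / real (Suc n) * z) \<longlonglongrightarrow> 0 * z"
        by (intro tendsto_intros LIMSEQ_Suc lim_1_over_n)
      then show "(\<lambda>n. \<phi> (1 / real (Suc n) * z)) \<longlonglongrightarrow> \<phi> 0"
        using isCont_tendsto_compose[OF cont] by simp
    qed
  qed (auto intro!: \<phi>1)
  then have "(\<lambda>n. Re (J (1 / real (Suc n)))) \<longlonglongrightarrow> 1"
    using N.prob_space by (simp add: \<phi>0 tendsto_Re[where a = 1, simplified])
  then have "eventually (\<lambda>n. Re (J (1 / real (Suc n))) > 1 - \<epsilon> / 4) sequentially"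
    by (rule order_tendstoD) (use \<epsilon> in auto)
  then obtain k where k: "Re (J (1 / real (Suc k))) > 1 - \<epsilon> / 4" by (auto simp: eventually_sequentially)
  define s where "s = 1 / real (Suc k)"
  have s: "s > 0" by (simp add: s_def)
  have "(\<lambda>n. Re (I n s)) \<longlonglongrightarrow> Re (J s)" by (intro tendsto_Re IJ)
  then have "eventually (\<lambda>n. Re (I n s) > 1 - \<epsilon> / 4) sequentially"
    by (rule order_tendstoD) (use k in \<open>auto simp: s_def\<close>)
  then obtain n0 where n0: "\<And>n. n \<ge> n0 \<Longrightarrow> Re (I n s) > 1 - \<epsilon> / 4" by (auto simp: eventually_sequentially)
  \<comment> \<open>This is the factor behind the choice of \<epsilon> / 4 above; it follows from
    exp (1/2) >= 3/2.\<close>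
  have half: "1 - exp (- 1 / 2 :: real) \<ge> 1 / 4"
  proof -
    have "exp (1/2 :: real) \<ge> 1 + 1/2" by (rule exp_ge_add_one_self)
    then have "exp (- 1 / 2 :: real) \<le> 1 / (3/2)" by (simp add: exp_minus inverse_eq_divide divide_simps)
    then show ?thesis by simp
  qed
  have big: "measure (\<mu> n) {-(1/s)<..1/s} > 1 - \<epsilon>" if n: "n \<ge> n0" for n
  proof -
    have [measurable]: "{x::real. \<bar>x\<bar> \<ge> 1 / s} \<in> sets borel" by measurable
    have "measure (\<mu> n) {x. \<bar>x\<bar> \<ge> 1 / s} * (1 / 4) \<le> measure (\<mu> n) {x. \<bar>x\<bar> \<ge> 1 / s} * (1 - exp (- 1 / 2))"
      by (intro mult_left_mono half) auto
    also have "\<dots> \<le> 1 - Re (I n s)" unfolding I_def by (rule m.tail_le_char[OF s])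
    finally have "measure (\<mu> n) {x. \<bar>x\<bar> \<ge> 1 / s} < \<epsilon>" using n0[OF n] by simp
    moreover have "measure (\<mu> n) (UNIV - {x. \<bar>x\<bar> \<ge> 1 / s}) = 1 - measure (\<mu> n) {x. \<bar>x\<bar> \<ge> 1 / s}"
      using m.prob_compl[of "{x. \<bar>x\<bar> \<ge> 1 / s}" n] by simp
    moreover have "measure (\<mu> n) (UNIV - {x. \<bar>x\<bar> \<ge> 1 / s}) \<le> measure (\<mu> n) {-(1/s)<..1/s}"
      by (intro m.finite_measure_mono) auto
    ultimately show ?thesis by simp
  qed
  have "\<forall>n. \<exists>K. measure (\<mu> n) {-K<..K} > 1 - \<epsilon>" using m.ex_interval_measure_gt[OF \<epsilon>] by blast
  then obtain K where K: "\<And>n. measure (\<mu> n) {-K n<..K n} > 1 - \<epsilon>" by metis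
  define B where "B = Max (insert (1 / s) (K ` {..<n0}))"
  have B1: "1 / s \<le> B" unfolding B_def by (intro Max_ge) auto
  have B2: "K n \<le> B" if "n < n0" for n unfolding B_def using that by (intro Max_ge) auto
  have "measure (\<mu> n) {-B<..B} > 1 - \<epsilon>" for n
  proof (cases "n \<ge> n0")
    case True
    have "measure (\<mu> n) {-(1/s)<..1/s} \<le> measure (\<mu> n) {-B<..B}"
      using B1 by (intro m.finite_measure_mono) auto
    with big[OF True] show ?thesis by simp
  next
    case False
    have "measure (\<mu> n) {-K n<..K n} \<le> measure (\<mu> n) {-B<..B}"
      using B2[of n] False by (intro m.finite_measure_mono) auto
    with K[of n] show ?thesis by simp
  qed
  moreover have "B > 0" using B1 s by (smt (verit) divide_pos_pos)
  ultimately show "\<exists>a b. a < b \<and> (\<forall>n. 1 - \<epsilon> < measure (\<mu> n) {a<..b})"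
    by (intro exI[of _ "-B"] exI[of _ B]) auto
qed

text \<open>Tightness gives a limit law along a subsequence, and its characteristic function must be
  \<phi>. Once \<phi> is known to be a characteristic function, \<open>levy_continuity\<close>
  handles the full sequence.\<close>

theorem levy_continuity_ex:
  fixes \<mu> :: "nat \<Rightarrow> real measure"
  assumes \<mu>: "\<And>n. real_distribution (\<mu> n)"
    and lim: "\<And>t. (\<lambda>n. char (\<mu> n) t) \<longlonglongrightarrow> \<phi> t" and cont: "isCont \<phi> 0"
  obtains \<nu> where "real_distribution \<nu>" "\<And>t. char \<nu> t = \<phi> t" "weak_conv_m \<mu> \<nu>"
proof -
  from tight_imp_convergent_subsubsequence[OF tight_of_char_tendsto[OF assms] strict_mono_id]
  obtain r \<nu> where r: "strict_mono (r :: nat \<Rightarrow> nat)" "real_distribution \<nu>" "weak_conv_m (\<mu> \<circ> id \<circ> r) \<nu>" by blast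
  have "char \<nu> t = \<phi> t" for t
  proof -
    have "(\<lambda>n. char ((\<mu> \<circ> id \<circ> r) n) t) \<longlonglongrightarrow> char \<nu> t"
      by (rule levy_continuity1[OF _ r(2,3)]) (simp add: \<mu>)
    moreover have "(\<lambda>n. char ((\<mu> \<circ> id \<circ> r) n) t) \<longlonglongrightarrow> \<phi> t"
      using LIMSEQ_subseq_LIMSEQ[OF lim[of t] r(1)] by (simp add: comp_def)
    ultimately show ?thesis by (rule LIMSEQ_unique)
  qed
  moreover have "weak_conv_m \<mu> \<nu>"
    by (rule levy_continuity) (use \<mu> r lim calculation in auto)
  ultimately show ?thesis using that r by blast
qed

section \<open>Characteristic functions of sums of independent variables\<close>

lemma char_convolution:
  assumes "real_distribution M" "real_distribution N"
  shows "real_distribution (distr (M \<Otimes>\<^sub>M N) borel (\<lambda>(x, y). x + y))"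
    and "char (distr (M \<Otimes>\<^sub>M N) borel (\<lambda>(x, y). x + y)) t = char M t * char N t"
proof -
  interpret M: real_distribution M by fact
  interpret N: real_distribution N by fact
  interpret P: pair_prob_space M N ..
  have [measurable]: "(\<lambda>(x, y). x + y) \<in> borel_measurable (M \<Otimes>\<^sub>M N)"
    unfolding split_beta' by simp
  show "real_distribution (distr (M \<Otimes>\<^sub>M N) borel (\<lambda>(x, y). x + y))"
    by (rule P.real_distribution_distr) simp
  have int: "integrable (M \<Otimes>\<^sub>M N) (\<lambda>(x, y). iexp (t * x) * iexp (t * y))"
    by (rule P.integrable_const_bound[where B = 1]) (auto simp: split_beta' norm_mult)
  have "char (distr (M \<Otimes>\<^sub>M N) borel (\<lambda>(x, y). x + y)) t = (\<integral>z. (case z of (x, y) \<Rightarrow> iexp (t * x) * iexp (t * y)) \<partial>(M \<Otimes>\<^sub>M N))"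
    unfolding char_def
    by (subst integral_distr) (auto simp: split_beta' exp_add[symmetric] algebra_simps)
  also have "\<dots> = (LINT x|M. LINT y|N. iexp (t * x) * iexp (t * y))"
    using P.integral_fst'[OF int] by simp
  also have "\<dots> = char M t * char N t"
    by (simp add: char_def)
  finally show "char (distr (M \<Otimes>\<^sub>M N) borel (\<lambda>(x, y). x + y)) t = char M t * char N t" .
qed

lemma char_PiM_sum:
  assumes "real_distribution R"
  shows "real_distribution (distr (\<Pi>\<^sub>M i\<in>{..<n::nat}. R) borel (\<lambda>x. \<Sum>i<n. x i))"
    and "char (distr (\<Pi>\<^sub>M i\<in>{..<n::nat}. R) borel (\<lambda>x. \<Sum>i<n. x i)) t = char R t ^ n"
proof -
  interpret R: real_distribution R by fact
  interpret P: product_prob_space "\<lambda>_. R" "{..<n}" ..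

  have [measurable]: "(\<lambda>x. \<Sum>i<n. x i) \<in> borel_measurable (\<Pi>\<^sub>M i\<in>{..<n::nat}. R)"
    by (rule borel_measurable_sum) auto
  show "real_distribution (distr (\<Pi>\<^sub>M i\<in>{..<n::nat}. R) borel (\<lambda>x. \<Sum>i<n. x i))"
    by (rule prob_space.real_distribution_distr[OF P.prob_space_axioms]) simp
  have "char (distr (\<Pi>\<^sub>M i\<in>{..<n::nat}. R) borel (\<lambda>x. \<Sum>i<n. x i)) t =
      (\<integral>x. (\<Prod>i<n. iexp (t * x i)) \<partial>(\<Pi>\<^sub>M i\<in>{..<n::nat}. R))"
    unfolding char_def
    by (subst integral_distr) (auto simp: sum_distrib_left exp_sum)
  also have "\<dots> = (\<Prod>i<n. LINT x|R. iexp (t * x))"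
    by (rule P.product_integral_prod) (auto intro!: R.integrable_const_bound[where B = 1])
  finally show "char (distr (\<Pi>\<^sub>M i\<in>{..<n::nat}. R) borel (\<lambda>x. \<Sum>i<n. x i)) t = char R t ^ n"
    by (simp add: char_def)
qed

section \<open>Laplace and Mellin integrals\<close>

text \<open>Only the integrand is dominated, not its derivative. Cauchy's estimate turns the bound
  \<open>g\<close> into the Lipschitz bound \<open>2 * g t / r\<close> on the ball of half the
  radius, which dominates the difference quotients.\<close>

lemma has_field_derivative_integral:
  fixes f :: "complex \<Rightarrow> 'a \<Rightarrow> complex"
  assumes r: "r > 0" and meas: "\<And>w. w \<in> ball z r \<Longrightarrow> f w \<in> borel_measurable M"
    and holo: "\<And>t. t \<in> space M \<Longrightarrow> (\<lambda>w. f w t) holomorphic_on ball z r"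
    and bound: "\<And>w t. w \<in> ball z r \<Longrightarrow> t \<in> space M \<Longrightarrow> norm (f w t) \<le> g t"
    and g: "integrable M g"
  shows "((\<lambda>w. \<integral>t. f w t \<partial>M) has_field_derivative (\<integral>t. deriv (\<lambda>w. f w t) z \<partial>M)) (at z)"
proof -
  have int: "integrable M (f w)" if "w \<in> ball z r" for w
    by (rule Bochner_Integration.integrable_bound[OF g meas[OF that]])
       (use bound[OF that] in \<open>auto intro!: AE_I2 order_trans[OF _ abs_ge_self]\<close>)
  have lip: "norm (f w t - f z t) \<le> 2 * g t / r * norm (w - z)"
    if w: "w \<in> ball z (r/2)" and t: "t \<in> space M" for w t
  proof (rule field_differentiable_bound)
    show "convex (ball z (r/2))" by simp
    show "((\<lambda>w. f w t) has_field_derivative deriv (\<lambda>w. f w t) x) (at x within ball z (r / 2))"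
      if "x \<in> ball z (r/2)" for x
      by (rule has_field_derivative_at_within, rule holomorphic_derivI[OF holo[OF t]])
         (use that r in auto)
    show "norm (deriv (\<lambda>w. f w t) x) \<le> 2 * g t / r" if x: "x \<in> ball z (r/2)" for x
    proof -
      have sub: "cball x (r/3) \<subseteq> ball z r"
        using x r by (auto simp: dist_norm) (smt (verit) dist_norm dist_triangle mem_ball dist_commute)
      have ne: "g t \<ge> 0" using bound[OF _ t, of z] r by (smt (verit) centre_in_ball norm_ge_zero)
      \<comment> \<open>Cauchy's estimate is taken on circles of radius r/2 * (1 - e), which stay
        inside \<open>ball z r\<close>; letting e tend to 0 gives the constant 2/r.\<close>
      have sub2: "cball x (r/2*(1-e)) \<subseteq> ball z r" if "e > 0" "e < 1" for e
      proof
        fix y assume "y \<in> cball x (r/2*(1-e))"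
        then have "dist x y \<le> r/2*(1-e)" by simp
        moreover have "r/2*(1-e) < r/2" using that r by (simp add: field_simps)
        moreover have "dist z y \<le> dist z x + dist x y" by (rule dist_triangle)
        ultimately show "y \<in> ball z r" using x by auto
      qed
      have "norm (deriv (\<lambda>w. f w t) x) * (r/2*(1-e)) \<le> g t" if e: "e > 0" "e < 1" for e
      proof -
        have "norm ((deriv ^^ 1) (\<lambda>w. f w t) x) \<le> fact 1 * g t / (r/2*(1-e)) ^ 1"
        proof (rule Cauchy_inequality)
          show "(\<lambda>w. f w t) holomorphic_on ball x (r/2*(1-e))"
            by (rule holomorphic_on_subset[OF holo[OF t]]) (use sub2[OF e] in auto)
          show "continuous_on (cball x (r/2*(1-e))) (\<lambda>w. f w t)"
            by (rule holomorphic_on_imp_continuous_on, rule holomorphic_on_subset[OF holo[OF t]])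
               (use sub2[OF e] in auto)
          show "0 < r/2*(1-e)" using e r by simp
          show "norm (f y t) \<le> g t" if "norm (x - y) = r/2*(1-e)" for y
          proof (intro bound t)
            have "y \<in> cball x (r/2*(1-e))" using that by (simp add: dist_norm)
            then show "y \<in> ball z r" using sub2[OF e] by blast
          qed
        qed
        then show ?thesis using e r by (simp add: field_simps)
      qed
      then have "eventually (\<lambda>e. norm (deriv (\<lambda>w. f w t) x) * (r/2*(1-e)) \<le> g t) (at_right 0)"
        by (intro eventually_at_rightI[of 0 1]) auto
      moreover have "((\<lambda>e. norm (deriv (\<lambda>w. f w t) x) * (r/2*(1-e))) \<longlongrightarrow>
          norm (deriv (\<lambda>w. f w t) x) * (r/2*(1-0))) (at_right 0)"
        by (intro tendsto_intros)
      ultimately have "norm (deriv (\<lambda>w. f w t) x) * (r/2*(1-0)) \<le> g t"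
        by (intro tendsto_upperbound) auto
      then show ?thesis using r by (simp add: field_simps)
    qed
  qed (use w r in auto)
  show ?thesis unfolding has_field_derivative_iff tendsto_at_iff_sequentially comp_def
  proof (intro allI impI)
    fix X :: "nat \<Rightarrow> complex" assume X: "\<forall>i. X i \<in> UNIV - {z}" "X \<longlonglongrightarrow> z"
    obtain N where N: "\<And>n. n \<ge> N \<Longrightarrow> X n \<in> ball z (r/2)"
      using X(2)[unfolded tendsto_iff, rule_format, of "r/2"] r
      by (auto simp: eventually_sequentially dist_commute)
    define Y where "Y n = X (n + N)" for n
    have Y: "Y \<longlonglongrightarrow> z" unfolding Y_def using X(2) by (rule LIMSEQ_ignore_initial_segment)
    have Yb: "Y n \<in> ball z (r/2)" and Yne: "Y n \<noteq> z" for n using N X(1) by (auto simp: Y_def)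
    have Yb': "Y n \<in> ball z r" for n using Yb[of n] r by auto
    have lim: "(\<lambda>n. (f (Y n) t - f z t) / (Y n - z)) \<longlonglongrightarrow> deriv (\<lambda>w. f w t) z" if "t \<in> space M" for t
    proof -
      have "((\<lambda>w. f w t) has_field_derivative deriv (\<lambda>w. f w t) z) (at z)"
        using holomorphic_derivI[OF holo[OF that]] r by auto
      then show ?thesis
        unfolding has_field_derivative_iff tendsto_at_iff_sequentially comp_def using Y Yne by auto
    qed
    have m: "(\<lambda>t. (f (Y n) t - f z t) / (Y n - z)) \<in> borel_measurable M" for n
      using meas[OF Yb'] meas[of z] r by (intro borel_measurable_divide borel_measurable_diff) auto
    have "(\<lambda>n. \<integral>t. (f (Y n) t - f z t) / (Y n - z) \<partial>M) \<longlonglongrightarrow> (\<integral>t. deriv (\<lambda>w. f w t) z \<partial>M)"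
    proof (rule integral_dominated_convergence)
      show "(\<lambda>t. deriv (\<lambda>w. f w t) z) \<in> borel_measurable M"
        by (rule borel_measurable_LIMSEQ_metric[OF m lim])
      show "integrable M (\<lambda>t. 2 * g t / r)" using g by simp
      show "AE t in M. norm ((f (Y n) t - f z t) / (Y n - z)) \<le> 2 * g t / r" for n
        using lip[OF Yb] Yne[of n] by (intro AE_I2) (simp add: norm_divide divide_le_eq)
    qed (use m lim in auto)
    moreover have "(\<integral>t. (f (Y n) t - f z t) / (Y n - z) \<partial>M) =
        ((\<integral>t. f (Y n) t \<partial>M) - (\<integral>t. f z t \<partial>M)) / (Y n - z)" for n
      using int[OF Yb'] int[of z] r by simp
    ultimately have "(\<lambda>n. ((\<integral>t. f (Y n) t \<partial>M) - (\<integral>t. f z t \<partial>M)) / (Y n - z)) \<longlonglongrightarrow> (\<integral>t. deriv (\<lambda>w. f w t) z \<partial>M)"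
      by (simp only:)
    then show "(\<lambda>n. ((\<integral>t. f (X n) t \<partial>M) - (\<integral>t. f z t \<partial>M)) / (X n - z)) \<longlonglongrightarrow> (\<integral>t. deriv (\<lambda>w. f w t) z \<partial>M)"
      unfolding Y_def by (rule LIMSEQ_offset)
  qed
qed

lemma holomorphic_on_integral:
  fixes f :: "complex \<Rightarrow> 'a \<Rightarrow> complex"
  assumes meas: "\<And>w. w \<in> S \<Longrightarrow> f w \<in> borel_measurable M"
    and holo: "\<And>t. t \<in> space M \<Longrightarrow> (\<lambda>w. f w t) holomorphic_on S"
    and bound: "\<And>z. z \<in> S \<Longrightarrow> \<exists>r>0. \<exists>g. ball z r \<subseteq> S \<and> integrable M g \<and>
      (\<forall>w\<in>ball z r. \<forall>t\<in>space M. norm (f w t) \<le> g t)"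
  shows "(\<lambda>w. \<integral>t. f w t \<partial>M) holomorphic_on S"
  unfolding holomorphic_on_def field_differentiable_def
proof (intro ballI)
  fix z assume "z \<in> S"
  from bound[OF this] obtain r g where r: "r > 0" "ball z r \<subseteq> S" "integrable M g"
    "\<forall>w\<in>ball z r. \<forall>t\<in>space M. norm (f w t) \<le> g t" by blast
  have "((\<lambda>w. \<integral>t. f w t \<partial>M) has_field_derivative (\<integral>t. deriv (\<lambda>w. f w t) z \<partial>M)) (at z)"
    by (rule has_field_derivative_integral[where g = g and r = r])
       (use r meas in \<open>auto intro!: holomorphic_on_subset[OF holo]\<close>)
  then show "\<exists>f'. ((\<lambda>w. \<integral>t. f w t \<partial>M) has_field_derivative f') (at z within S)"
    using has_field_derivative_at_within by blast
qed

lemma set_integrable_powr_exp: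
  fixes a x :: real
  assumes "a > -1" "x > 0"
  shows "set_integrable lborel {0<..} (\<lambda>t. t powr a * exp (- (x * t)))"
proof -
  have "set_integrable lebesgue {0<..} (\<lambda>t. norm (complex_of_real t powr (of_real (a + 1) - 1) / of_real (exp (x * t))))"
    by (rule set_integrable_norm, rule absolutely_integrable_Gamma_integral) (use assms in auto)
  then have "set_integrable lebesgue {0<..} (\<lambda>t. t powr a * exp (- (x * t)))"
    by (rule set_integrable_cong[THEN iffD1, rotated -1])
       (auto simp: norm_divide norm_powr_real_powr exp_minus field_simps)
  then show ?thesis unfolding set_integrable_def
    by (subst (asm) integrable_completion) (auto intro!: borel_measurable_continuous_on_indicator continuous_intros)
qed

lemma set_integrable_cpowr_exp:
  assumes "Re s > 0" "Re w > 0"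
  shows "set_integrable lborel {0<..} (\<lambda>t. complex_of_real t powr (s - 1) * exp (- (w * of_real t)))"
proof -
  have "set_integrable lborel {0<..} (\<lambda>t. t powr (Re s - 1) * exp (- (Re w * t)))"
    by (rule set_integrable_powr_exp) (use assms in auto)
  then show ?thesis unfolding set_integrable_def
    by (rule Bochner_Integration.integrable_bound)
       (auto intro!: borel_measurable_continuous_on_indicator continuous_intros AE_I2
           simp: norm_mult norm_powr_real_powr indicator_def)
qed

text \<open>Integrability at every positive real is enough: near \<open>z\<close> the integrand is
  dominated by the one at x = Re z / 2.\<close>

lemma holomorphic_on_Laplace:
  fixes h :: "real \<Rightarrow> complex"
  assumes h: "\<And>x. x > 0 \<Longrightarrow> set_integrable lborel {0<..} (\<lambda>t. h t * of_real (exp (- (x * t))))"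
  shows "(\<lambda>w. LINT t:{0<..}|lborel. h t * exp (- (w * of_real t))) holomorphic_on {w. Re w > 0}"
  unfolding set_lebesgue_integral_def
proof (rule holomorphic_on_integral)
  fix w assume w: "w \<in> {w. Re w > 0}"
  have "(\<lambda>t. (indicator {0<..} t *\<^sub>R (h t * of_real (exp (- (1 * t))))) * exp (of_real t - w * of_real t)) \<in> borel_measurable lborel"
    by (intro borel_measurable_times) (use h[of 1] in \<open>auto simp: set_integrable_def\<close>)
  also have "(\<lambda>t. (indicator {0<..} t *\<^sub>R (h t * of_real (exp (- (1 * t))))) * exp (of_real t - w * of_real t))
     = (\<lambda>t. indicator {0<..} t *\<^sub>R (h t * exp (- (w * of_real t))))"
    by (auto simp: indicator_def exp_of_real[symmetric] exp_add[symmetric] mult.assoc)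
  finally show "(\<lambda>t. indicator {0<..} t *\<^sub>R (h t * exp (- (w * of_real t)))) \<in> borel_measurable lborel" .
next
  fix z assume z: "z \<in> {w. Re w > 0}"
  define x where "x = Re z / 2"
  have x: "x > 0" using z by (simp add: x_def)
  show "\<exists>r>0. \<exists>g. ball z r \<subseteq> {w. 0 < Re w} \<and> integrable lborel g \<and>
       (\<forall>w\<in>ball z r. \<forall>t\<in>space lborel. cmod (indicat_real {0<..} t *\<^sub>R (h t * exp (- (w * of_real t)))) \<le> g t)"
  proof (intro exI conjI ballI)
    have Re: "x < Re w" if "w \<in> ball z x" for w
    proof -
      have "Re (z - w) \<le> norm (z - w)" by (rule complex_Re_le_cmod)
      with that show ?thesis by (simp add: x_def dist_norm)
    qed
    show "x > 0" by fact
    show "ball z x \<subseteq> {w. 0 < Re w}" using Re x by force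
    show "integrable lborel (\<lambda>t. norm (indicator {0<..} t *\<^sub>R (h t * of_real (exp (- (x * t))))))"
      using h[OF x] unfolding set_integrable_def by (rule integrable_norm)
    show "cmod (indicat_real {0<..} t *\<^sub>R (h t * exp (- (w * of_real t)))) \<le>
       norm (indicator {0<..} t *\<^sub>R (h t * of_real (exp (- (x * t)))))" if "w \<in> ball z x" for w t
      using Re[OF that] by (auto simp: indicator_def norm_mult intro!: mult_left_mono mult_right_mono)
  qed
qed (auto intro!: holomorphic_intros)

text \<open>Euler's integral is the case w = 1, scaling of the variable gives positive real w, and
  the identity theorem on the right half-plane gives the rest.\<close>

lemma Laplace_powr:
  assumes s: "Re s > 0" and w: "Re w > 0"
  shows "(LINT t:{0<..}|lborel. complex_of_real t powr (s - 1) * exp (- (w * of_real t))) = Gamma s * w powr (-s)"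
proof -
  define F where "F w = (LINT t:{0<..}|lborel. complex_of_real t powr (s - 1) * exp (- (w * of_real t)))" for w
  have F1: "F 1 = Gamma s"
  proof -
    have "((\<lambda>t. if t \<in> {0<..} then complex_of_real t powr (s - 1) * exp (- (1 * of_real t)) else 0) has_integral F 1) UNIV"
    proof (rule has_integral_eq[rotated -1])
      show "((\<lambda>t. indicat_real {0<..} t *\<^sub>R (complex_of_real t powr (s - 1) * exp (- (1 * of_real t)))) has_integral F 1) UNIV"
        unfolding F_def set_lebesgue_integral_def
        by (rule has_integral_integral_lborel) (use set_integrable_cpowr_exp[of s 1] s in \<open>simp add: set_integrable_def\<close>)
    qed (auto simp: indicator_def)
    then have "((\<lambda>t. complex_of_real t powr (s - 1) * exp (- (1 * of_real t))) has_integral F 1) {0<..}"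
      by (simp only: has_integral_restrict_UNIV)
    moreover have "((\<lambda>t. complex_of_real t powr (s - 1) / of_real (exp t)) has_integral Gamma s) {0<..}"
      by (rule iffD1[OF has_integral_spike_set_eq Gamma_integral_complex[OF s]])
         (auto intro: negligible_subset[of "{0}"])
    then have "((\<lambda>t. complex_of_real t powr (s - 1) * exp (- (1 * of_real t))) has_integral Gamma s) {0<..}"
      by (rule has_integral_eq[rotated -1]) (simp add: exp_minus exp_of_real divide_inverse)
    ultimately show ?thesis by (rule has_integral_unique)
  qed
  have Fx: "F (of_real x) = Gamma s * of_real x powr (-s)" if x: "x > 0" for x :: real
  proof -
    have "F 1 = x *\<^sub>R (\<integral>t. indicator {0<..} (0 + x * t) *\<^sub>R (complex_of_real (0 + x * t) powr (s - 1) * exp (- (1 * of_real (0 + x * t)))) \<partial>lborel)"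
      unfolding F_def set_lebesgue_integral_def by (subst lborel_integral_real_affine[of x _ 0]) (use x in auto)
    also have "\<dots> = x *\<^sub>R (\<integral>t. of_real x powr (s - 1) * (indicator {0<..} t *\<^sub>R (complex_of_real t powr (s - 1) * exp (- (of_real x * of_real t)))) \<partial>lborel)"
      using x by (intro arg_cong[where f="scaleR x"] Bochner_Integration.integral_cong)
        (auto simp: indicator_def zero_less_mult_iff powr_times_real)
    also have "\<dots> = of_real x powr s * F (of_real x)"
    proof -
      have "\<dots> = of_real x * (of_real x powr (s - 1) * F (of_real x))"
        unfolding F_def set_lebesgue_integral_def scaleR_conv_of_real[of x] by (subst integral_mult_right_zero) simp
      also have "of_real x * (of_real x powr (s - 1) * F (of_real x)) = of_real x powr s * F (of_real x)"
        using x by (simp add: powr_diff)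
      finally show ?thesis .
    qed
    finally show ?thesis using x F1 by (simp add: powr_minus field_simps)
  qed
  have "F w - Gamma s * w powr (-s) = 0"
  proof (rule analytic_continuation[of "\<lambda>w. F w - Gamma s * w powr (-s)" "{w. Re w > 0}" "of_real ` {0<..}" 1])
    show "(\<lambda>w. F w - Gamma s * w powr (-s)) holomorphic_on {w. 0 < Re w}"
      unfolding F_def
    proof (intro holomorphic_intros holomorphic_on_Laplace)
      fix x :: real assume "x > 0"
      then have "set_integrable lborel {0<..} (\<lambda>t. complex_of_real t powr (s - 1) * exp (- (of_real x * of_real t)))"
        by (intro set_integrable_cpowr_exp[OF s]) simp
      then show "set_integrable lborel {0<..} (\<lambda>t. complex_of_real t powr (s - 1) * of_real (exp (- (x * t))))"
        by (simp only: exp_of_real[symmetric] of_real_minus of_real_mult)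
    next
      show "w \<in> {w. 0 < Re w} \<Longrightarrow> w \<notin> \<real>\<^sub>\<le>\<^sub>0" for w by (auto simp: complex_nonpos_Reals_iff)
    qed
    show "open {w. 0 < Re w}" by (rule open_halfspace_Re_gt)
    show "connected {w. 0 < Re w}" by (intro convex_connected convex_halfspace_Re_gt)
    show "(1::complex) islimpt of_real ` {0<..}"
    proof (rule islimptI)
      fix T assume T: "(1::complex) \<in> T" "open T"
      then obtain e where e: "e > 0" "ball 1 e \<subseteq> T" by (meson openE)
      define y where "y = complex_of_real (1 + e/2)"
      have "dist 1 y = e/2" using e by (simp add: y_def dist_norm norm_divide)
      then have "y \<in> T" "y \<noteq> 1" using e by auto
      moreover have "y \<in> complex_of_real ` {0<..}" using e unfolding y_def by (intro imageI) simp
      ultimately show "\<exists>y\<in>complex_of_real ` {0<..}. y \<in> T \<and> y \<noteq> 1" by blast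
    qed
  qed (use w Fx in auto)
  then show ?thesis by (simp add: F_def)
qed

text \<open>Reduces uniform bounds on the half-line to two limits, which \<open>real_asymp\<close>
  can compute.\<close>

lemma bounded_on_Ioi:
  fixes f :: "real \<Rightarrow> real"
  assumes cont: "continuous_on {0<..} f" and l0: "(f \<longlongrightarrow> a) (at_right 0)" and l1: "(f \<longlongrightarrow> b) at_top"
  obtains K where "\<And>t. t > 0 \<Longrightarrow> \<bar>f t\<bar> \<le> K"
proof -
  have "eventually (\<lambda>t. \<bar>f t\<bar> < \<bar>a\<bar> + 1) (at_right 0)"
    by (rule order_tendstoD(2)[OF tendsto_rabs[OF l0]]) simp
  then obtain d where d: "d > 0" "\<And>t. 0 < t \<Longrightarrow> t < d \<Longrightarrow> \<bar>f t\<bar> < \<bar>a\<bar> + 1"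
    unfolding eventually_at_right_field by auto
  have "eventually (\<lambda>t. \<bar>f t\<bar> < \<bar>b\<bar> + 1) at_top"
    by (rule order_tendstoD(2)[OF tendsto_rabs[OF l1]]) simp
  then obtain T where T: "\<And>t. t \<ge> T \<Longrightarrow> \<bar>f t\<bar> < \<bar>b\<bar> + 1"
    unfolding eventually_at_top_linorder by auto
  have "compact (f ` {d..T})"
    by (intro compact_continuous_image continuous_on_subset[OF cont]) (use d in auto)
  then obtain B where B: "\<And>t. t \<in> {d..T} \<Longrightarrow> \<bar>f t\<bar> \<le> B"
    by (metis bounded_iff compact_imp_bounded imageI real_norm_def)
  show ?thesis
  proof (rule that[of "max (max (\<bar>a\<bar> + 1) (\<bar>b\<bar> + 1)) B"])
    fix t :: real assume "t > 0"
    then show "\<bar>f t\<bar> \<le> max (max (\<bar>a\<bar> + 1) (\<bar>b\<bar> + 1)) B"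
      using d(2)[of t] T[of t] B[of t] unfolding le_max_iff_disj atLeastAtMost_iff by linarith
  qed
qed

text \<open>For t > 0 this is the geometric series of exp (- k * t), k >= 0. The product of its
  values at t and \<tau> * t is the sum of exp (- t * x) over the lattice points x of the double
  zeta series.\<close>

definition geom_exp :: "real \<Rightarrow> real" where "geom_exp t = 1 / (1 - exp (- t))"

text \<open>The Laurent coefficients subtracted here reappear as the elementary part of \<open>log_Gamma2\<close>.\<close>

definition barnes_remainder :: "real \<Rightarrow> real \<Rightarrow> real" where
  "barnes_remainder \<tau> t = geom_exp t * geom_exp (\<tau> * t) - 1 / (\<tau> * t\<^sup>2) - (1 + \<tau>) / (2 * \<tau>) / t
     - (1 / 4 + (\<tau> + 1 / \<tau>) / 12)"

text \<open>The Bernoulli expansion 1/t + 1/2 + t/12 with errors valid on the whole half-line.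
  Several strengths are needed because in the product of two such expansions the error occurs alone,
  divided by t, and times another error.\<close>

lemma geom_exp_expansion:
  obtains K where "K \<ge> 0" "\<And>t. t > 0 \<Longrightarrow> \<bar>geom_exp t - 1 / t - 1 / 2\<bar> \<le> K"
    "\<And>t. t > 0 \<Longrightarrow> \<bar>geom_exp t - 1 / t - 1 / 2\<bar> \<le> K * t"
    "\<And>t. t > 0 \<Longrightarrow> \<bar>geom_exp t - 1 / t - 1 / 2 - t / 12\<bar> \<le> K * t\<^sup>2"
proof -
  define e :: "real \<Rightarrow> real" where "e t = 1 / (1 - exp (- t)) - 1 / t - 1 / 2" for t
  have c: "continuous_on {0<..} e"
    unfolding e_def by (intro continuous_intros) auto
  have l1: "(e \<longlongrightarrow> 0) (at_right 0)" "(e \<longlongrightarrow> 1 / 2) at_top"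
    unfolding e_def by real_asymp+
  obtain K1 where K1: "\<And>t. t > 0 \<Longrightarrow> \<bar>e t\<bar> \<le> K1"
    using bounded_on_Ioi[OF c l1] by blast
  have c2: "continuous_on {0<..} (\<lambda>t. e t / t)" by (intro continuous_intros c) auto
  have l2: "((\<lambda>t. e t / t) \<longlongrightarrow> 1 / 12) (at_right 0)" "((\<lambda>t. e t / t) \<longlongrightarrow> 0) at_top"
    unfolding e_def by real_asymp+
  obtain K2 where K2: "\<And>t. t > 0 \<Longrightarrow> \<bar>e t / t\<bar> \<le> K2"
    using bounded_on_Ioi[OF c2 l2] by blast
  have c3: "continuous_on {0<..} (\<lambda>t. (e t / t - 1 / 12) / t)" by (intro continuous_intros c) auto
  have l3: "((\<lambda>t. (e t / t - 1 / 12) / t) \<longlongrightarrow> 0) (at_right 0)" "((\<lambda>t. (e t / t - 1 / 12) / t) \<longlongrightarrow> 0) at_top"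
    unfolding e_def by real_asymp+
  obtain K3 where K3: "\<And>t. t > 0 \<Longrightarrow> \<bar>(e t / t - 1 / 12) / t\<bar> \<le> K3"
    using bounded_on_Ioi[OF c3 l3] by blast
  have e: "geom_exp t - 1 / t - 1 / 2 = e t" for t by (simp add: geom_exp_def e_def)
  show ?thesis
  proof (rule that[of "max K1 (max K2 K3)"])
    show "max K1 (max K2 K3) \<ge> 0" using K1[of 1] by linarith
    fix t :: real assume t: "t > 0"
    show "\<bar>geom_exp t - 1 / t - 1 / 2\<bar> \<le> max K1 (max K2 K3)"
      unfolding e using K1[OF t] by (simp add: le_max_iff_disj)
    have "\<bar>e t\<bar> \<le> K2 * t" using K2[OF t] t by (simp add: divide_le_eq)
    also have "\<dots> \<le> max K1 (max K2 K3) * t" using t by (intro mult_right_mono) auto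
    finally show "\<bar>geom_exp t - 1 / t - 1 / 2\<bar> \<le> max K1 (max K2 K3) * t" unfolding e .
    have "e t - t / 12 = ((e t / t - 1 / 12) / t) * t\<^sup>2"
      using t by (simp add: field_simps power2_eq_square)
    then have "\<bar>e t - t / 12\<bar> = \<bar>(e t / t - 1 / 12) / t\<bar> * t\<^sup>2" by (simp only: abs_mult abs_power2)
    also have "\<dots> \<le> K3 * t\<^sup>2" by (intro mult_right_mono K3[OF t]) simp
    also have "\<dots> \<le> max K1 (max K2 K3) * t\<^sup>2" using t by (intro mult_right_mono) auto
    finally show "\<bar>geom_exp t - 1 / t - 1 / 2 - t / 12\<bar> \<le> max K1 (max K2 K3) * t\<^sup>2" unfolding e .
  qed
qed

lemma half_sum_bound:
  fixes a b :: real
  assumes "\<bar>a\<bar> \<le> x" "\<bar>b\<bar> \<le> y"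
  shows "\<bar>(a + b) / 2\<bar> \<le> x + y"
  using assms by (simp add: abs_le_iff)

text \<open>Uniformity in \<tau> is the point: the explicit factor stays bounded for \<tau> in
  [1, 2], which later allows dominated convergence as \<tau> decreases to 1. The factor
  \<open>t\<close> keeps the remainder bounded after division by t.\<close>

lemma barnes_remainder_bound:
  obtains C where "C \<ge> 0" "\<And>\<tau> t. \<tau> > 0 \<Longrightarrow> t > 0 \<Longrightarrow> \<bar>barnes_remainder \<tau> t\<bar> \<le> C * (1 + \<tau>\<^sup>2 + 1 / \<tau>) * t"
proof -
  obtain K where K: "K \<ge> 0" "\<And>t. t > 0 \<Longrightarrow> \<bar>geom_exp t - 1 / t - 1 / 2\<bar> \<le> K"
    "\<And>t. t > 0 \<Longrightarrow> \<bar>geom_exp t - 1 / t - 1 / 2\<bar> \<le> K * t"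
    "\<And>t. t > 0 \<Longrightarrow> \<bar>geom_exp t - 1 / t - 1 / 2 - t / 12\<bar> \<le> K * t\<^sup>2"
    using geom_exp_expansion by blast
  show ?thesis
  proof (rule that[of "2 * K + K * K"])
    show "0 \<le> 2 * K + K * K" using K(1) by simp
    fix \<tau> t :: real assume \<tau>: "\<tau> > 0" and t: "t > 0"
    define e where "e s = geom_exp s - 1 / s - 1 / 2" for s
    have g: "geom_exp s = 1 / s + 1 / 2 + e s" for s by (simp add: e_def)
    have \<tau>t: "\<tau> * t > 0" using \<tau> t by simp
    \<comment> \<open>In the product of the two expansions the pole terms and 1/4 cancel against the
      subtracted part; the constants \<tau>/12 and 1/(12 \<tau>) are absorbed by the cross terms e
      (\<tau> * t) / t and e t / (\<tau> * t).\<close>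
    have eq: "barnes_remainder \<tau> t = (e (\<tau> * t) - \<tau> * t / 12) / t + (e t - t / 12) / (\<tau> * t)
        + (e t + e (\<tau> * t)) / 2 + e t * e (\<tau> * t)"
      unfolding barnes_remainder_def g using \<tau> t by (simp add: field_simps power2_eq_square)
    have "\<bar>(e (\<tau> * t) - \<tau> * t / 12) / t\<bar> \<le> K * \<tau>\<^sup>2 * t"
      using K(4)[OF \<tau>t] t by (simp add: e_def abs_divide divide_le_eq power_mult_distrib power2_eq_square mult_ac)
    moreover have "\<bar>(e t - t / 12) / (\<tau> * t)\<bar> \<le> K * (1 / \<tau>) * t"
      using K(4)[OF t] t \<tau> by (simp add: e_def abs_divide divide_simps power2_eq_square mult_ac abs_mult)
    moreover have "\<bar>(e t + e (\<tau> * t)) / 2\<bar> \<le> K * (1 + \<tau>) * t"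
    proof -
      have 1: "\<bar>e t\<bar> \<le> K * t" "\<bar>e (\<tau> * t)\<bar> \<le> K * (\<tau> * t)" using K(3)[OF t] K(3)[OF \<tau>t] by (simp_all add: e_def)
      have 2: "0 \<le> K * t" "0 \<le> K * (\<tau> * t)" using K(1) t \<tau>t by simp_all
      have "K * (1 + \<tau>) * t = K * t + K * (\<tau> * t)" by (simp add: algebra_simps)
      then show ?thesis using half_sum_bound[OF 1] by simp
    qed
    moreover have "\<bar>e t * e (\<tau> * t)\<bar> \<le> K * K * t"
      using mult_mono[OF K(3)[OF t] K(2)[OF \<tau>t]] K(1) t by (simp add: e_def[symmetric] abs_mult mult_ac)
    ultimately have "\<bar>barnes_remainder \<tau> t\<bar> \<le> (K * \<tau>\<^sup>2 + K * (1 / \<tau>) + K * (1 + \<tau>) + K * K) * t"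
      unfolding eq distrib_right[of _ _ t] by linarith
    also have "\<dots> \<le> (2 * K + K * K) * (1 + \<tau>\<^sup>2 + 1 / \<tau>) * t"
    proof (intro mult_right_mono)
      have "\<tau> \<le> 1 + \<tau>\<^sup>2" using sum_power2_ge_zero[of "\<tau> - 1" 0] zero_le_power2[of "\<tau>-1"] \<tau> by (simp add: power2_diff)
      then have "K * \<tau> \<le> K * (1 + \<tau>\<^sup>2)" using K(1) by (intro mult_left_mono)
      moreover have "0 \<le> K * K * \<tau>\<^sup>2" "0 \<le> K * K * (1/\<tau>)" "0 \<le> K * (1/\<tau>)" using K(1) \<tau> by auto
      ultimately show "K * \<tau>\<^sup>2 + K * (1 / \<tau>) + K * (1 + \<tau>) + K * K \<le> (2 * K + K * K) * (1 + \<tau>\<^sup>2 + 1 / \<tau>)"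
        unfolding distrib_right distrib_left by linarith
    qed (use t in auto)
    finally show "\<bar>barnes_remainder \<tau> t\<bar> \<le> (2 * K + K * K) * (1 + \<tau>\<^sup>2 + 1 / \<tau>) * t" .
  qed
qed

text \<open>This is the uniqueness behind both definite descriptions. The identity theorem gives
  equality on punctured neighbourhoods; at the centre either both functions have a pole, with value
  0, or both are continuous.\<close>

lemma nicely_meromorphic_eqI:
  assumes f: "f nicely_meromorphic_on UNIV" and g: "g nicely_meromorphic_on UNIV"
    and U: "open U" "U \<noteq> {}" and eq: "\<And>z. z \<in> U \<Longrightarrow> f z = g z"
  shows "f = g"
proof
  have mero: "(\<lambda>z. f z - g z) meromorphic_on UNIV"
    using f g by (intro meromorphic_intros) (auto simp: nicely_meromorphic_on_def)
  define h where "h = remove_sings (\<lambda>z. f z - g z)"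
  have h: "h nicely_meromorphic_on UNIV"
    unfolding h_def by (rule remove_sings_nicely_meromorphic[OF mero])
  have hU: "h z = 0" if "z \<in> U" for z
  proof -
    have "eventually (\<lambda>z. z \<in> U) (at z)" using U that by (simp add: eventually_at_topological) blast
    then have "(\<lambda>z. f z - g z) \<midarrow>z\<rightarrow> 0"
      by (intro tendsto_eventually) (auto elim!: eventually_mono simp: eq)
    then show ?thesis unfolding h_def by (rule remove_sings_eqI)
  qed
  have "h constant_on UNIV"
    by (rule constant_on_extend_nicely_meromorphic_on[OF h, of U]) (use U hU in \<open>auto simp: constant_on_def\<close>)
  then have h0: "h z = 0" for z
    using hU U(2) unfolding constant_on_def by (metis UNIV_I all_not_in_conv)
  fix z
  have "eventually (\<lambda>w. h w = f w - g w) (at z)"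
    unfolding h_def by (rule eventually_remove_sings_eq_at)
      (rule meromorphic_on_isolated_singularity[OF meromorphic_on_subset[OF mero]], simp)
  then have ev: "eventually (\<lambda>w. f w = g w) (at z)" by eventually_elim (simp add: h0)
  show "f z = g z"
  proof (cases "is_pole f z")
    case True
    then have "is_pole g z" using is_pole_cong[OF ev refl] by simp
    with True f g show ?thesis
      unfolding nicely_meromorphic_on_def by (metis UNIV_I not_tendsto_and_filterlim_at_infinity is_pole_def trivial_limit_at)
  next
    case False
    then have "\<not> is_pole g z" using is_pole_cong[OF ev refl] by simp
    with False f g have "f \<midarrow>z\<rightarrow> f z" "g \<midarrow>z\<rightarrow> g z" unfolding nicely_meromorphic_on_def by auto
    moreover have "g \<midarrow>z\<rightarrow> f z" using calculation(1) tendsto_cong[OF ev] by simp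
    ultimately show ?thesis using LIM_unique by blast
  qed
qed

text \<open>A bound along the positive reals alone forces the zero of order \<open>n\<close>: it
  makes f vanish at 0 and passes to the quotient by z with exponent lowered by one.\<close>

lemma holomorphic_on_factor_power:
  fixes f :: "complex \<Rightarrow> complex"
  assumes "f holomorphic_on ball 0 r" "r > 0" "\<And>t. 0 < t \<Longrightarrow> t < r \<Longrightarrow> norm (f (of_real t)) \<le> C * t ^ n"
  obtains g where "g holomorphic_on ball 0 r" "\<And>z. z \<in> ball 0 r \<Longrightarrow> f z = z ^ n * g z"
proof -
  have "\<exists>g. g holomorphic_on ball 0 r \<and> (\<forall>z\<in>ball 0 r. f z = z ^ n * g z)"
    using assms(1,3)
  proof (induction n arbitrary: f)
    case (Suc n)
    have "f \<midarrow>0\<rightarrow> f 0"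
      using Suc.prems(1) assms(2) by (metis centre_in_ball continuous_on_eq_continuous_at holomorphic_on_imp_continuous_on isCont_def open_ball)
    moreover have "filterlim complex_of_real (at 0) (at_right 0)"
      by (auto simp: filterlim_at eventually_at_right_field intro!: tendsto_eq_intros exI[of _ 1])
    ultimately have "((\<lambda>t. f (of_real t)) \<longlongrightarrow> f 0) (at_right 0)"
      by (rule filterlim_compose)
    then have "((\<lambda>t. norm (f (of_real t))) \<longlongrightarrow> norm (f 0)) (at_right 0)" by (rule tendsto_norm)
    moreover have "((\<lambda>t::real. C * t ^ Suc n) \<longlongrightarrow> C * 0 ^ Suc n) (at_right 0)" by (intro tendsto_intros)
    moreover have "eventually (\<lambda>t. norm (f (of_real t)) \<le> C * t ^ Suc n) (at_right 0)"
      using Suc.prems(2) assms(2) by (auto simp: eventually_at_right_field)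
    ultimately have "norm (f 0) \<le> C * 0 ^ Suc n" by (intro tendsto_le) auto
    then have f0: "f 0 = 0" by simp
    define g where "g z = (if z = 0 then deriv f 0 else (f z - f 0) / (z - 0))" for z
    have g: "g holomorphic_on ball 0 r"
      unfolding g_def by (rule pole_lemma_open[OF Suc.prems(1)]) simp
    have fg: "f z = z * g z" for z using f0 by (simp add: g_def)
    have "norm (g (of_real t)) \<le> C * t ^ n" if "0 < t" "t < r" for t
    proof -
      have "t * norm (g (of_real t)) \<le> t * (C * t ^ n)"
        using Suc.prems(2)[OF that] that by (simp add: fg norm_mult mult_ac)
      then show ?thesis using that by simp
    qed
    from Suc.IH[OF g this] obtain k where "k holomorphic_on ball 0 r" "\<forall>z\<in>ball 0 r. g z = z ^ n * k z" by blast
    then show ?case by (intro exI[of _ k]) (auto simp: fg)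
  qed auto
  then show ?thesis using that by blast
qed

text \<open>On Re s > -1 - N the first N terms form a rational function and the poles of the other
  terms lie outside, so the tail is holomorphic there. These half-planes exhaust the plane.\<close>

lemma meromorphic_on_simple_pole_series:
  fixes a :: "nat \<Rightarrow> complex"
  assumes a: "summable (\<lambda>n. norm (a n))"
  defines "F \<equiv> \<lambda>s. \<Sum>n. a n / (s + of_nat (Suc n))"
  shows "F meromorphic_on UNIV" "F holomorphic_on {s. Re s > -1}"
proof -
  have hol: "(\<lambda>s. \<Sum>n. a (n + N) / (s + of_nat (Suc (n + N)))) holomorphic_on {s. Re s > - 1 - real N}" (is "?G N holomorphic_on ?S N")
    and summ: "\<And>s. s \<in> {s. Re s > - 1 - real N} \<Longrightarrow> summable (\<lambda>n. a (n + N) / (s + of_nat (Suc (n + N))))" for N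
  proof -
    have aN: "summable (\<lambda>n. norm (a (n + N)))" using a by (rule summable_ignore_initial_segment)
    have low: "\<exists>r>0. \<exists>c>0. ball z r \<subseteq> ?S N \<and> (\<forall>w\<in>ball z r. \<forall>n. norm (a (n + N) / (w + of_nat (Suc (n + N)))) \<le> norm (a (n + N)) / c)"
      if z: "z \<in> ?S N" for z
    proof (intro exI conjI ballI allI)
      define c where "c = (Re z + 1 + real N) / 2"
      show c: "c > 0" and "c > 0" using z by (auto simp: c_def)
      have Re: "Re w + 1 + real N > c" if "w \<in> ball z c" for w
      proof -
        have "Re (z - w) \<le> norm (z - w)" by (rule complex_Re_le_cmod)
        with that show ?thesis by (simp add: c_def dist_norm)
      qed
      show "ball z c \<subseteq> ?S N" using Re c by force
      fix w n assume w: "w \<in> ball z c"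
      have "c \<le> Re (w + of_nat (Suc (n + N)))" using Re[OF w] by simp
      also have "\<dots> \<le> norm (w + of_nat (Suc (n + N)))" by (rule complex_Re_le_cmod)
      finally show "norm (a (n + N) / (w + of_nat (Suc (n + N)))) \<le> norm (a (n + N)) / c"
        unfolding norm_divide using c by (intro divide_left_mono mult_pos_pos) auto
    qed
    show s: "summable (\<lambda>n. a (n + N) / (s + of_nat (Suc (n + N))))" if s: "s \<in> ?S N" for s
    proof -
      from low[OF s] obtain c where "\<forall>n. norm (a (n + N) / (s + of_nat (Suc (n + N)))) \<le> norm (a (n + N)) / c"
        by (metis centre_in_ball)
      then show ?thesis by (intro summable_comparison_test'[OF summable_divide[OF aN, of c], of 0]) auto
    qed
    have sn: "summable (\<lambda>n. norm (a (n + N) / (s + of_nat (Suc (n + N)))))" if s: "s \<in> ?S N" for s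
    proof -
      from low[OF s] obtain c where "\<forall>n. norm (a (n + N) / (s + of_nat (Suc (n + N)))) \<le> norm (a (n + N)) / c"
        by (metis centre_in_ball)
      then show ?thesis by (intro summable_comparison_test'[OF summable_divide[OF aN, of c], of 0]) auto
    qed
    \<comment> \<open>The series is read as an integral over counting measure, so that
      \<open>holomorphic_on_integral\<close> applies.\<close>
    have "(\<lambda>s. \<integral>n. a (n + N) / (s + of_nat (Suc (n + N))) \<partial>count_space UNIV) holomorphic_on ?S N"
    proof (rule holomorphic_on_integral)
      fix z assume z: "z \<in> ?S N"
      from low[OF z] obtain r c where "r > 0" "c > 0" "ball z r \<subseteq> ?S N"
        "\<forall>w\<in>ball z r. \<forall>n. norm (a (n + N) / (w + of_nat (Suc (n + N)))) \<le> norm (a (n + N)) / c" by blast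
      then show "\<exists>r>0. \<exists>g. ball z r \<subseteq> ?S N \<and> integrable (count_space UNIV) g \<and>
          (\<forall>w\<in>ball z r. \<forall>n\<in>space (count_space UNIV). norm (a (n + N) / (w + of_nat (Suc (n + N)))) \<le> g n)"
        using summable_divide[OF aN, of c]
        by (intro exI[of _ r] conjI exI[of _ "\<lambda>n. norm (a (n + N)) / c"])
           (auto simp: integrable_count_space_nat_iff)
    next
      fix n
      have "s + of_nat (Suc (n + N)) \<noteq> 0" if "s \<in> ?S N" for s
      proof
        assume "s + of_nat (Suc (n + N)) = 0"
        then have "Re (s + of_nat (Suc (n + N))) = 0" by (simp only: zero_complex.sel)
        with that show False by simp
      qed
      then show "(\<lambda>w. a (n + N) / (w + of_nat (Suc (n + N)))) holomorphic_on ?S N"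
        by (intro holomorphic_intros) blast
    qed auto
    then show "?G N holomorphic_on ?S N"
    proof (rule holomorphic_transform)
      fix s assume "s \<in> ?S N"
      then have "integrable (count_space UNIV) (\<lambda>n. a (n + N) / (s + of_nat (Suc (n + N))))"
        using sn unfolding integrable_count_space_nat_iff by blast
      then show "(\<integral>n. a (n + N) / (s + of_nat (Suc (n + N))) \<partial>count_space UNIV) = ?G N s"
        by (rule integral_count_space_nat)
    qed
  qed
  have split: "F s = (\<Sum>n. a (n + N) / (s + of_nat (Suc (n + N)))) + (\<Sum>n<N. a n / (s + of_nat (Suc n)))"
    if "s \<in> {s. Re s > - 1 - real N}" for s N
    unfolding F_def
    by (rule suminf_split_initial_segment) (subst summable_iff_shift[symmetric, of _ N], use summ[OF that] in simp)
  have "F meromorphic_on {s. Re s > - 1 - real N}" for N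
  proof -
    have o: "open {s. Re s > - 1 - real N}" by (rule open_halfspace_Re_gt)
    have "(\<lambda>s. (\<Sum>n. a (n + N) / (s + of_nat (Suc (n + N)))) + (\<Sum>n<N. a n / (s + of_nat (Suc n)))) meromorphic_on {s. Re s > - 1 - real N}"
      by (intro meromorphic_intros analytic_on_imp_meromorphic_on) (use hol[of N] o in \<open>auto simp: analytic_on_open\<close>)
    also have "?this \<longleftrightarrow> ?thesis"
      by (intro meromorphic_on_cong refl)
         (use o in \<open>auto simp: eventually_at_topological split intro!: exI[of _ "{s. Re s > - 1 - real N}"]\<close>)
    finally show ?thesis .
  qed
  then have "F meromorphic_on (\<Union>N. {s. Re s > - 1 - real N})" by (intro meromorphic_on_UN) auto
  moreover have "(\<Union>N. {s. Re s > - 1 - real N}) = UNIV"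
  proof -
    have "\<exists>N. Re s > - 1 - real N" for s using reals_Archimedean2[of "- 1 - Re s"] by (auto simp: algebra_simps)
    then show ?thesis by auto
  qed
  ultimately show "F meromorphic_on UNIV" by simp
  show "F holomorphic_on {s. Re s > -1}" using hol[of 0] by (simp add: F_def)
qed

section \<open>Infinitely divisible exponents\<close>

definition is_char :: "(real \<Rightarrow> complex) \<Rightarrow> bool" where
  "is_char \<phi> \<longleftrightarrow> (\<exists>R. real_distribution R \<and> (\<forall>t. char R t = \<phi> t))"

text \<open>The condition is put on an exponent \<psi> rather than on exp \<psi>: n-th roots then
  need no choice of a logarithm, and the class is closed under sums and under pointwise limits
  continuous at 0.\<close>

definition ID_exponent :: "(real \<Rightarrow> complex) \<Rightarrow> bool" where
  "ID_exponent \<psi> \<longleftrightarrow> (\<forall>n::nat. n \<ge> 1 \<longrightarrow> is_char (\<lambda>t. exp (\<psi> t / of_nat n)))"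

lemma is_char_mult: "is_char \<phi> \<Longrightarrow> is_char \<psi> \<Longrightarrow> is_char (\<lambda>t. \<phi> t * \<psi> t)"
  unfolding is_char_def using char_convolution by metis

lemma is_char_distr:
  assumes "prob_space M" "X \<in> borel_measurable M" "\<And>t. (LINT x|M. iexp (t * X x)) = \<phi> t"
  shows "is_char \<phi>"
  unfolding is_char_def
proof (intro exI[of _ "distr M borel X"] conjI allI)
  show "real_distribution (distr M borel X)"
    by (rule prob_space.real_distribution_distr[OF assms(1,2)])
  show "char (distr M borel X) t = \<phi> t" for t
    unfolding char_def using assms by (subst integral_distr) auto
qed

lemma is_char_point: "is_char (\<lambda>t. iexp (a * t))"
proof (rule is_char_distr)
  interpret N: real_distribution std_normal_distribution by (rule real_dist_normal_dist)
  show "prob_space std_normal_distribution" by (rule N.prob_space_axioms)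
  show "(LINT x|std_normal_distribution. iexp (t * a)) = iexp (a * t)" for t
    by (simp add: N.prob_space[unfolded N.space_eq_univ] mult_ac del: of_real_mult)
qed auto

lemma is_char_power: "is_char \<phi> \<Longrightarrow> is_char (\<lambda>t. \<phi> t ^ n)"
proof (induction n)
  case 0
  then show ?case using is_char_point[of 0] by simp
qed (simp add: is_char_mult)

lemma is_char_LIMSEQ:
  assumes "\<And>n. is_char (\<phi> n)" "\<And>t. (\<lambda>n. \<phi> n t) \<longlonglongrightarrow> \<psi> t" "isCont \<psi> 0"
  shows "is_char \<psi>"
proof -
  from assms(1) obtain R where R: "\<And>n. real_distribution (R n)" "\<And>n t. char (R n) t = \<phi> n t"
    unfolding is_char_def by metis
  obtain \<nu> where "real_distribution \<nu>" "\<And>t. char \<nu> t = \<psi> t" "weak_conv_m R \<nu>"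
    by (rule levy_continuity_ex[of R \<psi>]) (use R assms in auto)
  then show ?thesis unfolding is_char_def by blast
qed

text \<open>Realised by b * X with an independent Bernoulli variable b of parameter p.\<close>

lemma is_char_mixture:
  assumes "is_char \<phi>" "0 \<le> p" "p \<le> 1"
  shows "is_char (\<lambda>t. 1 + of_real p * (\<phi> t - 1))"
proof -
  obtain R where R: "real_distribution R" "\<And>t. char R t = \<phi> t" using assms(1) unfolding is_char_def by blast
  interpret R: real_distribution R by fact
  interpret B: prob_space "measure_pmf (bernoulli_pmf p)" by (rule prob_space_measure_pmf)
  interpret P: pair_prob_space "measure_pmf (bernoulli_pmf p)" R ..
  define X where "X = (\<lambda>z::bool \<times> real. of_bool (fst z) * snd z)"
  have [measurable]: "X \<in> borel_measurable (measure_pmf (bernoulli_pmf p) \<Otimes>\<^sub>M R)"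
    unfolding X_def by measurable
  show ?thesis
  proof (rule is_char_distr[of "measure_pmf (bernoulli_pmf p) \<Otimes>\<^sub>M R" X])
    show "prob_space (measure_pmf (bernoulli_pmf p) \<Otimes>\<^sub>M R)" by (rule P.prob_space_axioms)
    fix t
    have int: "integrable (measure_pmf (bernoulli_pmf p) \<Otimes>\<^sub>M R) (\<lambda>z. iexp (t * X z))"
      by (rule P.integrable_const_bound[where B = 1]) auto
    have "(\<integral>z. iexp (t * X z) \<partial>(measure_pmf (bernoulli_pmf p) \<Otimes>\<^sub>M R)) =
      (LINT b|measure_pmf (bernoulli_pmf p). LINT x|R. iexp (t * X (b, x)))"
      by (rule P.integral_fst'[OF int, symmetric])
    also have "\<dots> = 1 + of_real p * (\<phi> t - 1)"
      using assms R(2)[of t] R.prob_space[unfolded R.space_eq_univ]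
      by (subst integral_measure_pmf[of UNIV])
         (auto simp: X_def char_def scaleR_conv_of_real algebra_simps UNIV_bool)
    finally show "(\<integral>z. iexp (t * X z) \<partial>(measure_pmf (bernoulli_pmf p) \<Otimes>\<^sub>M R)) = 1 + of_real p * (\<phi> t - 1)" .
  qed simp
qed

lemma LIMSEQ_exp_limit_complex: "(\<lambda>n. of_nat n * (exp (z / of_nat n) - 1)) \<longlonglongrightarrow> (z :: complex)"
proof (cases "z = 0")
  case False
  have "((\<lambda>w. (exp (z * w) - 1) / w) \<longlongrightarrow> z) (at 0)"
  proof -
    have "((\<lambda>w. exp (z * w)) has_field_derivative z) (at 0)" by (auto intro!: derivative_eq_intros)
    then show ?thesis by (simp add: has_field_derivative_iff)
  qed
  moreover have "filterlim (\<lambda>n. 1 / of_nat n :: complex) (at 0) sequentially"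
    unfolding filterlim_at
    by (intro conjI lim_1_over_n eventually_mono[OF eventually_gt_at_top[of 0]]) auto
  ultimately have "(\<lambda>n. (exp (z * (1 / of_nat n)) - 1) / (1 / of_nat n)) \<longlonglongrightarrow> z"
    by (rule filterlim_compose)
  then show ?thesis by (simp add: mult_ac)
qed auto

text \<open>Poisson approximation: the mixtures 1 + (c/m) * (\<phi> - 1), raised to the power m,
  converge to the exponential.\<close>

lemma is_char_exp:
  assumes \<phi>: "is_char \<phi>" and c: "c \<ge> 0"
  shows "is_char (\<lambda>t. exp (of_real c * (\<phi> t - 1)))"
proof -
  obtain R where R: "real_distribution R" "\<And>t. char R t = \<phi> t" using \<phi> unfolding is_char_def by blast
  interpret R: real_distribution R by fact
  \<comment> \<open>The shift by N makes c / (n + N) at most 1, hence a mixing probability for every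
    n.\<close>
  obtain N :: nat where N: "N \<ge> c" "N > 0" using real_arch_simple[of c] by (metis le_numeral_extra(3) max_0L max_def nat_le_linear of_nat_0_less_iff of_nat_max order.trans gr0I of_nat_Suc le_SucI less_Suc_eq_0_disj linorder_not_less of_nat_le_iff zero_less_Suc)
  define z where "z n t = 1 + of_real (c / real (n + N)) * (\<phi> t - 1)" for n t
  have cN: "c / real (n + N) \<le> 1" "c / real (n + N) \<ge> 0" for n using N c by (auto simp: divide_le_eq)
  have zc: "is_char (z n)" for n unfolding z_def using cN[of n] by (intro is_char_mixture[OF \<phi>]) auto
  have z1: "norm (z n t) \<le> 1" for n t
    using zc[of n] real_distribution.cmod_char_le_1 unfolding is_char_def by metis
  show ?thesis
  proof (rule is_char_LIMSEQ[of "\<lambda>n t. z n t ^ (n + N)"])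
    show "is_char (\<lambda>t. z n t ^ (n + N))" for n by (rule is_char_power[OF zc])
    fix t
    define w where "w = of_real c * (\<phi> t - 1)"
    have Re: "Re w \<le> 0"
      using R.cmod_char_le_1[of t] complex_Re_le_cmod[of "\<phi> t"] c unfolding w_def R(2)
      by (simp add: mult_nonneg_nonpos)
    have zw: "z n t = 1 + w / of_nat (n + N)" for n by (simp add: z_def w_def)
    have ex: "exp (w / of_nat (n + N)) ^ (n + N) = exp w" for n
    proof -
      have "of_nat (n + N) \<noteq> (0 :: complex)" using N by (simp only: of_nat_eq_0_iff)
      then show ?thesis unfolding exp_of_nat_mult[symmetric] by simp
    qed
    \<comment> \<open>Both bases lie in the closed unit disc, the exponential one because Re w <= 0,
      so their m-th powers differ by at most m times the difference of the bases.\<close>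
    have bound: "norm (z n t ^ (n + N) - exp w) \<le> norm (of_nat (n + N) * (exp (w / of_nat (n + N)) - 1) - w)" for n
    proof -
      have "norm (z n t ^ (n + N) - exp (w / of_nat (n + N)) ^ (n + N)) \<le> (n + N) * norm (z n t - exp (w / of_nat (n + N)))"
        by (rule norm_power_diff) (use z1 Re in \<open>auto simp: divide_nonpos_nonneg simp flip: of_nat_add\<close>)
      also have "\<dots> = norm (of_nat (n + N) * (z n t - exp (w / of_nat (n + N))))"
        by (simp add: norm_mult del: of_nat_add)
      also have "of_nat (n + N) * (z n t - exp (w / of_nat (n + N))) = - (of_nat (n + N) * (exp (w / of_nat (n + N)) - 1) - w)"
        using N by (simp add: zw field_simps del: of_nat_add)
      finally show ?thesis by (simp only: norm_minus_cancel ex)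
    qed
    have "(\<lambda>n. of_nat (n + N) * (exp (w / of_nat (n + N)) - 1) - w) \<longlonglongrightarrow> w - w"
      by (intro tendsto_intros LIMSEQ_ignore_initial_segment[OF LIMSEQ_exp_limit_complex])
    then have "(\<lambda>n. norm (of_nat (n + N) * (exp (w / of_nat (n + N)) - 1) - w)) \<longlonglongrightarrow> 0"
      using tendsto_norm_zero by force
    then have "(\<lambda>n. z n t ^ (n + N) - exp w) \<longlonglongrightarrow> 0"
      by (rule Lim_null_comparison[rotated]) (use bound in auto)
    then show "(\<lambda>n. z n t ^ (n + N)) \<longlonglongrightarrow> exp (of_real c * (\<phi> t - 1))"
      unfolding w_def using Lim_null by blast
  next
    show "isCont (\<lambda>t. exp (of_real c * (\<phi> t - 1))) 0"
      unfolding R(2)[symmetric] by (intro continuous_intros R.isCont_char)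
  qed
qed

text \<open>With total mass c > 0, k / c is the density of the jumps and c their rate; mass 0 gives
  the point mass at 0.\<close>

lemma is_char_compound_poisson:
  fixes k :: "real \<Rightarrow> real"
  assumes k: "integrable lborel k" "\<And>x. k x \<ge> 0"
  shows "is_char (\<lambda>t. exp (LINT x|lborel. (iexp (t * x) - 1) * of_real (k x)))"
proof -
  define c where "c = integral\<^sup>L lborel k"
  have c: "c \<ge> 0" unfolding c_def using k by simp
  have [measurable]: "k \<in> borel_measurable borel" using k(1) by (simp add: borel_measurable_integrable)
  have kc: "integrable lborel (\<lambda>x. complex_of_real (k x))" using k(1) by simp
  have ke: "integrable lborel (\<lambda>x. iexp (t * x) * of_real (k x))" for t
    by (rule Bochner_Integration.integrable_bound[OF kc]) (auto simp: norm_mult)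
  have split: "(LINT x|lborel. (iexp (t * x) - 1) * of_real (k x)) = (LINT x|lborel. iexp (t * x) * of_real (k x)) - of_real c" for t
    unfolding left_diff_distrib using ke kc by (simp add: c_def)
  show ?thesis
  proof (cases "c = 0")
    case True
    then have "AE x in lborel. k x = 0" unfolding c_def using k by (subst (asm) integral_nonneg_eq_0_iff_AE) auto
    then have "(LINT x|lborel. (iexp (t * x) - 1) * of_real (k x)) = 0" for t
      by (intro integral_eq_zero_AE) auto
    then show ?thesis using is_char_point[of 0] by simp
  next
    case False
    with c have c: "c > 0" by simp
    define R where "R = density lborel (\<lambda>x. ennreal (k x / c))"
    have "emeasure R UNIV = 1"
    proof -
      have "emeasure R UNIV = (\<integral>\<^sup>+x. ennreal (k x / c) \<partial>lborel)" unfolding R_def by (subst emeasure_density) auto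
      also have "\<dots> = ennreal (LINT x|lborel. k x / c)" using k c by (intro nn_integral_eq_integral) auto
      finally show ?thesis using c by (simp add: c_def)
    qed
    then have pR: "prob_space R" by (intro prob_spaceI) (simp add: R_def)
    have "is_char (\<lambda>t. (LINT x|lborel. iexp (t * x) * of_real (k x)) / of_real c)"
    proof (rule is_char_distr[OF pR, of "\<lambda>x. x"])
      fix t
      have "(LINT x|R. iexp (t * x)) = (LINT x|lborel. (k x / c) *\<^sub>R iexp (t * x))"
        unfolding R_def using k c by (subst integral_density) auto
      also have "\<dots> = (LINT x|lborel. (iexp (t * x) * of_real (k x)) / of_real c)"
        by (intro Bochner_Integration.integral_cong) (auto simp: scaleR_conv_of_real)
      finally show "(LINT x|R. iexp (t * x)) = (LINT x|lborel. iexp (t * x) * of_real (k x)) / of_real c" by simp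
    qed (simp add: R_def)
    from is_char_exp[OF this, of c] c show ?thesis
      unfolding split by (simp add: right_diff_distrib)
  qed
qed

lemma ID_exponent_add: "ID_exponent f \<Longrightarrow> ID_exponent g \<Longrightarrow> ID_exponent (\<lambda>t. f t + g t)"
  unfolding ID_exponent_def by (simp add: add_divide_distrib exp_add is_char_mult)

lemma ID_exponent_sum:
  assumes "\<And>i. i \<in> A \<Longrightarrow> ID_exponent (f i)"
  shows "ID_exponent (\<lambda>t. \<Sum>i\<in>A. f i t)"
  using assms
proof (induction A rule: infinite_finite_induct)
  case (insert x A)
  then show ?case by (simp add: ID_exponent_add)
qed (use is_char_point[of 0] in \<open>auto simp: ID_exponent_def\<close>)

lemma ID_exponent_LIMSEQ:
  assumes "\<And>n. ID_exponent (f n)" "\<And>t. (\<lambda>n. f n t) \<longlonglongrightarrow> g t" "isCont g 0"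
  shows "ID_exponent g"
  unfolding ID_exponent_def
proof (intro allI impI)
  fix n :: nat assume n: "n \<ge> 1"
  show "is_char (\<lambda>t. exp (g t / of_nat n))"
    by (rule is_char_LIMSEQ[of "\<lambda>m t. exp (f m t / of_nat n)"])
       (use assms n in \<open>auto simp: ID_exponent_def intro!: tendsto_intros continuous_intros\<close>)
qed

lemma ID_exponent_drift: "ID_exponent (\<lambda>t. \<i> * of_real (a * t))"
  unfolding ID_exponent_def
proof (intro allI impI)
  fix n :: nat assume "n \<ge> 1"
  have "is_char (\<lambda>t. iexp ((a / real n) * t))" by (rule is_char_point)
  then show "is_char (\<lambda>t. exp (\<i> * of_real (a * t) / of_nat n))" by simp
qed

lemma is_char_gauss: "is_char (\<lambda>t. exp (- of_real ((s * t)\<^sup>2 / 2)))"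
proof (rule is_char_distr[of std_normal_distribution "\<lambda>x. s * x"])
  interpret N: real_distribution std_normal_distribution by (rule real_dist_normal_dist)
  show "prob_space std_normal_distribution" by (rule N.prob_space_axioms)
  show "(LINT x|std_normal_distribution. iexp (t * (s * x))) = exp (- of_real ((s * t)\<^sup>2 / 2))" for t
    using char_std_normal_distribution[THEN fun_cong, of "t * s"]
    by (simp add: char_def mult_ac exp_of_real[symmetric])
qed auto

lemma ID_exponent_gauss: "ID_exponent (\<lambda>t. - of_real ((s * t)\<^sup>2 / 2))"
  unfolding ID_exponent_def
proof (intro allI impI)
  fix n :: nat assume "n \<ge> 1"
  then show "is_char (\<lambda>t. exp (- of_real ((s * t)\<^sup>2 / 2) / of_nat n))"
    using is_char_gauss[of "s / sqrt (real n)"] by (simp add: power_mult_distrib power_divide mult_ac)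
qed

lemma ID_exponent_compound_poisson:
  fixes k :: "real \<Rightarrow> real"
  assumes k: "integrable lborel k" "\<And>x. k x \<ge> 0"
  shows "ID_exponent (\<lambda>t. LINT x|lborel. (iexp (t * x) - 1) * of_real (k x))"
  unfolding ID_exponent_def
proof (intro allI impI)
  fix n :: nat assume "n \<ge> 1"
  then show "is_char (\<lambda>t. exp ((LINT x|lborel. (iexp (t * x) - 1) * of_real (k x)) / of_nat n))"
    using is_char_compound_poisson[of "\<lambda>x. k x / real n"] k by simp
qed

lemma norm_iexp_minus_1_le: "norm (iexp x - 1) \<le> \<bar>x\<bar>"
  using iexp_approx1[of x 0] by simp

lemma ID_exponent_levy:
  fixes k :: "real \<Rightarrow> real"
  assumes k: "set_integrable lborel {0<..} (\<lambda>x. x * k x)" "\<And>x. x > 0 \<Longrightarrow> k x \<ge> 0"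
  shows "ID_exponent (\<lambda>t. LINT x:{0<..}|lborel. (iexp (t * x) - 1) * of_real (k x))"
proof -
  define m where "m x = indicator {0<..} x * (x * k x)" for x
  have m: "integrable lborel m" using k(1) unfolding m_def set_integrable_def by simp
  have [measurable]: "m \<in> borel_measurable borel" using m by (simp add: borel_measurable_integrable)
  have m0: "m x \<ge> 0" for x using k(2)[of x] by (simp add: m_def indicator_def)
  have mk: "indicator {0<..} x *\<^sub>R ((iexp (t * x) - 1) * of_real (k x)) = (iexp (t * x) - 1) / of_real x * of_real (m x)" for t x
    by (simp add: m_def indicator_def)
  have tm: "integrable lborel (\<lambda>x. \<bar>t\<bar> * m x)" for t using m by simp
  have bnd: "norm ((iexp (t * x) - 1) / of_real x * of_real (m x)) \<le> \<bar>t\<bar> * m x" for t x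
  proof (cases "x = 0")
    case False
    have "norm ((iexp (t * x) - 1) / of_real x) \<le> \<bar>t\<bar>"
      using norm_iexp_minus_1_le[of "t * x"] False by (simp add: norm_divide divide_le_eq abs_mult)
    then show ?thesis using m0[of x] unfolding norm_mult by (intro mult_mono) auto
  qed (use m0 in simp)
  define kn where "kn n x = indicator {1 / real (Suc n)<..} x * (m x / x)" for n x
  show ?thesis unfolding set_lebesgue_integral_def mk
  proof (rule ID_exponent_LIMSEQ)
    show "ID_exponent (\<lambda>t. LINT x|lborel. (iexp (t * x) - 1) * of_real (kn n x))" for n
    proof (rule ID_exponent_compound_poisson)
      show "kn n x \<ge> 0" for x       proof (cases "x > 0")
        case True
        then show ?thesis using m0[of x] by (simp add: kn_def indicator_def)
      qed (simp add: kn_def m_def)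
      show "integrable lborel (kn n)"
      proof (rule Bochner_Integration.integrable_bound)
        show "integrable lborel (\<lambda>x. real (Suc n) * m x)" using m by simp
        have "norm (kn n x) \<le> norm (real (Suc n) * m x)" for x
        proof (cases "x > 1 / real (Suc n)")
          case True
          then have x: "x > 0" by (smt (verit) divide_pos_pos of_nat_0_less_iff zero_less_Suc)
          have "m x / x \<le> m x / (1 / real (Suc n))"
            by (rule divide_left_mono) (use True x m0 in auto)
          then show ?thesis using True x m0[of x] by (simp add: kn_def mult_ac)
        qed (simp add: kn_def)
        then show "AE x in lborel. norm (kn n x) \<le> norm (real (Suc n) * m x)" by simp
      qed (unfold kn_def, measurable)
    qed
    show "(\<lambda>n. LINT x|lborel. (iexp (t * x) - 1) * of_real (kn n x)) \<longlonglongrightarrow>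
        (LINT x|lborel. (iexp (t * x) - 1) / of_real x * of_real (m x))" for t
    proof (rule integral_dominated_convergence[where w = "\<lambda>x. \<bar>t\<bar> * m x"])
      show "AE x in lborel. (\<lambda>n. (iexp (t * x) - 1) * of_real (kn n x)) \<longlonglongrightarrow> (iexp (t * x) - 1) / of_real x * of_real (m x)"
      proof (intro AE_I2)
        fix x
        have "eventually (\<lambda>n. (iexp (t * x) - 1) * of_real (kn n x) = (iexp (t * x) - 1) / of_real x * of_real (m x)) sequentially"
        proof (cases "x > 0")
          case True
          then obtain N where "1 / real (Suc N) < x" by (metis nat_approx_posE)
          then have "1 / real (Suc n) < x" if "n \<ge> N" for n
            using that by (smt (verit) frac_le of_nat_0_less_iff of_nat_mono Suc_le_mono zero_less_Suc)
          then show ?thesis unfolding eventually_sequentially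
            by (intro exI[of _ N]) (auto simp: kn_def)
        qed (auto simp: kn_def m_def)
        then show "(\<lambda>n. (iexp (t * x) - 1) * of_real (kn n x)) \<longlonglongrightarrow> (iexp (t * x) - 1) / of_real x * of_real (m x)"
          by (rule tendsto_eventually)
      qed
      show "AE x in lborel. norm ((iexp (t * x) - 1) * of_real (kn n x)) \<le> \<bar>t\<bar> * m x" for n
      proof (intro AE_I2)
        fix x
        have "norm ((iexp (t * x) - 1) * of_real (kn n x)) \<le> norm ((iexp (t * x) - 1) / of_real x * of_real (m x))"
          by (auto simp: kn_def indicator_def norm_mult norm_divide)
        with bnd show "norm ((iexp (t * x) - 1) * of_real (kn n x)) \<le> \<bar>t\<bar> * m x" by (rule order_trans[rotated])
      qed
    qed (use m in \<open>auto simp: kn_def\<close>)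
    show "isCont (\<lambda>t. LINT x|lborel. (iexp (t * x) - 1) / of_real x * of_real (m x)) 0"
      unfolding isCont_def
    proof (rule Lim_null_comparison[where g = "\<lambda>t. \<bar>t\<bar> * integral\<^sup>L lborel m", THEN tendsto_eq_rhs])
      show "eventually (\<lambda>t. norm (LINT x|lborel. (iexp (t * x) - 1) / of_real x * of_real (m x)) \<le> \<bar>t\<bar> * integral\<^sup>L lborel m) (at 0)"
      proof (intro always_eventually allI)
        fix t
        have "norm (LINT x|lborel. (iexp (t * x) - 1) / of_real x * of_real (m x)) \<le> (LINT x|lborel. \<bar>t\<bar> * m x)"
          by (rule Bochner_Integration.integral_norm_bound_integral[OF Bochner_Integration.integrable_bound[OF tm[of t]] tm])
             (use order_trans[OF bnd abs_ge_self] bnd in \<open>auto intro!: AE_I2 simp del: abs_mult\<close>)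
        then show "norm (LINT x|lborel. (iexp (t * x) - 1) / of_real x * of_real (m x)) \<le> \<bar>t\<bar> * integral\<^sup>L lborel m" by simp
      qed
      show "((\<lambda>t. \<bar>t\<bar> * integral\<^sup>L lborel m) \<longlongrightarrow> 0) (at 0)" by (auto intro!: tendsto_eq_intros)
    qed simp
  qed
qed

section \<open>The double zeta function\<close>

lemma integral_cpowr_from_0:
  assumes p: "Re p > -1" and d: "d > 0"
  shows "set_integrable lborel {0<..d} (\<lambda>t. complex_of_real t powr p)"
    and "(LINT t:{0<..d}|lborel. complex_of_real t powr p) = of_real d powr (p + 1) / (p + 1)"
    and "(LINT t:{0<..d}|lborel. norm (complex_of_real t powr p)) = d powr (Re p + 1) / (Re p + 1)"
proof -
  have *: "((\<lambda>t. complex_of_real t powr p) has_integral of_real d powr (p + 1) / (p + 1)) {0<..d}" if "Re p > -1" for p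
  proof -
    have "p + 1 \<noteq> 0" using that by (auto simp: complex_eq_iff)
    then have "((\<lambda>t. complex_of_real t powr p) has_integral
            (of_real d powr (p + 1) / (p + 1) - of_real 0 powr (p + 1) / (p + 1))) {0..d}" using that d
      by (intro fundamental_theorem_of_calculus_interior)
         (auto intro!: continuous_intros derivative_eq_intros has_vector_derivative_real_field)
    then have "((\<lambda>t. complex_of_real t powr p) has_integral of_real d powr (p + 1) / (p + 1)) {0..d}" by simp
    then show ?thesis
      by (rule iffD1[OF has_integral_spike_set_eq, rotated -1]) (auto intro: negligible_subset[of "{0}"])
  qed
  have "set_integrable lebesgue {0<..d} (\<lambda>t. t powr (Re p))"
    by (intro nonnegative_absolutely_integrable_1 integrable_on_powr_from_0') (use p d in auto)
  then have r: "set_integrable lborel {0<..d} (\<lambda>t. t powr (Re p))"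
    unfolding set_integrable_def
    by (subst (asm) integrable_completion) (auto intro!: borel_measurable_continuous_on_indicator continuous_intros)
  show i: "set_integrable lborel {0<..d} (\<lambda>t. complex_of_real t powr p)"
    using r unfolding set_integrable_def
    by (rule Bochner_Integration.integrable_bound)
       (auto intro!: borel_measurable_continuous_on_indicator continuous_intros AE_I2
           simp: norm_mult norm_powr_real_powr indicator_def)
  have L: "(LINT t:{0<..d}|lborel. f t) = I" if "(f has_integral I) {0<..d}" "set_integrable lborel {0<..d} f"
    for f :: "real \<Rightarrow> 'a::euclidean_space" and I
  proof -
    have "((\<lambda>t. if t \<in> {0<..d} then f t else 0) has_integral (LINT t:{0<..d}|lborel. f t)) UNIV"
      using has_integral_integral_lborel[OF that(2)[unfolded set_integrable_def]]
      unfolding set_lebesgue_integral_def by (rule has_integral_eq[rotated]) (auto simp: indicator_def)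
    then show ?thesis using that(1) by (simp only: has_integral_restrict_UNIV) (rule has_integral_unique)
  qed
  show "(LINT t:{0<..d}|lborel. complex_of_real t powr p) = of_real d powr (p + 1) / (p + 1)"
    by (rule L[OF *[OF p] i])
  have "((\<lambda>t. Re (complex_of_real t powr of_real (Re p))) has_integral Re (of_real d powr (of_real (Re p) + 1) / (of_real (Re p) + 1))) {0<..d}"
    by (rule has_integral_Re, rule *) (use p in simp)
  moreover have "Re (of_real d powr (of_real (Re p) + 1) / (of_real (Re p) + 1)) = d powr (Re p + 1) / (Re p + 1)"
  proof -
    have "complex_of_real d powr (of_real (Re p) + 1) = complex_of_real d powr of_real (Re p + 1)" by simp
    also have "\<dots> = of_real (d powr (Re p + 1))" by (rule powr_of_real) (use d in auto)
    finally have "of_real d powr (of_real (Re p) + 1) / (of_real (Re p) + 1) = complex_of_real (d powr (Re p + 1) / (Re p + 1))"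
      by (simp only: of_real_divide of_real_add of_real_1)
    then show ?thesis by (simp only: Re_complex_of_real)
  qed
  moreover have "Re (complex_of_real t powr of_real (Re p)) = norm (complex_of_real t powr p)" if "t \<in> {0<..d}" for t
    using that powr_of_real[of t "Re p"] by (simp add: norm_powr_real_powr)
  ultimately have "((\<lambda>t. norm (complex_of_real t powr p)) has_integral d powr (Re p + 1) / (Re p + 1)) {0<..d}"
    by (metis (no_types, lifting) has_integral_eq)
  then show "(LINT t:{0<..d}|lborel. norm (complex_of_real t powr p)) = d powr (Re p + 1) / (Re p + 1)"
    by (rule L) (rule set_integrable_norm[OF i])
qed

text \<open>Near 0 the power series of \<open>g\<close> is integrated term by term, giving d^(s + 1)
  times the sum of a n / (s + n + 1), which is meromorphic; the part beyond d is entire in s by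
  exponential decay. Since \<open>h\<close> vanishes at 0, the integral itself already converges for
  Re s > -1, past the point s = 0 that matters.\<close>

lemma Mellin_continuation:
  fixes h :: "real \<Rightarrow> complex"
  assumes g: "g holomorphic_on ball 0 r" "r > 0"
    and hg: "\<And>t. 0 < t \<Longrightarrow> t < r \<Longrightarrow> h t = of_real t * g (of_real t)"
    and [measurable]: "h \<in> borel_measurable borel"
    and bound: "\<And>t. t > 0 \<Longrightarrow> norm (h t) \<le> C * t * exp (- (x * t))" and x: "x > 0" and C: "C \<ge> 0"
  shows "\<exists>K. K meromorphic_on UNIV \<and> K holomorphic_on {s. Re s > -1} \<and>
    (\<forall>s. Re s > -1 \<longrightarrow> set_integrable lborel {0<..} (\<lambda>t. of_real t powr (s - 1) * h t) \<and>
       K s = (LINT t:{0<..}|lborel. of_real t powr (s - 1) * h t))"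
proof -
  \<comment> \<open>Half the radius leaves room for absolute convergence of the power series at t =
    d.\<close>
  define d where "d = r / 2"
  have d: "d > 0" "d < r" using g(2) by (auto simp: d_def)
  define c where "c n = (deriv ^^ n) g 0 / fact n" for n
  have pow: "(\<lambda>n. c n * z ^ n) sums g z" if "norm z < r" for z
    using holomorphic_power_series[OF g(1), of z] that by (simp add: c_def)
  define a where "a n = c n * of_real d ^ n" for n
  have suma: "summable (\<lambda>n. norm (a n))"
    unfolding a_def
    by (rule powser_insidea[of _ "complex_of_real (3/4*r)"], rule sums_summable, rule pow)
       (use g(2) in \<open>auto simp: d_def\<close>)
  define F where "F s = (\<Sum>n. a n / (s + of_nat (Suc n)))" for s
  define T where "T s = (LINT t:{d<..}|lborel. of_real t powr (s - 1) * h t)" for s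
  have meas: "(\<lambda>t. indicator A t *\<^sub>R (of_real t powr (s - 1) * h t)) \<in> borel_measurable lborel"
    if "A \<subseteq> {0<..}" "A \<in> sets borel" for s :: complex and A
  proof -
    have "(\<lambda>t. (indicator {0<..} t *\<^sub>R (of_real t powr (s - 1))) * (indicator A t *\<^sub>R h t)) \<in> borel_measurable borel"
      by (intro borel_measurable_times borel_measurable_continuous_on_indicator borel_measurable_scaleR)
         (use that in \<open>auto intro!: continuous_intros borel_measurable_indicator\<close>)
    also have "(\<lambda>t. (indicator {0<..} t *\<^sub>R (of_real t powr (s - 1))) * (indicator A t *\<^sub>R h t)) =
       (\<lambda>t. indicator A t *\<^sub>R (of_real t powr (s - 1) * h t))"
    proof (rule ext)
      show "(indicator {0<..} t *\<^sub>R (of_real t powr (s - 1))) * (indicator A t *\<^sub>R h t) =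
          indicator A t *\<^sub>R (of_real t powr (s - 1) * h t)" for t
        by (cases "t \<in> A") (use that in auto)
    qed
    finally show ?thesis by simp
  qed
  have int: "set_integrable lborel {0<..} (\<lambda>t. of_real t powr (s - 1) * h t)" if "Re s > -1" for s
  proof -
    have "set_integrable lborel {0<..} (\<lambda>t. C * (t powr Re s * exp (- (x * t))))"
      using set_integrable_powr_exp[of "Re s" x] that x by simp
    then show ?thesis unfolding set_integrable_def
    proof (rule Bochner_Integration.integrable_bound)
      show "(\<lambda>t. indicator {0<..} t *\<^sub>R (of_real t powr (s - 1) * h t)) \<in> borel_measurable lborel"
        by (rule meas) auto
      have "norm (of_real t powr (s - 1) * h t) \<le> C * (t powr Re s * exp (- (x * t)))" if "t > 0" for t
      proof -
        have "norm (of_real t powr (s - 1) * h t) \<le> t powr (Re s - 1) * (C * t * exp (- (x * t)))"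
          using that bound[OF that] by (simp add: norm_mult norm_powr_real_powr mult_left_mono)
        also have "\<dots> = C * (t powr Re s * exp (- (x * t)))" using that by (simp add: powr_diff)
        finally show ?thesis .
      qed
      then show "AE t in lborel. norm (indicat_real {0<..} t *\<^sub>R (of_real t powr (s - 1) * h t)) \<le>
         norm (indicat_real {0<..} t *\<^sub>R (C * (t powr Re s * exp (- (x * t)))))"
        using C by (auto simp: indicator_def intro!: AE_I2 order_trans[OF _ abs_ge_self])
    qed
  qed
  have T: "T holomorphic_on UNIV"
    unfolding T_def set_lebesgue_integral_def
  proof (rule holomorphic_on_integral)
    fix z :: complex
    define B where "B = \<bar>Re z\<bar> + 2"
    show "\<exists>r>0. \<exists>g. ball z r \<subseteq> UNIV \<and> integrable lborel g \<and> (\<forall>s\<in>ball z r. \<forall>t\<in>space lborel.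
        norm (indicat_real {d<..} t *\<^sub>R (of_real t powr (s - 1) * h t)) \<le> g t)"
    proof (intro exI[of _ 1] exI[of _ "\<lambda>t. indicator {0<..} t *\<^sub>R ((1 + d powr (- 2 * B)) * C * (t powr (B + 1) * exp (- (x * t))))"] conjI ballI)
      show "integrable lborel (\<lambda>t. indicat_real {0<..} t *\<^sub>R ((1 + d powr (- 2 * B)) * C * (t powr (B + 1) * exp (- (x * t)))))"
        using set_integrable_powr_exp[of "B + 1" x] x unfolding set_integrable_def[symmetric] B_def
        by (intro set_integrable_mult_right) auto
      fix s t assume s: "s \<in> ball z 1"
      show "norm (indicat_real {d<..} t *\<^sub>R (of_real t powr (s - 1) * h t)) \<le>
         indicat_real {0<..} t *\<^sub>R ((1 + d powr (- 2 * B)) * C * (t powr (B + 1) * exp (- (x * t))))"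
      proof (cases "t > d")
        case True
        then have t: "t > 0" using d by simp
        have "\<bar>Re (z - s)\<bar> \<le> norm (z - s)" by (rule abs_Re_le_cmod)
        with s have a: "- B \<le> Re s - 1" "Re s - 1 \<le> B" by (auto simp: B_def dist_norm)
        \<comment> \<open>This is uniform in s, as |Re s - 1| <= B on the unit ball: compare with
          t^B for t >= 1, and with t^(-B) = t^(-2B) * t^B for d < t < 1.\<close>
        have "t powr (Re s - 1) \<le> (1 + d powr (- 2 * B)) * t powr B"
        proof (cases "t \<ge> 1")
          case True
          then have "t powr (Re s - 1) \<le> t powr B" using a by (intro powr_mono) auto
          also have "\<dots> \<le> (1 + d powr (- 2 * B)) * t powr B" by (simp add: mult_le_cancel_right1)
          finally show ?thesis .
        next
          case False
          then have "t powr (Re s - 1) \<le> t powr (- B)" using a t by (intro powr_mono') auto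
          also have "\<dots> = t powr (- 2 * B) * t powr B" using t by (simp add: powr_add[symmetric])
          also have "t powr (- 2 * B) \<le> d powr (- 2 * B)"
            using True d by (intro powr_mono2') (auto simp: B_def)
          also have "d powr (- 2 * B) * t powr B \<le> (1 + d powr (- 2 * B)) * t powr B"
            by (intro mult_right_mono) auto
          finally show ?thesis by (simp add: mult_right_mono)
        qed
        then have "t powr (Re s - 1) * norm (h t) \<le> ((1 + d powr (- 2 * B)) * t powr B) * (C * t * exp (- (x * t)))"
          using bound[OF t] by (intro mult_mono) auto
        also have "\<dots> = (1 + d powr (- 2 * B)) * C * (t powr (B + 1) * exp (- (x * t)))"
          using t by (simp add: powr_add)
        finally show ?thesis using True t by (simp add: norm_mult norm_powr_real_powr)
      next
        case False
        then show ?thesis using C by (simp add: indicator_def)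
      qed
    qed auto
  next
    show "(\<lambda>t. indicat_real {d<..} t *\<^sub>R (of_real t powr (w - 1) * h t)) \<in> borel_measurable lborel" for w
      by (rule meas) (use d in auto)
  next
    show "(\<lambda>w. indicat_real {d<..} t *\<^sub>R (of_real t powr (w - 1) * h t)) holomorphic_on UNIV" for t
      by (cases "t = 0") (use d in \<open>auto intro!: holomorphic_intros\<close>)
  qed
  have head: "(LINT t:{0<..d}|lborel. of_real t powr (s - 1) * h t) = of_real d powr (s + 1) * F s" if s: "Re s > -1" for s
  proof -
    have sn: "s + of_nat (Suc n) \<noteq> 0" for n using s by (auto simp: complex_eq_iff)
    have Ren: "Re (s + of_nat n) > - 1" for n using s by simp
    define f where "f n t = indicator {0<..d} t *\<^sub>R (c n * of_real t powr (s + of_nat n))" for n t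
    have fi: "integrable lborel (f n)" for n
      using integral_cpowr_from_0(1)[OF Ren[of n] d(1)] unfolding f_def set_integrable_def[symmetric] by simp
    have fI: "integral\<^sup>L lborel (f n) = of_real d powr (s + 1) * (a n / (s + of_nat (Suc n)))" for n
    proof -
      have "integral\<^sup>L lborel (f n) = c n * (of_real d powr (s + of_nat n + 1) / (s + of_nat n + 1))"
        using integral_cpowr_from_0(2)[OF Ren[of n] d(1)] unfolding f_def set_lebesgue_integral_def[symmetric] by simp
      also have "of_real d powr (s + of_nat n + 1) = of_real d powr (s + 1) * of_real d ^ n"
        using d by (simp add: powr_add powr_nat')
      finally show ?thesis by (simp add: a_def add_ac)
    qed
    have fN: "(LINT t|lborel. norm (f n t)) \<le> norm (a n) * (d powr (Re s + 1) / (Re s + 1))" for n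
    proof -
      have "(LINT t|lborel. norm (f n t)) = norm (c n) * (LINT t:{0<..d}|lborel. norm (complex_of_real t powr (s + of_nat n)))"
        unfolding f_def set_lebesgue_integral_def by (subst integral_mult_right_zero[symmetric]) (auto simp: norm_mult mult_ac intro!: Bochner_Integration.integral_cong)
      also have "\<dots> = norm (c n) * (d powr (Re s + n + 1) / (Re s + n + 1))"
        using integral_cpowr_from_0(3)[OF Ren[of n] d(1)] by simp
      also have "d powr (Re s + n + 1) = d ^ n * d powr (Re s + 1)"
        using d by (simp add: powr_add powr_realpow)
      also have "norm (c n) * (d ^ n * d powr (Re s + 1) / (Re s + n + 1)) = norm (a n) * (d powr (Re s + 1) / (Re s + n + 1))"
        using d by (simp add: a_def norm_mult norm_power)
      also have "\<dots> \<le> norm (a n) * (d powr (Re s + 1) / (Re s + 1))"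
        by (intro mult_left_mono divide_left_mono) (use s in auto)
      finally show ?thesis .
    qed
    have ft: "(\<lambda>n. f n t) sums (indicator {0<..d} t *\<^sub>R (of_real t powr (s - 1) * h t))" for t
    proof (cases "t \<in> {0<..d}")
      case True
      have "(\<lambda>n. of_real t powr s * (c n * of_real t ^ n)) sums (of_real t powr s * g (of_real t))"
        by (intro sums_mult pow) (use True d in auto)
      moreover have "of_real t powr s * (c n * of_real t ^ n) = f n t" for n
        using True by (simp add: f_def powr_add powr_nat')
      moreover have "of_real t powr s * g (of_real t) = of_real t powr (s - 1) * h t"
        using True d hg[of t] by (simp add: powr_diff)
      ultimately show ?thesis using True by simp
    qed (auto simp: f_def)
    have fs: "summable (\<lambda>n. norm (f n t))" for t
    proof (cases "t \<in> {0<..d}")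
      case True
      have "summable (\<lambda>n. norm (of_real t powr s) * norm (c n * complex_of_real t ^ n))"
        by (intro summable_mult powser_insidea[of _ "complex_of_real (3/4*r)"], rule sums_summable, rule pow)
           (use True g(2) in \<open>auto simp: d_def\<close>)
      moreover have "norm (of_real t powr s) * norm (c n * complex_of_real t ^ n) = norm (f n t)" for n
        using True by (simp add: f_def powr_add powr_nat' norm_mult norm_power)
      ultimately show ?thesis by simp
    qed (auto simp: f_def)
    have "(\<lambda>n. integral\<^sup>L lborel (f n)) sums (LINT t|lborel. (\<Sum>n. f n t))"
      by (rule sums_integral[OF fi])
         (use fs fN suma in \<open>auto intro!: summable_comparison_test'[OF summable_mult2[OF suma, of "d powr (Re s + 1) / (Re s + 1)"], of 0]\<close>)
    then have "(LINT t|lborel. (\<Sum>n. f n t)) = (\<Sum>n. of_real d powr (s + 1) * (a n / (s + of_nat (Suc n))))"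
      by (simp add: fI sums_iff)
    also have "\<dots> = of_real d powr (s + 1) * F s"
      unfolding F_def
    proof (rule suminf_mult)
      have "norm (a n / (s + of_nat (Suc n))) \<le> norm (a n) / (Re s + 1)" for n
      proof -
        have "Re s + 1 \<le> Re (s + of_nat (Suc n))" by simp
        also have "\<dots> \<le> norm (s + of_nat (Suc n))" by (rule complex_Re_le_cmod)
        finally show ?thesis unfolding norm_divide using s by (intro divide_left_mono mult_pos_pos) auto
      qed
      then show "summable (\<lambda>n. a n / (s + of_nat (Suc n)))"
        by (intro summable_comparison_test'[OF summable_divide[OF suma, of "Re s + 1"], of 0]) auto
    qed
    finally have "(LINT t|lborel. (\<Sum>n. f n t)) = of_real d powr (s + 1) * F s" .
    moreover have "(\<Sum>n. f n t) = indicator {0<..d} t *\<^sub>R (of_real t powr (s - 1) * h t)" for t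
      using ft by (simp add: sums_iff)
    ultimately show ?thesis by (simp add: set_lebesgue_integral_def)
  qed
  show ?thesis
  proof (intro exI[of _ "\<lambda>s. of_real d powr (s + 1) * F s + T s"] conjI allI impI)
    note F = meromorphic_on_simple_pole_series[OF suma, folded F_def]
    show "(\<lambda>s. of_real d powr (s + 1) * F s + T s) meromorphic_on UNIV"
      using d by (intro meromorphic_intros F analytic_on_imp_meromorphic_on[of T]
         analytic_on_imp_meromorphic_on[of "\<lambda>s. of_real d powr (s + 1)"])
         (auto simp: analytic_on_open T intro!: holomorphic_intros)
    show "(\<lambda>s. of_real d powr (s + 1) * F s + T s) holomorphic_on {s. Re s > - 1}"
      using d by (intro holomorphic_intros F holomorphic_on_subset[OF T]) auto
    fix s :: complex assume s: "Re s > - 1"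
    show "set_integrable lborel {0<..} (\<lambda>t. of_real t powr (s - 1) * h t)" by (rule int[OF s])
    have "(LINT t:{0<..d} \<union> {d<..}|lborel. of_real t powr (s - 1) * h t) =
      (LINT t:{0<..d}|lborel. of_real t powr (s - 1) * h t) + T s"
      unfolding T_def
      by (rule set_integral_Un) (use d in \<open>auto intro!: set_integrable_subset[OF int[OF s]]\<close>)
    moreover have "{0<..d} \<union> {d<..} = {0<..}" using d by auto
    ultimately show "of_real d powr (s + 1) * F s + T s = (LINT t:{0<..}|lborel. of_real t powr (s - 1) * h t)"
      by (simp add: head[OF s])
  qed
qed

definition barnes_kernel :: "real \<Rightarrow> real \<Rightarrow> real" where
  "barnes_kernel \<tau> t = geom_exp t * geom_exp (\<tau> * t)"

lemma barnes_kernel_eq: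
  "barnes_kernel \<tau> t = 1 / (\<tau> * t\<^sup>2) + (1 + \<tau>) / (2 * \<tau>) / t + (1 / 4 + (\<tau> + 1 / \<tau>) / 12) + barnes_remainder \<tau> t"
  by (simp add: barnes_kernel_def barnes_remainder_def)

lemma measurable_geom_exp [measurable]: "geom_exp \<in> borel_measurable borel"
  unfolding geom_exp_def by measurable

lemma measurable_barnes_kernel [measurable]: "barnes_kernel \<tau> \<in> borel_measurable borel"
  unfolding barnes_kernel_def by measurable

lemma measurable_barnes_remainder [measurable]: "barnes_remainder \<tau> \<in> borel_measurable borel"
  unfolding barnes_remainder_def by measurable

definition lattice_point :: "real \<Rightarrow> nat \<Rightarrow> real" where
  "lattice_point \<tau> n = real (fst (prod_decode n)) + real (snd (prod_decode n)) * \<tau>"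

lemma lattice_point_nonneg: "\<tau> > 0 \<Longrightarrow> lattice_point \<tau> n \<ge> 0"
  by (simp add: lattice_point_def)

text \<open>Two independent geometric series, enumerated along \<open>prod_decode\<close> so that
  termwise integration runs over a single index.\<close>

lemma barnes_kernel_sums:
  assumes "\<tau> > 0" "t > 0"
  shows "(\<lambda>n. exp (- (lattice_point \<tau> n * t))) sums barnes_kernel \<tau> t"
proof -
  define x y where "x = exp (- t)" and "y = exp (- (\<tau> * t))"
  have xy: "0 < x" "x < 1" "0 < y" "y < 1" using assms by (auto simp: x_def y_def)
  define f where "f = (\<lambda>(i::nat, j::nat). x ^ i * y ^ j)"
  have geo: "((\<lambda>n. z ^ n) has_sum (1 / (1 - z))) UNIV" if "0 < z" "z < 1" for z :: real
    by (rule norm_summable_imp_has_sum) (use that geometric_sums[of z] in \<open>auto simp: summable_geometric\<close>)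
  have row: "((\<lambda>j. f (i, j)) has_sum (x ^ i * (1 / (1 - y)))) UNIV" for i
    unfolding f_def prod.case using xy by (intro has_sum_cmult_right geo)
  have col: "((\<lambda>i. x ^ i * (1 / (1 - y))) has_sum (1 / (1 - x) * (1 / (1 - y)))) UNIV"
    using xy by (intro has_sum_cmult_left geo)
  have "f summable_on (UNIV \<times> UNIV)"
    by (rule summable_on_SigmaI[OF row has_sum_imp_summable[OF col]]) (use xy in \<open>auto simp: f_def\<close>)
  then have "(f has_sum (1 / (1 - x) * (1 / (1 - y)))) (UNIV \<times> UNIV)"
    by (rule has_sum_SigmaI[OF row col])
  then have "((\<lambda>n. f (prod_decode n)) has_sum (1 / (1 - x) * (1 / (1 - y)))) UNIV"
    using has_sum_reindex_bij_betw[OF bij_prod_decode, of f] by simp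
  moreover have "f (prod_decode n) = exp (- (lattice_point \<tau> n * t))" for n
    by (simp add: f_def x_def y_def lattice_point_def split_beta exp_of_nat_mult[symmetric] mult_exp_exp algebra_simps)
  ultimately have "((\<lambda>n. exp (- (lattice_point \<tau> n * t))) has_sum (1 / (1 - x) * (1 / (1 - y)))) UNIV" by simp
  then show ?thesis unfolding barnes_kernel_def geom_exp_def x_def y_def by (rule has_sum_imp_sums)
qed

text \<open>\<open>Mellin_continuation\<close> needs the remainder to be analytic at 0, not only
  small on the reals. With p z = (1 - exp (-z)) / z, entire and equal to 1 at 0, the function
  \<open>\<Phi>\<close> extends t^2 * remainder * exp (- w * t) holomorphically; the real bound of
  order t^3 gives it a zero of order 3, which leaves one factor t after division by t^2.\<close>

lemma barnes_remainder_Mellin: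
  assumes \<tau>: "\<tau> > 0" and w: "Re w > 0"
  shows "\<exists>K. K meromorphic_on UNIV \<and> K holomorphic_on {s. Re s > -1} \<and>
    (\<forall>s. Re s > -1 \<longrightarrow>
       set_integrable lborel {0<..} (\<lambda>t. of_real t powr (s - 1) * (of_real (barnes_remainder \<tau> t) * exp (- (w * of_real t)))) \<and>
       K s = (LINT t:{0<..}|lborel. of_real t powr (s - 1) * (of_real (barnes_remainder \<tau> t) * exp (- (w * of_real t)))))"
proof -
  define p :: "complex \<Rightarrow> complex" where "p z = (if z = 0 then 1 else (1 - exp (- z)) / z)" for z
  have d1: "deriv (\<lambda>z::complex. 1 - exp (- z)) 0 = 1" by (rule DERIV_imp_deriv) (auto intro!: derivative_eq_intros)
  have "(\<lambda>z. if z = 0 then deriv (\<lambda>z::complex. 1 - exp (- z)) 0 else ((1 - exp (- z)) - (1 - exp (- 0))) / (z - 0)) holomorphic_on UNIV"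
    by (intro pole_lemma_open[of "\<lambda>z. 1 - exp (- z)" UNIV 0] holomorphic_intros) auto
  also have "(\<lambda>z. if z = 0 then deriv (\<lambda>z::complex. 1 - exp (- z)) 0 else ((1 - exp (- z)) - (1 - exp (- 0))) / (z - 0)) = p"
    by (rule ext) (simp only: p_def d1 minus_zero exp_zero diff_self diff_zero)
  finally have p: "p holomorphic_on UNIV" .
  have pc: "p holomorphic_on A" for A by (rule holomorphic_on_subset[OF p]) auto
  have pt: "(\<lambda>z. p (of_real \<tau> * z)) holomorphic_on A" for A
    using holomorphic_on_compose[of "\<lambda>z. of_real \<tau> * z" A p] pc by (auto simp: o_def intro!: holomorphic_intros)
  have "open ((\<lambda>z. p z * p (of_real \<tau> * z)) -` (- {0}))"
    by (intro open_vimage holomorphic_on_imp_continuous_on holomorphic_intros pc pt) auto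
  moreover have "0 \<in> (\<lambda>z. p z * p (of_real \<tau> * z)) -` (- {0})" by (simp add: p_def)
  ultimately obtain r where r: "r > 0" "ball 0 r \<subseteq> (\<lambda>z. p z * p (of_real \<tau> * z)) -` (- {0})" by (meson openE)
  define \<Phi> where "\<Phi> z = exp (- (w * z)) * (1 / (of_real \<tau> * (p z * p (of_real \<tau> * z))) - 1 / of_real \<tau>
     - of_real ((1 + \<tau>) / (2 * \<tau>)) * z - of_real (1 / 4 + (\<tau> + 1 / \<tau>) / 12) * z\<^sup>2)" for z
  have \<Phi>: "\<Phi> holomorphic_on ball 0 r"
    unfolding \<Phi>_def by (intro holomorphic_intros pc pt) (use r \<tau> in auto)
  have \<Phi>t: "\<Phi> (of_real t) = of_real t ^ 2 * (of_real (barnes_remainder \<tau> t) * exp (- (w * of_real t)))" if t: "t > 0" for t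
  proof -
    have "p (of_real s) = of_real (1 / (geom_exp s * s))" if "s > 0" for s
    proof -
      have "p (of_real s) = of_real ((1 - exp (- s)) / s)"
        using that by (simp add: p_def exp_of_real[symmetric])
      also have "(1 - exp (- s)) / s = 1 / (geom_exp s * s)" using that by (simp add: geom_exp_def)
      finally show ?thesis .
    qed
    from this[OF t] this[of "\<tau> * t"] t \<tau>
    have "of_real \<tau> * (p (of_real t) * p (of_real \<tau> * of_real t)) = of_real (1 / (barnes_kernel \<tau> t * t\<^sup>2))"
      by (simp add: barnes_kernel_def power2_eq_square)
    then have "1 / (of_real \<tau> * (p (of_real t) * p (of_real \<tau> * of_real t))) = of_real (barnes_kernel \<tau> t * t\<^sup>2)" by simp
    also have "barnes_kernel \<tau> t * t\<^sup>2 = 1 / \<tau> + (1 + \<tau>) / (2 * \<tau>) * t + (1 / 4 + (\<tau> + 1 / \<tau>) / 12) * t\<^sup>2 + t\<^sup>2 * barnes_remainder \<tau> t"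
      unfolding barnes_kernel_eq using t \<tau> by (simp add: field_simps power2_eq_square)
    finally show ?thesis unfolding \<Phi>_def by (simp add: algebra_simps)
  qed
  obtain C where C: "C \<ge> 0" "\<And>\<tau> t. \<tau> > 0 \<Longrightarrow> t > 0 \<Longrightarrow> \<bar>barnes_remainder \<tau> t\<bar> \<le> C * (1 + \<tau>\<^sup>2 + 1 / \<tau>) * t"
    by (rule barnes_remainder_bound) blast
  define C' where "C' = C * (1 + \<tau>\<^sup>2 + 1 / \<tau>)"
  have C': "C' \<ge> 0" using C(1) \<tau> by (simp add: C'_def)
  have bd: "norm (of_real (barnes_remainder \<tau> t) * exp (- (w * of_real t))) \<le> C' * t * exp (- (Re w * t))" if "t > 0" for t
    using C(2)[OF \<tau> that] by (simp add: norm_mult C'_def mult_right_mono)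
  have "norm (\<Phi> (of_real t)) \<le> C' * t ^ 3" if "t > 0" "t < r" for t
  proof -
    have "norm (\<Phi> (of_real t)) \<le> t\<^sup>2 * (C' * t * exp (- (Re w * t)))"
      unfolding \<Phi>t[OF that(1)] norm_mult[of "_ ^ 2"] using bd[OF that(1)] by (intro mult_mono) (auto simp: norm_power)
    also have "\<dots> \<le> t\<^sup>2 * (C' * t * 1)" using C' that w by (intro mult_left_mono) auto
    finally show ?thesis by (simp add: power3_eq_cube power2_eq_square mult_ac)
  qed
  from holomorphic_on_factor_power[OF \<Phi> r(1) this]
  obtain g where g: "g holomorphic_on ball 0 r" "\<And>z. z \<in> ball 0 r \<Longrightarrow> \<Phi> z = z ^ 3 * g z" by blast
  show ?thesis
  proof (rule Mellin_continuation[OF g(1) r(1) _ _ bd w C'])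
    fix t :: real assume t: "0 < t" "t < r"
    have "of_real t ^ 2 * (of_real (barnes_remainder \<tau> t) * exp (- (w * of_real t))) = of_real t ^ 2 * (of_real t * g (of_real t))"
      unfolding \<Phi>t[OF t(1), symmetric] using g(2)[of "of_real t"] t
      by (simp add: power3_eq_cube power2_eq_square mult_ac)
    then show "of_real (barnes_remainder \<tau> t) * exp (- (w * of_real t)) = of_real t * g (of_real t)"
      using t by simp
  next
    show "(\<lambda>t. of_real (barnes_remainder \<tau> t) * exp (- (w * of_real t))) \<in> borel_measurable borel"
    proof -
      have [measurable]: "(\<lambda>t::real. exp (- (w * complex_of_real t))) \<in> borel_measurable borel"
        by (intro borel_measurable_continuous_onI continuous_intros)
      show ?thesis by measurable
    qed
  qed
qed

text \<open>The subtracted terms integrate to Gamma (s - 2), Gamma (s - 1) and Gamma s times powers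
  of w. Division by Gamma s leaves rational factors with poles at 1 and 2, and in this form the
  right-hand side makes sense for Re s > -1 away from those poles.\<close>

lemma barnes_kernel_Mellin:
  assumes \<tau>: "\<tau> > 0" and w: "Re w > 0" and s: "Re s > 2"
  defines "f \<equiv> \<lambda>t. complex_of_real t powr (s - 1) * (of_real (barnes_kernel \<tau> t) * exp (- (w * of_real t)))"
    and "R \<equiv> (LINT t:{0<..}|lborel. of_real t powr (s - 1) * (of_real (barnes_remainder \<tau> t) * exp (- (w * of_real t))))"
  shows "set_integrable lborel {0<..} f"
    and "rGamma s * (LINT t:{0<..}|lborel. f t) =
      of_real (1 / \<tau>) * w powr (2 - s) / ((s - 1) * (s - 2)) + of_real ((1 + \<tau>) / (2 * \<tau>)) * w powr (1 - s) / (s - 1)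
      + of_real (1 / 4 + (\<tau> + 1 / \<tau>) / 12) * w powr (- s) + rGamma s * R"
proof -
  define p where "p r t = complex_of_real t powr (r - 1) * exp (- (w * of_real t))" for r t
  have pi: "set_integrable lborel {0<..} (p r)" if "Re r > 0" for r
    unfolding p_def by (rule set_integrable_cpowr_exp[OF that w])
  have pI: "(LINT t:{0<..}|lborel. p r t) = Gamma r * w powr (- r)" if "Re r > 0" for r
    unfolding p_def by (rule Laplace_powr[OF that w])
  define q where "q t = complex_of_real t powr (s - 1) * (of_real (barnes_remainder \<tau> t) * exp (- (w * of_real t)))" for t
  have qi: "set_integrable lborel {0<..} q" and qI: "(LINT t:{0<..}|lborel. q t) = R"
    unfolding q_def R_def using barnes_remainder_Mellin[OF \<tau> w] s by auto
  define c2 c1 c0 :: complex where "c2 = of_real (1 / \<tau>)" and "c1 = of_real ((1 + \<tau>) / (2 * \<tau>))"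
    and "c0 = of_real (1 / 4 + (\<tau> + 1 / \<tau>) / 12)"
  have f_eq: "f t = c2 * p (s - 2) t + c1 * p (s - 1) t + c0 * p s t + q t" if t: "t > 0" for t
  proof -
    have 1: "complex_of_real t powr (s - 1 - 1) = complex_of_real t powr (s - 1) / of_real t"
      using t by (simp only: powr_diff) simp
    have 2: "complex_of_real t powr (s - 2 - 1) = complex_of_real t powr (s - 1) / of_real t ^ 2"
    proof -
      have "s - 2 - 1 = s - 1 - 1 - 1" by simp
      then have "complex_of_real t powr (s - 2 - 1) = complex_of_real t powr (s - 1) / of_real t / of_real t"
        using t by (simp only: powr_diff) simp
      then show ?thesis by (simp add: power2_eq_square[of "complex_of_real t"])
    qed
    show ?thesis unfolding f_def p_def q_def barnes_kernel_eq c2_def c1_def c0_def 1 2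
      using t \<tau> by (simp add: algebra_simps power2_eq_square)
  qed
  have si: "set_integrable lborel {0<..} (\<lambda>t. c2 * p (s - 2) t + c1 * p (s - 1) t + c0 * p s t + q t)"
    using s by (intro set_integral_add set_integrable_mult_right impI pi qi) auto
  show "set_integrable lborel {0<..} f"
    by (rule set_integrable_cong[THEN iffD1, OF refl refl _ si]) (simp add: f_eq)
  have "(LINT t:{0<..}|lborel. f t) = (LINT t:{0<..}|lborel. c2 * p (s - 2) t + c1 * p (s - 1) t + c0 * p s t + q t)"
    by (rule set_lebesgue_integral_cong) (auto simp: f_eq)
  also have "\<dots> = c2 * (Gamma (s - 2) * w powr (- (s - 2))) + c1 * (Gamma (s - 1) * w powr (- (s - 1))) + c0 * (Gamma s * w powr (- s)) + R"
    using s pi qi by (simp add: set_integral_add pI qI)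
  finally have I: "(LINT t:{0<..}|lborel. f t) = \<dots>" .
  have ne: "s \<noteq> 0" "s \<noteq> 1" "s \<noteq> 2" using s by auto
  have notZ: "r \<notin> \<int>\<^sub>\<le>\<^sub>0" if "Re r > 0" for r
    using that by (auto elim!: nonpos_Ints_cases)
  have G0: "Gamma (s - 1) \<noteq> 0" "Gamma (s - 2) \<noteq> 0"
    using notZ[of "s - 1"] notZ[of "s - 2"] s by (simp_all add: Gamma_eq_zero_iff)
  have G1: "Gamma s = (s - 1) * Gamma (s - 1)" "Gamma (s - 1) = (s - 2) * Gamma (s - 2)"
    using Gamma_plus1[of "s - 1"] Gamma_plus1[of "s - 2"] notZ[of "s - 1"] notZ[of "s - 2"] s by simp_all
  have g1: "rGamma s * Gamma (s - 1) = 1 / (s - 1)"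
    using G0 ne by (simp add: rGamma_inverse_Gamma G1(1) field_simps)
  have g2: "rGamma s * Gamma (s - 2) = 1 / ((s - 1) * (s - 2))"
    using G0 ne unfolding rGamma_inverse_Gamma G1 inverse_mult_distrib divide_inverse by (simp add: mult.assoc)
  have g0: "rGamma s * Gamma s = 1" using notZ[of s] s by (simp add: rGamma_inverse_Gamma Gamma_eq_zero_iff)
  have "rGamma s * (LINT t:{0<..}|lborel. f t) = c2 * (rGamma s * Gamma (s - 2)) * w powr (2 - s)
     + c1 * (rGamma s * Gamma (s - 1)) * w powr (1 - s) + c0 * (rGamma s * Gamma s) * w powr (- s) + rGamma s * R"
    unfolding I by (simp add: algebra_simps)
  also have "\<dots> = c2 * w powr (2 - s) / ((s - 1) * (s - 2)) + c1 * w powr (1 - s) / (s - 1) + c0 * w powr (- s) + rGamma s * R"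
    unfolding g0 g1 g2 by simp
  finally show "rGamma s * (LINT t:{0<..}|lborel. f t) =
      of_real (1 / \<tau>) * w powr (2 - s) / ((s - 1) * (s - 2)) + of_real ((1 + \<tau>) / (2 * \<tau>)) * w powr (1 - s) / (s - 1)
      + of_real (1 / 4 + (\<tau> + 1 / \<tau>) / 12) * w powr (- s) + rGamma s * R"
    unfolding c2_def c1_def c0_def .
qed

lemma barnes_zeta2_series_eq_integral:
  assumes \<tau>: "\<tau> > 0" and w: "Re w > 0" and s: "Re s > 2"
  shows "barnes_zeta2_series 1 \<tau> w s = rGamma s *
    (LINT t:{0<..}|lborel. complex_of_real t powr (s - 1) * (of_real (barnes_kernel \<tau> t) * exp (- (w * of_real t))))"
proof -
  define W where "W n = w + of_real (lattice_point \<tau> n)" for n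
  have W: "Re (W n) > 0" for n using w lattice_point_nonneg[OF \<tau>, of n] by (simp add: W_def)
  define f where "f n t = indicator {0<..} t *\<^sub>R (complex_of_real t powr (s - 1) * exp (- (W n * of_real t)))" for n t
  define F where "F t = indicator {0<..} t *\<^sub>R (complex_of_real t powr (s - 1) * (of_real (barnes_kernel \<tau> t) * exp (- (w * of_real t))))" for t
  have fi: "integrable lborel (f n)" for n
    using set_integrable_cpowr_exp[of s "W n"] W s unfolding f_def set_integrable_def by simp
  have fI: "integral\<^sup>L lborel (f n) = Gamma s * W n powr (- s)" for n
    using Laplace_powr[of s "W n"] W s unfolding f_def set_lebesgue_integral_def by simp
  have Fi: "integrable lborel F"
    using barnes_kernel_Mellin(1)[OF assms] unfolding F_def set_integrable_def by simp
  have f_eq: "f n t = (indicator {0<..} t *\<^sub>R (complex_of_real t powr (s - 1) * exp (- (w * of_real t)))) * of_real (exp (- (lattice_point \<tau> n * t)))" for n t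
    unfolding f_def W_def exp_of_real[symmetric] by (simp add: exp_add[symmetric] algebra_simps)
  have fS: "(\<lambda>n. f n t) sums F t" for t
  proof (cases "t > 0")
    case True
    have "(\<lambda>n. f n t) sums ((indicator {0<..} t *\<^sub>R (complex_of_real t powr (s - 1) * exp (- (w * of_real t)))) * of_real (barnes_kernel \<tau> t))"
      unfolding f_eq by (intro sums_mult sums_of_real barnes_kernel_sums \<tau> True)
    then show ?thesis by (simp add: F_def mult_ac)
  qed (simp add: f_def F_def)
  \<comment> \<open>The lattice point enters only through a positive real factor, so the norms sum
    to the norm of the limit. One integral therefore bounds all partial sums of the integrated
    norms, which justifies termwise integration.\<close>
  have nS: "(\<lambda>n. norm (f n t)) sums norm (F t)" for t
  proof (cases "t > 0")
    case True
    have pos: "barnes_kernel \<tau> t \<ge> 0" using sums_le[OF _ sums_zero barnes_kernel_sums[OF \<tau> True]] by simp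
    have "(\<lambda>n. norm (f n t)) sums (norm (indicator {0<..} t *\<^sub>R (complex_of_real t powr (s - 1) * exp (- (w * of_real t)))) * barnes_kernel \<tau> t)"
      unfolding f_eq norm_mult norm_of_real abs_exp_cancel by (intro sums_mult barnes_kernel_sums \<tau> True)
    then show ?thesis using pos by (simp add: F_def norm_mult mult_ac)
  qed (simp add: f_def F_def)
  have sN: "summable (\<lambda>n. LINT t|lborel. norm (f n t))"
  proof (rule summableI_nonneg_bounded)
    fix n
    have "(\<Sum>i<n. LINT t|lborel. norm (f i t)) = (LINT t|lborel. (\<Sum>i<n. norm (f i t)))"
      using fi by (subst Bochner_Integration.integral_sum) auto
    also have "\<dots> \<le> (LINT t|lborel. norm (F t))"
    proof (rule integral_mono)
      show "(\<Sum>i<n. norm (f i t)) \<le> norm (F t)" for t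
        using sum_le_suminf[OF sums_summable[OF nS[of t]], of "{..<n}"] sums_unique[OF nS[of t]] by simp
    qed (use fi Fi in auto)
    finally show "(\<Sum>i<n. LINT t|lborel. norm (f i t)) \<le> (LINT t|lborel. norm (F t))" .
  qed simp
  have "(\<lambda>n. integral\<^sup>L lborel (f n)) sums (LINT t|lborel. (\<Sum>n. f n t))"
    by (rule sums_integral[OF fi]) (use nS sN in \<open>auto intro: sums_summable\<close>)
  moreover have "(\<Sum>n. f n t) = F t" for t using fS[of t] by (simp add: sums_iff)
  ultimately have S: "(\<lambda>n. integral\<^sup>L lborel (f n)) sums integral\<^sup>L lborel F" by simp
  have "summable (\<lambda>n. norm (integral\<^sup>L lborel (f n)))"
    by (rule summable_comparison_test'[OF sN, of 0]) simp
  from norm_summable_imp_has_sum[OF this S] have "((\<lambda>n. Gamma s * W n powr (- s)) has_sum integral\<^sup>L lborel F) UNIV"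
    by (simp add: fI)
  then have "((\<lambda>n. rGamma s * (Gamma s * W n powr (- s))) has_sum (rGamma s * integral\<^sup>L lborel F)) UNIV"
    by (rule has_sum_cmult_right)
  moreover have "rGamma s * Gamma s = 1"
  proof -
    have "s \<notin> \<int>\<^sub>\<le>\<^sub>0" using s by (auto elim!: nonpos_Ints_cases)
    then show ?thesis by (simp add: rGamma_inverse_Gamma Gamma_eq_zero_iff)
  qed
  ultimately have "((\<lambda>n. W n powr (- s)) has_sum (rGamma s * integral\<^sup>L lborel F)) UNIV"
    by (simp add: mult.assoc[symmetric])
  moreover have "W n powr (- s) = (\<lambda>(k1, k2). (w + of_nat k1 * of_real 1 + of_nat k2 * of_real \<tau>) powr (- s)) (prod_decode n)" for n
    by (simp add: W_def lattice_point_def split_beta add_ac)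
  ultimately have "((\<lambda>(k1, k2). (w + of_nat k1 * of_real 1 + of_nat k2 * of_real \<tau>) powr (- s)) has_sum (rGamma s * integral\<^sup>L lborel F)) UNIV"
    using has_sum_reindex_bij_betw[OF bij_prod_decode, of "\<lambda>(k1, k2). (w + of_nat k1 * of_real 1 + of_nat k2 * of_real \<tau>) powr (- s)"]
    by simp
  then show ?thesis unfolding barnes_zeta2_series_def F_def set_lebesgue_integral_def by (rule infsumI)
qed

text \<open>The derivative at s = 0 of the continued zeta function. The three explicit terms give
  the elementary part; rGamma s * K s gives K 0, the Laplace transform, because
  \<open>rGamma\<close> vanishes at 0 with derivative 1.\<close>

definition log_Gamma2 :: "real \<Rightarrow> complex \<Rightarrow> complex" where
  "log_Gamma2 \<tau> w = of_real (1 / \<tau>) * (w\<^sup>2 * (3 / 4 - ln w / 2)) + of_real ((1 + \<tau>) / (2 * \<tau>)) * (w * ln w - w)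
     - of_real (1 / 4 + (\<tau> + 1 / \<tau>) / 12) * ln w
     + (LINT t:{0<..}|lborel. of_real (barnes_remainder \<tau> t / t) * exp (- (w * of_real t)))"

lemma barnes_zeta2_continuation:
  assumes \<tau>: "\<tau> > 0" and w: "Re w > 0"
  shows "\<exists>J. J meromorphic_on UNIV \<and> J holomorphic_on {s. Re s > -1} - {1, 2} \<and>
    (\<forall>s. Re s > 2 \<longrightarrow> J s = barnes_zeta2_series 1 \<tau> w s) \<and> deriv J 0 = log_Gamma2 \<tau> w"
proof -
  have w0: "w \<noteq> 0" using w by auto
  obtain K where K: "K meromorphic_on UNIV" "K holomorphic_on {s. Re s > -1}"
    "\<And>s. Re s > -1 \<Longrightarrow> K s = (LINT t:{0<..}|lborel. of_real t powr (s - 1) * (of_real (barnes_remainder \<tau> t) * exp (- (w * of_real t))))"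
    using barnes_remainder_Mellin[OF assms] by blast
  define c2 c1 c0 :: complex where "c2 = of_real (1 / \<tau>)" and "c1 = of_real ((1 + \<tau>) / (2 * \<tau>))"
    and "c0 = of_real (1 / 4 + (\<tau> + 1 / \<tau>) / 12)"
  define J where "J s = c2 * w powr (2 - s) / ((s - 1) * (s - 2)) + c1 * w powr (1 - s) / (s - 1) + c0 * w powr (- s) + rGamma s * K s" for s
  have hol: "(\<lambda>s. w powr (a - s)) holomorphic_on A" "(\<lambda>s. w powr (- s)) holomorphic_on A" for a A
    using w0 by (auto intro!: holomorphic_intros)
  have rG: "rGamma holomorphic_on A" for A :: "complex set" by (rule holomorphic_rGamma)
  show ?thesis
  proof (intro exI[of _ J] conjI allI impI)
    show "J meromorphic_on UNIV"
      unfolding J_def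
      by (intro meromorphic_intros K(1) analytic_on_imp_meromorphic_on[of "\<lambda>s. w powr (_ - s)"]
         analytic_on_imp_meromorphic_on[of "\<lambda>s. w powr (- s)"] analytic_on_imp_meromorphic_on[of rGamma])
         (auto simp: analytic_on_open hol rG)
    show "J holomorphic_on {s. Re s > -1} - {1, 2}"
      unfolding J_def by (intro holomorphic_intros hol rG holomorphic_on_subset[OF K(2)]) auto
    show "J s = barnes_zeta2_series 1 \<tau> w s" if s: "Re s > 2" for s
      unfolding barnes_zeta2_series_eq_integral[OF assms that] barnes_kernel_Mellin(2)[OF assms that]
      using K(3)[of s] s by (simp add: J_def c2_def c1_def c0_def)
    have K0: "K 0 = (LINT t:{0<..}|lborel. of_real (barnes_remainder \<tau> t / t) * exp (- (w * of_real t)))"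
      by (subst K(3)) (auto intro!: set_lebesgue_integral_cong simp: powr_minus field_simps)
    have dK: "(K has_field_derivative deriv K 0) (at 0)"
      by (rule holomorphic_derivI[OF K(2)]) (auto simp: open_halfspace_Re_gt)
    have dG: "(rGamma has_field_derivative 1) (at (0::complex))"
      using has_field_derivative_rGamma_nonpos_int[of 0] by simp
    have "(J has_field_derivative log_Gamma2 \<tau> w) (at 0)"
    proof -
      have dp: "((\<lambda>s. w powr (a - s)) has_field_derivative (- ln w * w powr a)) (at 0)" for a
        unfolding powr_def using w0 by (auto intro!: derivative_eq_intros)
      have dp0: "((\<lambda>s. w powr (- s)) has_field_derivative (- ln w)) (at 0)"
        using dp[of 0] w0 by simp
      \<comment> \<open>Quotient rule at s = 0, where the denominator has value 2 and derivative
        -3.\<close>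
      have d2: "((\<lambda>s. c2 * w powr (2 - s) / ((s - 1) * (s - 2))) has_field_derivative
          (c2 * (- ln w * w powr 2) * 2 - c2 * w powr 2 * (-3)) / 4) (at 0)"
        by (rule derivative_eq_intros dp refl | simp)+
      have d1: "((\<lambda>s. c1 * w powr (1 - s) / (s - 1)) has_field_derivative
          (c1 * (- ln w * w powr 1) * (-1) - c1 * w powr 1)) (at 0)"
        by (rule derivative_eq_intros dp refl | simp)+
      have d0: "((\<lambda>s. c0 * w powr (- s)) has_field_derivative (c0 * (- ln w))) (at 0)"
        by (rule DERIV_cmult[OF dp0])
      have dk: "((\<lambda>s. rGamma s * K s) has_field_derivative K 0) (at 0)"
        using DERIV_mult[OF dG dK] by simp
      have "(J has_field_derivative
          (c2 * (- ln w * w powr 2) * 2 - c2 * w powr 2 * (-3)) / 4 +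
          (c1 * (- ln w * w powr 1) * (-1) - c1 * w powr 1) + c0 * (- ln w) + K 0) (at 0)"
        unfolding J_def by (intro DERIV_add d2 d1 d0 dk)
      also have "(c2 * (- ln w * w powr 2) * 2 - c2 * w powr 2 * (-3)) / 4 +
          (c1 * (- ln w * w powr 1) * (-1) - c1 * w powr 1) + c0 * (- ln w) + K 0 = log_Gamma2 \<tau> w"
        unfolding log_Gamma2_def K0 c2_def[symmetric] c1_def[symmetric] c0_def[symmetric]
        using w0 by (simp add: field_simps power2_eq_square)
      finally show ?thesis .
    qed
    then show "deriv J 0 = log_Gamma2 \<tau> w" by (rule DERIV_imp_deriv)
  qed
qed

lemma barnes_zeta2_eqI:
  assumes J: "J meromorphic_on UNIV" "\<And>s. Re s > 2 \<Longrightarrow> J s = barnes_zeta2_series 1 \<tau> w s"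
    "J holomorphic_on {s. Re s > 2}"
  shows "barnes_zeta2 1 \<tau> w = remove_sings J"
  unfolding barnes_zeta2_def
proof (rule the_equality)
  have o: "open {s::complex. Re s > 2}" by (rule open_halfspace_Re_gt)
  have an: "J analytic_on {s}" if "Re s > 2" for s
    using J(3) o that by (auto simp: analytic_at)
  show *: "remove_sings J nicely_meromorphic_on UNIV \<and> (\<forall>s. 2 < Re s \<longrightarrow> remove_sings J s = barnes_zeta2_series 1 \<tau> w s)"
    using an J(2) by (auto simp: remove_sings_nicely_meromorphic[OF J(1)])
  show "f = remove_sings J" if "f nicely_meromorphic_on UNIV \<and> (\<forall>s. 2 < Re s \<longrightarrow> f s = barnes_zeta2_series 1 \<tau> w s)" for f
  proof (rule nicely_meromorphic_eqI[of f "remove_sings J" "{s. Re s > 2}"])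
    have "(3::complex) \<in> {s. Re s > 2}" by simp
    then show "{s::complex. Re s > 2} \<noteq> {}" by blast
  qed (use that * o in auto)
qed

lemma connected_slit_halfplane: "connected ({s::complex. Re s > -1} - {1, 2})" "open ({s::complex. Re s > -1} - {1, 2})"
  by (intro connected_open_delete_finite convex_connected convex_halfspace_Re_gt open_halfspace_Re_gt)
     (auto intro!: open_Diff open_halfspace_Re_gt)

lemma deriv_barnes_zeta2:
  assumes "\<tau> > 0" "Re w > 0"
  shows "deriv (barnes_zeta2 1 \<tau> w) 0 = log_Gamma2 \<tau> w"
proof -
  obtain J where J: "J meromorphic_on UNIV" "J holomorphic_on {s. Re s > -1} - {1, 2}"
    "\<And>s. Re s > 2 \<Longrightarrow> J s = barnes_zeta2_series 1 \<tau> w s" "deriv J 0 = log_Gamma2 \<tau> w"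
    using barnes_zeta2_continuation[OF assms] by blast
  have "barnes_zeta2 1 \<tau> w = remove_sings J"
    by (rule barnes_zeta2_eqI[OF J(1,3)]) (auto intro!: holomorphic_on_subset[OF J(2)])
  moreover have "J analytic_on {0}"
    using J(2) connected_slit_halfplane(2) unfolding analytic_at by (intro exI conjI) auto
  ultimately show ?thesis using J(4) by simp
qed

text \<open>Shifting w by a multiplies the integrand by exp (- a * t), so the mixed difference
  multiplies the kernel by (1 - exp (- t)) * (1 - exp (- \<tau> * t)) and turns it into 1. What
  remains is w^(-s), first for Re s > 2 and then, by continuation around the points 1 and 2, near s
  = 0, where it is differentiated.\<close>

lemma log_Gamma2_second_difference:
  assumes \<tau>: "\<tau> > 0" and w: "Re w > 0"
  shows "log_Gamma2 \<tau> w - log_Gamma2 \<tau> (w + 1) - log_Gamma2 \<tau> (w + of_real \<tau>) + log_Gamma2 \<tau> (w + 1 + of_real \<tau>) = - ln w"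
proof -
  let ?S = "{s::complex. Re s > -1} - {1, 2}"
  have "\<exists>J. J holomorphic_on ?S \<and> (\<forall>s. Re s > 2 \<longrightarrow> J s = barnes_zeta2_series 1 \<tau> v s) \<and> deriv J 0 = log_Gamma2 \<tau> v"
    if "Re v > 0" for v using barnes_zeta2_continuation[OF \<tau> that] by blast
  then obtain J where J: "\<And>v. Re v > 0 \<Longrightarrow> J v holomorphic_on ?S"
    "\<And>v s. Re v > 0 \<Longrightarrow> Re s > 2 \<Longrightarrow> J v s = barnes_zeta2_series 1 \<tau> v s"
    "\<And>v. Re v > 0 \<Longrightarrow> deriv (J v) 0 = log_Gamma2 \<tau> v" by metis
  have Re: "Re (w + 1) > 0" "Re (w + of_real \<tau>) > 0" "Re (w + 1 + of_real \<tau>) > 0" using w \<tau> by auto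
  have w0: "w \<noteq> 0" using w by auto
  define D where "D s = J w s - J (w + 1) s - J (w + of_real \<tau>) s + J (w + 1 + of_real \<tau>) s" for s
  have D: "D holomorphic_on ?S" unfolding D_def by (intro holomorphic_intros J(1) w Re)
  have D2: "D s = w powr (- s)" if s: "Re s > 2" for s
  proof -
    define I where "I v t = complex_of_real t powr (s - 1) * (of_real (barnes_kernel \<tau> t) * exp (- (v * of_real t)))" for v t
    have ii: "set_integrable lborel {0<..} (I v)" if "Re v > 0" for v
      using barnes_kernel_Mellin(1)[OF \<tau> that s] unfolding I_def .
    have JI: "J v s = rGamma s * (LINT t:{0<..}|lborel. I v t)" if "Re v > 0" for v
      using J(2)[OF that s] barnes_zeta2_series_eq_integral[OF \<tau> that s] unfolding I_def by simp
    have "D s = rGamma s * (LINT t:{0<..}|lborel. I w t - I (w + 1) t - I (w + of_real \<tau>) t + I (w + 1 + of_real \<tau>) t)"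
      unfolding D_def JI[OF w] JI[OF Re(1)] JI[OF Re(2)] JI[OF Re(3)]
      using ii[OF w] ii[OF Re(1)] ii[OF Re(2)] ii[OF Re(3)]
      by (simp add: set_integral_add set_integral_diff algebra_simps)
    also have "(LINT t:{0<..}|lborel. I w t - I (w + 1) t - I (w + of_real \<tau>) t + I (w + 1 + of_real \<tau>) t)
       = (LINT t:{0<..}|lborel. complex_of_real t powr (s - 1) * exp (- (w * of_real t)))"
    proof (rule set_lebesgue_integral_cong)
      show "\<forall>t. t \<in> {0<..} \<longrightarrow> I w t - I (w + 1) t - I (w + of_real \<tau>) t + I (w + 1 + of_real \<tau>) t =
          complex_of_real t powr (s - 1) * exp (- (w * of_real t))"
      proof (intro allI impI)
        fix t :: real assume t: "t \<in> {0<..}"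
        have e: "exp (- ((v + of_real a) * of_real t)) = exp (- (v * of_real t)) * of_real (exp (- (a * t)))" for v :: complex and a
          unfolding exp_of_real[symmetric] by (simp add: exp_add[symmetric] algebra_simps)
        have "I w t - I (w + 1) t - I (w + of_real \<tau>) t + I (w + 1 + of_real \<tau>) t =
          complex_of_real t powr (s - 1) * exp (- (w * of_real t)) *
          of_real (barnes_kernel \<tau> t * ((1 - exp (- t)) * (1 - exp (- (\<tau> * t)))))"
          unfolding I_def e[of w 1, simplified] e[of w \<tau>] e[of "w + 1" \<tau>] by (simp add: algebra_simps)
        also have "barnes_kernel \<tau> t * ((1 - exp (- t)) * (1 - exp (- (\<tau> * t)))) = 1"
          using t \<tau> by (simp add: barnes_kernel_def geom_exp_def)
        finally show "I w t - I (w + 1) t - I (w + of_real \<tau>) t + I (w + 1 + of_real \<tau>) t =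
          complex_of_real t powr (s - 1) * exp (- (w * of_real t))" by simp
      qed
    qed simp
    also have "\<dots> = Gamma s * w powr (- s)" using s w by (intro Laplace_powr) auto
    also have "rGamma s * (Gamma s * w powr (- s)) = w powr (- s)"
    proof -
      have "s \<notin> \<int>\<^sub>\<le>\<^sub>0" using s by (auto elim!: nonpos_Ints_cases)
      then show ?thesis by (simp add: rGamma_inverse_Gamma Gamma_eq_zero_iff)
    qed
    finally show ?thesis .
  qed
  have eq: "D s = w powr (- s)" if "s \<in> ?S" for s
  proof (rule analytic_continuation_open[of "{s. Re s > 2}" ?S D "\<lambda>s. w powr (- s)"])
    have "(3::complex) \<in> {s. Re s > 2}" by simp
    then show "{s::complex. Re s > 2} \<noteq> {}" by blast
  qed (use that D D2 w0 connected_slit_halfplane open_halfspace_Re_gt[of 2] in \<open>auto intro!: holomorphic_intros\<close>)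
  have dJ: "(J v has_field_derivative log_Gamma2 \<tau> v) (at 0)" if "Re v > 0" for v
    using holomorphic_derivI[OF J(1)[OF that] connected_slit_halfplane(2), of 0] J(3)[OF that] by simp
  have "(D has_field_derivative (log_Gamma2 \<tau> w - log_Gamma2 \<tau> (w + 1) - log_Gamma2 \<tau> (w + of_real \<tau>) + log_Gamma2 \<tau> (w + 1 + of_real \<tau>))) (at 0)"
    unfolding D_def by (intro DERIV_add DERIV_diff dJ w Re)
  then have "((\<lambda>s. w powr (- s)) has_field_derivative (log_Gamma2 \<tau> w - log_Gamma2 \<tau> (w + 1) - log_Gamma2 \<tau> (w + of_real \<tau>) + log_Gamma2 \<tau> (w + 1 + of_real \<tau>))) (at 0)"
    by (rule has_field_derivative_transform_within_open[where S = ?S]) (use eq connected_slit_halfplane in auto)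
  moreover have "((\<lambda>s. w powr (- s)) has_field_derivative (- ln w)) (at 0)"
    unfolding powr_def using w0 by (auto intro!: derivative_eq_intros)
  ultimately show ?thesis by (rule DERIV_unique)
qed

section \<open>The double gamma function\<close>

text \<open>The bracket is z^3 * g z with g holomorphic near 0, the power 3 being read off on
  positive reals. The factor n^2 then still leaves a null sequence.\<close>

lemma Ln_quadratic_remainder:
  "(\<lambda>n. of_nat n ^ 2 * (ln (1 + a / of_nat n) - a / of_nat n + (a / of_nat n)\<^sup>2 / 2)) \<longlonglongrightarrow> (0::complex)"
proof -
  define f where "f z = ln (1 + z) - z + z\<^sup>2 / 2" for z :: complex
  have f: "f holomorphic_on ball 0 1"
  proof -
    have "1 + z \<notin> \<real>\<^sub>\<le>\<^sub>0" if "z \<in> ball 0 1" for z :: complex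
      using that abs_Re_le_cmod[of z] by (auto simp: complex_nonpos_Reals_iff)
    then show ?thesis unfolding f_def by (intro holomorphic_intros) simp_all
  qed
  define r :: "real \<Rightarrow> real" where "r t = (ln (1 + t) - t + t\<^sup>2 / 2) / t ^ 3" for t
  have c: "continuous_on {0<..} r" unfolding r_def by (intro continuous_intros) auto
  have "(r \<longlongrightarrow> 1/3) (at_right 0)" "(r \<longlongrightarrow> 0) at_top" unfolding r_def by real_asymp+
  from bounded_on_Ioi[OF c this] obtain C where C: "\<And>t. t > 0 \<Longrightarrow> \<bar>r t\<bar> \<le> C" by blast
  have "norm (f (of_real t)) \<le> C * t ^ 3" if t: "0 < t" "t < 1" for t
  proof -
    have "f (of_real t) = of_real (ln (1 + t) - t + t\<^sup>2 / 2)"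
      using t Ln_of_real[of "1 + t"] by (simp add: f_def)
    then have "norm (f (of_real t)) = \<bar>ln (1 + t) - t + t\<^sup>2 / 2\<bar>" by (simp only: norm_of_real)
    also have "\<dots> = \<bar>r t\<bar> * t ^ 3" using t by (simp add: r_def abs_divide)
    also have "\<dots> \<le> C * t ^ 3" using C[OF t(1)] t by (intro mult_right_mono) auto
    finally show ?thesis .
  qed
  from holomorphic_on_factor_power[OF f _ this] obtain g where
    g: "g holomorphic_on ball 0 1" "\<And>z. z \<in> ball 0 1 \<Longrightarrow> f z = z ^ 3 * g z" by auto
  have an: "(\<lambda>n. a / of_nat n) \<longlonglongrightarrow> 0" by (rule lim_const_over_n)
  have "isCont g 0" using g(1) by (metis centre_in_ball continuous_on_eq_continuous_at holomorphic_on_imp_continuous_on open_ball zero_less_one)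
  then have "(\<lambda>n. g (a / of_nat n)) \<longlonglongrightarrow> g 0" using an by (rule isCont_tendsto_compose)
  then have "(\<lambda>n. a\<^sup>2 * (a / of_nat n) * g (a / of_nat n)) \<longlonglongrightarrow> a\<^sup>2 * 0 * g 0"
    by (intro tendsto_intros an)
  moreover have "eventually (\<lambda>n. a\<^sup>2 * (a / of_nat n) * g (a / of_nat n) = of_nat n ^ 2 * f (a / of_nat n)) sequentially"
    using eventually_conj[OF tendstoD[OF an zero_less_one] eventually_gt_at_top[of 0]]
  proof eventually_elim
    case (elim n)
    then show ?case using g(2)[of "a / of_nat n"] by (simp add: power2_eq_square power3_eq_cube dist_norm)
  qed
  ultimately have "(\<lambda>n. of_nat n ^ 2 * f (a / of_nat n)) \<longlonglongrightarrow> 0" by (auto elim: Lim_transform_eventually)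
  then show ?thesis by (simp add: f_def)
qed

lemma Ln_add_of_nat:
  fixes a :: complex
  assumes "real n > norm a"
  shows "ln (a + of_nat n) = of_real (ln (real n)) + ln (1 + a / of_nat n)"
proof -
  have n: "n > 0" using assms by (metis le_less_trans norm_ge_zero of_nat_0_less_iff)
  have "norm (a / of_nat n) < 1" using assms n by (simp add: norm_divide)
  then have "1 + a / of_nat n \<noteq> 0" by (metis add.inverse_unique norm_minus_cancel norm_one order_less_irrefl add_eq_0_iff)
  moreover have "a + of_nat n = of_real (real n) * (1 + a / of_nat n)" using n by (simp add: field_simps)
  ultimately show ?thesis using Ln_times_of_real[of "real n" "1 + a / of_nat n"] n by (simp add: Ln_of_nat)
qed

lemma Ln_add_of_nat_asymp: "(\<lambda>n. ln (a + of_nat n) - of_real (ln (real n))) \<longlonglongrightarrow> (0::complex)"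
proof -
  have "(\<lambda>n. ln (1 + a / of_nat n)) \<longlonglongrightarrow> ln (1 + 0)"
    by (intro tendsto_intros lim_const_over_n) auto
  moreover have "eventually (\<lambda>n. real n > norm a) sequentially" by real_asymp
  then have "eventually (\<lambda>n. ln (1 + a / of_nat n) = ln (a + of_nat n) - of_real (ln (real n))) sequentially"
    by eventually_elim (simp add: Ln_add_of_nat)
  ultimately show ?thesis by (auto elim: Lim_transform_eventually)
qed

text \<open>This expansion and the quadratic one below replace ln (a + n) by ln n and polynomials in
  a and n, so that in differences of shifted main terms all growth cancels by algebra.\<close>

lemma linear_Ln_asymp:
  "(\<lambda>n. ((a + of_nat n) * ln (a + of_nat n) - (a + of_nat n)) - ((a + of_nat n) * of_real (ln (real n)) - of_nat n)) \<longlonglongrightarrow> (0::complex)"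
proof -
  define e where "e n = of_nat n ^ 2 * (ln (1 + a / of_nat n) - a / of_nat n + (a / of_nat n)\<^sup>2 / 2)" for n
  have e: "e \<longlonglongrightarrow> 0" unfolding e_def by (rule Ln_quadratic_remainder)
  have i: "(\<lambda>n. 1 / of_nat n :: complex) \<longlonglongrightarrow> 0" by (rule lim_const_over_n)
  have "(\<lambda>n. a\<^sup>2 * (1 / of_nat n) / 2 - a ^ 3 * (1 / of_nat n) ^ 2 / 2 + e n * (1 / of_nat n) * (1 + a * (1 / of_nat n)))
    \<longlonglongrightarrow> a\<^sup>2 * 0 / 2 - a ^ 3 * 0 ^ 2 / 2 + 0 * 0 * (1 + a * 0)"
    by (intro tendsto_intros e i) auto
  moreover have "eventually (\<lambda>n. real n > norm a) sequentially" by real_asymp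
  then have "eventually (\<lambda>n. a\<^sup>2 * (1 / of_nat n) / 2 - a ^ 3 * (1 / of_nat n) ^ 2 / 2 + e n * (1 / of_nat n) * (1 + a * (1 / of_nat n)) =
     ((a + of_nat n) * ln (a + of_nat n) - (a + of_nat n)) - ((a + of_nat n) * of_real (ln (real n)) - of_nat n)) sequentially"
  proof eventually_elim
    case (elim n)
    then have n: "of_nat n \<noteq> (0::complex)" by (metis le_less_trans norm_ge_zero of_nat_0_less_iff of_nat_eq_0_iff less_irrefl)
    show ?case unfolding Ln_add_of_nat[OF elim] e_def using n
      by (simp add: field_simps power2_eq_square power3_eq_cube)
  qed
  ultimately show ?thesis by (auto elim: Lim_transform_eventually)
qed

lemma quadratic_Ln_asymp:
  "(\<lambda>n. (a + of_nat n)\<^sup>2 * (3 / 4 - ln (a + of_nat n) / 2) -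
     ((a + of_nat n)\<^sup>2 * (3 / 4 - of_real (ln (real n)) / 2) - of_nat n * a / 2 - 3 * a\<^sup>2 / 4)) \<longlonglongrightarrow> (0::complex)"
proof -
  define e where "e n = of_nat n ^ 2 * (ln (1 + a / of_nat n) - a / of_nat n + (a / of_nat n)\<^sup>2 / 2)" for n
  have e: "e \<longlonglongrightarrow> 0" unfolding e_def by (rule Ln_quadratic_remainder)
  have i: "(\<lambda>n. 1 / of_nat n :: complex) \<longlonglongrightarrow> 0" by (rule lim_const_over_n)
  have "(\<lambda>n. a ^ 4 * (1 / of_nat n)\<^sup>2 / 4 - e n * (1 + a * (1 / of_nat n))\<^sup>2 / 2)
    \<longlonglongrightarrow> a ^ 4 * 0\<^sup>2 / 4 - 0 * (1 + a * 0)\<^sup>2 / 2"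
    by (intro tendsto_intros e i) auto
  moreover have "eventually (\<lambda>n. real n > norm a) sequentially" by real_asymp
  then have "eventually (\<lambda>n. a ^ 4 * (1 / of_nat n)\<^sup>2 / 4 - e n * (1 + a * (1 / of_nat n))\<^sup>2 / 2 =
     (a + of_nat n)\<^sup>2 * (3 / 4 - ln (a + of_nat n) / 2) -
     ((a + of_nat n)\<^sup>2 * (3 / 4 - of_real (ln (real n)) / 2) - of_nat n * a / 2 - 3 * a\<^sup>2 / 4)) sequentially"
  proof eventually_elim
    case (elim n)
    then have n: "of_nat n \<noteq> (0::complex)" by (metis le_less_trans norm_ge_zero of_nat_0_less_iff of_nat_eq_0_iff less_irrefl)
    define l where "l = ln (1 + a / of_nat n)"
    show ?case unfolding Ln_add_of_nat[OF elim] e_def l_def[symmetric] using n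
      by (simp add: field_simps power2_eq_square power4_eq_xxxx)
  qed
  ultimately show ?thesis by (auto elim: Lim_transform_eventually)
qed

lemma integral_exp_Ioi:
  fixes x :: real
  assumes "x > 0"
  shows "set_integrable lborel {0<..} (\<lambda>t. exp (- (x * t)))" "(LINT t:{0<..}|lborel. exp (- (x * t))) = 1 / x"
proof -
  have "set_integrable lborel {0<..} (\<lambda>t. t powr 0 * exp (- (x * t)))"
    by (rule set_integrable_powr_exp) (use assms in auto)
  then show i: "set_integrable lborel {0<..} (\<lambda>t. exp (- (x * t)))"
    by (rule set_integrable_cong[THEN iffD1, OF refl refl, rotated]) auto
  have "complex_of_real (LINT t:{0<..}|lborel. exp (- (x * t))) = (LINT t:{0<..}|lborel. complex_of_real (exp (- (x * t))))"
    by (rule set_integral_complex_of_real[symmetric])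
  also have "\<dots> = (LINT t:{0<..}|lborel. complex_of_real t powr (1 - 1) * exp (- (of_real x * of_real t)))"
    by (rule set_lebesgue_integral_cong) (auto simp: exp_of_real[symmetric])
  also have "\<dots> = of_real (1 / x)" by (subst Laplace_powr) (use assms in \<open>auto simp: powr_minus inverse_eq_divide\<close>)
  finally show "(LINT t:{0<..}|lborel. exp (- (x * t))) = 1 / x" by (simp only: of_real_eq_iff)
qed

text \<open>The decay 1 / Re w is what makes all Laplace tails vanish along w + n.\<close>

lemma Laplace_bounded:
  fixes h :: "real \<Rightarrow> real"
  assumes [measurable]: "h \<in> borel_measurable borel" and h: "\<And>t. t > 0 \<Longrightarrow> \<bar>h t\<bar> \<le> C" and w: "Re w > 0"
  shows "set_integrable lborel {0<..} (\<lambda>t. of_real (h t) * exp (- (w * of_real t)))"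
    and "norm (LINT t:{0<..}|lborel. of_real (h t) * exp (- (w * of_real t))) \<le> C / Re w"
proof -
  have i: "integrable lborel (\<lambda>t. indicat_real {0<..} t *\<^sub>R (C * exp (- (Re w * t))))"
    using set_integrable_mult_right[OF integral_exp_Ioi(1)[OF w], of C] unfolding set_integrable_def by simp
  have "norm (complex_of_real (h t) * exp (- (w * complex_of_real t))) \<le> C * exp (- (Re w * t))" if "t > 0" for t
    using mult_right_mono[OF h[OF that], of "exp (- (Re w * t))"] by (simp add: norm_mult)
  then have b: "norm (indicat_real {0<..} t *\<^sub>R (complex_of_real (h t) * exp (- (w * complex_of_real t))))
     \<le> indicat_real {0<..} t *\<^sub>R (C * exp (- (Re w * t)))" for t
    by (auto simp: indicator_def)
  have [measurable]: "(\<lambda>t::real. exp (- (w * complex_of_real t))) \<in> borel_measurable borel"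
    by (intro borel_measurable_continuous_onI continuous_intros)
  have m: "(\<lambda>t. indicat_real {0<..} t *\<^sub>R (complex_of_real (h t) * exp (- (w * complex_of_real t)))) \<in> borel_measurable lborel"
    by measurable
  have i2: "integrable lborel (\<lambda>t. indicat_real {0<..} t *\<^sub>R (complex_of_real (h t) * exp (- (w * complex_of_real t))))"
  proof (rule Bochner_Integration.integrable_bound[OF i m], intro AE_I2)
    show "norm (indicat_real {0<..} t *\<^sub>R (complex_of_real (h t) * exp (- (w * complex_of_real t))))
       \<le> norm (indicat_real {0<..} t *\<^sub>R (C * exp (- (Re w * t))))" for t
      using order_trans[OF b abs_ge_self] by (simp only: real_norm_def)
  qed
  then show "set_integrable lborel {0<..} (\<lambda>t. of_real (h t) * exp (- (w * of_real t)))" unfolding set_integrable_def .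
  have "norm (LINT t:{0<..}|lborel. of_real (h t) * exp (- (w * of_real t))) \<le> (LINT t|lborel. indicator {0<..} t *\<^sub>R (C * exp (- (Re w * t))))"
    unfolding set_lebesgue_integral_def by (rule Bochner_Integration.integral_norm_bound_integral[OF i2 i b])
  also have "\<dots> = C * (LINT t:{0<..}|lborel. exp (- (Re w * t)))"
    unfolding set_lebesgue_integral_def[symmetric] by simp
  finally show "norm (LINT t:{0<..}|lborel. of_real (h t) * exp (- (w * of_real t))) \<le> C / Re w" by (simp add: integral_exp_Ioi[OF w])
qed

lemma Laplace_bounded_tendsto_0:
  fixes h :: "real \<Rightarrow> real" and w :: complex
  assumes "h \<in> borel_measurable borel" "\<And>t. t > 0 \<Longrightarrow> \<bar>h t\<bar> \<le> C"
  shows "(\<lambda>n. LINT t:{0<..}|lborel. of_real (h t) * exp (- ((w + of_nat n) * of_real t))) \<longlonglongrightarrow> 0"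
proof (rule Lim_null_comparison)
  have "eventually (\<lambda>n. real n > - Re w) sequentially" by real_asymp
  then show "eventually (\<lambda>n. norm (LINT t:{0<..}|lborel. of_real (h t) * exp (- ((w + of_nat n) * of_real t))) \<le> C / (Re w + real n)) sequentially"
    by eventually_elim (use Laplace_bounded(2)[OF assms, of "w + of_nat _"] in auto)
  show "(\<lambda>n. C / (Re w + real n)) \<longlonglongrightarrow> 0" by real_asymp
qed

lemma barnes_remainder_div_bound:
  obtains C where "C \<ge> 0" "\<And>\<tau> t. \<tau> > 0 \<Longrightarrow> t > 0 \<Longrightarrow> \<bar>barnes_remainder \<tau> t / t\<bar> \<le> C * (1 + \<tau>\<^sup>2 + 1 / \<tau>)"
proof -
  obtain C where C: "C \<ge> 0" "\<And>\<tau> t. \<tau> > 0 \<Longrightarrow> t > 0 \<Longrightarrow> \<bar>barnes_remainder \<tau> t\<bar> \<le> C * (1 + \<tau>\<^sup>2 + 1 / \<tau>) * t"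
    by (rule barnes_remainder_bound) blast
  show ?thesis by (rule that[OF C(1)]) (use C(2) in \<open>auto simp: divide_le_eq\<close>)
qed

section \<open>Main term and tail of the logarithm of the double gamma function\<close>

definition barnes_tail :: "real \<Rightarrow> complex \<Rightarrow> complex" where
  "barnes_tail \<tau> w = (LINT t:{0<..}|lborel. of_real (barnes_remainder \<tau> t / t) * exp (- (w * of_real t)))"

definition barnes_main :: "real \<Rightarrow> complex \<Rightarrow> complex" where
  "barnes_main \<tau> w = of_real (1 / \<tau>) * (w\<^sup>2 * (3 / 4 - ln w / 2)) + of_real ((1 + \<tau>) / (2 * \<tau>)) * (w * ln w - w)
     - of_real (1 / 4 + (\<tau> + 1 / \<tau>) / 12) * ln w"

lemma log_Gamma2_eq: "log_Gamma2 \<tau> w = barnes_main \<tau> w + barnes_tail \<tau> w"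
  by (simp add: log_Gamma2_def barnes_main_def barnes_tail_def)

lemma barnes_tail_integrable:
  assumes "\<tau> > 0" "Re w > 0"
  shows "set_integrable lborel {0<..} (\<lambda>t. of_real (barnes_remainder \<tau> t / t) * exp (- (w * of_real t)))"
proof -
  obtain C where "\<And>\<tau> t. \<tau> > 0 \<Longrightarrow> t > 0 \<Longrightarrow> \<bar>barnes_remainder \<tau> t / t\<bar> \<le> C * (1 + \<tau>\<^sup>2 + 1 / \<tau>)"
    using barnes_remainder_div_bound by blast
  with assms show ?thesis by (intro Laplace_bounded(1)) auto
qed

lemma barnes_tail_tendsto_0:
  assumes "\<tau> > 0"
  shows "(\<lambda>n. barnes_tail \<tau> (w + of_nat n)) \<longlonglongrightarrow> 0"
proof -
  obtain C where C: "\<And>\<tau> t. \<tau> > 0 \<Longrightarrow> t > 0 \<Longrightarrow> \<bar>barnes_remainder \<tau> t / t\<bar> \<le> C * (1 + \<tau>\<^sup>2 + 1 / \<tau>)"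
    using barnes_remainder_div_bound by blast
  show ?thesis unfolding barnes_tail_def by (rule Laplace_bounded_tendsto_0[OF _ C]) (use assms in auto)
qed

lemma log_Gamma2_holomorphic:
  assumes "\<tau> > 0"
  shows "log_Gamma2 \<tau> holomorphic_on {w. Re w > 0}"
proof -
  have "barnes_tail \<tau> holomorphic_on {w. Re w > 0}"
    unfolding barnes_tail_def
  proof (rule holomorphic_on_Laplace)
    fix x :: real assume "x > 0"
    then have "set_integrable lborel {0<..} (\<lambda>t. of_real (barnes_remainder \<tau> t / t) * exp (- (complex_of_real x * of_real t)))"
      by (intro barnes_tail_integrable assms) simp
    then show "set_integrable lborel {0<..} (\<lambda>t. of_real (barnes_remainder \<tau> t / t) * complex_of_real (exp (- (x * t))))"
      by (simp only: exp_of_real[symmetric] of_real_minus of_real_mult)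
  qed
  moreover have "barnes_main \<tau> holomorphic_on {w. Re w > 0}"
    unfolding barnes_main_def by (intro holomorphic_intros) (auto simp: complex_nonpos_Reals_iff)
  ultimately have "(\<lambda>w. barnes_main \<tau> w + barnes_tail \<tau> w) holomorphic_on {w. Re w > 0}" by (intro holomorphic_intros)
  then show ?thesis by (simp add: log_Gamma2_eq[abs_def])
qed

lemma log_Gamma2_LIMSEQ:
  fixes T :: "nat \<Rightarrow> real" and W :: "nat \<Rightarrow> complex"
  assumes T: "T \<longlonglongrightarrow> \<tau>" "\<And>n. 1 \<le> T n" "\<And>n. T n \<le> 2" and W: "W \<longlonglongrightarrow> w" "x > 0" "\<And>n. Re (W n) \<ge> x"
  shows "(\<lambda>n. log_Gamma2 (T n) (W n)) \<longlonglongrightarrow> log_Gamma2 \<tau> w"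
proof -
  have \<tau>: "\<tau> \<ge> 1" by (rule tendsto_lowerbound[OF T(1)]) (use T in auto)
  have w: "Re w \<ge> x" by (rule tendsto_lowerbound[OF tendsto_Re[OF W(1)]]) (use W in auto)
  obtain C where C: "C \<ge> 0" "\<And>\<tau> t. \<tau> > 0 \<Longrightarrow> t > 0 \<Longrightarrow> \<bar>barnes_remainder \<tau> t / t\<bar> \<le> C * (1 + \<tau>\<^sup>2 + 1 / \<tau>)"
    using barnes_remainder_div_bound by blast
  have "(\<lambda>n. barnes_main (T n) (W n)) \<longlonglongrightarrow> barnes_main \<tau> w"
    unfolding barnes_main_def by (intro tendsto_intros T W) (use w \<tau> W in \<open>auto simp: complex_nonpos_Reals_iff\<close>)
  moreover have "(\<lambda>n. barnes_tail (T n) (W n)) \<longlonglongrightarrow> barnes_tail \<tau> w"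
    unfolding barnes_tail_def set_lebesgue_integral_def
  proof (rule integral_dominated_convergence)
    \<comment> \<open>6 bounds 1 + \<tau>^2 + 1/\<tau> for 1 <= \<tau> <= 2, and x is a common lower
      bound for the real parts.\<close>
    show "integrable lborel (\<lambda>t. indicat_real {0<..} t *\<^sub>R (C * 6 * exp (- (x * t))))"
      using set_integrable_mult_right[OF integral_exp_Ioi(1)[OF W(2)], of "C * 6"]
      unfolding set_integrable_def by simp
    have meas: "(\<lambda>t. indicat_real {0<..} t *\<^sub>R (complex_of_real (barnes_remainder \<tau> t / t) * exp (- (w * complex_of_real t)))) \<in> borel_measurable lborel" for \<tau> w
    proof -
      have [measurable]: "(\<lambda>t::real. exp (- (w * complex_of_real t))) \<in> borel_measurable borel"
        by (intro borel_measurable_continuous_onI continuous_intros)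
      show ?thesis by measurable
    qed
    show "(\<lambda>t. indicat_real {0<..} t *\<^sub>R (complex_of_real (barnes_remainder \<tau> t / t) * exp (- (w * complex_of_real t)))) \<in> borel_measurable lborel"
      "(\<lambda>t. indicat_real {0<..} t *\<^sub>R (complex_of_real (barnes_remainder (T n) t / t) * exp (- (W n * complex_of_real t)))) \<in> borel_measurable lborel" for n
      by (rule meas)+
    show "AE t in lborel. norm (indicat_real {0<..} t *\<^sub>R (complex_of_real (barnes_remainder (T n) t / t) * exp (- (W n * complex_of_real t))))
       \<le> indicat_real {0<..} t *\<^sub>R (C * 6 * exp (- (x * t)))" for n
    proof (intro AE_I2)
      have "norm (complex_of_real (barnes_remainder (T n) t / t) * exp (- (W n * complex_of_real t))) \<le> C * 6 * exp (- (x * t))" if t: "t > 0" for t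
      proof -
        have "(T n)\<^sup>2 \<le> 2\<^sup>2" using T(2,3)[of n] by (intro power_mono) auto
        moreover have "1 / T n \<le> 1" using T(2)[of n] by simp
        ultimately have "1 + (T n)\<^sup>2 + 1 / T n \<le> 6" by simp
        then have "\<bar>barnes_remainder (T n) t / t\<bar> \<le> C * 6"
          using order_trans[OF C(2)[of "T n" t] mult_left_mono[OF _ C(1)]] T(2)[of n] t by simp
        moreover have "x * t \<le> Re (W n) * t" using W(3)[of n] t by (intro mult_right_mono) auto
        ultimately show ?thesis
          unfolding norm_mult norm_of_real using C(1) by (intro mult_mono) auto
      qed
      then show "norm (indicat_real {0<..} t *\<^sub>R (complex_of_real (barnes_remainder (T n) t / t) * exp (- (W n * complex_of_real t))))
       \<le> indicat_real {0<..} t *\<^sub>R (C * 6 * exp (- (x * t)))" for t by (auto simp: indicator_def)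
    qed
    show "AE t in lborel. (\<lambda>n. indicat_real {0<..} t *\<^sub>R (complex_of_real (barnes_remainder (T n) t / t) * exp (- (W n * complex_of_real t))))
      \<longlonglongrightarrow> indicat_real {0<..} t *\<^sub>R (complex_of_real (barnes_remainder \<tau> t / t) * exp (- (w * complex_of_real t)))"
    proof (intro AE_I2)
      fix t :: real
      show "(\<lambda>n. indicat_real {0<..} t *\<^sub>R (complex_of_real (barnes_remainder (T n) t / t) * exp (- (W n * complex_of_real t))))
        \<longlonglongrightarrow> indicat_real {0<..} t *\<^sub>R (complex_of_real (barnes_remainder \<tau> t / t) * exp (- (w * complex_of_real t)))"
      proof (cases "t > 0")
        case True
        then show ?thesis unfolding barnes_remainder_def geom_exp_def using \<tau>
          by (intro tendsto_intros T W) auto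
      qed simp
    qed
  qed
  ultimately show ?thesis unfolding log_Gamma2_eq by (intro tendsto_add)
qed

lemma islimpt_positive_reals: "(1::complex) islimpt of_real ` {0<..}"
proof (rule islimptI)
  fix T assume T: "(1::complex) \<in> T" "open T"
  then obtain e where e: "e > 0" "ball 1 e \<subseteq> T" by (meson openE)
  define y where "y = complex_of_real (1 + e/2)"
  have "dist 1 y = e/2" using e by (simp add: y_def dist_norm norm_divide)
  then have "y \<in> T" "y \<noteq> 1" using e by auto
  moreover have "y \<in> complex_of_real ` {0<..}" using e unfolding y_def by (intro imageI) simp
  ultimately show "\<exists>y\<in>complex_of_real ` {0<..}. y \<in> T \<and> y \<noteq> 1" by blast
qed

lemma halfplane_eqI:
  assumes "f holomorphic_on {w. Re w > 0}" "g holomorphic_on {w. Re w > 0}"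
    and "\<And>x::real. x > 0 \<Longrightarrow> f (of_real x) = g (of_real x)" and "Re w > 0"
  shows "f w = g w"
proof -
  have "f w - g w = 0"
  proof (rule analytic_continuation[of "\<lambda>w. f w - g w" "{w. Re w > 0}" "of_real ` {0<..}" 1])
    show "open {w. 0 < Re w}" by (rule open_halfspace_Re_gt)
    show "connected {w. 0 < Re w}" by (intro convex_connected convex_halfspace_Re_gt)
    show "(1::complex) islimpt of_real ` {0<..}" by (rule islimpt_positive_reals)
  qed (use assms in \<open>auto intro!: holomorphic_intros\<close>)
  then show ?thesis by simp
qed

text \<open>Stirling's formula reads Gamma x ~ sqrt (2 * pi) * exp (stirling_exponent x); the
  constant is left out because it is still to be determined.\<close>

definition stirling_exponent :: "real \<Rightarrow> real" where
  "stirling_exponent x = x * ln x - x - ln x / 2"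

text \<open>Stirling's constant from convergence alone. Euler's limit formula shows that the limit
  does not depend on x. Legendre duplication along y, y + 1/2 and 2 * y then evaluates E 1 * E (3/2)
  / E 2, which equals E 1.\<close>

lemma exp_log_Gamma2_diff_aux:
  fixes E :: "real \<Rightarrow> complex"
  defines "c \<equiv> \<lambda>x. exp (stirling_exponent x) * rGamma x"
  assumes lim: "\<And>x. x > 0 \<Longrightarrow> (\<lambda>n. of_real (c (x + real n))) \<longlonglongrightarrow> E x" and nz: "\<And>x. x > 0 \<Longrightarrow> E x \<noteq> 0"
    and x: "x > 0"
  shows "E x = of_real (1 / sqrt (2 * pi))"
proof -
  have rG: "rGamma y > 0" if "y > 0" for y :: real using that by (simp add: rGamma_inverse_Gamma Gamma_real_pos)
  have ratio: "E y = E 1" if y: "y > 0" for y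
  proof -
    have "Gamma_series' y \<longlonglongrightarrow> Gamma y" by (rule Gamma_series'_LIMSEQ)
    have eq: "c (y + real n) / c (1 + real n) =
        exp (stirling_exponent (real n + y) - stirling_exponent (real n + 1) - (y - 1) * ln (real n)) * (Gamma_series' y n / Gamma y)" if n: "n > 0" for n
    proof -
      have p: "pochhammer y n = Gamma (y + real n) / Gamma y"
        using y by (intro pochhammer_Gamma) (auto elim!: nonpos_Ints_cases)
      have f: "Gamma (1 + real n) = real n * fact (n - 1)"
        using n fact_reduce[of n, where 'a = real] by (simp add: Gamma_fact add.commute)
      have e: "exp ((y - 1) * ln (real n)) = exp (y * ln (real n)) / real n"
        using n by (simp add: left_diff_distrib exp_diff)
      have "Gamma y > 0" "Gamma (y + real n) > 0" "fact (n - 1) > (0::real)" using y by (auto intro!: Gamma_real_pos)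
      then show ?thesis unfolding c_def Gamma_series'_def p e exp_diff rGamma_inverse_Gamma f using n
        by (simp add: field_simps)
    qed
    have "(\<lambda>n. exp (stirling_exponent (real n + y) - stirling_exponent (real n + 1) - (y - 1) * ln (real n)) * (Gamma_series' y n / Gamma y)) \<longlonglongrightarrow> exp 0 * (Gamma y / Gamma y)"
    proof (intro tendsto_intros Gamma_series'_LIMSEQ)
      have "((\<lambda>x::real. stirling_exponent (x + y) - stirling_exponent (x + 1) - (y - 1) * ln x) \<longlongrightarrow> 0) at_top"
        unfolding stirling_exponent_def by real_asymp
      then show "(\<lambda>n. stirling_exponent (real n + y) - stirling_exponent (real n + 1) - (y - 1) * ln (real n)) \<longlonglongrightarrow> 0"
        by (rule filterlim_compose[OF _ filterlim_real_sequentially])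
      show "Gamma y \<noteq> 0" using Gamma_real_pos[OF y] by simp
    qed
    moreover have "eventually (\<lambda>n. exp (stirling_exponent (real n + y) - stirling_exponent (real n + 1) - (y - 1) * ln (real n)) * (Gamma_series' y n / Gamma y) = c (y + real n) / c (1 + real n)) sequentially"
      using eventually_gt_at_top[of "0::nat"] by eventually_elim (simp only: eq)
    ultimately have "(\<lambda>n. c (y + real n) / c (1 + real n)) \<longlonglongrightarrow> exp 0 * (Gamma y / Gamma y)"
      by (rule Lim_transform_eventually)
    then have "(\<lambda>n. c (y + real n) / c (1 + real n)) \<longlonglongrightarrow> 1"
      using Gamma_real_pos[OF y] by simp
    then have "(\<lambda>n. of_real (c (y + real n) / c (1 + real n))) \<longlonglongrightarrow> (of_real 1 :: complex)" by (rule tendsto_of_real)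
    moreover have "(\<lambda>n. of_real (c (y + real n) / c (1 + real n))) \<longlonglongrightarrow> E y / E 1"
      unfolding of_real_divide by (intro tendsto_divide lim nz y) simp_all
    ultimately have "E y / E 1 = 1" using LIMSEQ_unique by force
    then show ?thesis using nz[of 1] by simp
  qed
  have dup: "c (1 + real n) * c (1 + real n + 1/2) / c (2 * (1 + real n)) =
     exp (stirling_exponent (1 + real n) + stirling_exponent (1 + real n + 1 / 2) - stirling_exponent (2 * (1 + real n)) + (2 * (1 + real n) - 1) * ln 2) / sqrt pi" for n
  proof -
    define y where "y = 1 + real n"
    have y: "y > 0" by (simp add: y_def)
    have G: "Gamma y > 0" "Gamma (y + 1/2) > 0" "Gamma (2 * y) > 0" using y by (auto intro!: Gamma_real_pos)
    have yZ: "complex_of_real r \<notin> \<int>\<^sub>\<le>\<^sub>0" if "r > 0" for r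
    proof
      assume "complex_of_real r \<in> \<int>\<^sub>\<le>\<^sub>0"
      then obtain i where "complex_of_real r = of_int i" "i \<le> 0" by (auto elim: nonpos_Ints_cases)
      then have "r = real_of_int i" by (metis Re_complex_of_real of_real_of_int_eq)
      with that \<open>i \<le> 0\<close> show False by simp
    qed
    have "Gamma (complex_of_real y) * Gamma (complex_of_real y + 1 / 2) = exp ((1 - 2 * of_real y) * of_real (ln 2)) * of_real (sqrt pi) * Gamma (2 * of_real y)"
      using yZ[OF y] yZ[of "y + 1/2"] y by (intro Gamma_legendre_duplication) auto
    also have "complex_of_real y + 1 / 2 = of_real (y + 1 / 2)" by simp
    also have "2 * complex_of_real y = of_real (2 * y)" by simp
    also have "(1 - of_real (2 * y)) * of_real (ln 2) = complex_of_real ((1 - 2 * y) * ln 2)" by simp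
    finally have "Gamma y * Gamma (y + 1 / 2) = exp ((1 - 2 * y) * ln 2) * sqrt pi * Gamma (2 * y)"
      unfolding Gamma_complex_of_real exp_of_real of_real_mult[symmetric] of_real_eq_iff .
    then have "Gamma (2 * y) / (Gamma y * Gamma (y + 1/2)) = exp ((2 * y - 1) * ln 2) / sqrt pi"
      using G by (simp add: field_simps exp_diff)
    moreover have "c y * c (y + 1/2) / c (2 * y) =
        exp (stirling_exponent y + stirling_exponent (y + 1 / 2) - stirling_exponent (2 * y)) * (Gamma (2 * y) / (Gamma y * Gamma (y + 1/2)))"
      unfolding c_def rGamma_inverse_Gamma using G by (simp add: field_simps exp_diff exp_add)
    ultimately show ?thesis unfolding y_def[symmetric] by (simp add: exp_add)
  qed
  have "(\<lambda>n. stirling_exponent (1 + real n) + stirling_exponent (1 + real n + 1 / 2) - stirling_exponent (2 * (1 + real n)) + (2 * (1 + real n) - 1) * ln 2) \<longlonglongrightarrow> - ln 2 / 2"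
    unfolding stirling_exponent_def by real_asymp
  then have "(\<lambda>n. c (1 + real n) * c (1 + real n + 1/2) / c (2 * (1 + real n))) \<longlonglongrightarrow> exp (- ln 2 / 2) / sqrt pi"
    unfolding dup by (intro tendsto_intros) auto
  then have "(\<lambda>n. complex_of_real (c (1 + real n) * c (1 + real n + 1/2) / c (2 * (1 + real n)))) \<longlonglongrightarrow> of_real (exp (- ln 2 / 2) / sqrt pi)"
    by (rule tendsto_of_real)
  moreover have "(\<lambda>n. complex_of_real (c (1 + real n) * c (1 + real n + 1/2) / c (2 * (1 + real n)))) \<longlonglongrightarrow> E 1 * E (3/2) / E 2"
    unfolding of_real_divide of_real_mult
  proof (intro tendsto_divide tendsto_mult lim nz)
    show "(\<lambda>n. of_real (c (1 + real n + 1 / 2))) \<longlonglongrightarrow> E (3 / 2)"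
      using lim[of "3/2"] by (simp add: add_ac)
    have "strict_mono (\<lambda>n::nat. 2 * n)" by (simp add: strict_mono_def)
    from LIMSEQ_subseq_LIMSEQ[OF lim[of 2] this] show "(\<lambda>n. of_real (c (2 * (1 + real n)))) \<longlonglongrightarrow> E 2"
      by (simp add: o_def algebra_simps)
  qed simp_all
  ultimately have "E 1 * E (3/2) / E 2 = of_real (exp (- ln 2 / 2) / sqrt pi)" using LIMSEQ_unique by blast
  then have "E 1 = of_real (exp (- ln 2 / 2) / sqrt pi)" using ratio[of "3/2"] ratio[of 2] nz[of 1] by simp
  moreover have "exp (- ln 2 / 2 :: real) = 1 / sqrt 2"
    by (simp add: exp_minus ln_sqrt[symmetric] inverse_eq_divide)
  ultimately show ?thesis using ratio[OF x] by (simp add: real_sqrt_mult)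
qed

context
  fixes \<tau> :: real
  assumes \<tau>: "\<tau> > 0"
begin

text \<open>\<open>E\<close> is 1-periodic: by the second difference the step from y to y + 1 adds
  ln y to the exponent, and rGamma (y + 1) = rGamma y / y compensates. Hence E x can be evaluated at
  x + n, where the exponent is \<open>stirling_exponent\<close> up to an error tending to 0.\<close>

lemma exp_log_Gamma2_diff_LIMSEQ:
  fixes x :: real
  defines "E \<equiv> \<lambda>x. exp (log_Gamma2 \<tau> (of_real x) - log_Gamma2 \<tau> (of_real x + of_real \<tau>)) * rGamma (complex_of_real x)"
  assumes x: "x > 0"
  shows "(\<lambda>n. of_real (exp (stirling_exponent (x + real n)) * rGamma (x + real n))) \<longlonglongrightarrow> E x"
proof -
  have step: "E (y + 1) = E y" if y: "y > 0" for y
  proof -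
    have "log_Gamma2 \<tau> (of_real (y + 1)) - log_Gamma2 \<tau> (of_real (y + 1) + of_real \<tau>) =
        log_Gamma2 \<tau> (of_real y) - log_Gamma2 \<tau> (of_real y + of_real \<tau>) + ln (of_real y)"
      using log_Gamma2_second_difference[OF \<tau>, of "of_real y"] y by (simp add: algebra_simps)
    then show ?thesis
      using rGamma_plus1[of "complex_of_real y"] y unfolding E_def by (simp add: exp_add mult_ac)
  qed
  have En: "E (x + real n) = E x" for n
  proof (induction n)
    case (Suc n)
    then show ?case using step[of "x + real n"] x by (simp add: add_ac)
  qed simp
  define d where "d n = barnes_main \<tau> (of_real x + of_nat n) - barnes_main \<tau> (of_real (x + \<tau>) + of_nat n)
     - of_real (stirling_exponent (x + real n))" for n
  have d: "d \<longlonglongrightarrow> 0"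
  proof -
    define q l k where "q a n = (a + of_nat n)\<^sup>2 * (3 / 4 - ln (a + of_nat n) / 2) -
     ((a + of_nat n)\<^sup>2 * (3 / 4 - of_real (ln (real n)) / 2) - of_nat n * a / 2 - 3 * a\<^sup>2 / 4)"
      and "l a n = ((a + of_nat n) * ln (a + of_nat n) - (a + of_nat n)) - ((a + of_nat n) * of_real (ln (real n)) - of_nat n)"
      and "k a n = ln (a + of_nat n) - of_real (ln (real n))" for a :: complex and n
    have q: "q a \<longlonglongrightarrow> 0" and l: "l a \<longlonglongrightarrow> 0" and k: "k a \<longlonglongrightarrow> 0" for a
      unfolding q_def l_def k_def by (rule quadratic_Ln_asymp linear_Ln_asymp Ln_add_of_nat_asymp)+
    define t :: complex where "t = of_real \<tau>"
    have t: "t \<noteq> 0" using \<tau> by (simp add: t_def)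
    \<comment> \<open>This combination of the expansion errors is exactly \<open>d n\<close>: the
      polynomial and ln n terms of the main terms cancel against those of the Stirling
      exponent.\<close>
    have "(\<lambda>n. 1 / t * (q (of_real x) n - q (of_real x + t) n) + (1 + t) / (2 * t) * (l (of_real x) n - l (of_real x + t) n)
       - (1 / 4 + (t + 1 / t) / 12) * (k (of_real x) n - k (of_real x + t) n) - l (of_real x) n + k (of_real x) n / 2) \<longlonglongrightarrow>
       1 / t * (0 - 0) + (1 + t) / (2 * t) * (0 - 0) - (1 / 4 + (t + 1 / t) / 12) * (0 - 0) - 0 + 0 / 2"
      using t by (intro tendsto_intros q l k) auto
    moreover have "1 / t * (q (of_real x) n - q (of_real x + t) n) + (1 + t) / (2 * t) * (l (of_real x) n - l (of_real x + t) n)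
       - (1 / 4 + (t + 1 / t) / 12) * (k (of_real x) n - k (of_real x + t) n) - l (of_real x) n + k (of_real x) n / 2 = d n" for n
    proof -
      define z N L L1 L2 where "z = complex_of_real x" and "N = complex_of_nat n" and "L = complex_of_real (ln (real n))"
        and "L1 = ln (complex_of_real x + of_nat n)" and "L2 = ln (complex_of_real x + t + of_nat n)"
      have s: "of_real (stirling_exponent (x + real n)) = (z + N) * L1 - (z + N) - L1 / 2"
        using x Ln_of_real[of "x + real n"] by (simp add: stirling_exponent_def z_def N_def L1_def)
      show ?thesis unfolding d_def s barnes_main_def q_def l_def k_def using t
        unfolding of_real_add t_def[symmetric] of_real_divide of_real_mult of_real_1 of_real_numeral
          z_def[symmetric] N_def[symmetric] L_def[symmetric]
          L1_def[symmetric, folded z_def N_def] L2_def[symmetric, folded z_def N_def]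
        by (simp add: field_simps power2_eq_square)
    qed
    ultimately show ?thesis by simp
  qed
  define e where "e n = barnes_tail \<tau> (of_real x + of_nat n) - barnes_tail \<tau> (of_real (x + \<tau>) + of_nat n)" for n
  have e: "e \<longlonglongrightarrow> 0 - 0"
    unfolding e_def by (intro tendsto_diff barnes_tail_tendsto_0 \<tau>)
  have eq: "of_real (exp (stirling_exponent (x + real n)) * rGamma (x + real n)) = E x * exp (- (d n + e n))" for n
  proof -
    define y where "y = x + real n"
    have y: "y > 0" using x by (simp add: y_def)
    have "log_Gamma2 \<tau> (of_real y) - log_Gamma2 \<tau> (of_real y + of_real \<tau>) = of_real (stirling_exponent y) + (d n + e n)"
      unfolding log_Gamma2_eq d_def e_def y_def by (simp add: add_ac)
    then obtain D where D: "D = d n + e n" "log_Gamma2 \<tau> (of_real y) - log_Gamma2 \<tau> (of_real y + of_real \<tau>) = of_real (stirling_exponent y) + D"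
      by simp
    have "E y * exp (- D) = exp (of_real (stirling_exponent y)) * rGamma (of_real y)"
      unfolding E_def D(2) by (simp add: exp_add exp_minus)
    then have "E y * exp (- (d n + e n)) = exp (of_real (stirling_exponent y)) * rGamma (of_real y)"
      by (simp only: D(1))
    then show ?thesis using En[of n] by (simp add: y_def exp_of_real rGamma_complex_of_real[symmetric])
  qed
  have "(\<lambda>n. E x * exp (- (d n + e n))) \<longlonglongrightarrow> E x * exp (- (0 + (0 - 0)))"
    by (intro tendsto_intros d e)
  then show ?thesis unfolding eq by simp
qed

lemma exp_log_Gamma2_diff:
  assumes x: "x > 0"
  shows "exp (log_Gamma2 \<tau> (of_real x) - log_Gamma2 \<tau> (of_real x + of_real \<tau>)) * rGamma (complex_of_real x) = of_real (1 / sqrt (2 * pi))"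
proof (rule exp_log_Gamma2_diff_aux[OF exp_log_Gamma2_diff_LIMSEQ _ x])
  show "exp (log_Gamma2 \<tau> (of_real x) - log_Gamma2 \<tau> (of_real x + of_real \<tau>)) * rGamma (complex_of_real x) \<noteq> 0" if "x > 0" for x
  proof -
    have "rGamma x > 0" using Gamma_real_pos[OF that] by (simp add: rGamma_inverse_Gamma)
    then show ?thesis by (simp add: rGamma_complex_of_real)
  qed
qed auto

text \<open>The first-order equation in the direction \<tau>, which the kernel does not show
  directly, spreads from the positive reals by the identity theorem.\<close>

lemma exp_log_Gamma2_shift:
  assumes w: "Re w > 0"
  shows "exp (log_Gamma2 \<tau> w) = Gamma w / of_real (sqrt (2 * pi)) * exp (log_Gamma2 \<tau> (w + of_real \<tau>))"
proof -
  have sh: "(\<lambda>w. log_Gamma2 \<tau> (w + of_real \<tau>)) holomorphic_on {w. Re w > 0}"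
    by (rule holomorphic_on_compose_gen[of "\<lambda>w. w + of_real \<tau>" "{w. Re w > 0}" "log_Gamma2 \<tau>" "{w. Re w > 0}", unfolded o_def])
       (use \<tau> in \<open>auto intro!: holomorphic_intros log_Gamma2_holomorphic\<close>)
  have "exp (log_Gamma2 \<tau> w - log_Gamma2 \<tau> (w + of_real \<tau>)) * rGamma w = of_real (1 / sqrt (2 * pi))"
    by (rule halfplane_eqI[OF _ _ _ w, of "\<lambda>w. exp (log_Gamma2 \<tau> w - log_Gamma2 \<tau> (w + of_real \<tau>)) * rGamma w" "\<lambda>_. of_real (1 / sqrt (2 * pi))"])
       (use exp_log_Gamma2_diff in \<open>auto intro!: holomorphic_intros log_Gamma2_holomorphic \<tau> sh holomorphic_rGamma\<close>)
  moreover have "w \<notin> \<int>\<^sub>\<le>\<^sub>0" using w by (auto elim!: nonpos_Ints_cases)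
  ultimately show ?thesis by (simp add: exp_diff rGamma_inverse_Gamma Gamma_eq_zero_iff field_simps)
qed

end

lemma Stirling_rGamma:
  assumes "x > 0"
  shows "(\<lambda>n. exp (stirling_exponent (x + real n)) * rGamma (x + real n)) \<longlonglongrightarrow> 1 / sqrt (2 * pi)"
  using exp_log_Gamma2_diff_LIMSEQ[of 1 x] exp_log_Gamma2_diff[of 1 x] assms
  by (simp only: tendsto_of_real_iff zero_less_one)

text \<open>The reciprocal is continued, since it is entire: N applications of the shift by \<tau>
  reach Re w > - N * \<tau>, and the zeroes come from \<open>rGamma\<close>.\<close>

definition rGamma2_shifted :: "real \<Rightarrow> nat \<Rightarrow> complex \<Rightarrow> complex" where
  "rGamma2_shifted \<tau> N w = exp (- log_Gamma2 \<tau> (w + of_nat N * of_real \<tau>)) *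
     (\<Prod>k<N. of_real (sqrt (2 * pi)) * rGamma (w + of_nat k * of_real \<tau>))"

text \<open>The least N is only a choice; by \<open>rGamma2_eq_shifted\<close> every N with positive
  shifted real part gives the same value.\<close>

definition rGamma2 :: "real \<Rightarrow> complex \<Rightarrow> complex" where
  "rGamma2 \<tau> w = rGamma2_shifted \<tau> (LEAST N. Re w + real N * \<tau> > 0) w"

context
  fixes \<tau> :: real
  assumes \<tau>: "\<tau> > 0"
begin

lemma exp_minus_log_Gamma2_shift:
  assumes w: "Re w > 0"
  shows "exp (- log_Gamma2 \<tau> w) = of_real (sqrt (2 * pi)) * rGamma w * exp (- log_Gamma2 \<tau> (w + of_real \<tau>))"
proof -
  have "w \<notin> \<int>\<^sub>\<le>\<^sub>0" using w by (auto elim!: nonpos_Ints_cases)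
  then have "Gamma w \<noteq> 0" by (simp add: Gamma_eq_zero_iff)
  then show ?thesis
    using exp_log_Gamma2_shift[OF \<tau> w] by (simp add: exp_minus rGamma_inverse_Gamma field_simps)
qed

lemma rGamma2_shifted_Suc:
  assumes "Re w + real N * \<tau> > 0"
  shows "rGamma2_shifted \<tau> (Suc N) w = rGamma2_shifted \<tau> N w"
  using exp_minus_log_Gamma2_shift[of "w + of_nat N * of_real \<tau>"] assms
  by (simp add: rGamma2_shifted_def algebra_simps)

lemma rGamma2_eq_shifted:
  assumes "Re w + real N * \<tau> > 0"
  shows "rGamma2 \<tau> w = rGamma2_shifted \<tau> N w"
proof -
  define M where "M = (LEAST N. Re w + real N * \<tau> > 0)"
  have M: "Re w + real M * \<tau> > 0" unfolding M_def using assms by (rule LeastI)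
  have "M \<le> N" unfolding M_def using assms by (rule Least_le)
  then have "rGamma2_shifted \<tau> N w = rGamma2_shifted \<tau> M w"
  proof (induction N rule: dec_induct)
    case (step n)
    have "real M * \<tau> \<le> real n * \<tau>" using step \<tau> by (intro mult_right_mono) auto
    with M have "Re w + real n * \<tau> > 0" by linarith
    then show ?case using step rGamma2_shifted_Suc by simp
  qed simp
  then show ?thesis by (simp add: rGamma2_def M_def)
qed

lemma rGamma2_pos: "Re w > 0 \<Longrightarrow> rGamma2 \<tau> w = exp (- log_Gamma2 \<tau> w)"
  using rGamma2_eq_shifted[of w 0] by (simp add: rGamma2_shifted_def)

lemma ex_shift_pos: "\<exists>N::nat. x + real N * \<tau> > 0"
  using reals_Archimedean3[OF \<tau>] by (metis add.commute add_less_cancel_left minus_add_cancel neg_less_0_iff_less add_0 less_diff_eq diff_0 minus_less_iff)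

lemma rGamma2_shift: "rGamma2 \<tau> w = of_real (sqrt (2 * pi)) * rGamma w * rGamma2 \<tau> (w + of_real \<tau>)"
proof -
  obtain N where N: "Re w + real N * \<tau> > 0" using ex_shift_pos by blast
  have N1: "Re w + real (Suc N) * \<tau> > 0" "Re (w + of_real \<tau>) + real N * \<tau> > 0"
    using N \<tau> by (auto simp: algebra_simps)
  show ?thesis
    unfolding rGamma2_eq_shifted[OF N1(1)] rGamma2_eq_shifted[OF N1(2)] rGamma2_shifted_def
    by (subst prod.lessThan_Suc_shift) (simp add: algebra_simps)
qed

lemma rGamma2_holomorphic: "rGamma2 \<tau> holomorphic_on UNIV"
proof -
  have "rGamma2 \<tau> analytic_on {w}" for w
  proof -
    obtain N where N: "Re w + real N * \<tau> > 0" using ex_shift_pos by blast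
    define S where "S = {w. Re w > - (real N * \<tau>)}"
    have S: "open S" "w \<in> S" unfolding S_def using N by (auto simp: open_halfspace_Re_gt)
    have "(\<lambda>w. log_Gamma2 \<tau> (w + of_nat N * of_real \<tau>)) holomorphic_on S"
      by (rule holomorphic_on_compose_gen[of "\<lambda>w. w + of_nat N * of_real \<tau>" S "log_Gamma2 \<tau>" "{w. Re w > 0}", unfolded o_def])
         (auto intro!: holomorphic_intros log_Gamma2_holomorphic \<tau> simp: S_def)
    moreover have "(\<lambda>w. rGamma (w + c)) holomorphic_on S" for c :: complex
      using holomorphic_on_compose[OF _ holomorphic_rGamma, of "\<lambda>w. w + c" S] by (auto simp: o_def intro!: holomorphic_intros)
    ultimately have "rGamma2_shifted \<tau> N holomorphic_on S"
      unfolding rGamma2_shifted_def by (intro holomorphic_intros)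
    then have "rGamma2 \<tau> holomorphic_on S"
      by (rule holomorphic_transform) (auto simp: S_def intro!: rGamma2_eq_shifted[symmetric])
    then show ?thesis using S by (auto simp: analytic_at)
  qed
  then have "rGamma2 \<tau> analytic_on UNIV" by (subst analytic_on_analytic_at) auto
  then show ?thesis by (simp add: analytic_on_open)
qed

text \<open>Division by 0 gives the inverse the value 0 at its poles, as the normalisation demands;
  agreement on Re w > 0 then identifies it by uniqueness.\<close>

lemma Gamma2_eq: "Gamma2 1 \<tau> = (\<lambda>w. inverse (rGamma2 \<tau> w))"
  unfolding Gamma2_def
proof (rule the_equality)
  have pos: "inverse (rGamma2 \<tau> w) = exp (deriv (barnes_zeta2 1 \<tau> w) 0)" if "Re w > 0" for w
    using deriv_barnes_zeta2[OF \<tau> that] rGamma2_pos[OF that] by (simp add: exp_minus)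
  have n: "(\<lambda>w. inverse (rGamma2 \<tau> w)) nicely_meromorphic_on UNIV"
    by (intro nicely_meromorphic_on_inverse analytic_on_imp_nicely_meromorphic_on)
       (simp add: analytic_on_open rGamma2_holomorphic)
  show "(\<lambda>w. inverse (rGamma2 \<tau> w)) nicely_meromorphic_on UNIV \<and>
    (\<forall>w. 0 < Re w \<longrightarrow> inverse (rGamma2 \<tau> w) = exp (deriv (barnes_zeta2 1 \<tau> w) 0))"
    using n pos by blast
  show "g = (\<lambda>w. inverse (rGamma2 \<tau> w))" if g: "g nicely_meromorphic_on UNIV \<and>
    (\<forall>w. 0 < Re w \<longrightarrow> g w = exp (deriv (barnes_zeta2 1 \<tau> w) 0))" for g
  proof (rule nicely_meromorphic_eqI[OF _ n, of _ "{w. Re w > 0}"])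
    have "(1::complex) \<in> {w. Re w > 0}" by simp
    then show "{w::complex. Re w > 0} \<noteq> {}" by blast
  qed (use g pos open_halfspace_Re_gt[of 0] in auto)
qed

lemma Gamma2_pos: "Re w > 0 \<Longrightarrow> Gamma2 1 \<tau> w = exp (log_Gamma2 \<tau> w)"
  by (simp add: Gamma2_eq rGamma2_pos exp_minus)

end

section \<open>The G function: shift equation and zeroes\<close>

lemma barnes_G_eq: "barnes_G z = of_real (2 * pi) powr ((z - 1) / 2) * rGamma2 1 z / rGamma2 1 1"
  by (simp add: barnes_G_def Gamma2_eq field_simps)

lemma barnes_G_pos:
  assumes "Re z > 0"
  shows "barnes_G z = of_real (2 * pi) powr ((z - 1) / 2) * exp (log_Gamma2 1 1 - log_Gamma2 1 z)"
  using assms by (simp add: barnes_G_eq rGamma2_pos exp_diff exp_minus field_simps)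

lemma barnes_G_1 [simp]: "barnes_G 1 = 1"
  by (simp add: barnes_G_pos)

lemma barnes_G_nonzero_pos: "Re z > 0 \<Longrightarrow> barnes_G z \<noteq> 0"
  by (simp add: barnes_G_pos)

text \<open>Stated with \<open>rGamma\<close> so that it holds at every z, including the poles of
  Gamma.\<close>

lemma barnes_G_shift: "barnes_G z = rGamma z * barnes_G (z + 1)"
proof -
  have "of_real (2 * pi) powr (((z + 1) - 1) / 2) = of_real (2 * pi) powr ((z - 1) / 2) * of_real (sqrt (2 * pi))"
  proof -
    have "((z + 1) - 1) / 2 = (z - 1) / 2 + of_real (1 / 2)" by (simp add: field_simps)
    then have "of_real (2 * pi) powr (((z + 1) - 1) / 2) = of_real (2 * pi) powr ((z - 1) / 2) * of_real (2 * pi) powr of_real (1 / 2)"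
      by (simp only: powr_add)
    also have "complex_of_real (2 * pi) powr of_real (1 / 2) = of_real ((2 * pi) powr (1 / 2))"
      by (rule powr_of_real) auto
    finally show ?thesis by (simp add: powr_half_sqrt)
  qed
  then show ?thesis unfolding barnes_G_eq rGamma2_shift[of 1 z, simplified] by (simp add: mult_ac)
qed

lemma barnes_G_plus1: "z \<notin> \<int>\<^sub>\<le>\<^sub>0 \<Longrightarrow> barnes_G (z + 1) = Gamma z * barnes_G z"
  using barnes_G_shift[of z] by (simp add: rGamma_inverse_Gamma Gamma_eq_zero_iff)

lemma barnes_G_holomorphic: "barnes_G holomorphic_on A"
proof -
  have "barnes_G holomorphic_on UNIV"
    unfolding barnes_G_eq[abs_def] by (intro holomorphic_intros rGamma2_holomorphic) (auto simp: rGamma2_pos)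
  then show ?thesis by (rule holomorphic_on_subset) simp
qed

text \<open>There are no zeroes for Re z > 0. Descending by the shift equation, a step creates a
  zero only where \<open>rGamma\<close> vanishes.\<close>

lemma barnes_G_eq_0_iff: "barnes_G z = 0 \<longleftrightarrow> z \<in> \<int>\<^sub>\<le>\<^sub>0"
proof -
  have "barnes_G (z + of_nat n) = 0 \<longleftrightarrow> z + of_nat n \<in> \<int>\<^sub>\<le>\<^sub>0" if "Re z + n > 0" for n
  proof -
    have "z + of_nat n \<notin> \<int>\<^sub>\<le>\<^sub>0" using that by (auto elim!: nonpos_Ints_cases simp: complex_eq_iff)
    then show ?thesis using barnes_G_nonzero_pos[of "z + of_nat n"] that by simp
  qed
  moreover have "(barnes_G (z + of_nat n) = 0 \<longleftrightarrow> z + of_nat n \<in> \<int>\<^sub>\<le>\<^sub>0) \<Longrightarrow> (barnes_G z = 0 \<longleftrightarrow> z \<in> \<int>\<^sub>\<le>\<^sub>0)" for n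
  proof (induction n)
    case (Suc n)
    have "barnes_G (z + of_nat n) = 0 \<longleftrightarrow> z + of_nat n \<in> \<int>\<^sub>\<le>\<^sub>0"
    proof -
      have "z + of_nat n \<in> \<int>\<^sub>\<le>\<^sub>0" if nonpos: "z + of_nat n + 1 \<in> \<int>\<^sub>\<le>\<^sub>0"
      proof -
        obtain k where k: "z + of_nat n + 1 = of_int k" "k \<le> 0" using nonpos unfolding nonpos_Ints_def by blast
        then have "z + of_nat n = of_int (k - 1)" by (simp add: algebra_simps)
        moreover have "k - 1 \<le> 0" using k(2) by simp
        ultimately show ?thesis unfolding nonpos_Ints_def by blast
      qed
      then show ?thesis using Suc.prems barnes_G_shift[of "z + of_nat n"]
        by (auto simp: rGamma_eq_zero_iff add_ac)
    qed
    then show ?case by (rule Suc.IH)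
  qed simp
  moreover obtain n :: nat where "- Re z < real n" using reals_Archimedean2 by blast
  then have "Re z + real n > 0" by simp
  ultimately show ?thesis by blast
qed

section \<open>Zeroes and poles of the critical Mellin transform\<close>

text \<open>Treats zeroes, poles and regular points alike: k is any integer and the factorization
  concerns a punctured neighbourhood only. Orders then add under products, change sign under
  inverses and survive affine substitutions without case distinctions.\<close>

definition has_order :: "(complex \<Rightarrow> complex) \<Rightarrow> complex \<Rightarrow> int \<Rightarrow> bool" where
  "has_order f z k \<longleftrightarrow> (\<exists>g. g analytic_on {z} \<and> g z \<noteq> 0 \<and> eventually (\<lambda>w. f w = g w * (w - z) powi k) (at z))"

lemma has_order_0: "f analytic_on {z} \<Longrightarrow> f z \<noteq> 0 \<Longrightarrow> has_order f z 0"
  unfolding has_order_def by (intro exI[of _ f]) auto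

lemma has_order_mult:
  assumes "has_order f z k" "has_order g z l"
  shows "has_order (\<lambda>w. f w * g w) z (k + l)"
proof -
  obtain f' g' where f: "f' analytic_on {z}" "f' z \<noteq> 0" "eventually (\<lambda>w. f w = f' w * (w - z) powi k) (at z)"
    and g: "g' analytic_on {z}" "g' z \<noteq> 0" "eventually (\<lambda>w. g w = g' w * (w - z) powi l) (at z)"
    using assms unfolding has_order_def by blast
  have ne: "eventually (\<lambda>w. w \<noteq> z) (at z)" by (simp add: eventually_at_filter)
  have "eventually (\<lambda>w. f w * g w = (f' w * g' w) * (w - z) powi (k + l)) (at z)"
    using f(3) g(3) ne by eventually_elim (simp add: power_int_add)
  then show ?thesis unfolding has_order_def using f g
    by (intro exI[of _ "\<lambda>w. f' w * g' w"]) (auto intro: analytic_intros)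
qed

lemma has_order_inverse:
  assumes "has_order f z k"
  shows "has_order (\<lambda>w. inverse (f w)) z (- k)"
proof -
  obtain f' where f: "f' analytic_on {z}" "f' z \<noteq> 0" "eventually (\<lambda>w. f w = f' w * (w - z) powi k) (at z)"
    using assms unfolding has_order_def by blast
  have "eventually (\<lambda>w. inverse (f w) = inverse (f' w) * (w - z) powi (- k)) (at z)"
    using f(3) by eventually_elim (simp add: power_int_minus)
  then show ?thesis unfolding has_order_def using f
    by (intro exI[of _ "\<lambda>w. inverse (f' w)"]) (auto intro: analytic_intros)
qed

lemma analytic_on_compose_affine:
  fixes f :: "complex \<Rightarrow> complex"
  assumes "f analytic_on {c - m * z}"
  shows "(\<lambda>w. f (c - m * w)) analytic_on {z}"
proof -
  have "(\<lambda>w. c - m * w) analytic_on {z}"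
    unfolding analytic_at by (intro exI[of _ UNIV]) (auto intro!: holomorphic_intros)
  moreover have "f analytic_on (\<lambda>w. c - m * w) ` {z}" using assms by simp
  ultimately show ?thesis by (rule analytic_on_compose[unfolded o_def])
qed

lemma has_order_affine:
  assumes "has_order f (c - m * z) k" and m: "m \<noteq> 0"
  shows "has_order (\<lambda>w. f (c - m * w)) z k"
proof -
  obtain g where g: "g analytic_on {c - m * z}" "g (c - m * z) \<noteq> 0"
    "eventually (\<lambda>w. f w = g w * (w - (c - m * z)) powi k) (at (c - m * z))"
    using assms unfolding has_order_def by blast
  have "filterlim (\<lambda>w. c - m * w) (at (c - m * z)) (at z)"
    unfolding filterlim_at using m by (auto intro!: tendsto_intros simp: eventually_at_filter)
  from eventually_compose_filterlim[OF g(3) this]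
  have "eventually (\<lambda>w. f (c - m * w) = (g (c - m * w) * (- m) powi k) * (w - z) powi k) (at z)"
  proof eventually_elim
    case (elim w)
    have "c - m * w - (c - m * z) = (- m) * (w - z)" by (simp add: algebra_simps)
    with elim show ?case by (simp only: power_int_mult_distrib mult.assoc)
  qed
  moreover have "(\<lambda>w. g (c - m * w)) analytic_on {z}"
    by (rule analytic_on_compose_affine[OF g(1)])
  ultimately show ?thesis unfolding has_order_def using g(2) m
    by (intro exI[of _ "\<lambda>w. g (c - m * w) * (- m) powi k"]) (auto intro!: analytic_intros)
qed

lemma zorder_has_order:
  assumes "has_order f z k"
  shows "zorder f z = k"
proof -
  obtain g where g: "g analytic_on {z}" "g z \<noteq> 0" "eventually (\<lambda>w. f w = g w * (w - z) powi k) (at z)"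
    using assms unfolding has_order_def by blast
  obtain S where S: "open S" "z \<in> S" "g holomorphic_on S" using g(1) by (auto simp: analytic_at)
  obtain T where T: "open T" "z \<in> T" "\<And>w. w \<in> T \<Longrightarrow> w \<noteq> z \<Longrightarrow> f w = g w * (w - z) powi k"
    using g(3) unfolding eventually_at_topological by blast
  show ?thesis
    by (rule zorder_eqI[of "S \<inter> T" z g]) (use S T g(2) in \<open>auto intro: holomorphic_on_subset\<close>)
qed

lemma has_order_imp_eventually_nonzero:
  assumes "has_order f z k"
  shows "eventually (\<lambda>w. f w \<noteq> 0) (at z)"
proof -
  obtain g where g: "g analytic_on {z}" "g z \<noteq> 0" "eventually (\<lambda>w. f w = g w * (w - z) powi k) (at z)"
    using assms unfolding has_order_def by blast
  have "g \<midarrow>z\<rightarrow> g z" using g(1) by (simp add: analytic_at_imp_isCont isContD)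
  then have "eventually (\<lambda>w. g w \<noteq> 0) (at z)" using g(2) by (rule tendsto_imp_eventually_ne)
  moreover have ne: "eventually (\<lambda>w. w \<noteq> z) (at z)" by (simp add: eventually_at_filter)
  ultimately show ?thesis using g(3) by eventually_elim simp
qed

lemma has_order_rGamma: "has_order rGamma (- of_nat n) 1"
proof -
  define f where "f z = (if z = - of_nat n then deriv rGamma (- of_nat n) else (rGamma z - rGamma (- of_nat n)) / (z - (- of_nat n)))" for z :: complex
  have "f holomorphic_on UNIV"
    unfolding f_def by (rule pole_lemma_open) (auto intro: holomorphic_rGamma)
  then have an: "f analytic_on {- of_nat n}" by (rule holomorphic_on_imp_analytic_at) auto
  have "(rGamma has_field_derivative (- 1) ^ n * fact n) (at (- of_nat n :: complex))"
    by (rule has_field_derivative_rGamma_nonpos_int)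
  then have nz: "f (- of_nat n) \<noteq> 0" by (simp add: f_def DERIV_imp_deriv)
  have "rGamma w = f w * (w - (- of_nat n)) powi 1" if "w \<noteq> - of_nat n" for w
    using that by (simp add: f_def add_eq_0_iff2)
  then have "eventually (\<lambda>w. rGamma w = f w * (w - (- of_nat n)) powi 1) (at (- of_nat n :: complex))"
    unfolding eventually_at_filter by (intro always_eventually) blast
  with an nz show ?thesis unfolding has_order_def by (intro exI[of _ f] conjI)
qed

text \<open>By the shift equation the zero at -(n + 1) is the zero at -n moved by one, times the
  simple zero of \<open>rGamma\<close>.\<close>

lemma has_order_barnes_G: "has_order barnes_G (- of_nat n) (int n + 1)"
proof -
  have G: "(\<lambda>z. rGamma z * barnes_G (z + 1)) = barnes_G" by (rule ext) (rule barnes_G_shift[symmetric])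
  have an: "barnes_G analytic_on {z}" for z
    by (rule holomorphic_on_imp_analytic_at[OF barnes_G_holomorphic[of UNIV]]) auto
  show ?thesis
  proof (induction n)
    case 0
    have "(\<lambda>z. barnes_G (z + 1)) analytic_on {0}"
      using analytic_on_compose_affine[of barnes_G 1 "- 1" 0] an by (simp add: add.commute)
    then have "has_order (\<lambda>z. barnes_G (z + 1)) 0 0" by (intro has_order_0) auto
    from has_order_mult[OF has_order_rGamma[of 0, simplified] this] show ?case by (simp add: G)
  next
    case (Suc n)
    have "has_order (\<lambda>z. barnes_G (1 - (- 1) * z)) (- of_nat (Suc n)) (int n + 1)"
      using Suc.IH by (intro has_order_affine) auto
    then have "has_order (\<lambda>z. barnes_G (z + 1)) (- of_nat (Suc n)) (int n + 1)" by (simp add: add.commute)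
    from has_order_mult[OF has_order_rGamma[of "Suc n"] this] show ?case by (simp add: G add_ac)
  qed
qed

lemma barnes_G_analytic: "barnes_G analytic_on {z}"
  by (rule holomorphic_on_imp_analytic_at[OF barnes_G_holomorphic[of UNIV]]) auto

lemma has_order_barnes_G_nonzero: "z \<notin> \<int>\<^sub>\<le>\<^sub>0 \<Longrightarrow> has_order barnes_G z 0"
  by (rule has_order_0) (auto simp: barnes_G_analytic barnes_G_eq_0_iff)

definition barnes_order :: "complex \<Rightarrow> int" where
  "barnes_order z = (if z \<in> \<int>\<^sub>\<le>\<^sub>0 then 1 - \<lfloor>Re z\<rfloor> else 0)"

lemma barnes_order_of_int: "barnes_order (of_int k) = (if k \<le> 0 then 1 - k else 0)"
proof -
  have "(of_int k :: complex) \<in> \<int>\<^sub>\<le>\<^sub>0 \<longleftrightarrow> k \<le> 0" by (auto simp: nonpos_Ints_def)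
  then show ?thesis by (simp add: barnes_order_def)
qed

lemma has_order_barnes_G': "has_order barnes_G z (barnes_order z)"
proof (cases "z \<in> \<int>\<^sub>\<le>\<^sub>0")
  case True
  then obtain n :: nat where "z = - of_nat n" by (auto elim!: nonpos_Ints_cases')
  then have "z = of_int (- int n)" by simp
  then show ?thesis using has_order_barnes_G[of n] by (simp only: barnes_order_of_int) (simp add: add.commute)
qed (simp add: has_order_barnes_G_nonzero barnes_order_def)

lemma has_order_critical_mellin:
  "has_order critical_mellin q (barnes_order (4 - 2 * q) - barnes_order (1 - q) - 2 * barnes_order (2 - q) - barnes_order (4 - q))"
proof -
  have o: "has_order (\<lambda>q. barnes_G (c - m * q)) q (barnes_order (c - m * q))" if "m \<noteq> 0" for c m
    using has_order_affine[OF has_order_barnes_G' that] .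
  have 1: "has_order (\<lambda>q. barnes_G (c - q)) q (barnes_order (c - q))" for c
    using o[of 1 c] by simp
  have "has_order (\<lambda>q. barnes_G (4 - 2 * q) * inverse (barnes_G (1 - q) * (barnes_G (2 - q) * barnes_G (2 - q)) * barnes_G (4 - q))) q
     (barnes_order (4 - 2 * q) + - (barnes_order (1 - q) + (barnes_order (2 - q) + barnes_order (2 - q)) + barnes_order (4 - q)))"
    by (intro has_order_mult has_order_inverse o 1) simp
  then show ?thesis
    by (simp add: critical_mellin_def[abs_def] divide_inverse power2_eq_square algebra_simps)
qed

lemma critical_mellin_meromorphic: "critical_mellin meromorphic_on UNIV"
proof -
  have "(\<lambda>q. barnes_G (c - m * q)) meromorphic_on UNIV" for c m
    by (intro analytic_on_imp_meromorphic_on) (auto simp: analytic_on_open intro!: holomorphic_on_compose_gen[of _ _ barnes_G UNIV, unfolded o_def] holomorphic_intros barnes_G_holomorphic)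
  from this[of 4 2] this[of 1 1] this[of 2 1] this[of 4 1] show ?thesis
    unfolding critical_mellin_def[abs_def] by (intro meromorphic_intros) auto
qed

lemma critical_mellin_analytic:
  assumes "1 - q \<notin> \<int>\<^sub>\<le>\<^sub>0" "2 - q \<notin> \<int>\<^sub>\<le>\<^sub>0" "4 - q \<notin> \<int>\<^sub>\<le>\<^sub>0"
  shows "critical_mellin analytic_on {q}"
proof -
  have "(\<lambda>q. barnes_G (c - m * q)) analytic_on {q}" for c m
    by (rule analytic_on_compose_affine[OF barnes_G_analytic])
  from this[of 4 2] this[of 1 1] this[of 2 1] this[of 4 1] show ?thesis
    unfolding critical_mellin_def[abs_def] using assms by (intro analytic_intros) (auto simp: barnes_G_eq_0_iff)
qed

lemma nonpos_Ints_minus_iff: "of_nat m - q \<in> \<int>\<^sub>\<le>\<^sub>0 \<longleftrightarrow> (\<exists>n\<ge>m. q = of_nat n)" for q :: complex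
proof
  assume "of_nat m - q \<in> \<int>\<^sub>\<le>\<^sub>0"
  then obtain k where "of_nat m - q = - of_nat k" by (auto elim!: nonpos_Ints_cases')
  then have "q = of_nat (m + k)" by (simp add: algebra_simps)
  then show "\<exists>n\<ge>m. q = of_nat n" by (intro exI[of _ "m + k"]) auto
next
  assume "\<exists>n\<ge>m. q = of_nat n"
  then obtain n where n: "n \<ge> m" "q = of_nat n" by blast
  then have "of_nat m - q = - of_nat (n - m)" by (simp add: of_nat_diff)
  then show "of_nat m - q \<in> \<int>\<^sub>\<le>\<^sub>0" by simp
qed

lemma critical_mellin_analytic':
  assumes "\<And>n::nat. n \<ge> 1 \<Longrightarrow> q \<noteq> of_nat n"
  shows "critical_mellin analytic_on {q}"
  using nonpos_Ints_minus_iff[of 1 q] nonpos_Ints_minus_iff[of 2 q] nonpos_Ints_minus_iff[of 4 q] assms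
  by (intro critical_mellin_analytic) auto

lemma half_odd_neq_of_nat: "of_nat n + 5 / 2 \<noteq> (of_nat m :: complex)"
proof
  assume "of_nat n + 5 / 2 = (of_nat m :: complex)"
  then have "of_nat (2 * n + 5) = (of_nat (2 * m) :: complex)" by (simp add: field_simps)
  then show False by (simp only: of_nat_eq_iff) presburger
qed

lemma critical_mellin_zero:
  "critical_mellin analytic_on {of_nat n + 5/2}"
  "critical_mellin (of_nat n + 5/2) = 0"
  "zorder critical_mellin (of_nat n + 5/2) = 2 * int n + 2"
proof -
  let ?q = "of_nat n + 5/2 :: complex"
  show "critical_mellin analytic_on {?q}"
    by (rule critical_mellin_analytic') (rule half_odd_neq_of_nat)
  \<comment> \<open>An odd negative integer, where G has a zero of order 2 * n + 2; the other three
    arguments are half-integers, so nothing cancels it.\<close>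
  have e: "4 - 2 * ?q = - of_nat (2 * n + 1)" by (simp add: field_simps)
  have z: "barnes_G (4 - 2 * ?q) = 0" unfolding barnes_G_eq_0_iff e by (rule minus_of_nat_in_nonpos_Ints)
  show "critical_mellin ?q = 0" by (simp only: critical_mellin_def z) simp
  have ni: "of_nat m - ?q \<notin> \<int>\<^sub>\<le>\<^sub>0" for m
    unfolding nonpos_Ints_minus_iff using half_odd_neq_of_nat by blast
  have "barnes_order (4 - 2 * ?q) = 2 * int n + 2"
  proof -
    have "4 - 2 * ?q = of_int (- int (2 * n + 1))" unfolding e by simp
    then show ?thesis by (simp only: barnes_order_of_int) simp
  qed
  moreover have "barnes_order (1 - ?q) = 0" "barnes_order (2 - ?q) = 0" "barnes_order (4 - ?q) = 0"
    using ni[of 1] ni[of 2] ni[of 4] by (simp_all add: barnes_order_def)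
  ultimately show "zorder critical_mellin ?q = 2 * int n + 2"
    using zorder_has_order[OF has_order_critical_mellin[of ?q]] by simp
qed

text \<open>For n >= 3 the orders of G at 4 - 2 * n, 1 - n, 2 - n and 4 - n are 2 * n - 3, n, n - 1
  and n - 3, the third counted twice. At n = 1 and n = 2 some of these arguments are still positive,
  which gives the exceptional values.\<close>

lemma zorder_critical_mellin_of_nat:
  "zorder critical_mellin (of_nat n) = (if n = 0 then 0 else if n = 1 then -1 else if n = 2 then -3 else - (2 * int n - 2))"
proof -
  have "4 - 2 * of_nat n = (of_int (4 - 2 * int n) :: complex)" "1 - of_nat n = (of_int (1 - int n) :: complex)"
    "2 - of_nat n = (of_int (2 - int n) :: complex)" "4 - of_nat n = (of_int (4 - int n) :: complex)" by simp_all
  then show ?thesis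
    using zorder_has_order[OF has_order_critical_mellin[of "of_nat n"]] by (simp only: barnes_order_of_int) auto
qed

lemma critical_mellin_pole:
  assumes "n \<ge> 1"
  shows "is_pole critical_mellin (of_nat n)"
proof (rule zorder_neg_imp_is_pole)
  show "critical_mellin meromorphic_on {of_nat n}"
    by (rule meromorphic_on_subset[OF critical_mellin_meromorphic]) simp
  show "eventually (\<lambda>z. critical_mellin z \<noteq> 0) (at (of_nat n))"
    by (rule has_order_imp_eventually_nonzero[OF has_order_critical_mellin])
  show "zorder critical_mellin (of_nat n) < 0"
    unfolding zorder_critical_mellin_of_nat using assms by auto
qed

lemma critical_mellin_nonzero:
  assumes "\<And>n::nat. q \<noteq> of_nat n + 5/2" "\<And>n::nat. n \<ge> 1 \<Longrightarrow> q \<noteq> of_nat n"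
  shows "critical_mellin q \<noteq> 0"
proof -
  have "4 - 2 * q \<notin> \<int>\<^sub>\<le>\<^sub>0"
  proof
    assume "4 - 2 * q \<in> \<int>\<^sub>\<le>\<^sub>0"
    then obtain k where k: "4 - 2 * q = - of_nat k" by (auto elim!: nonpos_Ints_cases')
    \<comment> \<open>Even k makes q one of the poles, odd k one of the listed zeroes.\<close>
    then have q: "q = of_nat (k + 4) / 2" by (simp add: field_simps)
    show False
    proof (cases "even k")
      case True
      then obtain m where "k = 2 * m" by blast
      then have "q = of_nat (m + 2)" using q by (simp add: add_divide_distrib)
      then show False using assms(2)[of "m + 2"] by simp
    next
      case False
      then obtain m where "k = 2 * m + 1" by (auto elim: oddE)
      then have "q = of_nat m + 5/2" using q by (simp add: field_simps)
      then show False using assms(1)[of m] by simp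
    qed
  qed
  then show ?thesis unfolding critical_mellin_def
    using nonpos_Ints_minus_iff[of 1 q] nonpos_Ints_minus_iff[of 2 q] nonpos_Ints_minus_iff[of 4 q] assms(2)
    by (auto simp: barnes_G_eq_0_iff)
qed

section \<open>Functional equation and negative integer moments\<close>

lemma critical_mellin_functional_equation:
  assumes "\<And>n::nat. n \<ge> 1 \<Longrightarrow> q \<noteq> of_nat n"
  shows "critical_mellin q = Gamma (1 - q) * (Gamma (2 - q))\<^sup>2 * Gamma (4 - q)
           / (Gamma (4 - 2 * q) * Gamma (5 - 2 * q)) * critical_mellin (q - 1)"
proof -
  have n: "1 - q \<notin> \<int>\<^sub>\<le>\<^sub>0" "2 - q \<notin> \<int>\<^sub>\<le>\<^sub>0" "4 - q \<notin> \<int>\<^sub>\<le>\<^sub>0"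
    using nonpos_Ints_minus_iff[of 1 q] nonpos_Ints_minus_iff[of 2 q] nonpos_Ints_minus_iff[of 4 q] assms by auto
  have G: "barnes_G (1 - (q - 1)) = Gamma (1 - q) * barnes_G (1 - q)"
    "barnes_G (2 - (q - 1)) = Gamma (2 - q) * barnes_G (2 - q)"
    "barnes_G (4 - (q - 1)) = Gamma (4 - q) * barnes_G (4 - q)"
    using barnes_G_plus1[OF n(1)] barnes_G_plus1[OF n(2)] barnes_G_plus1[OF n(3)] by (simp_all add: algebra_simps)
  \<comment> \<open>The doubled argument moves by two unit steps. \<open>rGamma\<close> is kept
    because 4 - 2 * q may be a nonpositive integer; there Gamma is 0 by convention and both sides of
    the functional equation are 0.\<close>
  have G2: "barnes_G (4 - 2 * q) = rGamma (4 - 2 * q) * rGamma (5 - 2 * q) * barnes_G (4 - 2 * (q - 1))"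
    using barnes_G_shift[of "4 - 2 * q"] barnes_G_shift[of "5 - 2 * q"] by (simp add: algebra_simps)
  have "Gamma (1 - q) \<noteq> 0" "Gamma (2 - q) \<noteq> 0" "Gamma (4 - q) \<noteq> 0" using n by (simp_all add: Gamma_eq_zero_iff)
  then show ?thesis unfolding critical_mellin_def G G2 rGamma_inverse_Gamma
    by (simp add: field_simps power_mult_distrib)
qed

lemma critical_mellin_0 [simp]: "critical_mellin 0 = 1"
proof -
  have G2: "barnes_G 2 = 1" using barnes_G_plus1[of 1] by simp
  then show ?thesis using barnes_G_nonzero_pos[of 4] by (simp add: critical_mellin_def)
qed

text \<open>Induction with the functional equation at q = -l, solved for the value at q - 1. All
  gamma values are factorials, and passing from numerators (3 + l + k)! to (4 + l + k)! telescopes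
  to three boundary factorials.\<close>

lemma critical_mellin_minus_of_nat:
  "critical_mellin (- of_nat l) = (\<Prod>k<l. fact (3 + l + k) / ((fact (k + 1))\<^sup>2 * fact k))"
proof (induction l)
  case (Suc l)
  define P :: "nat \<Rightarrow> complex" where "P l = (\<Prod>k<l. fact (3 + l + k) / ((fact (k + 1))\<^sup>2 * fact k))" for l
  have g: "Gamma (1 - (- of_nat l)) = (fact l :: complex)" "Gamma (2 - (- of_nat l)) = (fact (l + 1) :: complex)"
    "Gamma (4 - (- of_nat l)) = (fact (l + 3) :: complex)" "Gamma (4 - 2 * (- of_nat l)) = (fact (2 * l + 3) :: complex)"
    "Gamma (5 - 2 * (- of_nat l)) = (fact (2 * l + 4) :: complex)"
  proof -
    have e: "1 - (- of_nat l) = (1 + of_nat l :: complex)" "2 - (- of_nat l) = (1 + of_nat (l + 1) :: complex)"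
      "4 - (- of_nat l) = (1 + of_nat (l + 3) :: complex)" "4 - 2 * (- of_nat l) = (1 + of_nat (2 * l + 3) :: complex)"
      "5 - 2 * (- of_nat l) = (1 + of_nat (2 * l + 4) :: complex)" by simp_all
    show "Gamma (1 - (- of_nat l)) = (fact l :: complex)" "Gamma (2 - (- of_nat l)) = (fact (l + 1) :: complex)"
    "Gamma (4 - (- of_nat l)) = (fact (l + 3) :: complex)" "Gamma (4 - 2 * (- of_nat l)) = (fact (2 * l + 3) :: complex)"
    "Gamma (5 - 2 * (- of_nat l)) = (fact (2 * l + 4) :: complex)"
      unfolding e Gamma_fact by (rule refl)+
  qed
  have "critical_mellin (- of_nat l) = Gamma (1 - (- of_nat l)) * (Gamma (2 - (- of_nat l)))\<^sup>2 * Gamma (4 - (- of_nat l))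
           / (Gamma (4 - 2 * (- of_nat l)) * Gamma (5 - 2 * (- of_nat l))) * critical_mellin (- of_nat l - 1)"
  proof (rule critical_mellin_functional_equation)
    fix n :: nat assume "n \<ge> 1"
    then have "Re (of_nat n) > Re (- of_nat l)" by simp
    then show "- of_nat l \<noteq> (of_nat n :: complex)" by (metis less_irrefl)
  qed
  then have "critical_mellin (- of_nat (Suc l)) = P l * (fact (2 * l + 3) * fact (2 * l + 4)) / (fact l * (fact (l + 1))\<^sup>2 * fact (l + 3))"
  proof -
    have solve: "X = Q * (d * e) / (a * b\<^sup>2 * c)"
      if "Q = a * b\<^sup>2 * c / (d * e) * X" "a \<noteq> 0" "b \<noteq> 0" "c \<noteq> 0" "d \<noteq> 0" "e \<noteq> 0" for X Q a b c d e :: complex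
      using that by (simp add: field_simps)
    assume "critical_mellin (- of_nat l) = Gamma (1 - (- of_nat l)) * (Gamma (2 - (- of_nat l)))\<^sup>2 * Gamma (4 - (- of_nat l))
           / (Gamma (4 - 2 * (- of_nat l)) * Gamma (5 - 2 * (- of_nat l))) * critical_mellin (- of_nat l - 1)"
    moreover have "critical_mellin (- of_nat l) = P l" using Suc.IH by (simp add: P_def)
    moreover have "- of_nat l - 1 = (- of_nat (Suc l) :: complex)" by simp
    ultimately have "P l = fact l * (fact (l + 1))\<^sup>2 * fact (l + 3) / (fact (2 * l + 3) * fact (2 * l + 4)) * critical_mellin (- of_nat (Suc l))"
      unfolding g by metis
    then show ?thesis by (rule solve) (rule fact_nonzero)+
  qed
  also have "\<dots> = P (Suc l)"
  proof -
    have e: "2 * l + 4 = 4 + l + l" "2 * l + 3 = 3 + l + l" by simp_all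
    define d :: complex where "d = (\<Prod>k<l. (fact (k + 1))\<^sup>2 * fact k)"
    have Pl: "P l = (\<Prod>k<l. fact (3 + l + k)) / d" by (simp add: P_def d_def prod_dividef)
    have "P (Suc l) = (\<Prod>k<Suc l. fact (4 + l + k)) / (d * ((fact (l + 1))\<^sup>2 * fact l))"
      by (simp add: P_def d_def prod_dividef)
    also have "(\<Prod>k<Suc l. fact (4 + l + k) :: complex) = (\<Prod>k<l. fact (4 + l + k)) * fact (2 * l + 4)"
      unfolding e by (rule prod.lessThan_Suc)
    also have "(\<Prod>k<l. fact (4 + l + k) :: complex) = (\<Prod>k<l. fact (3 + l + k)) * fact (2 * l + 3) / fact (l + 3)"
    proof -
      have "(\<Prod>k<Suc l. fact (3 + l + k) :: complex) = fact (3 + l) * (\<Prod>k<l. fact (4 + l + k))"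
        by (subst prod.lessThan_Suc_shift) (simp add: add.assoc)
      moreover have "(\<Prod>k<Suc l. fact (3 + l + k) :: complex) = (\<Prod>k<l. fact (3 + l + k)) * fact (2 * l + 3)"
        unfolding e by (rule prod.lessThan_Suc)
      ultimately show ?thesis by (simp add: field_simps)
    qed
    finally show ?thesis unfolding Pl by (simp add: field_simps)
  qed
  finally show ?case by (simp add: P_def)
qed simp

section \<open>The infinite product\<close>

lemma ln_fact_Stirling:
  "(\<lambda>n. ln (fact n) - (real n * ln (real n) - real n + ln (real n) / 2 + ln (2 * pi) / 2)) \<longlonglongrightarrow> 0"
proof -
  have p: "rGamma (1 + real n) = 1 / fact n" for n
    using Gamma_fact[of n, where 'a = real] by (simp add: rGamma_inverse_Gamma inverse_eq_divide)
  have "(\<lambda>n. exp (stirling_exponent (1 + real n)) * rGamma (1 + real n)) \<longlonglongrightarrow> 1 / sqrt (2 * pi)"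
    by (rule Stirling_rGamma) simp
  then have "(\<lambda>n. ln (exp (stirling_exponent (1 + real n)) * rGamma (1 + real n))) \<longlonglongrightarrow> ln (1 / sqrt (2 * pi))"
    by (rule tendsto_ln) simp
  moreover have "ln (exp (stirling_exponent (1 + real n)) * rGamma (1 + real n)) = stirling_exponent (1 + real n) - ln (fact n)" for n
    unfolding p by (simp add: ln_div)
  moreover have "ln (1 / sqrt (2 * pi)) = - (ln (2 * pi) / 2)"
    by (simp add: ln_div ln_sqrt)
  ultimately have "(\<lambda>n. stirling_exponent (1 + real n) - ln (fact n)) \<longlonglongrightarrow> - (ln (2 * pi) / 2)" by simp
  moreover have "(\<lambda>n. stirling_exponent (1 + real n) - (real n * ln (real n) - real n + ln (real n) / 2)) \<longlonglongrightarrow> 0"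
    unfolding stirling_exponent_def by real_asymp
  ultimately have "(\<lambda>n. (stirling_exponent (1 + real n) - (real n * ln (real n) - real n + ln (real n) / 2)) -
     (stirling_exponent (1 + real n) - ln (fact n)) - ln (2 * pi) / 2) \<longlonglongrightarrow> 0 - (- (ln (2 * pi) / 2)) - ln (2 * pi) / 2"
    by (intro tendsto_intros)
  then show ?thesis by (simp add: algebra_simps)
qed

text \<open>Normalised to tend to 1: it compares G (a + n + 1) with G (n + 1) * (n!)^a * n^((a^2 -
  a) / 2), which is exact for a = 0 and a = 1.\<close>

definition barnes_ratio :: "complex \<Rightarrow> nat \<Rightarrow> complex" where
  "barnes_ratio a n = barnes_G (a + of_nat n + 1) /
     (barnes_G (of_nat n + 1) * exp (a * of_real (ln (fact n)) + (a\<^sup>2 - a) / 2 * of_real (ln (real n))))"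

lemma barnes_ratio_LIMSEQ: "barnes_ratio a \<longlonglongrightarrow> 1"
proof -
  define q l k where "q a n = (a + of_nat n)\<^sup>2 * (3 / 4 - ln (a + of_nat n) / 2) -
     ((a + of_nat n)\<^sup>2 * (3 / 4 - of_real (ln (real n)) / 2) - of_nat n * a / 2 - 3 * a\<^sup>2 / 4)"
    and "l a n = ((a + of_nat n) * ln (a + of_nat n) - (a + of_nat n)) - ((a + of_nat n) * of_real (ln (real n)) - of_nat n)"
    and "k a n = ln (a + of_nat n) - of_real (ln (real n))" for a :: complex and n
  have q: "q a \<longlonglongrightarrow> 0" and l: "l a \<longlonglongrightarrow> 0" and k: "k a \<longlonglongrightarrow> 0" for a
    unfolding q_def l_def k_def by (rule quadratic_Ln_asymp linear_Ln_asymp Ln_add_of_nat_asymp)+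
  define s :: "nat \<Rightarrow> complex" where "s n = of_real (ln (fact n) - (real n * ln (real n) - real n + ln (real n) / 2 + ln (2 * pi) / 2))" for n
  have s: "s \<longlonglongrightarrow> 0" unfolding s_def using tendsto_of_real[OF ln_fact_Stirling, where 'a = complex] by (simp only: of_real_0)
  \<comment> \<open>The coefficient 5/12 is 1/4 + (\<tau> + 1/\<tau>) / 12 at \<tau> = 1. The term
    with \<open>s n\<close> brings in Stirling's formula for n!, whose ln (2 * pi) / 2 cancels the
    power of 2 * pi in G.\<close>
  define X where "X n = (q 1 n - q (a + 1) n) + (l 1 n - l (a + 1) n) - 5 / 12 * (k 1 n - k (a + 1) n)
     + barnes_tail 1 (1 + of_nat n) - barnes_tail 1 ((a + 1) + of_nat n) - a * s n" for n
  have "X \<longlonglongrightarrow> (0 - 0) + (0 - 0) - 5 / 12 * (0 - 0) + 0 - 0 - a * 0"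
    unfolding X_def by (intro tendsto_intros q l k s barnes_tail_tendsto_0) auto
  then have "(\<lambda>n. exp (X n)) \<longlonglongrightarrow> exp 0" by (intro tendsto_exp) simp
  moreover have "eventually (\<lambda>n. real n > - Re a) sequentially" by real_asymp
  then have "eventually (\<lambda>n. exp (X n) = barnes_ratio a n) sequentially"
  proof eventually_elim
    case (elim n)
    have G1: "barnes_G (a + of_nat n + 1) = exp ((a + of_nat n) / 2 * of_real (ln (2 * pi)) + (log_Gamma2 1 1 - log_Gamma2 1 (a + of_nat n + 1)))"
      using elim Ln_of_real[of "2 * pi"] by (subst barnes_G_pos) (auto simp: powr_def exp_add mult.commute)
    have G2: "barnes_G (of_nat n + 1) = exp (of_nat n / 2 * of_real (ln (2 * pi)) + (log_Gamma2 1 1 - log_Gamma2 1 (of_nat n + 1)))"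
      using Ln_of_real[of "2 * pi"] by (subst barnes_G_pos) (auto simp: powr_def exp_add mult.commute)
    define N L P F where "N = complex_of_nat n" and "L = complex_of_real (ln (real n))" and "P = complex_of_real (ln (2 * pi))"
      and "F = complex_of_real (ln (fact n))"
    have sn: "s n = F - (N * L - N + L / 2 + P / 2)" by (simp add: s_def N_def L_def P_def F_def)
    have e: "X n = ((a + N) / 2 * P + (log_Gamma2 1 1 - log_Gamma2 1 (a + N + 1))) -
        (N / 2 * P + (log_Gamma2 1 1 - log_Gamma2 1 (N + 1))) - (a * F + (a\<^sup>2 - a) / 2 * L)"
      unfolding X_def sn log_Gamma2_eq barnes_main_def q_def l_def k_def
        N_def[symmetric] L_def[symmetric]
      by (simp add: field_simps power2_eq_square)
    show ?case
      unfolding barnes_ratio_def G1 G2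
      unfolding N_def[symmetric] L_def[symmetric] P_def[symmetric] F_def[symmetric] e
      by (simp add: exp_diff exp_add)
  qed
  ultimately show ?thesis by (auto elim: Lim_transform_eventually)
qed

lemma barnes_G_eq_ratio:
  "barnes_G (a + of_nat n + 1) = barnes_ratio a n * (barnes_G (of_nat n + 1) *
     exp (a * of_real (ln (fact n)) + (a\<^sup>2 - a) / 2 * of_real (ln (real n))))"
  using barnes_G_nonzero_pos[of "of_nat n + 1"] by (simp add: barnes_ratio_def)

text \<open>Each gamma factor is a quotient of consecutive G values, so the product telescopes. The
  hypothesis keeps 2 - q, 3 - q and 3 - 2 * q off the nonpositive integers.\<close>

lemma critical_factor_partial_prod:
  assumes q: "\<And>n::nat. n \<ge> 2 \<Longrightarrow> 2 * q \<noteq> of_nat n"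
  shows "(\<Prod>m<n. critical_factor q (Suc m)) = exp (2 * q * of_real (ln (fact n))) *
     (barnes_G (2 - q + of_nat n) / barnes_G (2 - q)) ^ 3 / barnes_G (2 + of_nat n) ^ 3 *
     (barnes_G (3 - q + of_nat n) / barnes_G (3 - q)) * (barnes_G (3 - 2 * q) / barnes_G (3 - 2 * q + of_nat n))"
proof (induction n)
  case 0
  have "2 - q \<notin> \<int>\<^sub>\<le>\<^sub>0" "3 - q \<notin> \<int>\<^sub>\<le>\<^sub>0" "3 - 2 * q \<notin> \<int>\<^sub>\<le>\<^sub>0"
    using nonpos_Ints_minus_iff[of 2 q] nonpos_Ints_minus_iff[of 3 q] nonpos_Ints_minus_iff[of 3 "2 * q"] q q[of "2 * _"] by auto
  moreover have "barnes_G 2 = 1" using barnes_G_plus1[of 1] by simp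
  ultimately show ?case by (simp add: barnes_G_eq_0_iff)
next
  case (Suc n)
  have ni: "2 - q + of_nat n \<notin> \<int>\<^sub>\<le>\<^sub>0" "3 - q + of_nat n \<notin> \<int>\<^sub>\<le>\<^sub>0" "3 - 2 * q + of_nat n \<notin> \<int>\<^sub>\<le>\<^sub>0"
    using nonpos_Ints_minus_iff[of "2 + n" q] nonpos_Ints_minus_iff[of "3 + n" q] nonpos_Ints_minus_iff[of "3 + n" "2 * q"] q q[of "2 * _"]
    by (auto simp: algebra_simps)
  have n2: "2 + of_nat n \<notin> (\<int>\<^sub>\<le>\<^sub>0 :: complex set)"
    using nonpos_Ints_minus_iff[of "2 + n" 0] by auto
  have G: "barnes_G (z + of_nat (Suc n)) = Gamma (z + of_nat n) * barnes_G (z + of_nat n)" if "z + of_nat n \<notin> \<int>\<^sub>\<le>\<^sub>0" for z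
    using barnes_G_plus1[OF that] by (simp add: add_ac)
  have c: "critical_factor q (Suc n) = exp (2 * q * of_real (ln (real (Suc n)))) * (Gamma (2 - q + of_nat n) ^ 3 / Gamma (2 + of_nat n) ^ 3)
     * (Gamma (3 - q + of_nat n) / Gamma (3 - 2 * q + of_nat n))"
  proof -
    have e: "1 - q + of_nat (Suc n) = 2 - q + of_nat n" "1 + of_nat (Suc n) = (2 + of_nat n :: complex)"
      "2 - q + of_nat (Suc n) = 3 - q + of_nat n" "2 - 2 * q + of_nat (Suc n) = 3 - 2 * q + of_nat n" by simp_all
    have "complex_of_nat (Suc n) powr (2 * q) = exp (2 * q * of_real (ln (real (Suc n))))"
      unfolding powr_def by (simp del: of_nat_Suc)
    then show ?thesis unfolding critical_factor_def e by simp
  qed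
  have f: "exp (2 * q * of_real (ln (fact (Suc n)))) = exp (2 * q * of_real (ln (fact n))) * exp (2 * q * of_real (ln (real (Suc n))))"
    by (simp add: ln_mult exp_add[symmetric] algebra_simps del: of_nat_Suc)
  show ?case
    unfolding prod.lessThan_Suc Suc.IH c f G[OF ni(1)] G[OF ni(2)] G[OF ni(3)] G[OF n2]
    by (simp add: power_mult_distrib power_divide mult_ac)
qed

lemma critical_factor_partial_prod_LIMSEQ:
  assumes q: "\<And>n::nat. n \<ge> 2 \<Longrightarrow> 2 * q \<noteq> of_nat n"
  shows "(\<lambda>n. \<Prod>m<n. critical_factor q (Suc m)) \<longlonglongrightarrow> barnes_G (3 - 2 * q) / (barnes_G (2 - q) ^ 3 * barnes_G (3 - q))"
proof -
  define c where "c = barnes_G (3 - 2 * q) / (barnes_G (2 - q) ^ 3 * barnes_G (3 - q))"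
  have "(\<lambda>n. barnes_ratio (1 - q) n ^ 3 * barnes_ratio (2 - q) n / (barnes_ratio 1 n ^ 3 * barnes_ratio (2 - 2 * q) n) * c) \<longlonglongrightarrow>
     1 ^ 3 * 1 / (1 ^ 3 * 1) * c"
    by (intro tendsto_intros barnes_ratio_LIMSEQ) auto
  moreover have "barnes_ratio (1 - q) n ^ 3 * barnes_ratio (2 - q) n / (barnes_ratio 1 n ^ 3 * barnes_ratio (2 - 2 * q) n) * c =
     (\<Prod>m<n. critical_factor q (Suc m))" for n
  proof -
    define g F L where "g = barnes_G (of_nat n + 1)" and "F = complex_of_real (ln (fact n))" and "L = complex_of_real (ln (real n))"
    have g: "g \<noteq> 0" unfolding g_def by (rule barnes_G_nonzero_pos) simp
    have r: "barnes_ratio a n = barnes_G (a + of_nat n + 1) / (g * exp (a * F + (a\<^sup>2 - a) / 2 * L))" for a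
      by (simp add: barnes_ratio_def g_def F_def L_def)
    \<comment> \<open>The growth exponents balance: both sides have weight 5 - 4 * q for F and (4 *
      q^2 - 6 * q + 2) / 2 for L. The convergence factors m^(2q) account for the term with 2 * q *
      F.\<close>
    have "3 * ((1 - q) * F + ((1 - q)\<^sup>2 - (1 - q)) / 2 * L) + ((2 - q) * F + ((2 - q)\<^sup>2 - (2 - q)) / 2 * L)
      = 3 * (1 * F + (1\<^sup>2 - 1) / 2 * L) + ((2 - 2 * q) * F + ((2 - 2 * q)\<^sup>2 - (2 - 2 * q)) / 2 * L) - 2 * q * F"
      by (simp add: field_simps power2_eq_square)
    then have E: "exp ((1 - q) * F + ((1 - q)\<^sup>2 - (1 - q)) / 2 * L) ^ 3 * exp ((2 - q) * F + ((2 - q)\<^sup>2 - (2 - q)) / 2 * L)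
      = exp (1 * F + (1\<^sup>2 - 1) / 2 * L) ^ 3 * exp ((2 - 2 * q) * F + ((2 - 2 * q)\<^sup>2 - (2 - 2 * q)) / 2 * L) / exp (2 * q * F)"
      unfolding exp_of_nat_mult[of 3, simplified, symmetric] exp_add[symmetric] exp_diff[symmetric] by (simp only:)
    have sh: "1 - q + of_nat n + 1 = 2 - q + of_nat n" "2 - q + of_nat n + 1 = 3 - q + of_nat n"
      "1 + of_nat n + 1 = (2 + of_nat n :: complex)" "2 - 2 * q + of_nat n + 1 = 3 - 2 * q + of_nat n" by simp_all
    have alg: "(A / (g * e1)) ^ 3 * (B / (g * e2)) / ((C / (g * e3)) ^ 3 * (D / (g * e4))) * c = x * A ^ 3 * B / (C ^ 3 * D) * c"
      if "e1 ^ 3 * e2 = e3 ^ 3 * e4 / x" "x \<noteq> 0" "e1 \<noteq> 0" "e2 \<noteq> 0" "e3 \<noteq> 0" "e4 \<noteq> 0" for A B C D e1 e2 e3 e4 x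
    proof -
      have "(A / (g * e1)) ^ 3 * (B / (g * e2)) / ((C / (g * e3)) ^ 3 * (D / (g * e4))) = (e3 ^ 3 * e4) / (e1 ^ 3 * e2) * (A ^ 3 * B / (C ^ 3 * D))"
        using g that by (simp add: power_divide power_mult_distrib)
      also have "(e3 ^ 3 * e4) / (e1 ^ 3 * e2) = x" using that by (simp add: field_simps)
      finally show ?thesis by simp
    qed
    have pp: "(\<Prod>m<n. critical_factor q (Suc m)) = exp (2 * q * of_real (ln (fact n))) *
     (barnes_G (2 - q + of_nat n) / barnes_G (2 - q)) ^ 3 / barnes_G (2 + of_nat n) ^ 3 *
     (barnes_G (3 - q + of_nat n) / barnes_G (3 - q)) * (barnes_G (3 - 2 * q) / barnes_G (3 - 2 * q + of_nat n))"
      by (rule critical_factor_partial_prod) (rule q)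
    show ?thesis
      unfolding pp r sh F_def[symmetric]
      by (subst alg[OF E]) (simp_all add: c_def power_divide)
  qed
  ultimately show ?thesis by (simp add: c_def)
qed

lemma critical_mellin_prod:
  assumes q: "\<And>n::nat. n \<ge> 2 \<Longrightarrow> 2 * q \<noteq> of_nat n"
  shows "convergent_prod (\<lambda>k. critical_factor q (Suc k))"
    and "critical_mellin q = Gamma (1 - q) * Gamma (3 - 2 * q) / Gamma (3 - q) * (\<Prod>k. critical_factor q (Suc k))"
proof -
  have ni: "1 - q \<notin> \<int>\<^sub>\<le>\<^sub>0" "2 - q \<notin> \<int>\<^sub>\<le>\<^sub>0" "3 - q \<notin> \<int>\<^sub>\<le>\<^sub>0" "3 - 2 * q \<notin> \<int>\<^sub>\<le>\<^sub>0"
    using nonpos_Ints_minus_iff[of 1 q] nonpos_Ints_minus_iff[of 2 q] nonpos_Ints_minus_iff[of 3 q] nonpos_Ints_minus_iff[of 3 "2 * q"] q q[of "2 * _"]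
    by auto
  define L where "L = barnes_G (3 - 2 * q) / (barnes_G (2 - q) ^ 3 * barnes_G (3 - q))"
  \<comment> \<open>Convergence of an infinite product includes a nonzero limit.\<close>
  have L: "L \<noteq> 0" using ni by (simp add: L_def barnes_G_eq_0_iff)
  have lim: "(\<lambda>n. \<Prod>m\<le>n. critical_factor q (Suc m)) \<longlonglongrightarrow> L"
  proof -
    have "(\<lambda>n. \<Prod>m<n. critical_factor q (Suc m)) \<longlonglongrightarrow> L"
      unfolding L_def by (rule critical_factor_partial_prod_LIMSEQ) (rule q)
    from LIMSEQ_Suc[OF this] show ?thesis unfolding lessThan_Suc_atMost .
  qed
  have nz: "critical_factor q (Suc k) \<noteq> 0" for k
  proof -
    have "1 - q + of_nat (Suc k) \<notin> \<int>\<^sub>\<le>\<^sub>0" "2 - q + of_nat (Suc k) \<notin> \<int>\<^sub>\<le>\<^sub>0" "2 - 2 * q + of_nat (Suc k) \<notin> \<int>\<^sub>\<le>\<^sub>0"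
      using nonpos_Ints_minus_iff[of "2 + k" q] nonpos_Ints_minus_iff[of "3 + k" q] nonpos_Ints_minus_iff[of "3 + k" "2 * q"] q q[of "2 * _"]
      by (auto simp: algebra_simps)
    moreover have "(1 :: complex) + of_nat (Suc k) \<notin> \<int>\<^sub>\<le>\<^sub>0" using nonpos_Ints_minus_iff[of "2 + k" 0] by auto
    ultimately show ?thesis unfolding critical_factor_def by (simp add: Gamma_eq_zero_iff powr_def del: of_nat_Suc)
  qed
  show c: "convergent_prod (\<lambda>k. critical_factor q (Suc k))"
    unfolding convergent_prod_iff_nz_lim[OF nz] using lim L by blast
  have P: "(\<Prod>k. critical_factor q (Suc k)) = L"
    using LIMSEQ_unique[OF convergent_prod_LIMSEQ[OF c] lim] .
  have G: "barnes_G (4 - 2 * q) = Gamma (3 - 2 * q) * barnes_G (3 - 2 * q)" "barnes_G (4 - q) = Gamma (3 - q) * barnes_G (3 - q)"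
    "barnes_G (2 - q) = Gamma (1 - q) * barnes_G (1 - q)"
    using barnes_G_plus1[OF ni(4)] barnes_G_plus1[OF ni(3)] barnes_G_plus1[OF ni(1)] by (simp_all add: algebra_simps)
  have ne: "barnes_G (1 - q) \<noteq> 0" "Gamma (1 - q) \<noteq> 0" using ni by (simp_all add: barnes_G_eq_0_iff Gamma_eq_zero_iff)
  show "critical_mellin q = Gamma (1 - q) * Gamma (3 - 2 * q) / Gamma (3 - q) * (\<Prod>k. critical_factor q (Suc k))"
    unfolding P L_def critical_mellin_def G(1,2) using ne by (simp add: G(3) power_mult_distrib power2_eq_square power3_eq_cube)
qed

section \<open>The duplication formula\<close>

text \<open>The duplication formula of G asserts that this quotient is the exponential of a
  quadratic polynomial; \<open>barnes_dup_eq\<close> proves it with the constant kept as the value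
  at 2.\<close>

definition barnes_dup :: "complex \<Rightarrow> complex" where
  "barnes_dup z = barnes_G (2 * z) / (barnes_G z * (barnes_G (z + 1 / 2))\<^sup>2 * barnes_G (z + 1))"

text \<open>The quadratic exponent for which \<open>barnes_dup\<close> times \<open>exp (- dup_exponent)\<close> is 1-periodic.\<close>

definition dup_exponent :: "complex \<Rightarrow> complex" where
  "dup_exponent z = (2 - z) * of_real (ln (pi / 32)) + 2 * (2 - z)\<^sup>2 * of_real (ln 2)"

lemma barnes_dup_periodic:
  assumes z: "Re z > 0"
  shows "barnes_dup (z + 1) * exp (- dup_exponent (z + 1)) = barnes_dup z * exp (- dup_exponent z)"
proof -
  have ni: "w \<notin> \<int>\<^sub>\<le>\<^sub>0" if "Re w > 0" for w using that by (auto elim!: nonpos_Ints_cases)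
  have Re: "Re (2 * z) > 0" "Re (2 * z + 1) > 0" "Re (z + 1/2) > 0" "Re (z + 1) > 0" using z by auto
  have G: "barnes_G (2 * (z + 1)) = Gamma (2 * z + 1) * (Gamma (2 * z) * barnes_G (2 * z))"
    "barnes_G (z + 1) = Gamma z * barnes_G z" "barnes_G (z + 1 + 1) = Gamma (z + 1) * barnes_G (z + 1)"
    "barnes_G (z + 1 + 1 / 2) = Gamma (z + 1 / 2) * barnes_G (z + 1 / 2)"
    using barnes_G_plus1[OF ni[OF Re(1)]] barnes_G_plus1[OF ni[OF Re(2)]] barnes_G_plus1[OF ni[OF z]]
      barnes_G_plus1[OF ni[OF Re(3)]] barnes_G_plus1[OF ni[OF Re(4)]] by (simp_all add: algebra_simps)
  have g0: "Gamma z \<noteq> 0" "Gamma (z + 1/2) \<noteq> 0" "Gamma (z + 1) \<noteq> 0" "Gamma (2 * z) \<noteq> 0" "Gamma (2 * z + 1) \<noteq> 0"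
    using ni z Re by (simp_all add: Gamma_eq_zero_iff)
  have b0: "barnes_G z \<noteq> 0" "barnes_G (z + 1/2) \<noteq> 0" using z Re by (simp_all add: barnes_G_nonzero_pos)
  define D where "D = exp (complex_of_real (ln 2))"
  \<comment> \<open>Legendre duplication at z and, next, at z + 1/2; the product of the two contains
    exactly the gamma factors of a unit step of \<open>barnes_dup\<close>.\<close>
  have d1: "Gamma z * Gamma (z + 1/2) = exp ((1 - 2 * z) * of_real (ln 2)) * of_real (sqrt pi) * Gamma (2 * z)"
    by (rule Gamma_legendre_duplication) (use ni z Re in auto)
  have d2: "Gamma (z + 1/2) * Gamma (z + 1) = exp ((- 2 * z) * of_real (ln 2)) * of_real (sqrt pi) * Gamma (2 * z + 1)"
    using Gamma_legendre_duplication[of "z + 1/2"] ni[of "z + 1/2"] ni[of "z + 1"] Re by (simp add: algebra_simps)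
  have pr: "(Gamma z * Gamma (z + 1/2)) * (Gamma (z + 1/2) * Gamma (z + 1)) =
      exp ((1 - 4 * z) * of_real (ln 2)) * of_real pi * (Gamma (2 * z) * Gamma (2 * z + 1))"
  proof -
    have s: "complex_of_real (sqrt pi) * of_real (sqrt pi) = of_real pi" by (simp add: of_real_mult[symmetric] del: of_real_mult)
    have e: "exp ((1 - 2 * z) * complex_of_real (ln 2)) * exp ((- 2 * z) * of_real (ln 2)) = exp ((1 - 4 * z) * of_real (ln 2))"
      unfolding exp_add[symmetric] by (simp add: algebra_simps)
    have r: "(A * S * G) * (B * S * G') = (A * B) * (S * S) * (G * G')" for A B S G G' :: complex
      by (simp add: mult_ac)
    show ?thesis unfolding d1 d2 r s e ..
  qed
  have ex: "dup_exponent z - dup_exponent (z + 1) = of_real (ln pi) - (4 * z - 1) * of_real (ln 2) + 0"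
  proof -
    have "ln (pi / 32) = ln pi - 5 * ln 2"
      using ln_realpow[of 2 5] by (simp add: ln_div)
    then have "complex_of_real (ln (pi / 32)) = of_real (ln pi) - 5 * of_real (ln 2)" by simp
    then show ?thesis unfolding dup_exponent_def by (simp add: algebra_simps power2_eq_square)
  qed
  have ex': "exp (- dup_exponent (z + 1)) = exp (- dup_exponent z) * (of_real pi * exp ((1 - 4 * z) * of_real (ln 2)))"
  proof -
    have "- dup_exponent (z + 1) = - dup_exponent z + (of_real (ln pi) + (1 - 4 * z) * of_real (ln 2))"
      using ex by (simp add: algebra_simps)
    then have "exp (- dup_exponent (z + 1)) = exp (- dup_exponent z) * (exp (of_real (ln pi)) * exp ((1 - 4 * z) * of_real (ln 2)))"
      by (simp only: exp_add)
    then show ?thesis by (simp add: exp_of_real)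
  qed
  have "barnes_dup (z + 1) = barnes_dup z * ((Gamma (2 * z) * Gamma (2 * z + 1)) / ((Gamma z * Gamma (z + 1/2)) * (Gamma (z + 1/2) * Gamma (z + 1))))"
    unfolding barnes_dup_def G(1,3,4) unfolding G(2) using g0 b0 by (simp add: field_simps power2_eq_square)
  also have "\<dots> = barnes_dup z / (of_real pi * exp ((1 - 4 * z) * of_real (ln 2)))"
    unfolding pr using g0 by simp
  finally show ?thesis unfolding ex' by simp
qed

text \<open>Divided by exp (dup_exponent z), the quotient is 1-periodic and so determined by its
  behaviour along z + n. Comparison with z = 2 removes the common growth factor made of G (n + 1)
  and G (2 * n + 1).\<close>

lemma barnes_dup_eq:
  assumes z: "Re z > 0"
  shows "barnes_dup z = barnes_dup 2 * exp (dup_exponent z)"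
proof -
  define H where "H z = barnes_dup z * exp (- dup_exponent z)" for z
  have Hn: "H (z + of_nat n) = H z" if "Re z > 0" for z n
  proof (induction n)
    case (Suc n)
    then show ?case using barnes_dup_periodic[of "z + of_nat n"] that by (simp add: H_def add_ac)
  qed simp
  define R where "R z n = barnes_ratio (2 * z - 1) (2 * n) / (barnes_ratio (z - 1) n * (barnes_ratio (z - 1 / 2) n)\<^sup>2 * barnes_ratio z n)" for z n
  define X where "X z n = (2 * z - 1) * of_real (ln (fact (2 * n))) + ((2 * z - 1)\<^sup>2 - (2 * z - 1)) / 2 * of_real (ln (2 * real n))
     - ((z - 1) * of_real (ln (fact n)) + ((z - 1)\<^sup>2 - (z - 1)) / 2 * of_real (ln (real n)))
     - 2 * ((z - 1 / 2) * of_real (ln (fact n)) + ((z - 1 / 2)\<^sup>2 - (z - 1 / 2)) / 2 * of_real (ln (real n)))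
     - (z * of_real (ln (fact n)) + (z\<^sup>2 - z) / 2 * of_real (ln (real n))) - dup_exponent (z + of_nat n)" for z n
  have R: "R z \<longlonglongrightarrow> 1" for z
  proof -
    have "strict_mono (\<lambda>n::nat. 2 * n)" by (simp add: strict_mono_def)
    from LIMSEQ_subseq_LIMSEQ[OF barnes_ratio_LIMSEQ this]
    have "(\<lambda>n. barnes_ratio (2 * z - 1) (2 * n)) \<longlonglongrightarrow> 1" by (simp add: o_def)
    then have "R z \<longlonglongrightarrow> 1 / (1 * 1\<^sup>2 * 1)" unfolding R_def by (intro tendsto_intros barnes_ratio_LIMSEQ) auto
    then show ?thesis by simp
  qed
  have HR: "H (z + of_nat n) = barnes_G (of_nat (2 * n) + 1) / barnes_G (of_nat n + 1) ^ 4 * (R z n * exp (X z n))" for z n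
  proof -
    have sh: "2 * (z + of_nat n) = (2 * z - 1) + of_nat (2 * n) + 1" "z + of_nat n = (z - 1) + of_nat n + 1"
      "z + of_nat n + 1 / 2 = (z - 1 / 2) + of_nat n + 1" by (simp_all add: algebra_simps)
    have "barnes_dup (z + of_nat n) = barnes_G ((2 * z - 1) + of_nat (2 * n) + 1) /
       (barnes_G ((z - 1) + of_nat n + 1) * (barnes_G ((z - 1 / 2) + of_nat n + 1))\<^sup>2 * barnes_G (z + of_nat n + 1))"
      unfolding barnes_dup_def sh(1) sh(3) using sh(2) by simp
    then have dup: "barnes_dup (z + of_nat n) = barnes_ratio (2 * z - 1) (2 * n) * (barnes_G (of_nat (2 * n) + 1) *
        exp ((2 * z - 1) * of_real (ln (fact (2 * n))) + ((2 * z - 1)\<^sup>2 - (2 * z - 1)) / 2 * of_real (ln (2 * real n)))) /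
       (barnes_ratio (z - 1) n * (barnes_G (of_nat n + 1) * exp ((z - 1) * of_real (ln (fact n)) + ((z - 1)\<^sup>2 - (z - 1)) / 2 * of_real (ln (real n)))) *
        (barnes_ratio (z - 1 / 2) n * (barnes_G (of_nat n + 1) * exp ((z - 1 / 2) * of_real (ln (fact n)) + ((z - 1 / 2)\<^sup>2 - (z - 1 / 2)) / 2 * of_real (ln (real n)))))\<^sup>2 *
        (barnes_ratio z n * (barnes_G (of_nat n + 1) * exp (z * of_real (ln (fact n)) + (z\<^sup>2 - z) / 2 * of_real (ln (real n))))))"
      unfolding barnes_G_eq_ratio[of "2 * z - 1"] barnes_G_eq_ratio[of "z - 1"] barnes_G_eq_ratio[of "z - 1 / 2"] barnes_G_eq_ratio[of z]
      by (simp only: of_nat_mult of_nat_numeral)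
    have alg: "r1 * (g2 * exp E1) / (r2 * (g * exp E2) * (r3 * (g * exp E3))\<^sup>2 * (r4 * (g * exp E4))) * exp (- d) =
        g2 / g ^ 4 * ((r1 / (r2 * r3\<^sup>2 * r4)) * exp (E1 - E2 - 2 * E3 - E4 - d))" for r1 r2 r3 r4 g g2 E1 E2 E3 E4 d :: complex
      unfolding exp_diff exp_minus exp_double by (simp add: divide_inverse inverse_mult_distrib power2_eq_square power4_eq_xxxx mult_ac)
    show ?thesis unfolding H_def dup alg R_def X_def ..
  qed
  \<comment> \<open>The error of Stirling's approximation to the logarithm of the central binomial
    coefficient; the exponents at z and at 2 turn out to differ by a multiple of it.\<close>
  define w :: "nat \<Rightarrow> real" where "w n = ln (fact (2 * n)) - 2 * ln (fact n) - (2 * real n * ln 2 - ln (real n) / 2 - ln pi / 2)" for n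
  have w: "w \<longlonglongrightarrow> 0"
  proof -
    define s where "s n = ln (fact n) - (real n * ln (real n) - real n + ln (real n) / 2 + ln (2 * pi) / 2)" for n
    have s: "s \<longlonglongrightarrow> 0" unfolding s_def by (rule ln_fact_Stirling)
    have "strict_mono (\<lambda>n::nat. 2 * n)" by (simp add: strict_mono_def)
    from LIMSEQ_subseq_LIMSEQ[OF s this] have "(\<lambda>n. s (2 * n)) \<longlonglongrightarrow> 0" by (simp add: o_def)
    from tendsto_diff[OF this tendsto_mult[OF tendsto_const s, of 2]] have "(\<lambda>n. s (2 * n) - 2 * s n) \<longlonglongrightarrow> 0" by simp
    moreover have "eventually (\<lambda>n. s (2 * n) - 2 * s n = w n) sequentially"
      using eventually_gt_at_top[of 0]
    proof eventually_elim
      case (elim n)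
      have "ln (real (2 * n)) = ln 2 + ln (real n)" using elim by (simp add: ln_mult)
      moreover have "ln (2 * pi) = ln 2 + ln pi" by (simp add: ln_mult)
      ultimately show ?case unfolding s_def w_def by (simp add: field_simps)
    qed
    ultimately show ?thesis by (rule Lim_transform_eventually)
  qed
  have XX: "X z n - X 2 n = (2 * z - 4) * of_real (w n)" if "n > 0" for z n
  proof -
    have l: "complex_of_real (ln (2 * real n)) = of_real (ln 2) + of_real (ln (real n))" using that by (simp add: ln_mult)
    have "ln (pi / 32) = ln pi - 5 * ln 2"
      using ln_realpow[of 2 5] by (simp add: ln_div)
    then have p: "complex_of_real (ln (pi / 32)) = of_real (ln pi) - 5 * of_real (ln 2)" by simp
    show ?thesis unfolding X_def w_def dup_exponent_def l p
      by (simp add: field_simps power2_eq_square)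
  qed
  have nzH: "H 2 \<noteq> 0"
  proof -
    have "barnes_G (2 * 2) \<noteq> 0" "barnes_G 2 \<noteq> 0" "barnes_G (2 + 1/2) \<noteq> 0" "barnes_G (2 + 1) \<noteq> 0" by (simp_all add: barnes_G_nonzero_pos)
    then show ?thesis by (simp add: H_def barnes_dup_def)
  qed
  have "(\<lambda>n. R z n / R 2 n * exp ((2 * z - 4) * of_real (w n))) \<longlonglongrightarrow> 1 / 1 * exp ((2 * z - 4) * of_real 0)"
    by (intro tendsto_intros R w) auto
  moreover have "eventually (\<lambda>n. R z n / R 2 n * exp ((2 * z - 4) * of_real (w n)) = H z / H 2) sequentially"
    using eventually_gt_at_top[of 0]
  proof eventually_elim
    case (elim n)
    define c where "c = barnes_G (of_nat (2 * n) + 1) / barnes_G (of_nat n + 1) ^ 4"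
    have "c \<noteq> 0" unfolding c_def by (simp add: barnes_G_nonzero_pos)
    moreover have "H z = c * (R z n * exp (X z n))" "H 2 = c * (R 2 n * exp (X 2 n))"
      using HR[of z n] HR[of 2 n] Hn[OF z, of n] Hn[of 2 n] by (simp_all add: c_def)
    moreover have "exp ((2 * z - 4) * of_real (w n)) = exp (X z n) / exp (X 2 n)"
      unfolding XX[OF elim, symmetric] by (rule exp_diff)
    ultimately show ?case by simp
  qed
  ultimately have "(\<lambda>n::nat. H z / H 2) \<longlonglongrightarrow> 1" by (auto elim: Lim_transform_eventually)
  then have "H z = H 2" using nzH by (simp add: LIMSEQ_const_iff)
  moreover have "barnes_dup z = H z * exp (dup_exponent z)" by (simp add: H_def exp_minus)
  moreover have "H 2 = barnes_dup 2" by (simp add: H_def dup_exponent_def)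
  ultimately show ?thesis by simp
qed

text \<open>What \<open>barnes_dup\<close> leaves of the G quotient. Normalised at 2 and taken at 2
  - q, it is the Mellin transform of the inverse beta factor with parameters 2, 1/2, 1/2.\<close>

definition barnes_K :: "complex \<Rightarrow> complex" where
  "barnes_K w = (barnes_G (w + 1 / 2))\<^sup>2 / (barnes_G w * barnes_G (w + 1))"

lemma critical_mellin_factorization:
  assumes q: "Re q < 1"
  shows "critical_mellin q = exp (q * of_real (ln (pi / 32)) + 2 * q\<^sup>2 * of_real (ln 2)) *
     (barnes_K (2 - q) / barnes_K 2) * (2 / (2 - q)) * Gamma (1 - q)"
proof -
  have *: "critical_mellin q = barnes_dup 2 * exp (q * of_real (ln (pi / 32)) + 2 * q\<^sup>2 * of_real (ln 2)) * barnes_K (2 - q) * Gamma (1 - q) / (2 - q)"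
    if q: "Re q < 1" for q
  proof -
    have ni: "w \<notin> \<int>\<^sub>\<le>\<^sub>0" if "Re w > 0" for w using that by (auto elim!: nonpos_Ints_cases)
    have n: "1 - q \<notin> \<int>\<^sub>\<le>\<^sub>0" "2 - q \<notin> \<int>\<^sub>\<le>\<^sub>0" "3 - q \<notin> \<int>\<^sub>\<le>\<^sub>0" using q by (auto intro!: ni)
    have G: "barnes_G (2 - q) = Gamma (1 - q) * barnes_G (1 - q)" "barnes_G (2 - q + 1) = Gamma (2 - q) * barnes_G (2 - q)"
      "barnes_G (4 - q) = Gamma (3 - q) * barnes_G (2 - q + 1)"
      using barnes_G_plus1[OF n(1)] barnes_G_plus1[OF n(2)] barnes_G_plus1[OF n(3)] by (simp_all add: algebra_simps)
    have g3: "Gamma (3 - q) = (2 - q) * Gamma (2 - q)"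
      using Gamma_plus1[of "2 - q"] n(2) by (simp add: algebra_simps)
    have nz: "barnes_G (1 - q) \<noteq> 0" "barnes_G (2 - q + 1/2) \<noteq> 0" "Gamma (1 - q) \<noteq> 0" "Gamma (2 - q) \<noteq> 0" "2 - q \<noteq> 0"
      using q n by (auto simp: barnes_G_nonzero_pos Gamma_eq_zero_iff)
    have "critical_mellin q = barnes_dup (2 - q) * barnes_K (2 - q) * Gamma (1 - q) / (2 - q)"
    proof -
      have e: "4 - 2 * q = 2 * (2 - q)" by simp
      show ?thesis
        unfolding critical_mellin_def barnes_dup_def barnes_K_def e G(3) g3
        unfolding G(2) unfolding G(1) using nz by (simp add: field_simps power2_eq_square)
    qed
    also have "barnes_dup (2 - q) = barnes_dup 2 * exp (q * of_real (ln (pi / 32)) + 2 * q\<^sup>2 * of_real (ln 2))"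
      using barnes_dup_eq[of "2 - q"] q by (simp add: dup_exponent_def)
    finally show ?thesis .
  qed
  \<comment> \<open>The case q = 0, where the transform equals 1, eliminates the constant
    \<open>barnes_dup 2\<close> without evaluating G at half-integers.\<close>
  from *[of 0] have "barnes_dup 2 * barnes_K 2 = 2" by simp
  moreover from this have "barnes_K 2 \<noteq> 0" by auto
  ultimately have "barnes_dup 2 = 2 / barnes_K 2" by (simp add: field_simps)
  then show ?thesis unfolding *[OF q] by simp
qed

section \<open>Levy-Khintchine exponents\<close>

lemma exp_diff_bound:
  fixes a b :: complex
  assumes "Re a \<ge> x" "Re b \<ge> x" "t \<ge> 0"
  shows "norm (exp (- (a * of_real t)) - exp (- (b * of_real t))) \<le> norm (a - b) * t * exp (- (x * t))"
proof -
  have "norm (exp (- (a * of_real t)) - exp (- (b * of_real t))) \<le> (t * exp (- (x * t))) * norm (a - b)"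
  proof (rule field_differentiable_bound[of "{w. Re w \<ge> x}" "\<lambda>w. exp (- (w * of_real t))" "\<lambda>w. - of_real t * exp (- (w * of_real t))"])
    show "((\<lambda>w. exp (- (w * of_real t))) has_field_derivative - of_real t * exp (- (z * of_real t))) (at z within {w. Re w \<ge> x})" for z
      by (auto intro!: derivative_eq_intros)
    show "norm (- of_real t * exp (- (z * of_real t))) \<le> t * exp (- (x * t))" if "z \<in> {w. Re w \<ge> x}" for z
      using that assms by (simp add: norm_mult mult_left_mono mult_right_mono)
  qed (use assms in \<open>auto simp: convex_halfspace_Re_ge\<close>)
  then show ?thesis by (simp add: mult_ac)
qed

text \<open>For b = 1 differentiation in a cancels the denominator and leaves -1/a. So the integral
  plus ln a is constant, and it vanishes at a = 1; the general case is a difference of two such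
  integrals.\<close>

lemma Frullani:
  assumes a: "Re a > 0" and b: "Re b > 0"
  shows "set_integrable lborel {0<..} (\<lambda>t. (exp (- (a * of_real t)) - exp (- (b * of_real t))) / of_real t)"
    and "(LINT t:{0<..}|lborel. (exp (- (a * of_real t)) - exp (- (b * of_real t))) / of_real t) = ln b - ln a"
proof -
  have meas: "(\<lambda>t. indicat_real {0<..} t *\<^sub>R ((exp (- (a * of_real t)) - exp (- (b * of_real t))) / of_real t)) \<in> borel_measurable lborel" for a b :: complex
    by (auto intro!: borel_measurable_continuous_on_indicator continuous_intros)
  have bnd: "norm (indicat_real {0<..} t *\<^sub>R ((exp (- (a * of_real t)) - exp (- (b * of_real t))) / of_real t)) \<le>
     indicat_real {0<..} t *\<^sub>R (B * exp (- (x * t)))" if "Re a \<ge> x" "Re b \<ge> x" "norm (a - b) \<le> B" for a b x t B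
  proof (cases "t > 0")
    case True
    have "norm (exp (- (a * of_real t)) - exp (- (b * of_real t))) \<le> norm (a - b) * t * exp (- (x * t))"
      by (rule exp_diff_bound) (use that True in auto)
    also have "\<dots> \<le> B * t * exp (- (x * t))" using that True by (intro mult_right_mono) auto
    finally show ?thesis using True by (simp add: norm_divide divide_le_eq mult_ac)
  qed simp
  have ii: "integrable lborel (\<lambda>t. indicat_real {0<..} t *\<^sub>R (B * exp (- (x * t))))" if "x > 0" for x B :: real
    using set_integrable_mult_right[OF integral_exp_Ioi(1)[OF that], of B] unfolding set_integrable_def by simp
  have int: "set_integrable lborel {0<..} (\<lambda>t. (exp (- (a * of_real t)) - exp (- (b * of_real t))) / of_real t)" if "Re a > 0" "Re b > 0" for a b
    unfolding set_integrable_def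
  proof (rule Bochner_Integration.integrable_bound[OF ii[of "min (Re a) (Re b)" "norm (a - b)"] meas])
    have "norm (indicat_real {0<..} t *\<^sub>R ((exp (- (a * of_real t)) - exp (- (b * of_real t))) / of_real t)) \<le>
       norm (indicat_real {0<..} t *\<^sub>R (norm (a - b) * exp (- (min (Re a) (Re b) * t))))" for t
      unfolding real_norm_def by (rule order_trans[OF bnd abs_ge_self]) auto
    then show "AE t in lborel. norm (indicat_real {0<..} t *\<^sub>R ((exp (- (a * of_real t)) - exp (- (b * of_real t))) / of_real t)) \<le>
       norm (indicat_real {0<..} t *\<^sub>R (norm (a - b) * exp (- (min (Re a) (Re b) * t))))" by (intro AE_I2)
  qed (use that in auto)
  show "set_integrable lborel {0<..} (\<lambda>t. (exp (- (a * of_real t)) - exp (- (b * of_real t))) / of_real t)"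
    by (rule int[OF a b])
  define f where "f w = (LINT t:{0<..}|lborel. (exp (- (w * of_real t)) - exp (- (1 * of_real t))) / of_real t)" for w :: complex
  have df: "(f has_field_derivative - (1 / z)) (at z)" if z: "Re z > 0" for z
  proof -
    define r where "r = Re z / 2"
    have r: "r > 0" using z by (simp add: r_def)
    have Re: "r < Re w" if "w \<in> ball z r" for w
    proof -
      have "Re (z - w) \<le> norm (z - w)" by (rule complex_Re_le_cmod)
      with that show ?thesis by (simp add: r_def dist_norm)
    qed
    have dd: "((\<lambda>w. indicat_real {0<..} t *\<^sub>R ((exp (- (w * of_real t)) - exp (- (1 * of_real t))) / of_real t)) has_field_derivative
        indicat_real {0<..} t *\<^sub>R (- exp (- (w * of_real t)))) (at w within A)" for t and w :: complex and A
      by (cases "t > 0") (auto intro!: derivative_eq_intros)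
    have "(f has_field_derivative (LINT t|lborel. deriv (\<lambda>w. indicat_real {0<..} t *\<^sub>R ((exp (- (w * of_real t)) - exp (- (1 * of_real t))) / of_real t)) z)) (at z)"
      unfolding f_def set_lebesgue_integral_def
    proof (rule has_field_derivative_integral[OF r, where g = "\<lambda>t. indicat_real {0<..} t *\<^sub>R ((norm z + r + 1) * exp (- (min r 1 * t)))"])
      show "(\<lambda>w. indicat_real {0<..} t *\<^sub>R ((exp (- (w * of_real t)) - exp (- (1 * of_real t))) / of_real t)) holomorphic_on ball z r" for t
        unfolding holomorphic_on_def field_differentiable_def using dd by blast
      show "norm (indicat_real {0<..} t *\<^sub>R ((exp (- (w * of_real t)) - exp (- (1 * of_real t))) / of_real t)) \<le>
          indicat_real {0<..} t *\<^sub>R ((norm z + r + 1) * exp (- (min r 1 * t)))" if w: "w \<in> ball z r" for w t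
      proof (rule bnd)
        have "norm (w - 1) \<le> norm w + 1" using norm_triangle_ineq4[of w 1] by simp
        moreover have "norm w \<le> norm z + norm (w - z)" using norm_triangle_ineq[of z "w - z"] by simp
        ultimately show "norm (w - 1) \<le> norm z + r + 1" using w by (simp add: dist_norm norm_minus_commute)
      qed (use Re[OF w] in auto)
      show "integrable lborel (\<lambda>t. indicat_real {0<..} t *\<^sub>R ((norm z + r + 1) * exp (- (min r 1 * t))))"
        by (rule ii) (use r in auto)
    qed (rule meas)
    also have "(\<lambda>t. deriv (\<lambda>w. indicat_real {0<..} t *\<^sub>R ((exp (- (w * of_real t)) - exp (- (1 * of_real t))) / of_real t)) z) =
       (\<lambda>t. - (indicat_real {0<..} t *\<^sub>R exp (- (z * of_real t))))"
      using DERIV_imp_deriv[OF dd] by simp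
    also have "(LINT t|lborel. - (indicat_real {0<..} t *\<^sub>R exp (- (z * of_real t)))) = - (LINT t:{0<..}|lborel. exp (- (z * of_real t)))"
      by (simp add: set_lebesgue_integral_def)
    also have "(LINT t:{0<..}|lborel. exp (- (z * of_real t))) = (LINT t:{0<..}|lborel. complex_of_real t powr (1 - 1) * exp (- (z * of_real t)))"
      by (rule set_lebesgue_integral_cong) auto
    also have "\<dots> = 1 / z" by (subst Laplace_powr) (use z in \<open>auto simp: powr_minus inverse_eq_divide\<close>)
    finally show ?thesis .
  qed
  have "\<exists>c. \<forall>w\<in>{w. Re w > 0}. f w + ln w = c"
  proof (rule has_field_derivative_zero_constant[OF convex_halfspace_Re_gt])
    fix w assume "w \<in> {w. Re w > 0}"
    then have w: "Re w > 0" by simp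
    then have "((\<lambda>w. f w + ln w) has_field_derivative (- (1 / w) + 1 / w)) (at w within {w. Re w > 0})"
      by (intro DERIV_add has_field_derivative_at_within[OF df] has_field_derivative_at_within[OF has_field_derivative_Ln[unfolded inverse_eq_divide]])
         (auto simp: complex_nonpos_Reals_iff)
    then show "((\<lambda>w. f w + ln w) has_field_derivative 0) (at w within {w. Re w > 0})" by simp
  qed
  then obtain c where c: "\<And>w. Re w > 0 \<Longrightarrow> f w + ln w = c" by auto
  have "c = 0" using c[of 1] by (simp add: f_def)
  with c have fl: "f w = - ln w" if "Re w > 0" for w using that by (simp add: add_eq_0_iff)
  have "(LINT t:{0<..}|lborel. (exp (- (a * of_real t)) - exp (- (b * of_real t))) / of_real t) = f a - f b"
    unfolding f_def using int[OF a, of 1] int[OF b, of 1]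
    by (subst set_integral_diff(2)[symmetric]) (auto intro!: set_lebesgue_integral_cong simp: diff_divide_distrib)
  then show "(LINT t:{0<..}|lborel. (exp (- (a * of_real t)) - exp (- (b * of_real t))) / of_real t) = ln b - ln a"
    using fl[OF a] fl[OF b] by simp
qed

text \<open>In this quotient the factorials, G (n + 1) and the w-dependent powers of n cancel; the
  quadratic exponents leave n^(-1/4).\<close>

lemma barnes_K_asymp: "(\<lambda>n. barnes_K (w + of_nat n) * exp (of_real (ln (real n)) / 4)) \<longlonglongrightarrow> 1"
proof -
  have "barnes_K (w + of_nat n) * exp (of_real (ln (real n)) / 4) =
      (barnes_ratio (w - 1 / 2) n)\<^sup>2 / (barnes_ratio (w - 1) n * barnes_ratio w n)" for n
  proof -
    define g F L where "g = barnes_G (of_nat n + 1)" and "F = complex_of_real (ln (fact n))" and "L = complex_of_real (ln (real n))"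
    have g: "g \<noteq> 0" unfolding g_def by (rule barnes_G_nonzero_pos) simp
    have sh: "w + of_nat n + 1 / 2 = (w - 1 / 2) + of_nat n + 1" "w + of_nat n = (w - 1) + of_nat n + 1" by (simp_all add: algebra_simps)
    have K: "barnes_K (w + of_nat n) = (barnes_G ((w - 1 / 2) + of_nat n + 1))\<^sup>2 / (barnes_G ((w - 1) + of_nat n + 1) * barnes_G (w + of_nat n + 1))"
      unfolding barnes_K_def sh(1) using sh(2) by simp
    have alg: "(r1 * (g * exp E1))\<^sup>2 / ((r2 * (g * exp E2)) * (r3 * (g * exp E3))) * exp E4 = r1\<^sup>2 / (r2 * r3)"
      if "2 * E1 + E4 = E2 + E3" for r1 r2 r3 E1 E2 E3 E4
    proof -
      have "(exp E1)\<^sup>2 * exp E4 = exp E2 * exp E3" unfolding exp_double[symmetric] exp_add[symmetric] that ..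
      then show ?thesis using g by (simp add: power_mult_distrib power2_eq_square field_simps) 
    qed
    show ?thesis unfolding K barnes_G_eq_ratio g_def[symmetric] F_def[symmetric] L_def[symmetric]
      by (rule alg) (simp add: field_simps power2_eq_square)
  qed
  moreover have "(\<lambda>n. (barnes_ratio (w - 1 / 2) n)\<^sup>2 / (barnes_ratio (w - 1) n * barnes_ratio w n)) \<longlonglongrightarrow> 1\<^sup>2 / (1 * 1)"
    by (intro tendsto_intros barnes_ratio_LIMSEQ) auto
  ultimately show ?thesis by simp
qed

text \<open>The combination of half steps collapses to unit steps of G and leaves an elementary
  factor. Together with the growth rate this relation determines \<open>barnes_K\<close>.\<close>

lemma barnes_K_quadruple:
  assumes w: "Re w > 0"
  shows "barnes_K w * (barnes_K (w + 1 / 2))\<^sup>2 * barnes_K (w + 1) = 1 / w"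
proof -
  have ni: "w \<notin> \<int>\<^sub>\<le>\<^sub>0" if "Re w > 0" for w using that by (auto elim!: nonpos_Ints_cases)
  have Re: "Re (w + 1/2) > 0" "Re (w + 1) > 0" using w by auto
  have G: "barnes_G (w + 1 + 1) = w * Gamma w * barnes_G (w + 1)" "barnes_G (w + 1) = Gamma w * barnes_G w"
    using barnes_G_plus1[OF ni[OF w]] barnes_G_plus1[OF ni[OF Re(2)]] Gamma_plus1[of w] ni[OF w] by (auto simp: mult_ac)
  have e: "w + 1 / 2 + 1 / 2 = w + 1" "w + 1 / 2 + 1 = w + 1 + 1 / 2" by simp_all
  have nz: "barnes_G w \<noteq> 0" "barnes_G (w + 1 / 2) \<noteq> 0" "barnes_G (w + 1 + 1 / 2) \<noteq> 0" "Gamma w \<noteq> 0" "w \<noteq> 0"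
    using w ni[OF w] by (auto simp: barnes_G_nonzero_pos Gamma_eq_zero_iff)
  show ?thesis unfolding barnes_K_def e G(1) unfolding G(2) using nz by (simp add: field_simps power2_eq_square)
qed

text \<open>Multiplication by \<open>(1 + exp (- t / 2))\<^sup>2\<close> is the combination of shifts in \<open>barnes_K_quadruple\<close>.\<close>

definition levy_K :: "real \<Rightarrow> real" where
  "levy_K t = 1 / (1 + exp (- t / 2))\<^sup>2"

text \<open>Subtracting 1/4, the value of \<open>levy_K\<close> at 0, removes the singularity 1/t of
  the integrand. The subtracted part reappears, by Frullani, as the term - ln w / 4.\<close>

definition barnes_K_tail :: "complex \<Rightarrow> complex" where
  "barnes_K_tail w = (LINT t:{0<..}|lborel. of_real ((levy_K t - 1 / 4) / t) * exp (- (w * of_real t)))"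

lemma measurable_levy_K [measurable]: "levy_K \<in> borel_measurable borel"
  unfolding levy_K_def by measurable

lemma levy_K_bound: obtains C where "\<And>t. t > 0 \<Longrightarrow> \<bar>(levy_K t - 1 / 4) / t\<bar> \<le> C"
proof -
  have ne: "1 + exp (- (t / 2)) \<noteq> (0 :: real)" for t using exp_gt_zero[of "- (t / 2)"] by linarith
  have "continuous_on {0<..} (\<lambda>t. (levy_K t - 1 / 4) / t)"
    unfolding levy_K_def by (intro continuous_intros) (auto simp: ne)
  moreover have "((\<lambda>t. (levy_K t - 1 / 4) / t) \<longlongrightarrow> 1 / 8) (at_right 0)" "((\<lambda>t. (levy_K t - 1 / 4) / t) \<longlongrightarrow> 0) at_top"
    unfolding levy_K_def by real_asymp+
  ultimately obtain C where "\<And>t. t > 0 \<Longrightarrow> \<bar>(levy_K t - 1 / 4) / t\<bar> \<le> C" using bounded_on_Ioi by blast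
  then show ?thesis by (rule that)
qed

lemma barnes_K_tail_integrable:
  "Re w > 0 \<Longrightarrow> set_integrable lborel {0<..} (\<lambda>t. of_real ((levy_K t - 1 / 4) / t) * exp (- (w * of_real t)))"
proof -
  obtain C where "\<And>t. t > 0 \<Longrightarrow> \<bar>(levy_K t - 1 / 4) / t\<bar> \<le> C" using levy_K_bound by blast
  then show "Re w > 0 \<Longrightarrow> ?thesis" by (intro Laplace_bounded(1)) auto
qed

lemma barnes_K_tail_quadruple:
  assumes w: "Re w > 0"
  shows "barnes_K_tail w + 2 * barnes_K_tail (w + 1 / 2) + barnes_K_tail (w + 1) = ln (w + 1 / 2) / 2 + ln (w + 1) / 4 - 3 / 4 * ln w"
proof -
  have Re: "Re (w + 1/2) > 0" "Re (w + 1) > 0" using w by auto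
  note A = barnes_K_tail_integrable
  note F1 = Frullani[OF w Re(1)] and F2 = Frullani[OF w Re(2)]
  have "barnes_K_tail w + 2 * barnes_K_tail (w + 1 / 2) + barnes_K_tail (w + 1) =
    (LINT t:{0<..}|lborel. of_real ((levy_K t - 1 / 4) / t) * exp (- (w * of_real t)) + 2 * (of_real ((levy_K t - 1 / 4) / t) * exp (- ((w + 1 / 2) * of_real t)))
       + of_real ((levy_K t - 1 / 4) / t) * exp (- ((w + 1) * of_real t)))"
  proof -
    define f where "f v t = of_real ((levy_K t - 1 / 4) / t) * exp (- (v * complex_of_real t))" for v t
    have fi: "set_integrable lborel {0<..} (f w)" "set_integrable lborel {0<..} (f (w + 1 / 2))" "set_integrable lborel {0<..} (f (w + 1))"
      unfolding f_def using A[OF w] A[OF Re(1)] A[OF Re(2)] by blast+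
    show ?thesis unfolding barnes_K_tail_def f_def[symmetric] by (simp add: set_integral_add fi)
  qed
  also have "\<dots> = (LINT t:{0<..}|lborel. 1 / 2 * ((exp (- (w * of_real t)) - exp (- ((w + 1 / 2) * of_real t))) / of_real t)
       + 1 / 4 * ((exp (- (w * of_real t)) - exp (- ((w + 1) * of_real t))) / of_real t))"
  proof (rule set_lebesgue_integral_cong)
    show "\<forall>t. t \<in> {0<..} \<longrightarrow> of_real ((levy_K t - 1 / 4) / t) * exp (- (w * of_real t)) + 2 * (of_real ((levy_K t - 1 / 4) / t) * exp (- ((w + 1 / 2) * of_real t)))
       + of_real ((levy_K t - 1 / 4) / t) * exp (- ((w + 1) * of_real t)) =
       1 / 2 * ((exp (- (w * of_real t)) - exp (- ((w + 1 / 2) * of_real t))) / of_real t)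
       + 1 / 4 * ((exp (- (w * of_real t)) - exp (- ((w + 1) * of_real t))) / of_real t)"
    proof (intro allI impI)
      fix t :: real assume t: "t \<in> {0<..}"
      define u where "u = exp (- t / 2)"
      define E where "E = exp (- (w * of_real t))"
      have u: "u > 0" by (simp add: u_def)
      have e1: "exp (- ((w + 1 / 2) * of_real t)) = E * of_real u"
        unfolding E_def u_def exp_of_real[symmetric] by (simp add: exp_add[symmetric] algebra_simps)
      have e2: "exp (- ((w + 1) * of_real t)) = E * of_real (u\<^sup>2)"
        unfolding E_def u_def exp_double[symmetric] exp_of_real[symmetric] by (simp add: exp_add[symmetric] algebra_simps)
      have K: "levy_K t * (1 + u)\<^sup>2 = 1" unfolding levy_K_def u_def[symmetric] using u by simp
      have c: "c * E + 2 * (c * (E * U)) + c * (E * U\<^sup>2) = E * (c * (1 + U)\<^sup>2)" for c U :: complex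
        by (simp add: algebra_simps power2_eq_square)
      \<comment> \<open>The identity 1 - (1 + u)^2 / 4 = (1 - u) / 2 + (1 - u^2) / 4 splits the
        combination into the Frullani integrands for the shifts 1/2 and 1.\<close>
      have r: "(levy_K t - 1 / 4) / t * (1 + u)\<^sup>2 = 1 / 2 * ((1 - u) / t) + 1 / 4 * ((1 - u\<^sup>2) / t)"
      proof -
        have "(levy_K t - 1 / 4) / t * (1 + u)\<^sup>2 = (levy_K t * (1 + u)\<^sup>2 - (1 + u)\<^sup>2 / 4) / t"
          by (simp add: left_diff_distrib)
        also have "\<dots> = 1 / 2 * ((1 - u) / t) + 1 / 4 * ((1 - u\<^sup>2) / t)"
          unfolding K using t by (simp add: field_simps power2_eq_square)
        finally show ?thesis .
      qed
      have "of_real ((levy_K t - 1 / 4) / t) * E + 2 * (of_real ((levy_K t - 1 / 4) / t) * (E * of_real u)) + of_real ((levy_K t - 1 / 4) / t) * (E * of_real (u\<^sup>2))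
        = E * of_real ((levy_K t - 1 / 4) / t * (1 + u)\<^sup>2)"
        using c[of "of_real ((levy_K t - 1 / 4) / t)" "of_real u"] by (simp only: of_real_mult of_real_add of_real_power of_real_1)
      also have "\<dots> = 1 / 2 * ((E - E * of_real u) / of_real t) + 1 / 4 * ((E - E * of_real (u\<^sup>2)) / of_real t)"
        unfolding r by (simp add: algebra_simps diff_divide_distrib)
      finally show "of_real ((levy_K t - 1 / 4) / t) * exp (- (w * of_real t)) + 2 * (of_real ((levy_K t - 1 / 4) / t) * exp (- ((w + 1 / 2) * of_real t)))
       + of_real ((levy_K t - 1 / 4) / t) * exp (- ((w + 1) * of_real t)) =
       1 / 2 * ((exp (- (w * of_real t)) - exp (- ((w + 1 / 2) * of_real t))) / of_real t)
       + 1 / 4 * ((exp (- (w * of_real t)) - exp (- ((w + 1) * of_real t))) / of_real t)"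
        unfolding e1 e2 E_def[symmetric] .
    qed
  qed simp
  also have "\<dots> = 1 / 2 * (ln (w + 1 / 2) - ln w) + 1 / 4 * (ln (w + 1) - ln w)"
  proof -
    define f where "f v t = (exp (- (w * complex_of_real t)) - exp (- (v * complex_of_real t))) / complex_of_real t" for v t
    have "set_integrable lborel {0<..} (f (w + 1 / 2))" "set_integrable lborel {0<..} (f (w + 1))"
      "(LINT t:{0<..}|lborel. f (w + 1 / 2) t) = ln (w + 1 / 2) - ln w" "(LINT t:{0<..}|lborel. f (w + 1) t) = ln (w + 1) - ln w"
      unfolding f_def using F1 F2 by blast+
    then show ?thesis unfolding f_def[symmetric] by (simp add: set_integral_add)
  qed
  also have "1 / 2 * (ln (w + 1 / 2) - ln w) + 1 / 4 * (ln (w + 1) - ln w) = ln (w + 1 / 2) / 2 + ln (w + 1) / 4 - 3 / 4 * ln w"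
    by (simp add: field_simps)
  finally show ?thesis .
qed

text \<open>The quotient V of both sides satisfies V w * V (w + 1/2)^2 * V (w + 1) = 1 and tends to
  1 along w + n. For S w = V w * V (w + 1/2) this reads S w * S (w + 1/2) = 1, so S has period 1 and
  hence S = 1; the same argument once more gives V = 1.\<close>

lemma barnes_K_eq:
  assumes w: "Re w > 0"
  shows "barnes_K w = exp (barnes_K_tail w - ln w / 4)"
proof -
  define V where "V w = barnes_K w * exp (ln w / 4 - barnes_K_tail w)" for w
  have lim: "(\<lambda>n. V (w + of_nat n)) \<longlonglongrightarrow> 1" for w
  proof -
    obtain C where C: "\<And>t. t > 0 \<Longrightarrow> \<bar>(levy_K t - 1 / 4) / t\<bar> \<le> C" using levy_K_bound by blast
    have t: "(\<lambda>n. barnes_K_tail (w + of_nat n)) \<longlonglongrightarrow> 0"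
      unfolding barnes_K_tail_def by (rule Laplace_bounded_tendsto_0[OF _ C]) auto
    have "(\<lambda>n. (barnes_K (w + of_nat n) * exp (of_real (ln (real n)) / 4)) * exp ((ln (w + of_nat n) - of_real (ln (real n))) / 4 - barnes_K_tail (w + of_nat n)))
       \<longlonglongrightarrow> 1 * exp (0 / 4 - 0)"
      by (intro tendsto_mult barnes_K_asymp tendsto_exp tendsto_diff t tendsto_divide Ln_add_of_nat_asymp tendsto_const) auto
    moreover have "(barnes_K (w + of_nat n) * exp (of_real (ln (real n)) / 4)) * exp ((ln (w + of_nat n) - of_real (ln (real n))) / 4 - barnes_K_tail (w + of_nat n)) = V (w + of_nat n)" for n
      unfolding V_def by (simp add: exp_add[symmetric] mult.assoc diff_divide_distrib)
    ultimately show ?thesis by simp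
  qed
  have four: "V w * (V (w + 1 / 2))\<^sup>2 * V (w + 1) = 1" if w: "Re w > 0" for w
  proof -
    have w0: "w \<noteq> 0" using w by auto
    have "V w * (V (w + 1 / 2))\<^sup>2 * V (w + 1) = (barnes_K w * (barnes_K (w + 1 / 2))\<^sup>2 * barnes_K (w + 1)) *
        exp ((ln w / 4 - barnes_K_tail w) + 2 * (ln (w + 1 / 2) / 4 - barnes_K_tail (w + 1 / 2)) + (ln (w + 1) / 4 - barnes_K_tail (w + 1)))"
      unfolding V_def exp_add exp_double by (simp add: power_mult_distrib mult_ac)
    also have "(ln w / 4 - barnes_K_tail w) + 2 * (ln (w + 1 / 2) / 4 - barnes_K_tail (w + 1 / 2)) + (ln (w + 1) / 4 - barnes_K_tail (w + 1)) = ln w"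
    proof -
      have lin: "(z / 4 - A) + 2 * (x / 4 - B) + (y / 4 - C) = z / 4 + x / 2 + y / 4 - (A + 2 * B + C)" for x y z A B C :: complex
        by (simp add: algebra_simps)
      show ?thesis unfolding lin barnes_K_tail_quadruple[OF w] by simp
    qed
    finally show ?thesis unfolding barnes_K_quadruple[OF w] using w0 by simp
  qed
  have per: "f w = 1" if per: "\<And>w. Re w > 0 \<Longrightarrow> f (w + 1) = f w" and "\<And>w. (\<lambda>n. f (w + of_nat n)) \<longlonglongrightarrow> 1" and w: "Re w > 0" for f :: "complex \<Rightarrow> complex" and w
  proof -
    have "f (w + of_nat n) = f w" for n
    proof (induction n)
      case (Suc n)
      then show ?case using per[of "w + of_nat n"] w by (simp add: add_ac)
    qed simp
    then show ?thesis using that(2)[of w] by (simp add: LIMSEQ_const_iff)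
  qed
  define S where "S w = V w * V (w + 1 / 2)" for w
  have SS: "S w * S (w + 1 / 2) = 1" if "Re w > 0" for w
  proof -
    have "w + 1 / 2 + 1 / 2 = w + 1" by simp
    then have "S w * S (w + 1 / 2) = V w * (V (w + 1 / 2))\<^sup>2 * V (w + 1)"
      unfolding S_def by (simp only: power2_eq_square mult.assoc)
    then show ?thesis using four[OF that] by simp
  qed
  have e: "w + 1 / 2 + 1 / 2 = w + 1" for w :: complex by simp
  have S: "S w = 1" if "Re w > 0" for w
  proof (rule per[of S])
    fix w :: complex assume w: "Re w > 0"
    have "S w * S (w + 1 / 2) = 1" "S (w + 1 / 2) * S (w + 1) = 1"
      using SS[of w] SS[of "w + 1/2"] w by (auto simp: e)
    then show "S (w + 1) = S w" by (metis mult.commute mult.left_commute mult_1)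
  next
    fix w
    have "(\<lambda>n. V (w + of_nat n) * V ((w + 1 / 2) + of_nat n)) \<longlonglongrightarrow> 1 * 1" by (intro tendsto_mult lim)
    then show "(\<lambda>n. S (w + of_nat n)) \<longlonglongrightarrow> 1" by (simp add: S_def add_ac)
  qed fact
  have "V w = 1"
  proof (rule per[of V, OF _ lim w])
    fix w :: complex assume w: "Re w > 0"
    have "V w * V (w + 1 / 2) = 1" "V (w + 1 / 2) * V (w + 1) = 1"
      using S[of w] S[of "w + 1/2"] w by (auto simp: S_def e)
    then show "V (w + 1) = V w" by (metis mult.commute mult.left_commute mult_1)
  qed
  then obtain x where x: "x = ln w / 4 - barnes_K_tail w" "barnes_K w * exp x = 1" unfolding V_def by blast
  from x(2) have "barnes_K w = exp (- x)" by (simp add: exp_minus field_simps)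
  then show ?thesis by (simp add: x(1))
qed

section \<open>Exponents of the factors on the imaginary axis\<close>

lemma exp_minus_axis:
  "exp (- ((of_real m - \<i> * of_real t) * of_real x)) = exp (- (of_real m * of_real x)) * iexp (t * x)"
  by (simp add: exp_add[symmetric] algebra_simps)

lemma Ln_axis_levy:
  assumes m: "m > 0"
  shows "ln (of_real m) - ln (of_real m - \<i> * of_real t) =
     (LINT x:{0<..}|lborel. (iexp (t * x) - 1) * of_real (exp (- (m * x)) / x))"
proof -
  have "ln (of_real m) - ln (of_real m - \<i> * of_real t) =
     (LINT x:{0<..}|lborel. (exp (- ((of_real m - \<i> * of_real t) * of_real x)) - exp (- (of_real m * of_real x))) / of_real x)"
    by (rule Frullani(2)[symmetric]) (use m in auto)
  also have "\<dots> = (LINT x:{0<..}|lborel. (iexp (t * x) - 1) * of_real (exp (- (m * x)) / x))"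
  proof (rule set_lebesgue_integral_cong)
    have "(exp (- ((of_real m - \<i> * of_real t) * of_real x)) - exp (- (of_real m * of_real x))) / of_real x =
        (iexp (t * x) - 1) * of_real (exp (- (m * x)) / x)" for x
      unfolding exp_minus_axis of_real_divide exp_of_real[symmetric] of_real_minus of_real_mult[of m]
      by (simp add: algebra_simps)
    then show "\<forall>x. x \<in> {0<..} \<longrightarrow> (exp (- ((of_real m - \<i> * of_real t) * of_real x)) - exp (- (of_real m * of_real x))) / of_real x =
        (iexp (t * x) - 1) * of_real (exp (- (m * x)) / x)" by blast
  qed simp
  finally show ?thesis .
qed

text \<open>The exponent of the exponential law of rate m, whose Levy density is exp (- m * x) /
  x.\<close>

lemma ID_exponent_exponential:
  assumes m: "m > 0"
  shows "ID_exponent (\<lambda>t. ln (of_real m) - ln (of_real m - \<i> * of_real t))"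
  unfolding Ln_axis_levy[OF m]
proof (rule ID_exponent_levy)
  show "set_integrable lborel {0<..} (\<lambda>x. x * (exp (- (m * x)) / x))"
    by (rule set_integrable_cong[THEN iffD1, OF refl refl _ integral_exp_Ioi(1)[OF m]]) auto
qed auto

text \<open>The Gumbel law as a limit of sums of independent exponential variables of rates 1, ...,
  n + 1, shifted by - ln n; the exponents are those of \<open>ln_Gamma_series\<close> up to a
  vanishing constant.\<close>

lemma ID_exponent_ln_Gamma: "ID_exponent (\<lambda>t. ln_Gamma (1 - \<i> * of_real t))"
proof (rule ID_exponent_LIMSEQ)
  define E where "E k t = ln (of_real (real k)) - ln (of_real (real k) - \<i> * of_real t)" for k t
  define f where "f n t = \<i> * of_real (- ln (real n) * t) + (\<Sum>k\<in>{1..Suc n}. E k t)" for n t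
  show "ID_exponent (f n)" for n
    unfolding f_def E_def by (intro ID_exponent_add ID_exponent_drift ID_exponent_sum ID_exponent_exponential) auto
  fix t :: real
  define z where "z = 1 - \<i> * of_real t"
  have zn: "z \<notin> \<int>\<^sub>\<le>\<^sub>0" by (auto simp: z_def elim!: nonpos_Ints_cases simp: complex_eq_iff)
  \<comment> \<open>Rate 1 comes from - ln z and rate k + 1 from the k-th summand, since z / k + 1 =
    (k + 1 - i * t) / k.\<close>
  have eq: "ln_Gamma_series z n = f n t + of_real (ln (real n) - ln (real (Suc n)))" if n: "n > 0" for n
  proof -
    have summand: "ln (z / of_nat k + 1) = - E (Suc k) t + of_real (ln (real (Suc k)) - ln (real k))" if k: "k \<in> {1..n}" for k
    proof -
      have "z / of_nat k + 1 = of_real (1 / real k) * (of_real (real (Suc k)) - \<i> * of_real t)"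
        using k by (simp add: z_def field_simps)
      moreover have nz: "of_real (real (Suc k)) - \<i> * of_real t \<noteq> 0" by (simp add: complex_eq_iff)
      have "ln (of_real (1 / real k) * (of_real (real (Suc k)) - \<i> * of_real t)) =
          of_real (ln (1 / real k)) + ln (of_real (real (Suc k)) - \<i> * of_real t)"
        using Ln_times_of_real[OF _ nz, of "1 / real k"] Ln_of_real[of "1 / real k"] k by (simp del: of_nat_Suc)
      ultimately have "ln (z / of_nat k + 1) = of_real (ln (1 / real k)) + ln (of_real (real (Suc k)) - \<i> * of_real t)"
        by (simp only:)
      moreover have "complex_of_real (ln (real (Suc k))) = ln (of_real (real (Suc k)))" by (simp add: Ln_of_real del: of_nat_Suc)
      ultimately show ?thesis using k by (simp add: E_def ln_div)
    qed
    have "(\<Sum>k=1..n. ln (z / of_nat k + 1)) = (\<Sum>k=1..n. - E (Suc k) t) + (\<Sum>k=1..n. of_real (ln (real (Suc k)) - ln (real k)))"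
      by (simp only: sum.distrib[symmetric]) (rule sum.cong, auto simp: summand simp del: of_nat_Suc)
    also have "(\<Sum>k=1..n. of_real (ln (real (Suc k)) - ln (real k))) = (of_real (ln (real (Suc n))) :: complex)"
    proof -
      have "(\<Sum>k=1..n. ln (real (Suc k)) - ln (real k)) = ln (real (Suc n)) - ln (real 1)"
        using n by (intro sum_Suc_diff) auto
      then show ?thesis by (simp only: of_real_sum[symmetric]) simp
    qed
    also have "(\<Sum>k=1..n. - E (Suc k) t) = - (\<Sum>k\<in>{1..Suc n}. E k t) + E 1 t"
    proof -
      have "(\<Sum>k=1..n. g (Suc k)) = (\<Sum>k\<in>{1..Suc n}. g k) - g 1" for g :: "nat \<Rightarrow> complex"
        by (induction n) auto
      from this[of "\<lambda>k. E k t"] show ?thesis by (simp add: sum_negf)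
    qed
    finally have S: "(\<Sum>k=1..n. ln (z / of_nat k + 1)) = - (\<Sum>k\<in>{1..Suc n}. E k t) + E 1 t + of_real (ln (real (Suc n)))" .
    have "E 1 t = - ln z" by (simp add: E_def z_def)
    then have "ln_Gamma_series z n = z * of_real (ln (real n)) + (\<Sum>k\<in>{1..Suc n}. E k t) - of_real (ln (real (Suc n)))"
      unfolding ln_Gamma_series_def S using n by simp
    then show ?thesis by (simp add: f_def z_def algebra_simps)
  qed
  have "ln_Gamma_series z \<longlonglongrightarrow> ln_Gamma z" by (rule ln_Gamma_complex_LIMSEQ[OF zn])
  moreover have "(\<lambda>n. complex_of_real (ln (real n) - ln (real (Suc n)))) \<longlonglongrightarrow> of_real 0"
    by (rule tendsto_of_real) real_asymp
  ultimately have "(\<lambda>n. ln_Gamma_series z n - of_real (ln (real n) - ln (real (Suc n)))) \<longlonglongrightarrow> ln_Gamma z - of_real 0"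
    by (rule tendsto_diff)
  moreover have "eventually (\<lambda>n. ln_Gamma_series z n - of_real (ln (real n) - ln (real (Suc n))) = f n t) sequentially"
    using eventually_gt_at_top[of "0::nat"] by eventually_elim (simp add: eq)
  ultimately show "(\<lambda>n. f n t) \<longlonglongrightarrow> ln_Gamma (1 - \<i> * of_real t)"
    unfolding z_def by (auto elim: Lim_transform_eventually)
next
  have "isCont (\<lambda>t. 1 - \<i> * complex_of_real t) 0" by (intro continuous_intros)
  moreover have "isCont ln_Gamma (1 - \<i> * complex_of_real 0)"
  proof -
    have "(ln_Gamma has_field_derivative Digamma 1) (at (1::complex))"
      by (rule has_field_derivative_ln_Gamma_complex) auto
    then show ?thesis using DERIV_isCont by simp
  qed
  ultimately show "isCont (\<lambda>t. ln_Gamma (1 - \<i> * complex_of_real t)) 0" by (rule isCont_o2)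
qed

text \<open>The Frullani integral with weight 1/4 restores the subtracted constant, so that the
  increment from 2 to 2 - i * t has the nonnegative Levy density levy_K x * exp (- 2 * x) /
  x.\<close>

lemma ID_exponent_barnes_K: "ID_exponent (\<lambda>t. (barnes_K_tail (2 - \<i> * of_real t) - ln (2 - \<i> * of_real t) / 4) - (barnes_K_tail 2 - ln 2 / 4))"
proof -
  have "(barnes_K_tail (2 - \<i> * of_real t) - ln (2 - \<i> * of_real t) / 4) - (barnes_K_tail 2 - ln 2 / 4) =
     (LINT x:{0<..}|lborel. (iexp (t * x) - 1) * of_real (levy_K x * exp (- (2 * x)) / x))" for t
  proof -
    define f where "f v x = of_real ((levy_K x - 1 / 4) / x) * exp (- (v * complex_of_real x))" for v x
    define g where "g x = (exp (- ((2 - \<i> * of_real t) * of_real x)) - exp (- (2 * of_real x))) / complex_of_real x" for x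
    have fi: "set_integrable lborel {0<..} (f (2 - \<i> * of_real t))" "set_integrable lborel {0<..} (f 2)"
      unfolding f_def by (rule barnes_K_tail_integrable, simp)+
    have gi: "set_integrable lborel {0<..} g" and gI: "(LINT x:{0<..}|lborel. g x) = ln 2 - ln (2 - \<i> * of_real t)"
      unfolding g_def using Frullani[of "2 - \<i> * of_real t" 2] by auto
    have "(barnes_K_tail (2 - \<i> * of_real t) - ln (2 - \<i> * of_real t) / 4) - (barnes_K_tail 2 - ln 2 / 4) =
      (LINT x:{0<..}|lborel. f (2 - \<i> * of_real t) x - f 2 x + 1 / 4 * g x)"
      unfolding barnes_K_tail_def f_def[symmetric] using fi gi gI
      by (simp add: set_integral_add set_integral_diff diff_divide_distrib)
    also have "\<dots> = (LINT x:{0<..}|lborel. (iexp (t * x) - 1) * of_real (levy_K x * exp (- (2 * x)) / x))"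
    proof (rule set_lebesgue_integral_cong)
      have "f (2 - \<i> * of_real t) x - f 2 x + 1 / 4 * g x = (iexp (t * x) - 1) * of_real (levy_K x * exp (- (2 * x)) / x)" if "x > 0" for x
      proof -
        have e1: "exp (- ((2 - \<i> * of_real t) * of_real x)) = of_real (exp (- (2 * x))) * iexp (t * x)"
          using exp_minus_axis[of 2 t x] by (simp add: exp_of_real[symmetric])
        have e2: "exp (- (2 * complex_of_real x)) = of_real (exp (- (2 * x)))" by (simp add: exp_of_real[symmetric])
        have alg: "C * (E * I) - C * E + 1 / 4 * ((E * I - E) / X) = (I - 1) * (E * (C + 1 / (4 * X)))" for C E I X :: complex
          by (simp add: algebra_simps diff_divide_distrib)
        have "complex_of_real ((levy_K x - 1 / 4) / x) + 1 / (4 * of_real x) = of_real (levy_K x / x)"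
          by (simp add: diff_divide_distrib)
        then show ?thesis unfolding f_def g_def e1 e2 alg by simp
      qed
      then show "\<forall>x. x \<in> {0<..} \<longrightarrow> f (2 - \<i> * of_real t) x - f 2 x + 1 / 4 * g x = (iexp (t * x) - 1) * of_real (levy_K x * exp (- (2 * x)) / x)" by blast
    qed simp
    finally show ?thesis .
  qed
  moreover have "ID_exponent (\<lambda>t. LINT x:{0<..}|lborel. (iexp (t * x) - 1) * of_real (levy_K x * exp (- (2 * x)) / x))"
  proof (rule ID_exponent_levy)
    have K: "0 \<le> levy_K x" "levy_K x \<le> 1" for x
    proof -
      have "1 \<le> (1 + exp (- x / 2))\<^sup>2" by (rule one_le_power) simp
      then show "0 \<le> levy_K x" "levy_K x \<le> 1" by (simp_all add: levy_K_def divide_le_eq)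
    qed
    have i: "set_integrable lborel {0<..} (\<lambda>x::real. exp (- (2 * x)))" by (rule integral_exp_Ioi) simp
    then have "set_integrable lborel {0<..} (\<lambda>x. levy_K x * exp (- (2 * x)))"
      unfolding set_integrable_def
      by (rule Bochner_Integration.integrable_bound) (use K in \<open>auto simp: indicator_def intro!: AE_I2 mult_left_le_one_le\<close>)
    then show "set_integrable lborel {0<..} (\<lambda>x. x * (levy_K x * exp (- (2 * x)) / x))"
      by (rule set_integrable_cong[THEN iffD1, OF refl refl, rotated]) auto
    show "0 \<le> levy_K x * exp (- (2 * x)) / x" if "x > 0" for x using K that by simp
  qed
  ultimately show ?thesis by simp
qed

text \<open>The summands belong to pi/32, the inverse beta factor, the Pareto factor and the Frechet
  factor. The Gaussian is kept apart because absolute continuity will be read off from it.\<close>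

definition critical_exponent :: "real \<Rightarrow> complex" where
  "critical_exponent t = \<i> * of_real (ln (pi / 32) * t) +
     ((barnes_K_tail (2 - \<i> * of_real t) - ln (2 - \<i> * of_real t) / 4) - (barnes_K_tail 2 - ln 2 / 4)) +
     (ln (of_real 2) - ln (of_real 2 - \<i> * of_real t)) + ln_Gamma (1 - \<i> * of_real t)"

lemma ID_exponent_critical: "ID_exponent critical_exponent"
  unfolding critical_exponent_def
  by (intro ID_exponent_add ID_exponent_drift ID_exponent_barnes_K ID_exponent_exponential ID_exponent_ln_Gamma) simp

lemma critical_mellin_axis:
  "critical_mellin (\<i> * of_real t) = exp (critical_exponent t) * exp (- of_real ((2 * sqrt (ln 2) * t)\<^sup>2 / 2))"
proof -
  let ?q = "\<i> * complex_of_real t"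
  have K: "barnes_K (2 - ?q) / barnes_K 2 = exp ((barnes_K_tail (2 - ?q) - ln (2 - ?q) / 4) - (barnes_K_tail 2 - ln 2 / 4))"
    unfolding exp_diff[of "barnes_K_tail (2 - ?q) - ln (2 - ?q) / 4"] using barnes_K_eq[of "2 - ?q"] barnes_K_eq[of 2] by simp
  have ne: "2 - ?q \<noteq> 0" by (simp add: complex_eq_iff)
  then have X: "2 / (2 - ?q) = exp (ln (of_real 2) - ln (of_real 2 - ?q))" by (simp add: exp_diff)
  have "1 - ?q \<notin> \<int>\<^sub>\<le>\<^sub>0" by (auto elim!: nonpos_Ints_cases simp: complex_eq_iff)
  then have G: "Gamma (1 - ?q) = exp (ln_Gamma (1 - ?q))" by (simp add: Gamma_complex_altdef)
  have e: "?q * of_real (ln (pi / 32)) + 2 * ?q\<^sup>2 * of_real (ln 2) = \<i> * of_real (ln (pi / 32) * t) + - of_real ((2 * sqrt (ln 2) * t)\<^sup>2 / 2)"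
    by (simp add: power_mult_distrib)
  have "Re ?q < 1" by simp
  then show ?thesis
    unfolding critical_mellin_factorization[OF \<open>Re ?q < 1\<close>] K X G e critical_exponent_def exp_add
    by (simp only: mult_ac)
qed

section \<open>Moments and laws\<close>

lemma cmoment_axis_eq_char:
  assumes N: "real_distribution N" and pos: "AE x in N. 0 < x"
  shows "char (distr N borel ln) t = cmoment N (\<i> * of_real t)"
proof -
  interpret real_distribution N by fact
  have "char (distr N borel ln) t = (LINT x|N. iexp (t * ln x))"
    unfolding char_def by (subst integral_distr) auto
  also have "\<dots> = cmoment N (\<i> * of_real t)"
    unfolding cmoment_def
  proof (rule integral_cong_AE)
    show "AE x in N. iexp (t * ln x) = complex_of_real x powr (\<i> * of_real t)"
      using pos by eventually_elim (simp add: powr_def Ln_of_real mult_ac)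
  qed (auto simp: powr_def)
  finally show ?thesis .
qed

lemma distr_exp_ln:
  assumes N: "real_distribution N" and pos: "AE x in N. 0 < x"
  shows "distr (distr N borel ln) borel exp = N"
proof -
  interpret real_distribution N by fact
  have "distr (distr N borel ln) borel exp = distr N borel (\<lambda>x. exp (ln x))"
    by (subst distr_distr) (auto simp: o_def)
  also have "\<dots> = distr N N (\<lambda>x. x)"
    by (rule distr_cong_AE) (use pos in \<open>auto elim: eventually_mono\<close>)
  finally show ?thesis by (simp add: distr_id)
qed

lemma real_distribution_eqI_cmoment:
  assumes "real_distribution N" "AE x in N. 0 < x" "real_distribution N'" "AE x in N'. 0 < x"
    and "\<And>t. cmoment N (\<i> * of_real t) = cmoment N' (\<i> * of_real t)"
  shows "N = N'"
proof -
  have d: "real_distribution (distr M borel ln)" if "real_distribution M" for M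
  proof -
    interpret real_distribution M by fact
    show ?thesis by (rule real_distribution_distr) auto
  qed
  have "distr N borel ln = distr N' borel ln"
  proof (rule Levy_uniqueness[OF d[OF assms(1)] d[OF assms(3)]])
    show "char (distr N borel ln) = char (distr N' borel ln)"
    proof
      fix t
      show "char (distr N borel ln) t = char (distr N' borel ln) t"
        unfolding cmoment_axis_eq_char[OF assms(1,2)] cmoment_axis_eq_char[OF assms(3,4)] by (rule assms(5))
    qed
  qed
  then have "distr (distr N borel ln) borel exp = distr (distr N' borel ln) borel exp" by (rule arg_cong)
  then show ?thesis unfolding distr_exp_ln[OF assms(1,2)] distr_exp_ln[OF assms(3,4)] .
qed

lemma weak_conv_m_distr_continuous:
  assumes \<mu>: "\<And>n. real_distribution (\<mu> n)" "real_distribution \<nu>" "weak_conv_m \<mu> \<nu>"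
    and f: "continuous_on UNIV (f :: real \<Rightarrow> real)"
  shows "weak_conv_m (\<lambda>n. distr (\<mu> n) borel f) (distr \<nu> borel f)"
proof -
  have [measurable]: "f \<in> borel_measurable borel" using f by (rule borel_measurable_continuous_onI)
  have fc: "isCont f x" for x using f by (simp add: continuous_on_eq_continuous_at)
  have d: "real_distribution (distr M borel f)" if "real_distribution M" for M
  proof -
    interpret real_distribution M by fact
    show ?thesis by (rule real_distribution_distr) auto
  qed
  show ?thesis
  proof (rule integral_bdd_continuous_conv_imp_weak_conv[OF d[OF \<mu>(1)] d[OF \<mu>(2)]])
    fix g :: "real \<Rightarrow> real" and B assume g: "\<And>x. isCont g x" "\<And>x. \<bar>g x\<bar> \<le> B"
    have [measurable]: "g \<in> borel_measurable borel"
      using g(1) by (intro borel_measurable_continuous_onI) (simp add: continuous_at_imp_continuous_on)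
    have i: "integral\<^sup>L (distr M borel f) g = (LINT x|M. g (f x))" if "real_distribution M" for M
    proof -
      interpret real_distribution M by fact
      show ?thesis by (subst integral_distr) auto
    qed
    have "(\<lambda>n. LINT x|\<mu> n. g (f x)) \<longlonglongrightarrow> (LINT x|\<nu>. g (f x))"
      by (rule weak_conv_imp_integral_bdd_continuous_conv[OF \<mu>])
         (use g fc in \<open>auto intro: isCont_o2\<close>)
    then show "(\<lambda>n. integral\<^sup>L (distr (\<mu> n) borel f) g) \<longlonglongrightarrow> integral\<^sup>L (distr \<nu> borel f) g"
      by (simp add: i \<mu>)
  qed
qed

text \<open>Weak convergence passes the bound C to every truncation min (f x) k, which is bounded
  and continuous; monotone convergence in k then bounds the integral of f.\<close>

lemma integrable_weak_limit:
  fixes f :: "real \<Rightarrow> real"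
  assumes \<mu>: "\<And>n. real_distribution (\<mu> n)" "real_distribution \<nu>" "weak_conv_m \<mu> \<nu>"
    and f: "\<And>x. isCont f x" "\<And>x. 0 \<le> f x"
    and int: "\<And>n. integrable (\<mu> n) f" "\<And>n. integral\<^sup>L (\<mu> n) f \<le> C"
  shows "integrable \<nu> f"
proof -
  interpret n: real_distribution \<nu> by fact
  have [measurable]: "f \<in> borel_measurable borel"
    using f(1) by (intro borel_measurable_continuous_onI) (simp add: continuous_at_imp_continuous_on)
  have bound: "(LINT x|\<nu>. min (f x) (real k)) \<le> C" for k :: nat
  proof (rule tendsto_upperbound)
    show "(\<lambda>n. LINT x|\<mu> n. min (f x) (real k)) \<longlonglongrightarrow> (LINT x|\<nu>. min (f x) (real k))"
      by (rule weak_conv_imp_integral_bdd_continuous_conv[OF \<mu>, of _ "real k"])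
         (use f in \<open>auto intro!: continuous_intros\<close>)
    show "eventually (\<lambda>n. (LINT x|\<mu> n. min (f x) (real k)) \<le> C) sequentially"
    proof (intro always_eventually allI)
      fix n
      interpret m: real_distribution "\<mu> n" by fact
      have "(LINT x|\<mu> n. min (f x) (real k)) \<le> integral\<^sup>L (\<mu> n) f"
        by (rule integral_mono[OF m.integrable_const_bound[where B = "real k"] int(1)]) (use f(2) in auto)
      with int(2)[of n] show "(LINT x|\<mu> n. min (f x) (real k)) \<le> C" by simp
    qed
  qed simp
  have "(\<integral>\<^sup>+x. ennreal (f x) \<partial>\<nu>) \<le> ennreal C"
  proof -
    have "(\<integral>\<^sup>+x. ennreal (f x) \<partial>\<nu>) = (\<integral>\<^sup>+x. (SUP k. ennreal (min (f x) (real k))) \<partial>\<nu>)"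
    proof (rule nn_integral_cong)
      fix x
      show "ennreal (f x) = (SUP k. ennreal (min (f x) (real k)))"
      proof (rule antisym)
        obtain k :: nat where "f x \<le> real k" using real_arch_simple by blast
        then show "ennreal (f x) \<le> (SUP k. ennreal (min (f x) (real k)))"
          by (intro SUP_upper2[of k]) auto
        show "(SUP k. ennreal (min (f x) (real k))) \<le> ennreal (f x)" by (intro SUP_least ennreal_leI) auto
      qed
    qed
    also have "\<dots> = (SUP k. \<integral>\<^sup>+x. ennreal (min (f x) (real k)) \<partial>\<nu>)"
      by (rule nn_integral_monotone_convergence_SUP) (auto simp: incseq_def le_fun_def intro!: ennreal_leI)
    also have "\<dots> \<le> ennreal C"
    proof (rule SUP_least)
      fix k :: nat
      have "integrable \<nu> (\<lambda>x. min (f x) (real k))"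
        by (rule n.integrable_const_bound[where B = "real k"]) (use f(2) in auto)
      then have "(\<integral>\<^sup>+x. ennreal (min (f x) (real k)) \<partial>\<nu>) = ennreal (LINT x|\<nu>. min (f x) (real k))"
        by (rule nn_integral_eq_integral) (use f(2) in auto)
      then show "(\<integral>\<^sup>+x. ennreal (min (f x) (real k)) \<partial>\<nu>) \<le> ennreal C" using bound[of k] by (simp add: ennreal_leI)
    qed
    finally show ?thesis .
  qed
  then show ?thesis
    by (intro integrableI_bounded) (use f(2) in \<open>auto simp: order_le_less_trans\<close>)
qed

text \<open>Used at x = 1 - 1/\<tau>: the scaling of the law cancels the divergence of Gamma (1 -
  1/\<tau>) in the Selberg transform.\<close>

lemma Gamma_real_mult_tendsto_1: "((\<lambda>x::real. x * Gamma x) \<longlongrightarrow> 1) (at_right 0)"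
proof -
  have "isCont Gamma (1::real)" by (intro continuous_intros) auto
  then have "((\<lambda>x::real. Gamma (x + 1)) \<longlongrightarrow> Gamma 1) (at_right 0)"
    by (rule isCont_tendsto_compose) (auto intro!: tendsto_eq_intros)
  moreover have "eventually (\<lambda>x::real. Gamma (x + 1) = x * Gamma x) (at_right 0)"
    using eventually_at_right_less[of "0::real"] by eventually_elim (rule Gamma_plus1, auto elim!: nonpos_Ints_cases)
  ultimately show ?thesis by (auto elim: Lim_transform_eventually)
qed

lemma critical_mellin_eq_Gamma2:
  assumes "Re q < 1"
  shows "critical_mellin q = of_real (2 * pi) powr q * exp (2 * (log_Gamma2 1 (2 - q) - log_Gamma2 1 2) + (log_Gamma2 1 (1 - q) - log_Gamma2 1 1)
     + (log_Gamma2 1 (4 - q) - log_Gamma2 1 (4 - 2 * q)))"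
proof -
  define P where "P = complex_of_real (ln (2 * pi))"
  have pw: "of_real (2 * pi) powr z = exp (z * P)" for z
    unfolding P_def powr_def using Ln_of_real[of "2 * pi"] by simp
  \<comment> \<open>G 2 = 1 trades half a power of 2 * pi for the difference of
    \<open>log_Gamma2\<close> at 1 and 2; used twice, it produces the normalisation of the Selberg
    transform.\<close>
  have "barnes_G 2 = 1" using barnes_G_plus1[of 1] by simp
  then have g2: "exp (P / 2 + (log_Gamma2 1 1 - log_Gamma2 1 2)) = 1"
    using barnes_G_pos[of 2] pw[of "1 / 2"] by (simp add: exp_add)
  have Re: "Re (1 - q) > 0" "Re (2 - q) > 0" "Re (4 - q) > 0" "Re (4 - 2 * q) > 0" using assms by auto
  define L where "L = log_Gamma2 1"
  have alg: "exp a / (exp b * (exp c)\<^sup>2 * exp d) = exp (a - b - 2 * c - d)" for a b c d :: complex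
    by (simp add: exp_diff exp_double)
  have "critical_mellin q = exp (((4 - 2 * q - 1) / 2 * P + (L 1 - L (4 - 2 * q))) - ((1 - q - 1) / 2 * P + (L 1 - L (1 - q)))
     - 2 * ((2 - q - 1) / 2 * P + (L 1 - L (2 - q))) - ((4 - q - 1) / 2 * P + (L 1 - L (4 - q))))"
    unfolding critical_mellin_def barnes_G_pos[OF Re(1)] barnes_G_pos[OF Re(2)] barnes_G_pos[OF Re(3)] barnes_G_pos[OF Re(4)]
      pw L_def[symmetric] exp_add[symmetric] alg ..
  also have "\<dots> = exp ((q * P + (2 * (L (2 - q) - L 2) + (L (1 - q) - L 1) + (L (4 - q) - L (4 - 2 * q)))) - 2 * (P / 2 + (L 1 - L 2)))"
    by (rule arg_cong[of _ _ exp]) (simp add: field_simps)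
  also have "\<dots> = exp (q * P + (2 * (L (2 - q) - L 2) + (L (1 - q) - L 1) + (L (4 - q) - L (4 - 2 * q))))"
    unfolding exp_diff exp_double using g2 by (simp add: L_def)
  finally show ?thesis unfolding pw L_def exp_add .
qed

text \<open>At \<tau> = 1 the double gamma arguments become 2 - q, 1 - q, 4 - q and 4 - 2 * q. All
  stay in the right half-plane for Re q < 1, so the exponential formula applies throughout and
  \<open>log_Gamma2_LIMSEQ\<close> gives the limit.\<close>

lemma selberg_mellin_LIMSEQ:
  assumes t: "\<And>n. 1 < t n" "\<And>n. t n \<le> 2" "t \<longlonglongrightarrow> 1" and q: "Re q < 1"
  shows "(\<lambda>n. of_real (1 - 1 / t n) powr (- q) * selberg_mellin (t n) q) \<longlonglongrightarrow> critical_mellin q"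
proof -
  define x where "x n = 1 - 1 / t n" for n
  have x0: "x n > 0" for n using t(1)[of n] by (simp add: x_def)
  have tc: "(\<lambda>n. complex_of_real (t n)) \<longlonglongrightarrow> 1" using tendsto_of_real[OF t(3), where 'a = complex] by simp
  have xl: "x \<longlonglongrightarrow> 0" unfolding x_def using t(3) by (auto intro!: tendsto_eq_intros)
  have xG: "(\<lambda>n. x n * Gamma (x n)) \<longlonglongrightarrow> 1"
  proof (rule filterlim_compose[OF Gamma_real_mult_tendsto_1])
    have "x n \<in> {0<..} \<and> x n \<noteq> 0" for n using x0[of n] by auto
    then show "filterlim x (at_right 0) sequentially" using xl by (simp add: filterlim_at)
  qed
  have G0: "Gamma (x n) > 0" for n using x0[of n] by (rule Gamma_real_pos)
  have L: "(\<lambda>n. log_Gamma2 (t n) (w + c * of_real (t n))) \<longlonglongrightarrow> log_Gamma2 1 (w + c)"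
    if "Re w + Re c > 0" "Im c = 0" "Re c \<ge> 0" for w c
  proof (rule log_Gamma2_LIMSEQ[OF t(3), where x = "Re w + Re c"])
    show "(\<lambda>n. w + c * of_real (t n)) \<longlonglongrightarrow> w + c" using t(3) by (auto intro!: tendsto_eq_intros)
    show "Re w + Re c \<le> Re (w + c * of_real (t n))" for n
      using that t(1)[of n] by (simp add: mult_le_cancel_left1)
  qed (use t that in \<open>auto intro: less_imp_le\<close>)
  have "(\<lambda>n. of_real (x n * Gamma (x n)) powr (- q) * of_real (t n) powr (q / of_real (t n)) * of_real (2 * pi) powr q *
     exp (2 * (log_Gamma2 (t n) ((1 - q) + 1 * of_real (t n)) - log_Gamma2 (t n) (1 + 1 * of_real (t n)))
       + (log_Gamma2 (t n) ((- q) + 1 * of_real (t n)) - log_Gamma2 (t n) (0 + 1 * of_real (t n)))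
       + (log_Gamma2 (t n) ((2 - q) + 2 * of_real (t n)) - log_Gamma2 (t n) ((2 - 2 * q) + 2 * of_real (t n))))) \<longlonglongrightarrow>
     of_real 1 powr (- q) * 1 powr (q / 1) * of_real (2 * pi) powr q *
     exp (2 * (log_Gamma2 1 ((1 - q) + 1) - log_Gamma2 1 (1 + 1)) + (log_Gamma2 1 (- q + 1) - log_Gamma2 1 (0 + 1))
       + (log_Gamma2 1 ((2 - q) + 2) - log_Gamma2 1 ((2 - 2 * q) + 2)))"
    by (intro tendsto_intros L xG tc) (use q in auto)
  also have "of_real 1 powr (- q) * 1 powr (q / 1) * of_real (2 * pi) powr q *
     exp (2 * (log_Gamma2 1 ((1 - q) + 1) - log_Gamma2 1 (1 + 1)) + (log_Gamma2 1 (- q + 1) - log_Gamma2 1 (0 + 1))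
       + (log_Gamma2 1 ((2 - q) + 2) - log_Gamma2 1 ((2 - 2 * q) + 2))) = critical_mellin q"
    unfolding critical_mellin_eq_Gamma2[OF q] by simp
  also have "(\<lambda>n. of_real (x n * Gamma (x n)) powr (- q) * of_real (t n) powr (q / of_real (t n)) * of_real (2 * pi) powr q *
     exp (2 * (log_Gamma2 (t n) ((1 - q) + 1 * of_real (t n)) - log_Gamma2 (t n) (1 + 1 * of_real (t n)))
       + (log_Gamma2 (t n) ((- q) + 1 * of_real (t n)) - log_Gamma2 (t n) (0 + 1 * of_real (t n)))
       + (log_Gamma2 (t n) ((2 - q) + 2 * of_real (t n)) - log_Gamma2 (t n) ((2 - 2 * q) + 2 * of_real (t n))))) =
     (\<lambda>n. of_real (1 - 1 / t n) powr (- q) * selberg_mellin (t n) q)"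
  proof (rule ext)
    fix n
    have t0: "t n > 0" using t(1)[of n] by simp
    have Re: "Re (1 - q + of_real (t n)) > 0" "Re (1 + of_real (t n)) > 0" "Re (of_real (t n) - q) > 0" "Re (of_real (t n)) > 0"
      "Re (2 - q + 2 * of_real (t n)) > 0" "Re (2 - 2 * q + 2 * of_real (t n)) > 0" using q t(1)[of n] by auto
    have p: "of_real (x n * Gamma (x n)) powr (- q) = of_real (x n) powr (- q) * of_real (Gamma (x n)) powr (- q)"
      using x0[of n] G0[of n] by (simp add: powr_times_real)
    show "of_real (x n * Gamma (x n)) powr (- q) * of_real (t n) powr (q / of_real (t n)) * of_real (2 * pi) powr q *
     exp (2 * (log_Gamma2 (t n) ((1 - q) + 1 * of_real (t n)) - log_Gamma2 (t n) (1 + 1 * of_real (t n)))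
       + (log_Gamma2 (t n) ((- q) + 1 * of_real (t n)) - log_Gamma2 (t n) (0 + 1 * of_real (t n)))
       + (log_Gamma2 (t n) ((2 - q) + 2 * of_real (t n)) - log_Gamma2 (t n) ((2 - 2 * q) + 2 * of_real (t n)))) =
      of_real (1 - 1 / t n) powr (- q) * selberg_mellin (t n) q"
      unfolding selberg_mellin_def Gamma2_pos[OF t0 Re(1)] Gamma2_pos[OF t0 Re(2)] Gamma2_pos[OF t0 Re(3)]
        Gamma2_pos[OF t0 Re(4)] Gamma2_pos[OF t0 Re(5)] Gamma2_pos[OF t0 Re(6)] x_def[symmetric] p
        exp_diff[symmetric] exp_double[symmetric] exp_add
      by (simp add: mult_ac)
  qed
  finally show ?thesis .
qed

section \<open>Gaussian laws, convolutions and products of positive variables\<close>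

lemma char_normal:
  assumes s: "s > 0"
  shows "char (density lborel (normal_density 0 s)) t = exp (- of_real ((s * t)\<^sup>2 / 2))"
proof -
  have "char (density lborel (normal_density 0 s)) t = (LINT x|lborel. normal_density 0 s x *\<^sub>R iexp (t * x))"
    unfolding char_def by (subst integral_density) auto
  also have "\<dots> = s *\<^sub>R (LINT x|lborel. normal_density 0 s (0 + s * x) *\<^sub>R iexp (t * (0 + s * x)))"
    using s by (subst lborel_integral_real_affine[of s _ 0]) auto
  also have "\<dots> = (LINT x|lborel. s *\<^sub>R (normal_density 0 s (0 + s * x) *\<^sub>R iexp (t * (0 + s * x))))"
    by (simp only: scaleR_conv_of_real integral_mult_right_zero)
  also have "\<dots> = (LINT x|lborel. std_normal_density x *\<^sub>R iexp ((t * s) * x))"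
  proof (rule Bochner_Integration.integral_cong[OF refl])
    fix x
    have "s * normal_density 0 s (0 + s * x) = std_normal_density x"
      using s by (simp add: normal_density_def real_sqrt_mult power_mult_distrib)
    then show "s *\<^sub>R (normal_density 0 s (0 + s * x) *\<^sub>R iexp (t * (0 + s * x))) = std_normal_density x *\<^sub>R iexp ((t * s) * x)"
      by (metis (no_types, lifting) add_0 mult.assoc scaleR_scaleR)
  qed
  also have "\<dots> = char std_normal_distribution (t * s)"
    unfolding char_def by (subst integral_density) auto
  finally show ?thesis by (simp add: char_std_normal_distribution exp_of_real[symmetric] mult.commute)
qed

lemma real_distribution_normal: "s > 0 \<Longrightarrow> real_distribution (density lborel (normal_density 0 s))"
  unfolding real_distribution_def real_distribution_axioms_def
  using prob_space_normal_density[of s 0] by simp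

text \<open>By Fubini the inner integral is the G-measure of a translate of a Lebesgue null set,
  which is again a null set.\<close>

lemma absolutely_continuous_convolution:
  assumes G: "real_distribution G" "absolutely_continuous lborel G" and R: "real_distribution R"
  shows "absolutely_continuous lborel (distr (G \<Otimes>\<^sub>M R) borel (\<lambda>(x, y). x + y))"
  unfolding absolutely_continuous_def
proof
  interpret G: real_distribution G by fact
  interpret R: real_distribution R by fact
  interpret P: pair_prob_space G R ..
  have [measurable]: "(\<lambda>(x, y). x + y) \<in> borel_measurable (G \<Otimes>\<^sub>M R)" unfolding split_beta' by simp
  fix A :: "real set" assume A: "A \<in> null_sets lborel"
  then have Ab [measurable]: "A \<in> sets borel" by auto
  have "emeasure (distr (G \<Otimes>\<^sub>M R) borel (\<lambda>(x, y). x + y)) A = (\<integral>\<^sup>+z. indicator A (fst z + snd z) \<partial>(G \<Otimes>\<^sub>M R))"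
    by (subst nn_integral_indicator[symmetric], simp, subst nn_integral_distr) (auto simp: split_beta')
  also have "\<dots> = (\<integral>\<^sup>+y. \<integral>\<^sup>+x. indicator A (x + y) \<partial>G \<partial>R)"
    by (subst P.nn_integral_snd[symmetric]) auto
  also have "\<dots> = (\<integral>\<^sup>+y. 0 \<partial>R)"
  proof (rule nn_integral_cong)
    fix y
    have "{x. x - (- y) \<in> A} \<in> null_sets lborel" by (rule null_sets_translation[OF A])
    then have "{x. x + y \<in> A} \<in> null_sets G" using G(2) by (auto simp: absolutely_continuous_def)
    then have "emeasure G {x. x + y \<in> A} = 0" by auto
    moreover have "(\<integral>\<^sup>+x. indicator A (x + y) \<partial>G) = (\<integral>\<^sup>+x. indicator {x. x + y \<in> A} x \<partial>G)"
      by (rule nn_integral_cong) (auto simp: indicator_def)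
    ultimately show "(\<integral>\<^sup>+x. indicator A (x + y) \<partial>G) = 0" by simp
  qed
  finally show "A \<in> null_sets (distr (G \<Otimes>\<^sub>M R) borel (\<lambda>(x, y). x + y))" by (auto simp: null_sets_def)
qed

lemma measurable_cpowr [measurable]: "(\<lambda>x. complex_of_real x powr q) \<in> borel_measurable borel"
  unfolding powr_def by measurable

text \<open>For imaginary exponents the powers have modulus 1 on positive reals, so the integrand is
  bounded and Fubini applies to arbitrary positive variables.\<close>

lemma integral_powr_pair:
  fixes t :: real
  assumes "prob_space M" "prob_space N" and [measurable]: "f \<in> borel_measurable M" "g \<in> borel_measurable N"
    and pos: "AE x in M. 0 < f x" "AE x in N. 0 < g x"
  shows "prob_space (M \<Otimes>\<^sub>M N)" "AE z in M \<Otimes>\<^sub>M N. 0 < f (fst z) * g (snd z)"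
    "(\<integral>z. complex_of_real (f (fst z) * g (snd z)) powr (\<i> * of_real t) \<partial>(M \<Otimes>\<^sub>M N)) =
      (LINT x|M. complex_of_real (f x) powr (\<i> * of_real t)) * (LINT x|N. complex_of_real (g x) powr (\<i> * of_real t))"
proof -
  interpret M: prob_space M by fact
  interpret N: prob_space N by fact
  interpret P: pair_prob_space M N ..
  show "prob_space (M \<Otimes>\<^sub>M N)" by (rule P.prob_space_axioms)
  have AE2: "AE z in M \<Otimes>\<^sub>M N. 0 < f (fst z) \<and> 0 < g (snd z)"
  proof (rule P.AE_pair_measure)
    show "AE x in M. AE y in N. 0 < f (fst (x, y)) \<and> 0 < g (snd (x, y))"
      using pos(1) by eventually_elim (use pos(2) in simp)
  qed measurable
  then show "AE z in M \<Otimes>\<^sub>M N. 0 < f (fst z) * g (snd z)" by eventually_elim simp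
  define h :: "real \<Rightarrow> complex" where "h x = iexp (t * ln x)" for x
  have [measurable]: "h \<in> borel_measurable borel" unfolding h_def by measurable
  have hp: "complex_of_real x powr (\<i> * of_real t) = h x" if "x > 0" for x
    using that by (simp add: h_def powr_def Ln_of_real mult_ac)
  have int: "integrable (M \<Otimes>\<^sub>M N) (\<lambda>z. h (f (fst z)) * h (g (snd z)))"
    by (rule P.integrable_const_bound[where B = 1]) (auto simp: h_def norm_mult)
  have "(\<integral>z. complex_of_real (f (fst z) * g (snd z)) powr (\<i> * of_real t) \<partial>(M \<Otimes>\<^sub>M N)) = (\<integral>z. h (f (fst z)) * h (g (snd z)) \<partial>(M \<Otimes>\<^sub>M N))"
  proof (rule integral_cong_AE)
    show "AE z in M \<Otimes>\<^sub>M N. complex_of_real (f (fst z) * g (snd z)) powr (\<i> * of_real t) = h (f (fst z)) * h (g (snd z))"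
      using AE2
    proof eventually_elim
      case (elim z)
      then have "complex_of_real (f (fst z) * g (snd z)) powr (\<i> * of_real t) = h (f (fst z) * g (snd z))" by (intro hp) simp
      also have "\<dots> = h (f (fst z)) * h (g (snd z))"
        using elim unfolding h_def exp_add[symmetric] by (simp add: ln_mult algebra_simps)
      finally show ?case .
    qed
    show "(\<lambda>z. complex_of_real (f (fst z) * g (snd z)) powr (\<i> * of_real t)) \<in> borel_measurable (M \<Otimes>\<^sub>M N)"
      by (rule measurable_compose[OF _ measurable_cpowr]) simp
  qed simp
  also have "\<dots> = (LINT x|M. LINT y|N. h (f x) * h (g y))"
    using P.integral_fst'[OF int] by simp
  also have "\<dots> = (LINT x|M. h (f x)) * (LINT y|N. h (g y))" by simp
  also have "(LINT x|M. h (f x)) = (LINT x|M. complex_of_real (f x) powr (\<i> * of_real t))"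
    by (rule integral_cong_AE) (use pos(1) in \<open>auto elim!: eventually_mono simp: hp intro!: measurable_compose[OF _ measurable_cpowr]\<close>)
  also have "(LINT x|N. h (g x)) = (LINT x|N. complex_of_real (g x) powr (\<i> * of_real t))"
    by (rule integral_cong_AE) (use pos(2) in \<open>auto elim!: eventually_mono simp: hp intro!: measurable_compose[OF _ measurable_cpowr]\<close>)
  finally show "(\<integral>z. complex_of_real (f (fst z) * g (snd z)) powr (\<i> * of_real t) \<partial>(M \<Otimes>\<^sub>M N)) =
      (LINT x|M. complex_of_real (f x) powr (\<i> * of_real t)) * (LINT x|N. complex_of_real (g x) powr (\<i> * of_real t))" .
qed

section \<open>Imaginary-axis moments of the four factors\<close>

lemma lognormal_law_cmoment:
  assumes v: "v > 0"
  shows "real_distribution (lognormal_law 0 v)" "AE x in lognormal_law 0 v. 0 < x"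
    "cmoment (lognormal_law 0 v) (\<i> * of_real t) = exp (- of_real (v * t\<^sup>2 / 2))"
proof -
  interpret real_distribution "density lborel (normal_density 0 (sqrt v))"
    by (rule real_distribution_normal) (use v in simp)
  show rd: "real_distribution (lognormal_law 0 v)" unfolding lognormal_law_def by (rule real_distribution_distr) simp
  show pos: "AE x in lognormal_law 0 v. 0 < x" unfolding lognormal_law_def by (subst AE_distr_iff) auto
  have "distr (lognormal_law 0 v) borel ln = density lborel (normal_density 0 (sqrt v))"
    unfolding lognormal_law_def by (subst distr_distr) (auto simp: o_def distr_id2)
  then show "cmoment (lognormal_law 0 v) (\<i> * of_real t) = exp (- of_real (v * t\<^sup>2 / 2))"
    using cmoment_axis_eq_char[OF rd pos, of t] char_normal[of "sqrt v" t] v by (simp add: power_mult_distrib)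
qed

lemma density_law_cmoment:
  assumes [measurable]: "g \<in> borel_measurable borel" and g: "\<And>x. 0 \<le> g x" "\<And>x. x \<le> 0 \<Longrightarrow> g x = 0"
    and int: "integrable lborel g" "integral\<^sup>L lborel g = 1"
  shows "real_distribution (density lborel (\<lambda>x. ennreal (g x)))" "AE x in density lborel (\<lambda>x. ennreal (g x)). 0 < x"
    "cmoment (density lborel (\<lambda>x. ennreal (g x))) q = (LINT x|lborel. g x *\<^sub>R complex_of_real x powr q)"
proof -
  have "emeasure (density lborel (\<lambda>x. ennreal (g x))) UNIV = 1"
    using int g by (subst emeasure_density) (auto simp: nn_integral_eq_integral)
  then have "prob_space (density lborel (\<lambda>x. ennreal (g x)))" by (intro prob_spaceI) simp
  then show "real_distribution (density lborel (\<lambda>x. ennreal (g x)))"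
    unfolding real_distribution_def real_distribution_axioms_def by simp
  show "AE x in density lborel (\<lambda>x. ennreal (g x)). 0 < x"
    by (subst AE_density) (auto intro!: AE_I2, metis g(2) less_irrefl not_less)
  show "cmoment (density lborel (\<lambda>x. ennreal (g x))) q = (LINT x|lborel. g x *\<^sub>R complex_of_real x powr q)"
    unfolding cmoment_def using g by (subst integral_density) auto
qed

lemma pareto2_law_cmoment:
  "real_distribution pareto2_law" "AE x in pareto2_law. 0 < x"
  "cmoment pareto2_law (\<i> * of_real t) = 2 / (2 - \<i> * of_real t)"
proof -
  define g :: "real \<Rightarrow> real" where "g y = (if y > 1 then 2 / y ^ 3 else 0)" for y
  have [measurable]: "g \<in> borel_measurable borel" unfolding g_def by measurable
  have e: "einterval 1 \<infinity> = {1<..}" by (auto simp: einterval_def one_ereal_def)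
  have gi: "g y = indicator {1<..} y *\<^sub>R (2 / y ^ 3)" for y by (simp add: g_def indicator_def)
  have lims: "((\<lambda>y::real. - (1 / y\<^sup>2)) \<longlongrightarrow> - 1) (at_right 1)" "((\<lambda>y::real. - (1 / y\<^sup>2)) \<longlongrightarrow> 0) at_top"
    by (auto intro!: tendsto_eq_intros)[1] real_asymp
  have FTC: "set_integrable lborel (einterval 1 \<infinity>) (\<lambda>y. 2 / y ^ 3)" "(LBINT y=1..\<infinity>. 2 / y ^ 3) = 0 - (-1)"
  proof -
    have A: "(((\<lambda>y::real. - (1 / y\<^sup>2)) \<circ> real_of_ereal) \<longlongrightarrow> - 1) (at_right 1)"
      using lims(1) by (simp add: one_ereal_def ereal_tendsto_simps1)
    have B: "(((\<lambda>y::real. - (1 / y\<^sup>2)) \<circ> real_of_ereal) \<longlongrightarrow> 0) (at_left \<infinity>)"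
      using lims(2) by (simp add: ereal_tendsto_simps1)
    have D: "DERIV (\<lambda>y. - (1 / y\<^sup>2)) y :> 2 / y ^ 3" if "1 < ereal y" "ereal y < \<infinity>" for y
      using that by (auto intro!: derivative_eq_intros simp: one_ereal_def field_simps power2_eq_square power3_eq_cube)
    have C: "isCont (\<lambda>y. 2 / y ^ 3) y" if "1 < ereal y" "ereal y < \<infinity>" for y
      using that by (intro continuous_intros) (auto simp: one_ereal_def)
    have P: "AE y in lborel. 1 < ereal y \<longrightarrow> ereal y < \<infinity> \<longrightarrow> 0 \<le> 2 / y ^ 3"
      by (rule AE_I2) (auto simp: one_ereal_def)
    note I = interval_integral_FTC_nonneg[where F = "\<lambda>y. - (1 / y\<^sup>2)", OF _ D C P A B]
    show "set_integrable lborel (einterval 1 \<infinity>) (\<lambda>y. 2 / y ^ 3)" "(LBINT y=1..\<infinity>. 2 / y ^ 3) = 0 - (-1)"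
      by (rule I; simp)+
  qed
  have gI: "integrable lborel g" "integral\<^sup>L lborel g = 1"
    using FTC unfolding e set_integrable_def gi[abs_def] by (simp_all add: interval_lebesgue_integral_def one_ereal_def[symmetric] e set_lebesgue_integral_def)
  note L = density_law_cmoment[of g, OF _ _ _ gI]
  have D: "pareto2_law = density lborel (\<lambda>x. ennreal (g x))" unfolding pareto2_law_def g_def ..
  show "real_distribution pareto2_law" "AE x in pareto2_law. 0 < x"
    unfolding D by (rule L; simp add: g_def)+
  have ne: "2 - \<i> * complex_of_real t \<noteq> 0" by (simp add: complex_eq_iff)
  define F where "F y = - (2 / (2 - \<i> * of_real t)) * complex_of_real y powr (\<i> * of_real t - 2)" for y
  define f where "f y = 2 * complex_of_real y powr (\<i> * of_real t - 3)" for y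
  have fg: "indicator {1<..} y *\<^sub>R f y = g y *\<^sub>R complex_of_real y powr (\<i> * of_real t)" for y
  proof (cases "y > 1")
    case True
    have "complex_of_real y powr (\<i> * of_real t - of_nat 3) = complex_of_real y powr (\<i> * of_real t) / complex_of_real y powr of_nat 3"
      by (rule powr_diff)
    also have "complex_of_real y powr of_nat 3 = of_real y ^ 3" using True by (intro powr_nat') simp
    finally show ?thesis using True by (simp add: f_def g_def scaleR_conv_of_real)
  qed (simp add: g_def)
  have fi: "set_integrable lborel (einterval 1 \<infinity>) f"
    unfolding e set_integrable_def fg
    by (rule Bochner_Integration.integrable_bound[OF gI(1)])
       (auto simp: g_def norm_powr_real_powr intro!: AE_I2)
  have "(LBINT y=1..\<infinity>. f y) = 0 - F 1"
  proof (rule interval_integral_FTC_integrable[OF _ _ _ fi])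
    show "(F has_vector_derivative f y) (at y)" if "1 < ereal y" "ereal y < \<infinity>" for y
    proof -
      have y: "y > 1" using that by (simp add: one_ereal_def)
      have "((\<lambda>z. - (2 / (2 - \<i> * of_real t)) * z powr (\<i> * of_real t - 2)) has_field_derivative
          - (2 / (2 - \<i> * of_real t)) * ((\<i> * of_real t - 2) * of_real y powr (\<i> * of_real t - 2 - 1))) (at (of_real y))"
        by (intro DERIV_cmult has_field_derivative_powr) (use y in auto)
      moreover have "- (2 / (2 - \<i> * of_real t)) * ((\<i> * of_real t - 2) * of_real y powr (\<i> * of_real t - 2 - 1)) = f y"
      proof -
        have "- (2 / d) * (- d * z) = 2 * z" if "d \<noteq> 0" for d z :: complex using that by simp
        from this[OF ne] show ?thesis
          unfolding f_def diff_diff_eq minus_diff_eq by simp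
      qed
      ultimately have "((\<lambda>z. - (2 / (2 - \<i> * of_real t)) * z powr (\<i> * of_real t - 2)) has_field_derivative f y) (at (of_real y))"
        by simp
      from has_vector_derivative_real_field[OF this] show ?thesis unfolding F_def .
    qed
    show "isCont f y" if "1 < ereal y" "ereal y < \<infinity>" for y
      unfolding f_def using that by (intro continuous_intros) (auto simp: one_ereal_def)
    have "isCont F 1" unfolding F_def by (intro continuous_intros) auto
    then have "(F \<longlongrightarrow> F 1) (at_right 1)" unfolding isCont_def by (rule tendsto_mono[rotated]) (rule at_le, simp)
    then show "((F \<circ> real_of_ereal) \<longlongrightarrow> F 1) (at_right 1)" by (simp add: one_ereal_def ereal_tendsto_simps1)
    have "(F \<longlongrightarrow> 0) at_top"
    proof (rule Lim_null_comparison)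
      show "((\<lambda>y::real. norm (2 / (2 - \<i> * of_real t)) * y powr (- 2)) \<longlongrightarrow> 0) at_top" by real_asymp
      show "eventually (\<lambda>y. norm (F y) \<le> norm (2 / (2 - \<i> * of_real t)) * y powr (- 2)) at_top"
        using eventually_gt_at_top[of 0] by eventually_elim (simp add: F_def norm_mult norm_divide norm_powr_real_powr)
    qed
    then show "((F \<circ> real_of_ereal) \<longlongrightarrow> 0) (at_left \<infinity>)" by (simp add: ereal_tendsto_simps1)
  qed auto
  then have "(LINT y|lborel. g y *\<^sub>R complex_of_real y powr (\<i> * of_real t)) = 2 / (2 - \<i> * of_real t)"
    unfolding interval_lebesgue_integral_def e set_lebesgue_integral_def fg by (simp add: F_def)
  then show "cmoment pareto2_law (\<i> * of_real t) = 2 / (2 - \<i> * of_real t)"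
    unfolding D by (subst L) (auto simp: g_def)
qed

text \<open>The substitution y = 1/u turns the Frechet density into exp (- u), so this is Euler's
  integral at 1 - q.\<close>

lemma frechet1_integral:
  assumes q: "Re q < 1"
  shows "integrable lborel (\<lambda>y. (if y > 0 then exp (- 1 / y) / y\<^sup>2 else 0) *\<^sub>R complex_of_real y powr q)"
    "(LINT y|lborel. (if y > 0 then exp (- 1 / y) / y\<^sup>2 else 0) *\<^sub>R complex_of_real y powr q) = Gamma (1 - q)"
proof -
  define f where "f u = complex_of_real u powr (- q) * exp (- (1 * of_real u))" for u
  define k where "k y = (if y > 0 then exp (- 1 / y) / y\<^sup>2 else 0) *\<^sub>R complex_of_real y powr q" for y :: real
  have [measurable]: "k \<in> borel_measurable borel" unfolding k_def by measurable
  have [measurable]: "f \<in> borel_measurable borel" unfolding f_def by measurable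
  have fi: "set_integrable lborel {0<..} f" "(LINT u:{0<..}|lborel. f u) = Gamma (1 - q)"
    using set_integrable_cpowr_exp[of "1 - q" 1] Laplace_powr[of "1 - q" 1] q by (simp_all add: f_def[abs_def])
  have fl: "f absolutely_integrable_on {0<..}"
    using fi(1) unfolding set_integrable_def by (simp add: integrable_completion)
  have fI: "integral {0<..} f = Gamma (1 - q)"
    using set_lebesgue_integral_eq_integral(2)[OF fl] fi(2) by (simp add: set_lebesgue_integral_def integral_completion)
  have im: "inverse ` {0<..} = {(0::real)<..}"
    by (force simp: image_iff intro: bexI[of _ "inverse x" for x])
  have "(\<lambda>x. \<bar>- (inverse x ^ 2)\<bar> *\<^sub>R f (inverse x)) absolutely_integrable_on {0<..} \<and>
      integral {0<..} (\<lambda>x. \<bar>- (inverse x ^ 2)\<bar> *\<^sub>R f (inverse x)) = Gamma (1 - q)"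
    by (subst has_absolute_integral_change_of_variables_real)
       (use fl fI in \<open>auto simp: im inj_on_def power2_eq_square intro!: derivative_eq_intros\<close>)
  moreover have hk: "\<bar>- (inverse x ^ 2)\<bar> *\<^sub>R f (inverse x) = k x" if "x \<in> {0<..}" for x
  proof -
    have "complex_of_real (inverse x) powr (- q) = of_real x powr q"
      using that by (simp add: powr_def Ln_of_real ln_inverse del: of_real_inverse)
    moreover have "exp (- (1 * complex_of_real (inverse x))) = of_real (exp (- 1 / x))"
      by (simp add: exp_of_real[symmetric] field_simps)
    ultimately show ?thesis using that by (simp add: f_def k_def scaleR_conv_of_real field_simps)
  qed
  moreover have "(\<lambda>x. \<bar>- (inverse x ^ 2)\<bar> *\<^sub>R f (inverse x)) absolutely_integrable_on {0<..} \<longleftrightarrow> k absolutely_integrable_on {0<..}"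
    by (rule set_integrable_cong) (auto simp only: hk)
  moreover have "integral {0<..} (\<lambda>x. \<bar>- (inverse x ^ 2)\<bar> *\<^sub>R f (inverse x)) = integral {0<..} k"
    by (rule Henstock_Kurzweil_Integration.integral_cong) (rule hk)
  ultimately have "k absolutely_integrable_on {0<..}" "integral {0<..} k = Gamma (1 - q)"
    by (simp_all only:)
  moreover have "(\<lambda>x. indicator {0<..} x *\<^sub>R k x) = k" by (auto simp: k_def indicator_def)
  ultimately have "integrable lborel k" "integral\<^sup>L lborel k = Gamma (1 - q)"
    using set_lebesgue_integral_eq_integral(2)[of "{0<..}" k]
    by (simp_all add: set_integrable_def set_lebesgue_integral_def integrable_completion integral_completion)
  then show "integrable lborel (\<lambda>y. (if y > 0 then exp (- 1 / y) / y\<^sup>2 else 0) *\<^sub>R complex_of_real y powr q)"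
    "(LINT y|lborel. (if y > 0 then exp (- 1 / y) / y\<^sup>2 else 0) *\<^sub>R complex_of_real y powr q) = Gamma (1 - q)"
    unfolding k_def by simp_all
qed

lemma frechet1_law_cmoment:
  "real_distribution frechet1_law" "AE x in frechet1_law. 0 < x"
  "cmoment frechet1_law (\<i> * of_real t) = Gamma (1 - \<i> * of_real t)"
proof -
  define g :: "real \<Rightarrow> real" where "g y = (if y > 0 then exp (- 1 / y) / y\<^sup>2 else 0)" for y
  have "g y *\<^sub>R complex_of_real y powr 0 = complex_of_real (g y)" for y
    by (simp add: g_def powr_def scaleR_conv_of_real)
  then have "integrable lborel (\<lambda>y. complex_of_real (g y))" "(LINT y|lborel. complex_of_real (g y)) = of_real 1"
    using frechet1_integral[of 0] by (simp_all add: g_def[symmetric])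
  then have gI: "integrable lborel g" "integral\<^sup>L lborel g = 1"
    unfolding complex_of_real_integrable_eq integral_complex_of_real of_real_eq_iff .
  have D: "frechet1_law = density lborel (\<lambda>x. ennreal (g x))" unfolding frechet1_law_def g_def ..
  have g: "g \<in> borel_measurable borel" "0 \<le> g x" "x \<le> 0 \<Longrightarrow> g x = 0" for x unfolding g_def by auto
  note L = density_law_cmoment[OF g gI]
  show "real_distribution frechet1_law" "AE x in frechet1_law. 0 < x"
    unfolding D by (rule L; assumption)+
  have "cmoment frechet1_law (\<i> * of_real t) = (LINT y|lborel. g y *\<^sub>R complex_of_real y powr (\<i> * of_real t))"
    unfolding D by (rule L)
  also have "\<dots> = Gamma (1 - \<i> * of_real t)" unfolding g_def by (rule frechet1_integral) simp
  finally show "cmoment frechet1_law (\<i> * of_real t) = Gamma (1 - \<i> * of_real t)" .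
qed

text \<open>The reciprocal turns the exponent q into -q. For a = (1, 1) the resulting double gamma
  quotients are those of \<open>barnes_K\<close>, in which the powers of 2 * pi from G
  cancel.\<close>

lemma beta22_inverse_law_cmoment:
  assumes B: "beta22_distribution 1 1 2 (1/2) (1/2) B"
  shows "real_distribution (distr B borel inverse)" "AE x in distr B borel inverse. 0 < x"
    "cmoment (distr B borel inverse) (\<i> * of_real t) = barnes_K (2 - \<i> * of_real t) / barnes_K 2"
proof -
  have rB: "real_distribution B" and pos: "AE x in B. 0 < x \<and> x \<le> 1"
    and mom: "Re q > -2 \<Longrightarrow> cmoment B q = beta22_mellin 1 1 2 (1/2) (1/2) q" for q
    using B by (auto simp: beta22_distribution_def has_cmoment_def)
  interpret real_distribution B by fact
  show "real_distribution (distr B borel inverse)" by (rule real_distribution_distr) simp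
  show "AE x in distr B borel inverse. 0 < x"
    by (subst AE_distr_iff) (use pos in \<open>auto elim: eventually_mono\<close>)
  define q where "q = \<i> * complex_of_real t"
  have "cmoment (distr B borel inverse) q = (LINT x|B. complex_of_real (inverse x) powr q)"
    unfolding cmoment_def by (rule integral_distr) (auto intro: measurable_cpowr)
  also have "\<dots> = cmoment B (- q)"
    unfolding cmoment_def
  proof (rule integral_cong_AE)
    show "AE x in B. complex_of_real (inverse x) powr q = of_real x powr (- q)"
      using pos by eventually_elim (simp add: powr_def Ln_of_real ln_inverse del: of_real_inverse)
  qed (auto intro: measurable_compose[OF _ measurable_cpowr])
  also have "\<dots> = beta22_mellin 1 1 2 (1/2) (1/2) (- q)" by (rule mom) (simp add: q_def)
  also have "\<dots> = barnes_K (2 - q) / barnes_K 2"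
  proof -
    define P where "P = complex_of_real (ln (2 * pi))"
    define L where "L = log_Gamma2 1"
    have pw: "of_real (2 * pi) powr z = exp (z * P)" for z
      unfolding P_def powr_def using Ln_of_real[of "2 * pi"] by simp
    have G: "barnes_G z = exp ((z - 1) / 2 * P + (L 1 - L z))" if "Re z > 0" for z
      unfolding barnes_G_pos[OF that] pw L_def exp_add ..
    have G2: "Gamma2 1 1 z = exp (L z)" if "Re z > 0" for z unfolding L_def by (rule Gamma2_pos) (use that in auto)
    have K: "barnes_K z = exp (2 * L 1 - 2 * L (z + 1/2) + L z + L (z + 1) - 2 * L 1)" if "Re z > 0" for z
    proof -
      have "barnes_K z = exp (2 * ((z + 1/2 - 1) / 2 * P + (L 1 - L (z + 1/2))) - (((z - 1) / 2 * P + (L 1 - L z)) + ((z + 1 - 1) / 2 * P + (L 1 - L (z + 1)))))"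
      proof -
        have alg: "(exp a)\<^sup>2 / (exp b * exp c) = exp (2 * a - (b + c))" for a b c :: complex
          by (simp add: exp_diff exp_double exp_add)
        have r: "Re (z + 1/2) > 0" "Re (z + 1) > 0" using that by auto
        show ?thesis unfolding barnes_K_def G[OF that] G[OF r(1)] G[OF r(2)] alg ..
      qed
      also have "2 * ((z + 1/2 - 1) / 2 * P + (L 1 - L (z + 1/2))) - (((z - 1) / 2 * P + (L 1 - L z)) + ((z + 1 - 1) / 2 * P + (L 1 - L (z + 1))))
        = 2 * L 1 - 2 * L (z + 1/2) + L z + L (z + 1) - 2 * L 1"
        by (simp add: field_simps)
      finally show ?thesis .
    qed
    have Re: "Re (2 - q) > 0" by (simp add: q_def)
    have e: "- q + 2 = 2 - q" "- q + (2 + 1 / 2) = 2 - q + 1 / 2" "- q + (2 + 1) = 2 - q + 1"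
      "of_real (2 + 1 / 2) = (2 + 1 / 2 :: complex)" "of_real (2 + 1 / 2 + 1 / 2) = (2 + 1 :: complex)" "of_real 2 = (2 :: complex)"
      by simp_all
    have Re': "Re (2 - q + 1/2) > 0" "Re (2 - q + 1) > 0" "Re (2::complex) > 0" "Re (2 + 1/2::complex) > 0" "Re (2 + 1::complex) > 0"
      using Re by simp_all
    have alg: "(exp a / exp a') * (exp b' / exp b) * (exp b' / exp b) * (exp c / exp c') = exp (- 2 * b + a + c) / exp (- 2 * b' + a' + c')"
      for a a' b b' c c' :: complex
    proof -
      have e: "exp (- 2 * b + a + c) = exp a * exp c / (exp b * exp b)" for a b c :: complex
        unfolding exp_add[symmetric] exp_diff[symmetric] by (simp add: algebra_simps)
      have "(u / u') * (v' / v) * (v' / v) * (w / w') = (u * w / (v * v)) / (u' * w' / (v' * v'))" for u u' v v' w w' :: complex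
        by (simp add: mult_ac)
      then show ?thesis unfolding e .
    qed
    have r: "2 * L 1 - 2 * L z + L z' + L z'' - 2 * L 1 = - 2 * L z + L z' + L z''" for z z' z'' by simp
    have g: "Gamma2 1 1 (- q + of_real 2) = exp (L (2 - q))" "Gamma2 1 1 (- q + of_real (2 + 1 / 2)) = exp (L (2 - q + 1 / 2))"
      "Gamma2 1 1 (- q + of_real (2 + 1 / 2 + 1 / 2)) = exp (L (2 - q + 1))" "Gamma2 1 1 (of_real 2) = exp (L 2)"
      "Gamma2 1 1 (of_real (2 + 1 / 2)) = exp (L (2 + 1 / 2))" "Gamma2 1 1 (of_real (2 + 1 / 2 + 1 / 2)) = exp (L (2 + 1))"
      using G2[OF Re] G2[OF Re'(1)] G2[OF Re'(2)] G2[OF Re'(3)] G2[OF Re'(4)] G2[OF Re'(5)] by (simp_all only: e)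
    show ?thesis
      unfolding beta22_mellin_def g K[OF Re] K[OF Re'(3)] alg r ..
  qed
  finally show "cmoment (distr B borel inverse) (\<i> * of_real t) = barnes_K (2 - \<i> * of_real t) / barnes_K 2" unfolding q_def .
qed

section \<open>The critical law\<close>

lemma has_cmoment_distr_exp:
  assumes "real_distribution \<nu>"
  shows "has_cmoment (distr \<nu> borel exp) q c \<longleftrightarrow>
    integrable \<nu> (\<lambda>x. exp (q * of_real x)) \<and> (LINT x|\<nu>. exp (q * of_real x)) = c"
proof -
  interpret real_distribution \<nu> by fact
  have e: "complex_of_real (exp x) powr q = exp (q * of_real x)" for x by (simp add: powr_def exp_of_real[symmetric] Ln_exp)
  show ?thesis
    unfolding has_cmoment_def cmoment_def
    by (subst integrable_distr_eq, simp, rule measurable_cpowr, subst integral_distr, simp, rule measurable_cpowr, simp only: e)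
qed

lemma scaled_law:
  assumes N: "real_distribution N" "AE x in N. 0 < x" and k: "k > 0"
  shows "real_distribution (distr N borel (\<lambda>x. x / k))" "AE x in distr N borel (\<lambda>x. x / k). 0 < x"
    "has_cmoment N q c \<Longrightarrow> has_cmoment (distr N borel (\<lambda>x. x / k)) q (of_real k powr (- q) * c)"
proof -
  interpret real_distribution N by fact
  show "real_distribution (distr N borel (\<lambda>x. x / k))" by (rule real_distribution_distr) simp
  show "AE x in distr N borel (\<lambda>x. x / k). 0 < x"
    by (subst AE_distr_iff) (use N(2) k in \<open>auto elim: eventually_mono\<close>)
  assume c: "has_cmoment N q c"
  have d: "(\<lambda>x. x / k) \<in> N \<rightarrow>\<^sub>M borel" by simp
  have m: "(\<lambda>x. complex_of_real (x / k) powr q) \<in> borel_measurable N"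
    by (rule measurable_compose[OF _ measurable_cpowr]) simp
  have m': "(\<lambda>x. of_real k powr (- q) * complex_of_real x powr q) \<in> borel_measurable N"
    by (intro borel_measurable_times borel_measurable_const measurable_compose[OF _ measurable_cpowr]) simp
  have ae: "AE x in N. complex_of_real (x / k) powr q = of_real k powr (- q) * of_real x powr q"
    using N(2)
  proof eventually_elim
    case (elim x)
    have "complex_of_real (x / k) powr q = exp (q * of_real (ln (x / k)))"
      using elim k by (subst powr_def) (simp add: Ln_of_real del: of_real_divide)
    also have "\<dots> = exp (- q * of_real (ln k)) * exp (q * of_real (ln x))"
      using elim k by (simp add: ln_div exp_add[symmetric] algebra_simps)
    also have "\<dots> = of_real k powr (- q) * of_real x powr q" using elim k by (simp add: powr_def Ln_of_real)
    finally show ?case .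
  qed
  have "integrable N (\<lambda>x. complex_of_real (x / k) powr q)"
    by (subst integrable_cong_AE[OF m m' ae]) (use c in \<open>simp add: has_cmoment_def\<close>)
  moreover have "(LINT x|N. complex_of_real (x / k) powr q) = of_real k powr (- q) * c"
    by (subst integral_cong_AE[OF m m' ae]) (use c in \<open>simp add: has_cmoment_def cmoment_def\<close>)
  ultimately show "has_cmoment (distr N borel (\<lambda>x. x / k)) q (of_real k powr (- q) * c)"
    unfolding has_cmoment_def cmoment_def
    by (simp only: integrable_distr_eq[OF d measurable_cpowr] integral_distr[OF d measurable_cpowr])
qed

text \<open>Built as the convolution of the Gaussian with the law of exponent
  \<open>critical_exponent\<close>, so that absolute continuity is inherited from the first;
  infinite divisibility comes from the sum of the two exponents and uniqueness of characteristic
  functions.\<close>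

lemma critical_law_ex:
  obtains \<nu> where "real_distribution \<nu>" "\<And>t. char \<nu> t = critical_mellin (\<i> * of_real t)"
    "infinitely_divisible \<nu>" "absolutely_continuous lborel \<nu>"
proof -
  define s where "s = 2 * sqrt (ln (2::real))"
  have s: "s > 0" by (simp add: s_def)
  define G where "G = density lborel (normal_density 0 s)"
  have G: "real_distribution G" unfolding G_def by (rule real_distribution_normal[OF s])
  have Gc: "char G t = exp (- of_real ((s * t)\<^sup>2 / 2))" for t unfolding G_def by (rule char_normal[OF s])
  have Ga: "absolutely_continuous lborel G" unfolding G_def by (rule absolutely_continuousI_density) simp
  obtain R where R: "real_distribution R" "\<And>t. char R t = exp (critical_exponent t)"
    using ID_exponent_critical[unfolded ID_exponent_def, rule_format, of 1] unfolding is_char_def by auto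
  define \<nu> where "\<nu> = distr (G \<Otimes>\<^sub>M R) borel (\<lambda>(x, y). x + y)"
  have \<nu>: "real_distribution \<nu>" unfolding \<nu>_def by (rule char_convolution[OF G R(1)])
  have \<nu>e: "char \<nu> t = exp (critical_exponent t + - of_real ((s * t)\<^sup>2 / 2))" for t
    unfolding \<nu>_def char_convolution(2)[OF G R(1)] Gc R(2) exp_add by (rule mult.commute)
  show ?thesis
  proof
    show "real_distribution \<nu>" by fact
    show "char \<nu> t = critical_mellin (\<i> * of_real t)" for t
      unfolding \<nu>e critical_mellin_axis exp_add s_def ..
    show "absolutely_continuous lborel \<nu>" unfolding \<nu>_def by (rule absolutely_continuous_convolution[OF G Ga R(1)])
    show "infinitely_divisible \<nu>" unfolding infinitely_divisible_def
    proof (intro allI impI)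
      fix n :: nat assume n: "n \<ge> 1"
      obtain R' where R': "real_distribution R'"
          "\<And>t. char R' t = exp ((critical_exponent t + - of_real ((s * t)\<^sup>2 / 2)) / of_nat n)"
        using ID_exponent_add[OF ID_exponent_critical ID_exponent_gauss[of s], unfolded ID_exponent_def, rule_format, OF n]
        unfolding is_char_def by auto
      have "\<nu> = distr (\<Pi>\<^sub>M i\<in>{..<n}. R') borel (\<lambda>x. \<Sum>i<n. x i)"
      proof (rule Levy_uniqueness[OF \<nu> char_PiM_sum(1)[OF R'(1)]], rule ext)
        fix t
        have "exp (z / of_nat n) ^ n = exp z" for z :: complex
          using n by (simp add: exp_of_nat_mult[symmetric])
        then show "char \<nu> t = char (distr (\<Pi>\<^sub>M i\<in>{..<n}. R') borel (\<lambda>x. \<Sum>i<n. x i)) t"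
          unfolding char_PiM_sum(2)[OF R'(1)] R'(2) \<nu>e by (rule sym)
      qed
      with R'(1) show "\<exists>R. real_distribution R \<and> \<nu> = distr (\<Pi>\<^sub>M i\<in>{..<n}. R) borel (\<lambda>x. \<Sum>i<n. x i)" by blast
    qed
  qed
qed

definition scaled_selberg :: "(real \<Rightarrow> real measure) \<Rightarrow> real \<Rightarrow> real measure" where
  "scaled_selberg M \<tau> = distr (M \<tau>) borel (\<lambda>x. x / (1 - 1 / \<tau>))"

lemma scaled_selberg:
  assumes "selberg_distribution \<tau> (M \<tau>)" "\<tau> > 1"
  shows "real_distribution (scaled_selberg M \<tau>)" "AE x in scaled_selberg M \<tau>. 0 < x"
    "Re q < 1 \<Longrightarrow> has_cmoment (scaled_selberg M \<tau>) q (of_real (1 - 1 / \<tau>) powr (- q) * selberg_mellin \<tau> q)"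
proof -
  have k: "1 - 1 / \<tau> > 0" using assms(2) by simp
  have N: "real_distribution (M \<tau>)" "AE x in M \<tau>. 0 < x" "Re q < \<tau> \<Longrightarrow> has_cmoment (M \<tau>) q (selberg_mellin \<tau> q)" for q
    using assms(1) unfolding selberg_distribution_def by auto
  show "real_distribution (scaled_selberg M \<tau>)" "AE x in scaled_selberg M \<tau>. 0 < x"
    "Re q < 1 \<Longrightarrow> has_cmoment (scaled_selberg M \<tau>) q (of_real (1 - 1 / \<tau>) powr (- q) * selberg_mellin \<tau> q)"
    unfolding scaled_selberg_def using scaled_law[OF N(1,2) k] N(3)[of q] assms(2) by auto
qed

lemma scaled_selberg_ln_weak_conv:
  assumes M: "\<And>\<tau>. \<tau> > 1 \<Longrightarrow> selberg_distribution \<tau> (M \<tau>)"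
    and t: "\<And>n. 1 < t n" "\<And>n. t n \<le> 2" "t \<longlonglongrightarrow> 1"
    and \<nu>: "real_distribution \<nu>" "\<And>t. char \<nu> t = critical_mellin (\<i> * of_real t)"
  shows "\<And>n. real_distribution (distr (scaled_selberg M (t n)) borel ln)"
    "weak_conv_m (\<lambda>n. distr (scaled_selberg M (t n)) borel ln) \<nu>"
proof -
  note S = scaled_selberg[where M = M and \<tau> = "t n" for n, OF M[OF t(1)] t(1)]
  show rd: "real_distribution (distr (scaled_selberg M (t n)) borel ln)" for n
  proof -
    interpret real_distribution "scaled_selberg M (t n)" by (rule S)
    show ?thesis by (rule real_distribution_distr) simp
  qed
  show "weak_conv_m (\<lambda>n. distr (scaled_selberg M (t n)) borel ln) \<nu>"
  proof (rule levy_continuity[OF rd \<nu>(1)])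
    fix u
    have q: "Re (\<i> * complex_of_real u) < 1" by simp
    have "char (distr (scaled_selberg M (t n)) borel ln) u =
        of_real (1 - 1 / t n) powr (- (\<i> * complex_of_real u)) * selberg_mellin (t n) (\<i> * of_real u)" for n
      using S(3)[OF q, of n] unfolding cmoment_axis_eq_char[OF S(1,2)] has_cmoment_def by (rule conjunct2)
    then show "(\<lambda>n. char (distr (scaled_selberg M (t n)) borel ln) u) \<longlonglongrightarrow> char \<nu> u"
      using selberg_mellin_LIMSEQ[OF t q] unfolding \<nu>(2) by presburger
  qed
qed

lemma scaled_selberg_weak_conv:
  assumes M: "\<And>\<tau>. \<tau> > 1 \<Longrightarrow> selberg_distribution \<tau> (M \<tau>)"
    and t: "filterlim t (at_right 1) sequentially"
    and \<nu>: "real_distribution \<nu>" "\<And>t. char \<nu> t = critical_mellin (\<i> * of_real t)"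
  shows "weak_conv_m (\<lambda>n. scaled_selberg M (t n)) (distr \<nu> borel exp)"
proof -
  \<comment> \<open>The uniform bounds need all parameters in (1, 2]; only finitely many terms are
    changed, which leaves the limit alone.\<close>
  define t' where "t' n = (if 1 < t n \<and> t n \<le> 2 then t n else 2)" for n
  have tl: "t \<longlonglongrightarrow> 1" and t1: "eventually (\<lambda>n. t n > 1) sequentially"
    using t by (auto simp: filterlim_at elim: eventually_mono)
  have "eventually (\<lambda>n. t n < 2) sequentially" by (rule order_tendstoD[OF tl]) simp
  with t1 have ev: "eventually (\<lambda>n. t' n = t n) sequentially" by eventually_elim (simp add: t'_def)
  have t': "\<And>n. 1 < t' n" "\<And>n. t' n \<le> 2" by (auto simp: t'_def)
  have t'l: "t' \<longlonglongrightarrow> 1"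
    by (rule Lim_transform_eventually[OF tl]) (use ev in \<open>auto elim: eventually_mono\<close>)
  note S = scaled_selberg[where M = M and \<tau> = "t' n" for n, OF M[OF t'(1)] t'(1)]
  note L = scaled_selberg_ln_weak_conv[of M t', OF M t' t'l \<nu>]
  have "weak_conv_m (\<lambda>n. distr (distr (scaled_selberg M (t' n)) borel ln) borel exp) (distr \<nu> borel exp)"
    by (rule weak_conv_m_distr_continuous[OF L(1) \<nu>(1) L(2)]) (auto intro: continuous_intros)
  then have "weak_conv_m (\<lambda>n. scaled_selberg M (t' n)) (distr \<nu> borel exp)"
    by (simp only: distr_exp_ln[OF S(1,2)])
  then show ?thesis
    unfolding weak_conv_m_def weak_conv_def
  proof (intro allI impI)
    fix x
    assume "\<forall>x. isCont (cdf (distr \<nu> borel exp)) x \<longrightarrow> (\<lambda>n. cdf (scaled_selberg M (t' n)) x) \<longlonglongrightarrow> cdf (distr \<nu> borel exp) x"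
      and "isCont (cdf (distr \<nu> borel exp)) x"
    then have "(\<lambda>n. cdf (scaled_selberg M (t' n)) x) \<longlonglongrightarrow> cdf (distr \<nu> borel exp) x" by blast
    then show "(\<lambda>n. cdf (scaled_selberg M (t n)) x) \<longlonglongrightarrow> cdf (distr \<nu> borel exp) x"
      by (rule Lim_transform_eventually) (use ev in \<open>auto elim: eventually_mono\<close>)
  qed
qed

text \<open>The moments at the real point c converge, hence are bounded along the sequence, and
  \<open>integrable_weak_limit\<close> carries integrability over to the limit law.\<close>

lemma critical_law_integrable_exp:
  assumes M: "\<And>\<tau>. \<tau> > 1 \<Longrightarrow> selberg_distribution \<tau> (M \<tau>)"
    and \<nu>: "real_distribution \<nu>" "\<And>t. char \<nu> t = critical_mellin (\<i> * of_real t)"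
    and c: "c < (1::real)"
  shows "integrable \<nu> (\<lambda>x. exp (c * x))"
proof -
  define t where "t n = 1 + 1 / real (Suc n)" for n
  have t: "\<And>n. 1 < t n" "\<And>n. t n \<le> 2" by (auto simp: t_def)
  have tl: "t \<longlonglongrightarrow> 1" unfolding t_def using tendsto_add[OF tendsto_const LIMSEQ_Suc[OF lim_1_over_n], of "1::real"] by simp
  note S = scaled_selberg[where M = M and \<tau> = "t n" for n, OF M[OF t(1)] t(1)]
  note L = scaled_selberg_ln_weak_conv[of M t, OF M t tl \<nu>]
  define Y where "Y n = distr (scaled_selberg M (t n)) borel ln" for n
  define m where "m n = of_real (1 - 1 / t n) powr (- complex_of_real c) * selberg_mellin (t n) (of_real c)" for n
  have q: "Re (complex_of_real c) < 1" using c by simp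
  have rY: "real_distribution (Y n)" for n unfolding Y_def by (rule L(1))
  have "has_cmoment (distr (Y n) borel exp) (of_real c) (m n)" for n
    unfolding Y_def distr_exp_ln[OF S(1,2)] m_def by (rule S(3)[OF q])
  then have I: "integrable (Y n) (\<lambda>x. complex_of_real (exp (c * x)))" "(LINT x|Y n. complex_of_real (exp (c * x))) = m n" for n
    unfolding has_cmoment_distr_exp[OF rY] exp_of_real[symmetric] of_real_mult by auto
  then have I: "integrable (Y n) (\<lambda>x. exp (c * x))" "of_real (LINT x|Y n. exp (c * x)) = m n" for n
    unfolding complex_of_real_integrable_eq integral_complex_of_real by auto
  have "m \<longlonglongrightarrow> critical_mellin (of_real c)"
    unfolding m_def by (rule selberg_mellin_LIMSEQ[OF t tl q])
  then have "Bseq m" by (intro convergent_imp_Bseq convergentI)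
  then obtain C where C: "\<And>n. norm (m n) \<le> C" unfolding Bseq_def by blast
  show ?thesis
  proof (rule integrable_weak_limit)
    show "real_distribution (Y n)" for n unfolding Y_def by (rule L(1))
    show "weak_conv_m Y \<nu>" unfolding Y_def by (rule L(2))
    show "real_distribution \<nu>" by (rule \<nu>(1))
    show "integral\<^sup>L (Y n) (\<lambda>x. exp (c * x)) \<le> C" for n
      using C[of n] unfolding I(2)[symmetric] norm_of_real by linarith
  qed (use I(1) in auto)
qed

lemma critical_law_has_cmoment:
  assumes M: "\<And>\<tau>. \<tau> > 1 \<Longrightarrow> selberg_distribution \<tau> (M \<tau>)"
    and \<nu>: "real_distribution \<nu>" "\<And>t. char \<nu> t = critical_mellin (\<i> * of_real t)"
    and q: "Re q < 1"
  shows "has_cmoment (distr \<nu> borel exp) q (critical_mellin q)"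
proof -
  interpret real_distribution \<nu> by fact
  have ie: "integrable \<nu> (\<lambda>x. exp (c * x))" if "c < 1" for c
    by (rule critical_law_integrable_exp[of M, OF _ \<nu> that]) (rule M)
  define F where "F q = (LINT x|\<nu>. exp (q * of_real x))" for q :: complex
  define S where "S = {q::complex. Re q < 1}"
  have S: "open S" "connected S"
    unfolding S_def by (auto intro: open_halfspace_Re_lt convex_connected convex_halfspace_Re_lt)
  have "F holomorphic_on S"
    unfolding F_def
  proof (rule holomorphic_on_integral)
    fix z assume z: "z \<in> S"
    define r where "r = (1 - Re z) / 2"
    have r: "r > 0" "Re z + r < 1" "Re z - r < 1" using z by (auto simp: r_def S_def field_simps)
    have B: "\<bar>Re w - Re z\<bar> < r" if "w \<in> ball z r" for w
      using abs_Re_le_cmod[of "w - z"] that by (simp add: dist_norm norm_minus_commute)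
    show "\<exists>r>0. \<exists>g. ball z r \<subseteq> S \<and> integrable \<nu> g \<and> (\<forall>w\<in>ball z r. \<forall>x\<in>space \<nu>. norm (exp (w * complex_of_real x)) \<le> g x)"
    proof (intro exI conjI ballI)
      show "0 < r" by (rule r)
      show "ball z r \<subseteq> S" using B r unfolding S_def by fastforce
      \<comment> \<open>The first exponential dominates for x >= 0, the second for x <= 0; both
        rates are below 1.\<close>
      show "integrable \<nu> (\<lambda>x. exp ((Re z + r) * x) + exp ((Re z - r) * x))"
        by (intro Bochner_Integration.integrable_add ie r)
      fix w x assume "w \<in> ball z r"
      from B[OF this] have "Re w * x \<le> (Re z + r) * x \<or> Re w * x \<le> (Re z - r) * x"
        by (cases "x \<ge> 0") (auto intro: mult_right_mono mult_right_mono_neg)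
      then have "exp (Re w * x) \<le> exp ((Re z + r) * x) \<or> exp (Re w * x) \<le> exp ((Re z - r) * x)" by simp
      then show "norm (exp (w * complex_of_real x)) \<le> exp ((Re z + r) * x) + exp ((Re z - r) * x)"
        by (auto intro: add_increasing add_increasing2)
    qed
  qed (auto intro!: holomorphic_intros S)
  moreover have "critical_mellin holomorphic_on S"
  proof (rule analytic_imp_holomorphic)
    have "critical_mellin analytic_on {z}" if "z \<in> S" for z
      by (rule critical_mellin_analytic') (use that in \<open>auto simp: S_def\<close>)
    then show "critical_mellin analytic_on S" using analytic_on_analytic_at by blast
  qed
  ultimately have "(\<lambda>z. F z - critical_mellin z) holomorphic_on S" by (rule holomorphic_on_diff)
  then have "F q - critical_mellin q = 0"
  \<comment> \<open>The two sides are known to agree on the imaginary axis, which lies in the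
    interior of Re q < 1 and accumulates at 0.\<close>
  proof (rule analytic_continuation[where U = "range (\<lambda>t. \<i> * complex_of_real t)" and \<xi> = 0])
    show "0 islimpt range (\<lambda>t. \<i> * complex_of_real t)"
      unfolding islimpt_approachable
    proof (intro allI impI)
      fix e :: real assume "e > 0"
      then show "\<exists>x'\<in>range (\<lambda>t. \<i> * complex_of_real t). x' \<noteq> 0 \<and> dist x' 0 < e"
        by (intro bexI[OF _ rangeI[of _ "e / 2"]]) (auto simp: norm_mult)
    qed
    show "F z - critical_mellin z = 0" if zr: "z \<in> range (\<lambda>t. \<i> * complex_of_real t)" for z
    proof -
      obtain t where z: "z = \<i> * of_real t" using zr by blast
      show ?thesis unfolding z F_def \<nu>(2)[symmetric] char_def by (simp add: mult.assoc)
    qed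
  qed (use S q in \<open>auto simp: S_def\<close>)
  moreover have "integrable \<nu> (\<lambda>x. exp (q * of_real x))"
    by (rule Bochner_Integration.integrable_bound[OF ie[OF q]]) auto
  ultimately show ?thesis unfolding has_cmoment_distr_exp[OF \<nu>(1)] F_def by simp
qed

text \<open>Both laws live on the positive half-line, where moments on the imaginary axis determine
  a law. The product measure is built up from the right, one application of
  \<open>integral_powr_pair\<close> per factor.\<close>

lemma critical_law_factorization:
  assumes \<nu>: "real_distribution \<nu>" "\<And>t. char \<nu> t = critical_mellin (\<i> * of_real t)"
    and B: "beta22_distribution 1 1 2 (1/2) (1/2) B"
  shows "distr \<nu> borel exp = distr
         (lognormal_law 0 (4 * ln 2) \<Otimes>\<^sub>M distr B borel inverse \<Otimes>\<^sub>M pareto2_law \<Otimes>\<^sub>M frechet1_law)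
         borel (\<lambda>(l, x2, x3, y). pi / 32 * l * x2 * x3 * y)"
proof -
  define L where "L = lognormal_law 0 (4 * ln 2)"
  define X where "X = distr B borel inverse"
  have v: "4 * ln (2::real) > 0" by simp
  note L = lognormal_law_cmoment[OF v, folded L_def]
  note X = beta22_inverse_law_cmoment[OF B, folded X_def]
  note P = pareto2_law_cmoment and F = frechet1_law_cmoment
  interpret \<nu>: real_distribution \<nu> by fact
  interpret L: real_distribution L by (rule L)
  interpret X: real_distribution X by (rule X)
  interpret P: real_distribution pareto2_law by (rule P)
  interpret F: real_distribution frechet1_law by (rule F)
  have [measurable_cong]: "sets L = sets borel" "sets X = sets borel" "sets pareto2_law = sets borel" "sets frechet1_law = sets borel"
    by simp_all
  have posL: "AE x in L. 0 < pi / 32 * x" using L(2) by eventually_elim simp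
  have mL: "(LINT x|L. complex_of_real (pi / 32 * x) powr (\<i> * of_real t)) = exp (\<i> * of_real t * of_real (ln (pi / 32))) * cmoment L (\<i> * of_real t)" for t
  proof -
    have "(LINT x|L. complex_of_real (pi / 32 * x) powr (\<i> * of_real t)) =
        (LINT x|L. exp (\<i> * of_real t * of_real (ln (pi / 32))) * complex_of_real x powr (\<i> * of_real t))"
    proof (rule integral_cong_AE)
      show "AE x in L. complex_of_real (pi / 32 * x) powr (\<i> * of_real t) = exp (\<i> * of_real t * of_real (ln (pi / 32))) * complex_of_real x powr (\<i> * of_real t)"
        using L(2)
      proof eventually_elim
        case (elim x)
        have "complex_of_real (pi / 32 * x) powr (\<i> * of_real t) = exp (\<i> * of_real t * of_real (ln (pi / 32 * x)))"
          using elim Ln_of_real[of "pi / 32 * x"] by (simp add: powr_def del: of_real_mult of_real_divide)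
        also have "ln (pi / 32 * x) = ln (pi / 32) + ln x" by (rule ln_mult_pos) (use elim in auto)
        finally show ?case using elim by (simp add: powr_def Ln_of_real exp_add[symmetric] algebra_simps)
      qed
      show "(\<lambda>x. complex_of_real (pi / 32 * x) powr (\<i> * of_real t)) \<in> borel_measurable L"
        by (rule measurable_compose[OF _ measurable_cpowr]) simp
      show "(\<lambda>x. exp (\<i> * of_real t * of_real (ln (pi / 32))) * complex_of_real x powr (\<i> * of_real t)) \<in> borel_measurable L"
        by (intro borel_measurable_times borel_measurable_const measurable_compose[OF _ measurable_cpowr]) simp
    qed
    then show ?thesis by (simp only: integral_mult_right_zero cmoment_def)
  qed
  have m: "(\<lambda>x. x) \<in> borel_measurable L" "(\<lambda>x. x) \<in> borel_measurable X"
      "(\<lambda>x. x) \<in> borel_measurable pareto2_law" "(\<lambda>x. x) \<in> borel_measurable frechet1_law" by simp_all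
  define M3 where "M3 = pareto2_law \<Otimes>\<^sub>M frechet1_law"
  define M2 where "M2 = X \<Otimes>\<^sub>M M3"
  note I3 = integral_powr_pair[OF P.prob_space_axioms F.prob_space_axioms m(3,4) P(2) F(2), folded M3_def]
  have m3: "(\<lambda>z. fst z * snd z) \<in> borel_measurable M3" unfolding M3_def by measurable
  note I2 = integral_powr_pair[OF X.prob_space_axioms I3(1) m(2) m3 X(2) I3(2), folded M2_def]
  have m2: "(\<lambda>z. fst z * (fst (snd z) * snd (snd z))) \<in> borel_measurable M2" unfolding M2_def M3_def by measurable
  have mc: "(\<lambda>x. pi / 32 * x) \<in> borel_measurable L" by simp
  note I1 = integral_powr_pair[OF L.prob_space_axioms I2(1) mc m2 posL I2(2)]
  define Q where "Q = distr (L \<Otimes>\<^sub>M M2) borel (\<lambda>z. pi / 32 * fst z * (fst (snd z) * (fst (snd (snd z)) * snd (snd (snd z)))))"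
  have mQ: "(\<lambda>z. pi / 32 * fst z * (fst (snd z) * (fst (snd (snd z)) * snd (snd (snd z))))) \<in> borel_measurable (L \<Otimes>\<^sub>M M2)"
    unfolding M2_def M3_def by measurable
  interpret Q: prob_space "L \<Otimes>\<^sub>M M2" by (rule I1(1))
  have "distr \<nu> borel exp = Q"
  proof (rule real_distribution_eqI_cmoment)
    show rE: "real_distribution (distr \<nu> borel exp)" by (rule \<nu>.real_distribution_distr) simp
    show pE: "AE x in distr \<nu> borel exp. 0 < x" by (subst AE_distr_iff) auto
    show "real_distribution Q" unfolding Q_def by (rule Q.real_distribution_distr) (rule mQ)
    show "AE x in Q. 0 < x" unfolding Q_def by (subst AE_distr_iff) (use mQ I1(2) in auto)
    fix t
    define q where "q = \<i> * complex_of_real t"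
    have "distr (distr \<nu> borel exp) borel ln = \<nu>"
      by (subst distr_distr) (auto simp: o_def distr_id2)
    then have "cmoment (distr \<nu> borel exp) q = critical_mellin q"
      using cmoment_axis_eq_char[OF rE pE, of t] \<nu>(2)[of t] unfolding q_def by simp
    also have "\<dots> = exp (q * of_real (ln (pi / 32)) + 2 * q\<^sup>2 * of_real (ln 2)) *
       (barnes_K (2 - q) / barnes_K 2) * (2 / (2 - q)) * Gamma (1 - q)"
      by (rule critical_mellin_factorization) (simp add: q_def)
    also have "exp (q * of_real (ln (pi / 32)) + 2 * q\<^sup>2 * of_real (ln 2)) = exp (q * of_real (ln (pi / 32))) * cmoment L q"
    proof -
      \<comment> \<open>On the axis q^2 = - t^2, so the quadratic term is the exponent of a centred
        Gaussian of variance 4 * ln 2.\<close>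
      have e: "2 * q\<^sup>2 * of_real (ln 2) = - of_real (4 * ln 2 * t\<^sup>2 / 2)" by (simp add: q_def power_mult_distrib)
      show ?thesis unfolding exp_add e L(3)[of t, folded q_def] ..
    qed
    also have "\<dots> * (barnes_K (2 - q) / barnes_K 2) * (2 / (2 - q)) * Gamma (1 - q) =
        exp (q * of_real (ln (pi / 32))) * cmoment L q * (cmoment X q * (cmoment pareto2_law q * cmoment frechet1_law q))"
      unfolding q_def X(3) P(3) F(3) by (simp only: mult.assoc)
    also have "\<dots> = cmoment Q q"
      unfolding Q_def
      unfolding cmoment_def[of "distr _ _ _"] integral_distr[OF mQ measurable_cpowr]
      unfolding q_def I1(3) I2(3) I3(3) mL cmoment_def ..
    finally show "cmoment (distr \<nu> borel exp) (\<i> * of_real t) = cmoment Q (\<i> * of_real t)" unfolding q_def .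
  qed
  also have "Q = distr (L \<Otimes>\<^sub>M M2) borel (\<lambda>(l, x2, x3, y). pi / 32 * l * x2 * x3 * y)"
    unfolding Q_def by (rule arg_cong[of _ _ "distr _ _"]) (auto simp: fun_eq_iff)
  finally show ?thesis unfolding L_def M2_def M3_def X_def .
qed

lemma critical_law_negative_moments:
  assumes N: "real_distribution N" "AE x in N. 0 < x"
    and m: "has_cmoment N (- of_nat l) (critical_mellin (- of_nat l))"
  shows "integrable N (\<lambda>x. x powi (- int l))"
    "(LINT x|N. x powi (- int l)) = (\<Prod>k<l. fact (3 + l + k) / ((fact (k + 1))\<^sup>2 * fact k))"
proof -
  interpret real_distribution N by fact
  have [measurable]: "(\<lambda>x::real. x powi (- int l)) \<in> borel_measurable borel" by (simp add: power_int_minus)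
  have ae: "AE x in N. complex_of_real x powr (- of_nat l) = of_real (x powi (- int l))"
    using N(2) by eventually_elim (simp add: powr_minus powr_nat' power_int_minus)
  have ms: "(\<lambda>x. complex_of_real x powr (- of_nat l)) \<in> borel_measurable N"
    by (rule measurable_compose[OF _ measurable_cpowr]) simp
  have ms': "(\<lambda>x. complex_of_real (x powi (- int l))) \<in> borel_measurable N"
    by measurable
  have "integrable N (\<lambda>x. complex_of_real (x powi (- int l)))"
    using m unfolding has_cmoment_def integrable_cong_AE[OF ms ms' ae] by simp
  then show "integrable N (\<lambda>x. x powi (- int l))" unfolding complex_of_real_integrable_eq .
  have "complex_of_real (LINT x|N. x powi (- int l)) = critical_mellin (- of_nat l)"
    using m unfolding has_cmoment_def cmoment_def integral_cong_AE[OF ms ms' ae] integral_complex_of_real by simp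
  also have "\<dots> = of_real (\<Prod>k<l. fact (3 + l + k) / ((fact (k + 1))\<^sup>2 * fact k))"
    unfolding critical_mellin_minus_of_nat by (simp add: of_real_prod)
  finally show "(LINT x|N. x powi (- int l)) = (\<Prod>k<l. fact (3 + l + k) / ((fact (k + 1))\<^sup>2 * fact k))"
    unfolding of_real_eq_iff .
qed

theorem theorem6p1:
  fixes M :: "real \<Rightarrow> real measure"
  assumes M: "\<And>\<tau>. \<tau> > 1 \<Longrightarrow> selberg_distribution \<tau> (M \<tau>)"
  shows "\<exists>Mc :: real measure.
    real_distribution Mc \<and> (AE x in Mc. 0 < x) \<and>
    (\<forall>t :: nat \<Rightarrow> real. filterlim t (at_right 1) sequentially \<longrightarrow>
       weak_conv_m (\<lambda>n. distr (M (t n)) borel (\<lambda>x. x / (1 - 1 / t n))) Mc) \<and>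
    \<comment> \<open>Mellin transform\<close>
    (\<forall>q. Re q < 1 \<longrightarrow> has_cmoment Mc q (critical_mellin q)) \<and>
    \<comment> \<open>zeroes and poles of the meromorphic continuation\<close>
    critical_mellin meromorphic_on UNIV \<and>
    (\<forall>n::nat. critical_mellin analytic_on {of_nat n + 5/2} \<and>
       critical_mellin (of_nat n + 5/2) = 0 \<and>
       zorder critical_mellin (of_nat n + 5/2) = 2 * int n + 2) \<and>
    is_pole critical_mellin 1 \<and> zorder critical_mellin 1 = - 1 \<and>
    is_pole critical_mellin 2 \<and> zorder critical_mellin 2 = - 3 \<and>
    (\<forall>n::nat. n \<ge> 3 \<longrightarrow> is_pole critical_mellin (of_nat n) \<and>
       zorder critical_mellin (of_nat n) = - (2 * int n - 2)) \<and>
    (\<forall>q. (\<forall>n::nat. q \<noteq> of_nat n + 5/2) \<and> (\<forall>n::nat. n \<ge> 1 \<longrightarrow> q \<noteq> of_nat n) \<longrightarrow>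
       critical_mellin analytic_on {q} \<and> critical_mellin q \<noteq> 0) \<and>
    \<comment> \<open>functional equation, for the moments and for the continuation\<close>
    (\<forall>q. Re q < 1 \<longrightarrow>
       cmoment Mc q =
         Gamma (1 - q) * (Gamma (2 - q))\<^sup>2 * Gamma (4 - q)
           / (Gamma (4 - 2 * q) * Gamma (5 - 2 * q)) * cmoment Mc (q - 1)) \<and>
    (\<forall>q. (\<forall>n::nat. n \<ge> 1 \<longrightarrow> q \<noteq> of_nat n) \<longrightarrow>
       critical_mellin q =
         Gamma (1 - q) * (Gamma (2 - q))\<^sup>2 * Gamma (4 - q)
           / (Gamma (4 - 2 * q) * Gamma (5 - 2 * q)) * critical_mellin (q - 1)) \<and>
    \<comment> \<open>infinite product, for the moments and, where all gamma factors in front are finite,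
        for the continuation\<close>
    (\<forall>q. Re q < 1 \<longrightarrow>
       convergent_prod (\<lambda>k. critical_factor q (Suc k)) \<and>
       cmoment Mc q =
         Gamma (1 - q) * Gamma (3 - 2 * q) / Gamma (3 - q)
           * (\<Prod>k. critical_factor q (Suc k))) \<and>
    (\<forall>q. (\<forall>n::nat. n \<ge> 2 \<longrightarrow> 2 * q \<noteq> of_nat n) \<longrightarrow>
       convergent_prod (\<lambda>k. critical_factor q (Suc k)) \<and>
       critical_mellin q =
         Gamma (1 - q) * Gamma (3 - 2 * q) / Gamma (3 - q)
           * (\<Prod>k. critical_factor q (Suc k))) \<and>
    \<comment> \<open>negative integer moments\<close>
    (\<forall>l::nat. integrable Mc (\<lambda>x. x powi (- int l)) \<and>
       (LINT x|Mc. x powi (- int l)) =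
         (\<Prod>k<l. fact (3 + l + k) / ((fact (k + 1))\<^sup>2 * fact k))) \<and>
    \<comment> \<open>factorization into independent factors, as an image of the product measure\<close>
    (\<forall>B. beta22_distribution 1 1 2 (1/2) (1/2) B \<longrightarrow>
       Mc = distr
         (lognormal_law 0 (4 * ln 2) \<Otimes>\<^sub>M distr B borel inverse \<Otimes>\<^sub>M pareto2_law \<Otimes>\<^sub>M frechet1_law)
         borel
         (\<lambda>(l, x2, x3, y). pi / 32 * l * x2 * x3 * y)) \<and>
    infinitely_divisible (distr Mc borel ln) \<and>
    absolutely_continuous lborel (distr Mc borel ln)"
proof -
  obtain \<nu> where \<nu>: "real_distribution \<nu>" "\<And>t. char \<nu> t = critical_mellin (\<i> * of_real t)"
    and id: "infinitely_divisible \<nu>" and ac: "absolutely_continuous lborel \<nu>"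
    by (rule critical_law_ex) (rule that)
  interpret real_distribution \<nu> by fact
  \<comment> \<open>The limit is found on the logarithmic scale and transported back, so the claims
    about the law of ln are claims about \<open>\<nu>\<close> itself.\<close>
  define Mc where "Mc = distr \<nu> borel exp"
  have rd: "real_distribution Mc" unfolding Mc_def by (rule real_distribution_distr) simp
  have pos: "AE x in Mc. 0 < x" unfolding Mc_def by (subst AE_distr_iff) auto
  have ln: "distr Mc borel ln = \<nu>" unfolding Mc_def by (subst distr_distr) (auto simp: o_def distr_id2)
  have wc: "weak_conv_m (\<lambda>n. distr (M (t n)) borel (\<lambda>x. x / (1 - 1 / t n))) Mc"
    if "filterlim t (at_right 1) sequentially" for t
    using scaled_selberg_weak_conv[of M t \<nu>, OF M that \<nu>] unfolding Mc_def scaled_selberg_def .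
  have mom: "has_cmoment Mc q (critical_mellin q)" if "Re q < 1" for q
    unfolding Mc_def by (rule critical_law_has_cmoment[of M, OF M \<nu> that])
  then have cm: "cmoment Mc q = critical_mellin q" if "Re q < 1" for q
    using that unfolding has_cmoment_def by blast
  have n1: "q \<noteq> of_nat n" if "Re q < 1" "n \<ge> 1" for q :: complex and n using that by auto
  have n2: "2 * q \<noteq> of_nat n" if "Re q < 1" "n \<ge> 2" for q :: complex and n
  proof
    assume "2 * q = of_nat n"
    from arg_cong[OF this, of Re] that show False by simp
  qed
  note nm = critical_law_negative_moments[OF rd pos mom]
  have p1: "is_pole critical_mellin 1" "zorder critical_mellin 1 = - 1" "is_pole critical_mellin 2" "zorder critical_mellin 2 = - 3"
    using critical_mellin_pole[of 1] critical_mellin_pole[of 2] zorder_critical_mellin_of_nat[of 1] zorder_critical_mellin_of_nat[of 2]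
    by simp_all
  have pn: "is_pole critical_mellin (of_nat n)" "zorder critical_mellin (of_nat n) = - (2 * int n - 2)" if "n \<ge> 3" for n
    using critical_mellin_pole[of n] zorder_critical_mellin_of_nat[of n] that by auto
  have fe: "cmoment Mc q = Gamma (1 - q) * (Gamma (2 - q))\<^sup>2 * Gamma (4 - q) / (Gamma (4 - 2 * q) * Gamma (5 - 2 * q)) * cmoment Mc (q - 1)"
    if "Re q < 1" for q
    using critical_mellin_functional_equation[of q] n1[OF that] cm[OF that] cm[of "q - 1"] that by simp
  have ip: "convergent_prod (\<lambda>k. critical_factor q (Suc k))"
      "cmoment Mc q = Gamma (1 - q) * Gamma (3 - 2 * q) / Gamma (3 - q) * (\<Prod>k. critical_factor q (Suc k))"
    if "Re q < 1" for q
    unfolding cm[OF that] by (rule critical_mellin_prod; rule n2[OF that]; assumption)+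
  show ?thesis
  proof (intro exI[of _ Mc] conjI allI impI)
    fix q :: complex
    assume "\<forall>n::nat. n \<ge> 1 \<longrightarrow> q \<noteq> of_nat n"
    then show "critical_mellin q = Gamma (1 - q) * (Gamma (2 - q))\<^sup>2 * Gamma (4 - q)
        / (Gamma (4 - 2 * q) * Gamma (5 - 2 * q)) * critical_mellin (q - 1)"
      by (intro critical_mellin_functional_equation) blast
  next
    fix q :: complex
    assume q: "\<forall>n::nat. n \<ge> 2 \<longrightarrow> 2 * q \<noteq> of_nat n"
    show "convergent_prod (\<lambda>k. critical_factor q (Suc k))"
        "critical_mellin q = Gamma (1 - q) * Gamma (3 - 2 * q) / Gamma (3 - q) * (\<Prod>k. critical_factor q (Suc k))"
      by (rule critical_mellin_prod; use q in blast)+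
  next
    fix q :: complex
    assume q: "(\<forall>n::nat. q \<noteq> of_nat n + 5/2) \<and> (\<forall>n::nat. n \<ge> 1 \<longrightarrow> q \<noteq> of_nat n)"
    show "critical_mellin analytic_on {q}" by (rule critical_mellin_analytic') (use q in blast)
    show "critical_mellin q \<noteq> 0" by (rule critical_mellin_nonzero) (use q in blast)+
  next
    show "integrable Mc (\<lambda>x. x powi (- int l))"
        "(LINT x|Mc. x powi (- int l)) = (\<Prod>k<l. fact (3 + l + k) / ((fact (k + 1))\<^sup>2 * fact k))" for l
      by (rule nm; simp)+
  next
    fix B assume "beta22_distribution 1 1 2 (1/2) (1/2) B"
    then show "Mc = distr
        (lognormal_law 0 (4 * ln 2) \<Otimes>\<^sub>M distr B borel inverse \<Otimes>\<^sub>M pareto2_law \<Otimes>\<^sub>M frechet1_law)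
        borel (\<lambda>(l, x2, x3, y). pi / 32 * l * x2 * x3 * y)"
      unfolding Mc_def by (rule critical_law_factorization[OF \<nu>])
  qed (rule rd pos critical_mellin_meromorphic critical_mellin_zero p1 |
      rule wc mom pn fe ip, assumption | rule id[folded ln] ac[folded ln])+
qed

end
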